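(* Let $0\le\beta<\alpha<1$, let $u_0\in\mathcal{B}$, let $\mathcal{U}$ be a neighborhood of $u_0$, and let $(T_u)_{u\in\mathcal{U}}$ be a $C^{1+\alpha}$ family of $C^{1+\alpha}$ expanding maps of a Riemannian manifold $X$. For each $u\in\mathcal{U}$ let $\mathcal{L}_u$ be the weighted transfer operator on $C^{1+\alpha}(X)$ associated with $T_u$, $$\mathcal{L}_u\phi(x)=\sum_{y:\,T_uy=x}g(u,y)\phi(y).$$ Let $\lambda_u>0$ be its dominating eigenvalue, and let $\phi(u)\in C^{1+\alpha}(X)$ and $\ell_u\in(C^{1+\alpha}(X))^*$ be the associated eigenvectors of $\mathcal{L}_u$ and $\mathcal{L}_u^*$ respectively, normalized as in the context. Let $\Pi_u$ be the associated spectral projector and $R_u=\mathcal{L}_u-\lambda_u\Pi_u$. Then: (1) The map $u\in\mathcal{U}\mapsto\phi(u)\in C^\beta(X)$ is differentiable. (2) Its derivative with respect to $u$ at $u=u_0$ is given by $$D_u\phi(u_0)=\frac{1}{\lambda_{u_0}}\big(Id-\lambda_{u_0}^{-1}R_{u_0}\big)^{-1}(Id-\Pi_{u_0})\,\partial_u\mathcal{L}_u|_{u=u_0}\phi(u_0).$$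
   Context: Setting. $X$ is a compact connected Riemannian manifold, $\mathcal{B}=\mathbb{R}^d$ with $d\ge1$, and $\mathcal{U}$ is open. A $C^1$ map $T:X\to X$ is expanding if there is $\lambda>1$ with $\|DT(x)v\|\ge\lambda\|v\|$ for all $x\in X$, $v\in T_xX$. A $C^{1+\alpha}$ family of $C^{1+\alpha}$ expanding maps means: $(u,x)\mapsto T_u(x)$ is of class $C^{1+\alpha}$ and each $T_u$ is expanding. The weight $g:\mathcal{U}\times X\to\mathbb{R}$ is a positive $C^{1+\alpha}$ function. For $k\in\mathbb N$ and $\rho\in(0,1)$, $C^{k+\rho}$ is the space of $C^k$ maps whose $k$-th differential is $\rho$-Hölder, with its usual norm. Spectral data. On $C^r(X)$, $0<r\le1+\alpha$, $\mathcal{L}_u$ has a spectral gap: $\lambda_u$ is a simple isolated eigenvalue equal to the spectral radius (the dominating eigenvalue), and the rest of the spectrum lies in a disk centered at $0$ of strictly smaller radius. The normalization is $\langle\ell_u,\phi(u)\rangle=1$ and $\langle\ell_{u_0},\phi(u)\rangle=1$ for all $u\in\mathcal{U}$. $\Pi_uz=\langle\ell_u,z\rangle\phi(u)$ is the spectral projector on the one-dimensional eigenspace of $\lambda_u$, and there are $C>0$, $\sigma\in(0,1)$ with $\|\lambda_u^{-n}R_u^n\|\le C\sigma^n$ for all $n$, as operators on $C^r(X)$. For $\phi\in C^{1+\alpha}(X)$ and $h\in\mathcal{B}$, $(\partial_u\mathcal{L}_u|_{u=u_0}\phi).h$ is the function on $X$ whose value at $x$ is the derivative at $u=u_0$, in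 the direction $h$, of $u\mapsto\mathcal{L}_u\phi(x)$; it belongs to $C^\alpha(X)$. In (2) the inverse of $Id-\lambda_{u_0}^{-1}R_{u_0}$ is taken on Hölder spaces $C^r(X)$, $0<r\le\alpha$, and $D_u\phi(u_0)$ is the linear map obtained by applying the right-hand side to each direction $h\in\mathcal{B}$. *)

theory Defs
  imports "HOL-Analysis.Analysis"
begin

section \<open>Riemannian manifolds\<close>

text \<open>
  A manifold is a Hausdorff topological space (a type of class \<open>t2_space\<close>) with a smooth atlas
  modelled on a Euclidean space. A chart is a pair of its domain and its coordinate map; the
  values of the coordinate map outside the domain are irrelevant. The atlas need not be maximal.
  For compact spaces, second countability follows from the existence of the atlas.
\<close>

type_synonym ('x, 'e) chart = "'x set \<times> ('x \<Rightarrow> 'e)"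

definition chart_img :: "('x, 'e) chart \<Rightarrow> 'e set" where
  "chart_img c = snd c ` fst c"

definition chart_inv :: "('x, 'e) chart \<Rightarrow> 'e \<Rightarrow> 'x" where
  "chart_inv c = inv_into (fst c) (snd c)"

text \<open>The set \<open>S\<close> is meant to be open. In finite dimension, continuity of all iterated
  directional derivatives is continuity of the iterated differentials.\<close>

primrec Ck_on :: "nat \<Rightarrow> 'a set \<Rightarrow> ('a::real_normed_vector \<Rightarrow> 'b::real_normed_vector) \<Rightarrow> bool" where
  "Ck_on 0 S f \<longleftrightarrow> continuous_on S f"
| "Ck_on (Suc k) S f \<longleftrightarrow>
     (\<forall>x\<in>S. f differentiable (at x)) \<and> (\<forall>v. Ck_on k S (\<lambda>x. frechet_derivative f (at x) v))"

definition smooth_on :: "'a set \<Rightarrow> ('a::real_normed_vector \<Rightarrow> 'b::real_normed_vector) \<Rightarrow> bool" where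
  "smooth_on S f \<longleftrightarrow> (\<forall>k. Ck_on k S f)"

definition smooth_atlas :: "('x::t2_space, 'e::euclidean_space) chart set \<Rightarrow> bool" where
  "smooth_atlas A \<longleftrightarrow>
     (\<forall>c\<in>A. open (fst c) \<and> open (chart_img c) \<and>
        homeomorphism (fst c) (chart_img c) (snd c) (chart_inv c)) \<and>
     (\<Union>c\<in>A. fst c) = UNIV \<and>
     (\<forall>c\<in>A. \<forall>d\<in>A. smooth_on (snd c ` (fst c \<inter> fst d)) (snd d \<circ> chart_inv c))"

text \<open>The differential at \<open>x\<close> of a map \<open>f\<close> of the manifold, read in a chart \<open>c\<close> at \<open>x\<close> and a
  chart \<open>d\<close> at \<open>f x\<close>.\<close>

definition chart_diff ::
  "('x, 'e::euclidean_space) chart \<Rightarrow> ('x, 'e) chart \<Rightarrow> ('x \<Rightarrow> 'x) \<Rightarrow> 'x \<Rightarrow> 'e \<Rightarrow> 'e" where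
  "chart_diff c d f x = frechet_derivative (\<lambda>z. snd d (f (chart_inv c z))) (at (snd c x))"

text \<open>\<open>G c x\<close> is the inner product on the tangent space at \<open>x\<close>, expressed in the
  coordinates of the chart \<open>c\<close>.\<close>

definition riemannian_metric ::
  "('x::t2_space, 'e::euclidean_space) chart set \<Rightarrow>
   (('x, 'e) chart \<Rightarrow> 'x \<Rightarrow> 'e \<Rightarrow> 'e \<Rightarrow> real) \<Rightarrow> bool" where
  "riemannian_metric A G \<longleftrightarrow>
     (\<forall>c\<in>A. \<forall>x\<in>fst c. bilinear (G c x) \<and> (\<forall>v w. G c x v w = G c x w v) \<and>
        (\<forall>v. v \<noteq> 0 \<longrightarrow> G c x v v > 0)) \<and>
     (\<forall>c\<in>A. \<forall>v w. smooth_on (chart_img c) (\<lambda>z. G c (chart_inv c z) v w)) \<and>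
     (\<forall>c\<in>A. \<forall>d\<in>A. \<forall>x\<in>fst c \<inter> fst d. \<forall>v w.
        G c x v w = G d x (chart_diff c d id x v) (chart_diff c d id x w))"

definition compact_connected_riemannian_manifold ::
  "('x::t2_space, 'e::euclidean_space) chart set \<Rightarrow>
   (('x, 'e) chart \<Rightarrow> 'x \<Rightarrow> 'e \<Rightarrow> 'e \<Rightarrow> real) \<Rightarrow> bool" where
  "compact_connected_riemannian_manifold A G \<longleftrightarrow>
     smooth_atlas A \<and> riemannian_metric A G \<and>
     compact (UNIV :: 'x set) \<and> connected (UNIV :: 'x set)"


section \<open>Expanding maps and \<open>C\<^sup>1\<^sup>+\<^sup>\<alpha>\<close> families\<close>

definition C1_map :: "('x::t2_space, 'e::euclidean_space) chart set \<Rightarrow> ('x \<Rightarrow> 'x) \<Rightarrow> bool" where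
  "C1_map A f \<longleftrightarrow> continuous_on UNIV f \<and>
     (\<forall>c\<in>A. \<forall>d\<in>A. Ck_on 1 {z \<in> chart_img c. f (chart_inv c z) \<in> fst d}
        (\<lambda>z. snd d (f (chart_inv c z))))"

definition expanding_map ::
  "('x::t2_space, 'e::euclidean_space) chart set \<Rightarrow>
   (('x, 'e) chart \<Rightarrow> 'x \<Rightarrow> 'e \<Rightarrow> 'e \<Rightarrow> real) \<Rightarrow> ('x \<Rightarrow> 'x) \<Rightarrow> bool" where
  "expanding_map A G f \<longleftrightarrow> C1_map A f \<and>
     (\<exists>\<kappa>>1. \<forall>c\<in>A. \<forall>d\<in>A. \<forall>x\<in>fst c. f x \<in> fst d \<longrightarrow>
        (\<forall>v. sqrt (G d (f x) (chart_diff c d f x v) (chart_diff c d f x v))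
               \<ge> \<kappa> * sqrt (G c x v v)))"

text \<open>For maps on the non-compact manifold \<open>U \<times> X\<close>, being of class \<open>C\<^sup>1\<^sup>+\<^sup>\<alpha>\<close> is a local
  condition in charts: the differential is locally \<open>\<alpha>\<close>-Hoelder.\<close>

definition local_C1_holder ::
  "real \<Rightarrow> 'a set \<Rightarrow> ('a::euclidean_space \<Rightarrow> 'b::euclidean_space) \<Rightarrow> bool" where
  "local_C1_holder \<alpha> S f \<longleftrightarrow>
     (\<exists>f' :: 'a \<Rightarrow> 'a \<Rightarrow>\<^sub>L 'b.
        (\<forall>x\<in>S. (f has_derivative blinfun_apply (f' x)) (at x)) \<and>
        (\<forall>x\<in>S. \<exists>\<epsilon>>0. \<exists>C. \<forall>y\<in>S \<inter> ball x \<epsilon>. \<forall>z\<in>S \<inter> ball x \<epsilon>.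
           norm (f' y - f' z) \<le> C * dist y z powr \<alpha>))"

definition C1_holder_map_family ::
  "('x::t2_space, 'e::euclidean_space) chart set \<Rightarrow> real \<Rightarrow> 'p::euclidean_space set \<Rightarrow>
   ('p \<Rightarrow> 'x \<Rightarrow> 'x) \<Rightarrow> bool" where
  "C1_holder_map_family A \<alpha> U T \<longleftrightarrow>
     continuous_on (U \<times> UNIV) (\<lambda>(u, x). T u x) \<and>
     (\<forall>c\<in>A. \<forall>d\<in>A.
        local_C1_holder \<alpha> {(u, z). u \<in> U \<and> z \<in> chart_img c \<and> T u (chart_inv c z) \<in> fst d}
          (\<lambda>(u, z). snd d (T u (chart_inv c z))))"

definition C1_holder_fun_family ::
  "('x::t2_space, 'e::euclidean_space) chart set \<Rightarrow> real \<Rightarrow> 'p::euclidean_space set \<Rightarrow>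
   ('p \<Rightarrow> 'x \<Rightarrow> real) \<Rightarrow> bool" where
  "C1_holder_fun_family A \<alpha> U g \<longleftrightarrow>
     (\<forall>c\<in>A. local_C1_holder \<alpha> (U \<times> chart_img c) (\<lambda>(u, z). g u (chart_inv c z)))"


section \<open>The spaces \<open>C\<^sup>r(X)\<close> for \<open>0 \<le> r < 2\<close>\<close>

text \<open>
  The norm of \<open>C\<^sup>r(X)\<close> is computed in a finite cover of \<open>X\<close> by coordinate balls, given as triples
  of a chart, a centre and a radius, whose closures lie in the image of the chart. Different
  covers yield the same spaces with equivalent norms.
\<close>

definition coordinate_cover ::
  "('x::t2_space, 'e::euclidean_space) chart set \<Rightarrow> (('x, 'e) chart \<times> 'e \<times> real) set \<Rightarrow> bool" where
  "coordinate_cover A N \<longleftrightarrow> finite N \<and>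
     (\<forall>(c, a, R)\<in>N. c \<in> A \<and> R > 0 \<and> cball a R \<subseteq> chart_img c) \<and>
     (\<Union>(c, a, R)\<in>N. chart_inv c ` ball a R) = UNIV"

definition holder_on ::
  "real \<Rightarrow> 'e set \<Rightarrow> ('e::euclidean_space \<Rightarrow> 'b::real_normed_vector) \<Rightarrow> bool" where
  "holder_on \<rho> S f \<longleftrightarrow> (\<exists>C. \<forall>x\<in>S. \<forall>y\<in>S. norm (f x - f y) \<le> C * dist x y powr \<rho>)"

definition holder_seminorm_on ::
  "real \<Rightarrow> 'e set \<Rightarrow> ('e::euclidean_space \<Rightarrow> 'b::real_normed_vector) \<Rightarrow> real" where
  "holder_seminorm_on \<rho> S f =
     Sup {norm (f x - f y) / dist x y powr \<rho> | x y. x \<in> S \<and> y \<in> S \<and> x \<noteq> y}"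

text \<open>Bounded \<open>C\<^sup>\<rho>\<close> functions for \<open>0 \<le> \<rho> < 1\<close>; there is no Hoelder condition if \<open>\<rho> = 0\<close>.\<close>

definition C_frac_on ::
  "real \<Rightarrow> 'e set \<Rightarrow> ('e::euclidean_space \<Rightarrow> 'b::real_normed_vector) \<Rightarrow> bool" where
  "C_frac_on \<rho> S f \<longleftrightarrow>
     continuous_on S f \<and> bounded (f ` S) \<and> (\<rho> > 0 \<longrightarrow> holder_on \<rho> S f)"

definition C_frac_norm_on ::
  "real \<Rightarrow> 'e set \<Rightarrow> ('e::euclidean_space \<Rightarrow> 'b::real_normed_vector) \<Rightarrow> real" where
  "C_frac_norm_on \<rho> S f =
     (SUP x\<in>S. norm (f x)) + (if \<rho> > 0 then holder_seminorm_on \<rho> S f else 0)"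

definition Diff :: "('e::euclidean_space \<Rightarrow> 'b::euclidean_space) \<Rightarrow> 'e \<Rightarrow> 'e \<Rightarrow>\<^sub>L 'b" where
  "Diff f x = Blinfun (frechet_derivative f (at x))"

definition Cr_on :: "real \<Rightarrow> 'e set \<Rightarrow> ('e::euclidean_space \<Rightarrow> 'b::euclidean_space) \<Rightarrow> bool" where
  "Cr_on r S f \<longleftrightarrow>
     (if r < 1 then C_frac_on r S f
      else C_frac_on 0 S f \<and> (\<forall>x\<in>S. f differentiable (at x)) \<and> C_frac_on (r - 1) S (Diff f))"

definition Cr_norm_on ::
  "real \<Rightarrow> 'e set \<Rightarrow> ('e::euclidean_space \<Rightarrow> 'b::euclidean_space) \<Rightarrow> real" where
  "Cr_norm_on r S f =
     (if r < 1 then C_frac_norm_on r S f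
      else C_frac_norm_on 0 S f + C_frac_norm_on (r - 1) S (Diff f))"

definition Cr ::
  "(('x, 'e::euclidean_space) chart \<times> 'e \<times> real) set \<Rightarrow> real \<Rightarrow>
   ('x \<Rightarrow> 'b::euclidean_space) set" where
  "Cr N r = {f. \<forall>(c, a, R)\<in>N. Cr_on r (ball a R) (\<lambda>z. f (chart_inv c z))}"

definition Cr_norm ::
  "(('x, 'e::euclidean_space) chart \<times> 'e \<times> real) set \<Rightarrow> real \<Rightarrow>
   ('x \<Rightarrow> 'b::euclidean_space) \<Rightarrow> real" where
  "Cr_norm N r f = (\<Sum>(c, a, R)\<in>N. Cr_norm_on r (ball a R) (\<lambda>z. f (chart_inv c z)))"

text \<open>Frechet derivative at \<open>u\<close> of a map \<open>F\<close> with values in \<open>C\<^sup>r(X)\<close>.\<close>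

definition Cr_has_derivative ::
  "(('x, 'e::euclidean_space) chart \<times> 'e \<times> real) set \<Rightarrow> real \<Rightarrow>
   ('p::euclidean_space \<Rightarrow> 'x \<Rightarrow> real) \<Rightarrow> ('p \<Rightarrow> 'x \<Rightarrow> real) \<Rightarrow> 'p \<Rightarrow> bool" where
  "Cr_has_derivative N r F D u \<longleftrightarrow>
     (\<forall>\<^sub>F v in nhds u. F v \<in> Cr N r) \<and>
     (\<forall>h. D h \<in> Cr N r) \<and> (\<forall>x. linear (\<lambda>h. D h x)) \<and>
     (\<exists>K. \<forall>h. Cr_norm N r (D h) \<le> K * norm h) \<and>
     ((\<lambda>h. Cr_norm N r (\<lambda>x. F (u + h) x - F u x - D h x) / norm h) \<longlongrightarrow> 0) (at 0)"


section \<open>Operators on \<open>C\<^sup>r(X)\<close>\<close>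

definition Cr_dual ::
  "(('x, 'e::euclidean_space) chart \<times> 'e \<times> real) set \<Rightarrow> real \<Rightarrow>
   (('x \<Rightarrow> real) \<Rightarrow> real) \<Rightarrow> bool" where
  "Cr_dual N r l \<longleftrightarrow>
     (\<forall>f\<in>Cr N r. \<forall>h\<in>Cr N r. l (\<lambda>x. f x + h x) = l f + l h) \<and>
     (\<forall>f\<in>Cr N r. \<forall>a. l (\<lambda>x. a * f x) = a * l f) \<and>
     (\<exists>K. \<forall>f\<in>Cr N r. \<bar>l f\<bar> \<le> K * Cr_norm N r f)"

definition Cr_invertible ::
  "(('x, 'e::euclidean_space) chart \<times> 'e \<times> real) set \<Rightarrow> real \<Rightarrow>
   (('x \<Rightarrow> 'b::euclidean_space) \<Rightarrow> 'x \<Rightarrow> 'b) \<Rightarrow> bool" where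
  "Cr_invertible N r M \<longleftrightarrow> bij_betw M (Cr N r) (Cr N r) \<and>
     (\<exists>K. \<forall>f\<in>Cr N r. Cr_norm N r f \<le> K * Cr_norm N r (M f))"

text \<open>The spectrum is that of an operator on complex-valued functions; for an operator given by a
  real kernel this is its complexification.\<close>

definition Cr_spectrum ::
  "(('x, 'e::euclidean_space) chart \<times> 'e \<times> real) set \<Rightarrow> real \<Rightarrow>
   (('x \<Rightarrow> complex) \<Rightarrow> 'x \<Rightarrow> complex) \<Rightarrow> complex set" where
  "Cr_spectrum N r L = {z. \<not> Cr_invertible N r (\<lambda>f x. z * f x - L f x)}"

text \<open>Simplicity is algebraic: the generalized eigenspace is one-dimensional.\<close>

definition Cr_simple_eigenvalue ::
  "(('x, 'e::euclidean_space) chart \<times> 'e \<times> real) set \<Rightarrow> real \<Rightarrow>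
   (('x \<Rightarrow> complex) \<Rightarrow> 'x \<Rightarrow> complex) \<Rightarrow> complex \<Rightarrow> bool" where
  "Cr_simple_eigenvalue N r L z \<longleftrightarrow>
     (\<exists>v\<in>Cr N r. v \<noteq> (\<lambda>x. 0) \<and> L v = (\<lambda>x. z * v x) \<and>
        {f \<in> Cr N r. \<exists>n. ((\<lambda>f x. L f x - z * f x) ^^ n) f = (\<lambda>x. 0)} =
        {f. \<exists>a. f = (\<lambda>x. a * v x)})"

definition Cr_spectral_gap ::
  "(('x, 'e::euclidean_space) chart \<times> 'e \<times> real) set \<Rightarrow> real \<Rightarrow>
   (('x \<Rightarrow> complex) \<Rightarrow> 'x \<Rightarrow> complex) \<Rightarrow> real \<Rightarrow> bool" where
  "Cr_spectral_gap N r L lam \<longleftrightarrow>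
     Cr_simple_eigenvalue N r L (of_real lam) \<and>
     (SUP z\<in>Cr_spectrum N r L. cmod z) = lam \<and>
     (\<exists>\<rho><lam. Cr_spectrum N r L - {of_real lam} \<subseteq> cball 0 \<rho>)"


section \<open>Weighted transfer operators\<close>

text \<open>An expanding map of a compact manifold has finite fibres, so the sum is never a
  sum over an infinite set.\<close>

definition transfer_op ::
  "('x \<Rightarrow> 'x) \<Rightarrow> ('x \<Rightarrow> real) \<Rightarrow> ('x \<Rightarrow> 'b::real_vector) \<Rightarrow> 'x \<Rightarrow> 'b" where
  "transfer_op T g f x = (\<Sum>y | T y = x. g y *\<^sub>R f y)"

definition eigen_proj ::
  "(('x \<Rightarrow> real) \<Rightarrow> real) \<Rightarrow> ('x \<Rightarrow> real) \<Rightarrow> ('x \<Rightarrow> real) \<Rightarrow> 'x \<Rightarrow> real" where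
  "eigen_proj l \<phi> f x = l f * \<phi> x"

definition remainder_op ::
  "('x \<Rightarrow> 'x) \<Rightarrow> ('x \<Rightarrow> real) \<Rightarrow> real \<Rightarrow> (('x \<Rightarrow> real) \<Rightarrow> real) \<Rightarrow> ('x \<Rightarrow> real) \<Rightarrow>
   ('x \<Rightarrow> real) \<Rightarrow> 'x \<Rightarrow> real" where
  "remainder_op T g lam l \<phi> f x = transfer_op T g f x - lam * eigen_proj l \<phi> f x"

definition transfer_op_param_deriv ::
  "('p::real_vector \<Rightarrow> 'x \<Rightarrow> 'x) \<Rightarrow> ('p \<Rightarrow> 'x \<Rightarrow> real) \<Rightarrow> 'p \<Rightarrow> ('x \<Rightarrow> real) \<Rightarrow> 'p \<Rightarrow> 'x \<Rightarrow> real" where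
  "transfer_op_param_deriv T g u f h x =
     deriv (\<lambda>t. transfer_op (T (u + t *\<^sub>R h)) (g (u + t *\<^sub>R h)) f x) 0"

text \<open>
  Spectral data of one transfer operator. The left eigenvector \<open>l\<close> is a functional defined on all
  the spaces \<open>C\<^sup>r(X)\<close> with \<open>0 < r \<le> 1 + \<alpha>\<close>, so that the projector and the remainder operator act on
  each of them: by the spectral gap on \<open>C\<^sup>r(X)\<close>, the left eigenvector on \<open>C\<^sup>1\<^sup>+\<^sup>\<alpha>(X)\<close> has a unique
  extension to a left eigenvector on \<open>C\<^sup>r(X)\<close>. The constants of the exponential bound may depend on
  \<open>r\<close> and on the operator. That the eigenvalue is isolated is part of the condition on the rest of
  the spectrum.
\<close>

definition spectral_data ::
  "(('x, 'e::euclidean_space) chart \<times> 'e \<times> real) set \<Rightarrow> real \<Rightarrow> ('x \<Rightarrow> 'x) \<Rightarrow> ('x \<Rightarrow> real) \<Rightarrow>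
   real \<Rightarrow> ('x \<Rightarrow> real) \<Rightarrow> (('x \<Rightarrow> real) \<Rightarrow> real) \<Rightarrow> bool" where
  "spectral_data N \<alpha> T g lam \<phi> l \<longleftrightarrow>
     lam > 0 \<and> \<phi> \<in> Cr N (1 + \<alpha>) \<and> transfer_op T g \<phi> = (\<lambda>x. lam * \<phi> x) \<and>
     (\<forall>r\<in>{0<..1 + \<alpha>}.
        Cr_dual N r l \<and> (\<forall>f\<in>Cr N r. l (transfer_op T g f) = lam * l f) \<and>
        Cr_spectral_gap N r (transfer_op T g) lam \<and>
        (\<exists>C>0. \<exists>\<sigma>\<in>{0<..<1}. \<forall>n. \<forall>f\<in>Cr N r.
           (remainder_op T g lam l \<phi> ^^ n) f \<in> Cr N r \<and>
           Cr_norm N r (\<lambda>x. (remainder_op T g lam l \<phi> ^^ n) f x / lam ^ n)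
             \<le> C * \<sigma> ^ n * Cr_norm N r f))"

end

theory Submission
  imports Defs
begin

text \<open>
  Let \<open>\<psi> u = \<phi> u / \<langle>l v, \<phi> u\<rangle>\<close>, which makes sense since the eigenfunctions are positive up to sign:
  they are limits of \<open>(L u)\<^sup>n 1\<close>, which stays in a cone of functions with Lipschitz logarithm.
  The Lasota-Yorke inequality bounds \<open>\<psi> u\<close> in \<open>C\<^sup>1\<^sup>+\<^sup>\<alpha>\<close> uniformly for \<open>u\<close> near \<open>v\<close>. Since
  \<open>\<langle>l v, \<psi> u\<rangle> = 1\<close>, subtracting the eigenvalue equations gives
  \<open>(Id - R v / lam v) (\<psi> u - \<phi> v) = (1 / lam v) ((L u - L v) \<psi> u - (lam u - lam v) \<psi> u)\<close>,
  where \<open>lam u - lam v = \<langle>l v, (L u - L v) \<psi> u\<rangle>\<close>. The resolvent on \<open>C\<^sup>\<alpha>\<close> then shows that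
  \<open>\<psi> u - \<phi> v = O(\<bar>u - v\<bar>)\<close> in \<open>C\<^sup>\<alpha>\<close>. On functions bounded in \<open>C\<^sup>1\<^sup>+\<^sup>\<alpha>\<close>, \<open>L u - L v\<close> equals its
  linear part up to \<open>o(\<bar>u - v\<bar>)\<close> uniformly and is \<open>O(\<bar>u - v\<bar>)\<close> in \<open>C\<^sup>\<alpha>\<close>; interpolation turns this
  into \<open>o(\<bar>u - v\<bar>)\<close> in \<open>C\<^sup>r\<close> for \<open>r < \<alpha>\<close>, and the resolvent on \<open>C\<^sup>r\<close> yields the derivative of \<open>\<psi>\<close>,
  hence of \<open>\<phi>\<close>.
\<close>

section \<open>Germs of class \<open>C\<^sup>1\<^sup>+\<^sup>\<alpha>\<close>\<close>

text \<open>Differentiating \<open>L u\<close> in \<open>u\<close> costs one derivative in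
  \<open>x\<close>: as operators on C^{1+\<alpha>} the \<open>L u\<close> need not even depend
  continuously on \<open>u\<close>, and the derivative only sends C^{1+\<alpha>} to C^\<alpha>.
  Perturbation theory on a single space therefore does not apply. Moreover the spectral data are
  given for each parameter separately, with constants that may depend on it, so only the resolvent
  at the fixed point \<open>v\<close> is usable, and uniformity in \<open>u\<close> must come from
  the dynamics and from compactness. Two circularities are broken. The uniform Lasota-Yorke bound
  presupposes control of \<open>lam u\<close>; this comes from positivity, by comparing growth rates
  of iterates. The bound it yields for \<open>\<psi> u\<close> is proportional to the supremum S of
  \<open>\<bar>\<psi> u\<bar>\<close>, which is finite but not yet uniform; the resolvent estimate
  is linear in S with a small factor, so S \<le> B + S / 2. Normalizing by \<open>l v\<close>, with
  \<open>v\<close> the point where the derivative is taken, makes \<open>R v\<close> and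
  \<open>L v\<close> agree on \<open>\<psi> u - \<phi> v\<close>. The prescribed normalization by
  one fixed functional is restored at the end by a scalar factor.\<close>

definition C1_holder_at ::
  "real \<Rightarrow> ('a::real_normed_vector \<Rightarrow> 'b::real_normed_vector) \<Rightarrow> 'a \<Rightarrow> bool" where
  "C1_holder_at \<alpha> f p \<longleftrightarrow> (\<exists>f' \<epsilon> C. \<epsilon> > 0 \<and>
     (\<forall>x\<in>ball p \<epsilon>. (f has_derivative blinfun_apply (f' x)) (at x)) \<and>
     (\<forall>x\<in>ball p \<epsilon>. \<forall>y\<in>ball p \<epsilon>. norm (f' x - f' y) \<le> C * dist x y powr \<alpha>))"

text \<open>One constant bounds the value, the derivative and its Hoelder quotient. The derivative
  is carried as a bounded linear map, so that operator norms and compositions are at hand.\<close>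

definition C1_holder_bound ::
  "real \<Rightarrow> real \<Rightarrow> 'a set \<Rightarrow> ('a::real_normed_vector \<Rightarrow> 'b::real_normed_vector) \<Rightarrow>
   ('a \<Rightarrow> 'a \<Rightarrow>\<^sub>L 'b) \<Rightarrow> bool" where
  "C1_holder_bound \<alpha> K S f f' \<longleftrightarrow>
     (\<forall>x\<in>S. (f has_derivative blinfun_apply (f' x)) (at x) \<and> norm (f x) \<le> K \<and> norm (f' x) \<le> K) \<and>
     (\<forall>x\<in>S. \<forall>y\<in>S. norm (f' x - f' y) \<le> K * dist x y powr \<alpha>)"

lemma C1_holder_boundD:
  assumes "C1_holder_bound \<alpha> K S f f'" "x \<in> S"
  shows "(f has_derivative blinfun_apply (f' x)) (at x)" "norm (f x) \<le> K" "norm (f' x) \<le> K"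
    "y \<in> S \<Longrightarrow> norm (f' x - f' y) \<le> K * dist x y powr \<alpha>"
  using assms by (auto simp: C1_holder_bound_def)

lemma C1_holder_bound_nonneg: "C1_holder_bound \<alpha> K S f f' \<Longrightarrow> x \<in> S \<Longrightarrow> K \<ge> 0"
  using C1_holder_boundD(2) norm_ge_zero order_trans by blast

lemma C1_holder_bound_mono:
  assumes "C1_holder_bound \<alpha> K S f f'" "K \<le> K'" "S' \<subseteq> S"
  shows "C1_holder_bound \<alpha> K' S' f f'"
  unfolding C1_holder_bound_def
proof (intro conjI ballI)
  fix x y assume x: "x \<in> S'" and y: "y \<in> S'"
  have "norm (f' x - f' y) \<le> K * dist x y powr \<alpha>"
    using assms x y by (auto simp: C1_holder_bound_def)
  also have "\<dots> \<le> K' * dist x y powr \<alpha>" using assms(2) by (intro mult_right_mono) auto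
  finally show "norm (f' x - f' y) \<le> K' * dist x y powr \<alpha>" .
qed (use assms in \<open>auto simp: C1_holder_bound_def intro: order_trans\<close>)

lemma powr_le_one: "0 \<le> x \<Longrightarrow> x \<le> 1 \<Longrightarrow> 0 \<le> a \<Longrightarrow> x powr a \<le> (1::real)"
  using powr_mono2[of a x 1] by simp

lemma le_powr_of_le_one:
  fixes x :: real
  assumes "0 \<le> x" "x \<le> 1" "a \<le> 1"
  shows "x \<le> x powr a"
proof (cases "x = 0")
  case False
  then show ?thesis using powr_mono'[of a 1 x] assms by simp
qed simp

text \<open>The radius is kept at most 1/2, so that distances inside the ball are at most 1 and
  Lipschitz bounds are also \<alpha>-Hoelder bounds.\<close>

lemma C1_holder_at_bound:
  assumes "C1_holder_at \<alpha> f p" "0 < \<alpha>"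
  obtains f' \<epsilon> K where "0 < \<epsilon>" "\<epsilon> \<le> 1/2" "C1_holder_bound \<alpha> K (ball p \<epsilon>) f f'"
proof -
  obtain f' e C where e: "e > 0"
    and d: "\<And>x. x \<in> ball p e \<Longrightarrow> (f has_derivative blinfun_apply (f' x)) (at x)"
    and h: "\<And>x y. x \<in> ball p e \<Longrightarrow> y \<in> ball p e \<Longrightarrow> norm (f' x - f' y) \<le> C * dist x y powr \<alpha>"
    using assms(1) unfolding C1_holder_at_def by blast
  have "isCont f p" using d[of p] e has_derivative_continuous by auto
  then obtain e1 where e1: "e1 > 0" "\<And>x. dist x p < e1 \<Longrightarrow> dist (f x) (f p) < 1"
    unfolding continuous_at_eps_delta by (metis zero_less_one)
  define \<epsilon> where "\<epsilon> = min (1/2) (min e e1)"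
  define K where "K = max \<bar>C\<bar> (max (norm (f p) + 1) (norm (f' p) + \<bar>C\<bar>))"
  have eps: "\<epsilon> > 0" "\<epsilon> \<le> 1/2" "\<epsilon> \<le> e" "\<epsilon> \<le> e1" using e e1(1) by (auto simp: \<epsilon>_def)
  have "C1_holder_bound \<alpha> K (ball p \<epsilon>) f f'"
    unfolding C1_holder_bound_def
  proof (intro conjI ballI)
    fix x assume x: "x \<in> ball p \<epsilon>"
    then have xe: "x \<in> ball p e" using eps by auto
    show "(f has_derivative blinfun_apply (f' x)) (at x)" using d[OF xe] .
    have "dist (f x) (f p) < 1" using x eps by (intro e1(2)) (auto simp: dist_commute)
    then have "norm (f x) \<le> norm (f p) + 1" unfolding dist_norm using norm_triangle_ineq2[of "f x" "f p"] by linarith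
    then show "norm (f x) \<le> K" by (auto simp: K_def)
    have "norm (f' x - f' p) \<le> C * dist x p powr \<alpha>" using h[OF xe] e by auto
    also have "\<dots> \<le> \<bar>C\<bar> * 1"
      using x eps(2) assms(2) by (intro mult_mono powr_le_one) (auto simp: dist_commute)
    finally have "norm (f' x) \<le> norm (f' p) + \<bar>C\<bar>" using norm_triangle_ineq2[of "f' x" "f' p"] by linarith
    then show "norm (f' x) \<le> K" by (auto simp: K_def)
  next
    fix x y assume x: "x \<in> ball p \<epsilon>" "y \<in> ball p \<epsilon>"
    then have "norm (f' x - f' y) \<le> C * dist x y powr \<alpha>" using eps by (intro h) auto
    also have "\<dots> \<le> K * dist x y powr \<alpha>" by (intro mult_right_mono) (auto simp: K_def)
    finally show "norm (f' x - f' y) \<le> K * dist x y powr \<alpha>" .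
  qed
  with eps that show ?thesis by blast
qed

lemma C1_holder_bound_lipschitz:
  assumes "convex S" "C1_holder_bound \<alpha> K S f f'" "x \<in> S" "y \<in> S"
  shows "norm (f x - f y) \<le> K * dist x y"
  unfolding dist_norm
proof (rule differentiable_bound[OF assms(1)])
  show "\<And>x. x \<in> S \<Longrightarrow> (f has_derivative blinfun_apply (f' x)) (at x within S)"
    using C1_holder_boundD(1)[OF assms(2)] has_derivative_at_withinI by blast
  show "\<And>x. x \<in> S \<Longrightarrow> onorm (blinfun_apply (f' x)) \<le> K"
    using C1_holder_boundD(3)[OF assms(2)] by (simp add: norm_blinfun.rep_eq)
qed (use assms in auto)

lemma C1_holder_at_continuous:
  assumes "C1_holder_at \<alpha> f p" shows "isCont f p"
proof -
  obtain f' where "(f has_derivative blinfun_apply (f' p)) (at p)"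
    using assms unfolding C1_holder_at_def by (meson centre_in_ball)
  then show ?thesis using has_derivative_continuous by blast
qed

text \<open>The chain rule and the product rule for the weighted composition \<open>\<gamma> \<cdot> (f \<circ> s)\<close>, with the
  constants kept apart: the Hoelder constant \<open>Ma\<close> of \<open>Df\<close> only enters through the contraction
  rate \<open>q\<close> of \<open>s\<close>, which is what makes the Lasota-Yorke inequality work.\<close>

lemma weighted_composition_estimate:
  fixes \<gamma> :: "'a::real_normed_vector \<Rightarrow> real" and s :: "'a \<Rightarrow> 'b::real_normed_vector"
    and f :: "'b \<Rightarrow> 'c::real_normed_vector"
  assumes S: "convex S" "\<And>x y. x \<in> S \<Longrightarrow> y \<in> S \<Longrightarrow> dist x y \<le> 1" and \<alpha>: "0 < \<alpha>" "\<alpha> \<le> 1"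
    and \<gamma>: "C1_holder_bound \<alpha> K S \<gamma> \<gamma>'" "\<And>x. x \<in> S \<Longrightarrow> \<bar>\<gamma> x\<bar> \<le> k"
    and s: "C1_holder_bound \<alpha> K S s s'" "\<And>x. x \<in> S \<Longrightarrow> norm (s' x) \<le> q" "s ` S \<subseteq> B"
    and f: "\<And>z. z \<in> B \<Longrightarrow> (f has_derivative blinfun_apply (f' z)) (at z)"
      "\<And>z. z \<in> B \<Longrightarrow> norm (f z) \<le> M0" "\<And>z. z \<in> B \<Longrightarrow> norm (f' z) \<le> M1"
      "\<And>z z'. z \<in> B \<Longrightarrow> z' \<in> B \<Longrightarrow> norm (f' z - f' z') \<le> Ma * dist z z' powr \<alpha>"
      "0 \<le> Ma"
    and B: "convex B"
  defines "F' \<equiv> \<lambda>x. blinfun_compose (blinfun_scaleR_left (f (s x))) (\<gamma>' x) + \<gamma> x *\<^sub>R (f' (s x) o\<^sub>L s' x)"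
  shows "\<And>x. x \<in> S \<Longrightarrow> ((\<lambda>x. \<gamma> x *\<^sub>R f (s x)) has_derivative blinfun_apply (F' x)) (at x)"
    and "\<And>x. x \<in> S \<Longrightarrow> norm (\<gamma> x *\<^sub>R f (s x)) \<le> k * M0"
    and "\<And>x. x \<in> S \<Longrightarrow> norm (F' x) \<le> K * M0 + k * M1 * q"
    and "\<And>x y. x \<in> S \<Longrightarrow> y \<in> S \<Longrightarrow> norm (F' x - F' y) \<le>
      ((M1 * q * K + M0 * K) + (K * M1 * q + k * (Ma * q powr \<alpha>) * q + k * M1 * K)) * dist x y powr \<alpha>"
proof -
  fix x assume x: "x \<in> S"
  have sx: "s x \<in> B" using x s by auto
  have nn: "0 \<le> K" "0 \<le> q" "0 \<le> k" "0 \<le> M0" "0 \<le> M1"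
    using C1_holder_bound_nonneg[OF \<gamma>(1) x] order_trans[OF norm_ge_zero s(2)[OF x]]
      order_trans[OF abs_ge_zero \<gamma>(2)[OF x]] order_trans[OF norm_ge_zero f(2)[OF sx]]
      order_trans[OF norm_ge_zero f(3)[OF sx]] by auto
  have fs: "((\<lambda>x. f (s x)) has_derivative blinfun_apply (f' (s x) o\<^sub>L s' x)) (at x)"
    using has_derivative_compose[OF C1_holder_boundD(1)[OF s(1) x] f(1)[OF sx]] by (simp add: o_def blinfun_compose.rep_eq)
  show "((\<lambda>x. \<gamma> x *\<^sub>R f (s x)) has_derivative blinfun_apply (F' x)) (at x)"
    unfolding F'_def
    by (rule has_derivative_eq_rhs[OF has_derivative_scaleR[OF C1_holder_boundD(1)[OF \<gamma>(1) x] fs]])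
       (auto simp: blinfun.bilinear_simps algebra_simps)
  show "norm (\<gamma> x *\<^sub>R f (s x)) \<le> k * M0"
    using \<gamma>(2)[OF x] f(2)[OF sx] nn by (auto intro!: mult_mono)
  have bs: "norm (blinfun_compose (blinfun_scaleR_left a) b) \<le> norm a * norm b" for a :: 'c and b :: "'a \<Rightarrow>\<^sub>L real"
    using norm_blinfun_compose[of "blinfun_scaleR_left a" b]
    by (rule order_trans) (intro mult_right_mono norm_blinfun_bound, auto)
  have "norm (blinfun_compose (blinfun_scaleR_left (f (s x))) (\<gamma>' x)) \<le> M0 * K"
    by (rule order_trans[OF bs]) (use f(2)[OF sx] C1_holder_boundD(3)[OF \<gamma>(1) x] nn in \<open>auto intro!: mult_mono\<close>)
  moreover have "norm (\<gamma> x *\<^sub>R (f' (s x) o\<^sub>L s' x)) \<le> k * (M1 * q)"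
    unfolding norm_scaleR using \<gamma>(2)[OF x] order_trans[OF norm_blinfun_compose mult_mono[OF f(3)[OF sx] s(2)[OF x]]] nn
    by (intro mult_mono) auto
  ultimately show "norm (F' x) \<le> K * M0 + k * M1 * q"
    unfolding F'_def by (intro order_trans[OF norm_triangle_ineq]) (simp add: algebra_simps)
  fix y assume y: "y \<in> S"
  have sy: "s y \<in> B" using y s by auto
  let ?d = "dist x y powr \<alpha>"
  \<comment> \<open>Distances in \<open>S\<close> are at most 1, so the Lipschitz terms can be
    absorbed into \<alpha>-Hoelder ones.\<close>
  have dd: "dist x y \<le> ?d" using le_powr_of_le_one[OF zero_le_dist S(2)[OF x y] \<alpha>(2)] .
  have d0: "0 \<le> ?d" by simp
  have sl: "norm (s x - s y) \<le> q * dist x y" unfolding dist_norm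
    by (rule differentiable_bound[OF S(1) has_derivative_at_withinI[OF C1_holder_boundD(1)[OF s(1)]] _ x y])
       (use s(2) in \<open>auto simp: norm_blinfun.rep_eq\<close>)
  have gl: "\<bar>\<gamma> x - \<gamma> y\<bar> \<le> K * dist x y"
    using C1_holder_bound_lipschitz[OF S(1) \<gamma>(1) x y] by simp
  have fl: "norm (f (s x) - f (s y)) \<le> M1 * norm (s x - s y)"
    by (rule differentiable_bound[OF B has_derivative_at_withinI[OF f(1)] _ sx sy])
       (use f(3) in \<open>auto simp: norm_blinfun.rep_eq\<close>)
  have fl': "norm (f (s x) - f (s y)) \<le> M1 * q * ?d"
  proof -
    have "M1 * norm (s x - s y) \<le> M1 * (q * ?d)"
      using sl mult_left_mono[OF dd nn(2)] nn by (intro mult_left_mono) linarith+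
    then show ?thesis using fl by simp
  qed
  have dfl: "norm (f' (s x) - f' (s y)) \<le> Ma * q powr \<alpha> * ?d"
  proof -
    have "norm (f' (s x) - f' (s y)) \<le> Ma * dist (s x) (s y) powr \<alpha>" using f(4) sx sy by auto
    also have "\<dots> \<le> Ma * (q * dist x y) powr \<alpha>"
      using sl f(5) \<alpha> by (intro mult_left_mono powr_mono2) (auto simp: dist_norm)
    also have "\<dots> = Ma * q powr \<alpha> * ?d" using nn by (simp add: powr_mult)
    finally show ?thesis .
  qed
  have sxy: "norm (s' x - s' y) \<le> K * ?d" "norm (\<gamma>' x - \<gamma>' y) \<le> K * ?d"
    using C1_holder_boundD(4)[OF s(1) x y] C1_holder_boundD(4)[OF \<gamma>(1) x y] by auto
  \<comment> \<open>One factor is changed at a time. Of the five terms only the fourth contains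
    \<open>Ma\<close>, and there it is multiplied by \<open>q powr \<alpha> * q\<close>.\<close>
  have eq: "F' x - F' y =
      (blinfun_compose (blinfun_scaleR_left (f (s x) - f (s y))) (\<gamma>' x)
       + blinfun_compose (blinfun_scaleR_left (f (s y))) (\<gamma>' x - \<gamma>' y))
      + ((\<gamma> x - \<gamma> y) *\<^sub>R (f' (s x) o\<^sub>L s' x) + \<gamma> y *\<^sub>R ((f' (s x) - f' (s y)) o\<^sub>L s' x)
       + \<gamma> y *\<^sub>R (f' (s y) o\<^sub>L (s' x - s' y)))"
    unfolding F'_def by (rule blinfun_eqI) (simp add: blinfun.bilinear_simps algebra_simps)
  have t1: "norm (blinfun_compose (blinfun_scaleR_left (f (s x) - f (s y))) (\<gamma>' x)) \<le> (M1 * q * ?d) * K"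
    by (rule order_trans[OF bs mult_mono]) (use fl' C1_holder_boundD(3)[OF \<gamma>(1) x] nn d0 in auto)
  have t2: "norm (blinfun_compose (blinfun_scaleR_left (f (s y))) (\<gamma>' x - \<gamma>' y)) \<le> M0 * (K * ?d)"
    by (rule order_trans[OF bs mult_mono]) (use f(2)[OF sy] sxy nn d0 in auto)
  have t3: "norm ((\<gamma> x - \<gamma> y) *\<^sub>R (f' (s x) o\<^sub>L s' x)) \<le> (K * ?d) * (M1 * q)"
    unfolding norm_scaleR
    by (rule mult_mono[OF order_trans[OF _ order_trans[OF gl mult_left_mono[OF dd nn(1)]]]
         order_trans[OF norm_blinfun_compose mult_mono[OF f(3)[OF sx] s(2)[OF x]]]])
       (use nn in auto)
  have t4: "norm (\<gamma> y *\<^sub>R ((f' (s x) - f' (s y)) o\<^sub>L s' x)) \<le> k * ((Ma * q powr \<alpha> * ?d) * q)"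
    unfolding norm_scaleR
    by (rule mult_mono[OF _ order_trans[OF norm_blinfun_compose mult_mono[OF dfl s(2)[OF x]]]])
       (use \<gamma>(2)[OF y] nn f(5) in auto)
  have t5: "norm (\<gamma> y *\<^sub>R (f' (s y) o\<^sub>L (s' x - s' y))) \<le> k * (M1 * (K * ?d))"
    unfolding norm_scaleR
    by (rule mult_mono[OF _ order_trans[OF norm_blinfun_compose mult_mono[OF f(3)[OF sy] sxy(1)]]])
       (use \<gamma>(2)[OF y] nn in auto)
  have "norm (F' x - F' y) \<le> ((M1 * q * ?d) * K + M0 * (K * ?d))
      + ((K * ?d) * (M1 * q) + k * ((Ma * q powr \<alpha> * ?d) * q) + k * (M1 * (K * ?d)))"
    unfolding eq by (intro norm_triangle_mono t1 t2 t3 t4 t5)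
  then show "norm (F' x - F' y) \<le>
      ((M1 * q * K + M0 * K) + (K * M1 * q + k * (Ma * q powr \<alpha>) * q + k * M1 * K)) * ?d"
    by (simp add: algebra_simps)
qed

text \<open>Contains both the chain rule (\<open>\<gamma>\<close> constant 1) and the product rule
  (\<open>s\<close> the identity) for germs.\<close>

lemma C1_holder_at_scaleR_compose:
  fixes f :: "'b::real_normed_vector \<Rightarrow> 'c::real_normed_vector"
  assumes \<gamma>: "C1_holder_at \<alpha> \<gamma> p" and s: "C1_holder_at \<alpha> s p" and f: "C1_holder_at \<alpha> f (s p)"
    and \<alpha>: "0 < \<alpha>" "\<alpha> \<le> 1"
  shows "C1_holder_at \<alpha> (\<lambda>x. \<gamma> x *\<^sub>R f (s x)) p"
proof -
  obtain \<gamma>' e1 K1 where 1: "0 < e1" "e1 \<le> 1/2" "C1_holder_bound \<alpha> K1 (ball p e1) \<gamma> \<gamma>'"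
    using C1_holder_at_bound[OF \<gamma> \<alpha>(1)] by blast
  obtain s' e2 K2 where 2: "0 < e2" "e2 \<le> 1/2" "C1_holder_bound \<alpha> K2 (ball p e2) s s'"
    using C1_holder_at_bound[OF s \<alpha>(1)] by blast
  obtain f' e3 K3 where 3: "0 < e3" "e3 \<le> 1/2" "C1_holder_bound \<alpha> K3 (ball (s p) e3) f f'"
    using C1_holder_at_bound[OF f \<alpha>(1)] by blast
  obtain e4 where 4: "0 < e4" "\<And>x. dist x p < e4 \<Longrightarrow> dist (s x) (s p) < e3"
    using C1_holder_at_continuous[OF s] 3(1) unfolding continuous_at_eps_delta by blast
  define e where "e = min (min e1 e2) e4"
  define K where "K = max K1 K2"
  let ?S = "ball p e"
  have e: "0 < e" "e \<le> e1" "e \<le> e2" "e \<le> e4" using 1 2 4 by (auto simp: e_def)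
  have g: "C1_holder_bound \<alpha> K ?S \<gamma> \<gamma>'" and s': "C1_holder_bound \<alpha> K ?S s s'"
    by (rule C1_holder_bound_mono[OF 1(3)] C1_holder_bound_mono[OF 2(3)]; use e in \<open>auto simp: K_def\<close>)+
  have d: "dist x y \<le> 1" if "x \<in> ?S" "y \<in> ?S" for x y
    using that e 1(2) dist_triangle[of x y p] by (auto simp: dist_commute)
  have sB: "s ` ?S \<subseteq> ball (s p) e3" using 4(2) e by (auto simp: dist_commute)
  have nn: "0 \<le> K3" "0 \<le> K" using C1_holder_bound_nonneg[OF 3(3), of "s p"] C1_holder_bound_nonneg[OF g, of p] 3(1) e(1) by auto
  note est = weighted_composition_estimate[OF convex_ball d \<alpha> g _ s' _ sB C1_holder_boundD(1,2,3)[OF 3(3)]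
     C1_holder_boundD(4)[OF 3(3)] nn(1) convex_ball, of K K]
  define F' where "F' = (\<lambda>x. blinfun_compose (blinfun_scaleR_left (f (s x))) (\<gamma>' x) + \<gamma> x *\<^sub>R (f' (s x) o\<^sub>L s' x))"
  define C where "C = K3 * K * K + K3 * K + (K * K3 * K + K * (K3 * K powr \<alpha>) * K + K * K3 * K)"
  have "(\<forall>x\<in>?S. ((\<lambda>x. \<gamma> x *\<^sub>R f (s x)) has_derivative blinfun_apply (F' x)) (at x)) \<and>
     (\<forall>x\<in>?S. \<forall>y\<in>?S. norm (F' x - F' y) \<le> C * dist x y powr \<alpha>)"
    unfolding F'_def C_def using est(1,4) C1_holder_boundD(2)[OF g] C1_holder_boundD(3)[OF s'] by auto
  with e(1) show ?thesis unfolding C1_holder_at_def by blast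
qed

lemma C1_holder_at_linear:
  assumes "bounded_linear h" shows "C1_holder_at \<alpha> h p"
proof -
  have "(0::real) < 1 \<and> (\<forall>x\<in>ball p 1. (h has_derivative blinfun_apply (Blinfun h)) (at x)) \<and>
     (\<forall>x\<in>ball p 1. \<forall>y\<in>ball p 1. norm (Blinfun h - Blinfun h) \<le> 0 * dist x y powr \<alpha>)"
    using assms by (auto simp: bounded_linear_Blinfun_apply bounded_linear_imp_has_derivative)
  then show ?thesis unfolding C1_holder_at_def
    by - (rule exI[of _ "\<lambda>x. Blinfun h"], rule exI[of _ 1], rule exI[of _ 0], simp)
qed

lemma C1_holder_at_const: "C1_holder_at \<alpha> (\<lambda>x. k) p"
proof -
  have "(0::real) < 1 \<and> (\<forall>x\<in>ball p 1. ((\<lambda>x. k) has_derivative blinfun_apply 0) (at x)) \<and>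
     (\<forall>x\<in>ball p 1. \<forall>y\<in>ball p 1. norm (0::'a \<Rightarrow>\<^sub>L 'b) \<le> 0 * dist x y powr \<alpha>)"
    by (auto simp: zero_blinfun.rep_eq)
  then show ?thesis unfolding C1_holder_at_def
    by - (rule exI[of _ "\<lambda>x. 0"], rule exI[of _ 1], rule exI[of _ 0], simp)
qed

lemma C1_holder_at_compose:
  assumes "C1_holder_at \<alpha> s p" "C1_holder_at \<alpha> f (s p)" "0 < \<alpha>" "\<alpha> \<le> 1"
  shows "C1_holder_at \<alpha> (\<lambda>x. f (s x)) p"
  using C1_holder_at_scaleR_compose[OF C1_holder_at_const[of \<alpha> 1] assms] by simp

lemma C1_holder_at_mult:
  fixes f h :: "'a::real_normed_vector \<Rightarrow> real"
  assumes "C1_holder_at \<alpha> f p" "C1_holder_at \<alpha> h p" "0 < \<alpha>" "\<alpha> \<le> 1"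
  shows "C1_holder_at \<alpha> (\<lambda>x. f x * h x) p"
  using C1_holder_at_scaleR_compose[OF assms(1) C1_holder_at_linear[OF bounded_linear_ident] assms(2-4)] by simp

lemma C1_holder_at_add:
  assumes "C1_holder_at \<alpha> f p" "C1_holder_at \<alpha> h p" "0 < \<alpha>"
  shows "C1_holder_at \<alpha> (\<lambda>x. f x + h x) p"
proof -
  obtain f' e1 K1 where 1: "0 < e1" "C1_holder_bound \<alpha> K1 (ball p e1) f f'"
    using C1_holder_at_bound[OF assms(1,3)] by blast
  obtain h' e2 K2 where 2: "0 < e2" "C1_holder_bound \<alpha> K2 (ball p e2) h h'"
    using C1_holder_at_bound[OF assms(2,3)] by blast
  define e where "e = min e1 e2"
  have "0 < e \<and> (\<forall>x\<in>ball p e. ((\<lambda>x. f x + h x) has_derivative blinfun_apply (f' x + h' x)) (at x)) \<and>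
     (\<forall>x\<in>ball p e. \<forall>y\<in>ball p e. norm ((f' x + h' x) - (f' y + h' y)) \<le> (K1 + K2) * dist x y powr \<alpha>)"
  proof (intro conjI ballI)
    show "0 < e" using 1 2 by (simp add: e_def)
    fix x assume "x \<in> ball p e"
    then have x: "x \<in> ball p e1" "x \<in> ball p e2" by (auto simp: e_def)
    show "((\<lambda>x. f x + h x) has_derivative blinfun_apply (f' x + h' x)) (at x)"
      using has_derivative_add[OF C1_holder_boundD(1)[OF 1(2) x(1)] C1_holder_boundD(1)[OF 2(2) x(2)]]
      by (simp add: plus_blinfun.rep_eq)
    fix y assume "y \<in> ball p e"
    then have y: "y \<in> ball p e1" "y \<in> ball p e2" by (auto simp: e_def)
    have "norm ((f' x + h' x) - (f' y + h' y)) \<le> norm (f' x - f' y) + norm (h' x - h' y)"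
      by (rule norm_diff_triangle_ineq)
    then show "norm ((f' x + h' x) - (f' y + h' y)) \<le> (K1 + K2) * dist x y powr \<alpha>"
      using C1_holder_boundD(4)[OF 1(2) x(1) y(1)] C1_holder_boundD(4)[OF 2(2) x(2) y(2)]
      by (simp add: distrib_right)
  qed
  then show ?thesis unfolding C1_holder_at_def
    by - (rule exI[of _ "\<lambda>x. f' x + h' x"], rule exI[of _ e], rule exI[of _ "K1 + K2"])
qed

lemma C1_holder_at_Pair:
  assumes "C1_holder_at \<alpha> f p" "C1_holder_at \<alpha> h p" "0 < \<alpha>" "\<alpha> \<le> 1"
  shows "C1_holder_at \<alpha> (\<lambda>x. (f x, h x)) p"
proof -
  have "C1_holder_at \<alpha> (\<lambda>x. (f x, 0::'c)) p"
    by (rule C1_holder_at_compose[OF assms(1) C1_holder_at_linear assms(3,4)])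
       (intro bounded_linear_Pair bounded_linear_ident bounded_linear_zero)
  moreover have "C1_holder_at \<alpha> (\<lambda>x. (0::'b, h x)) p"
    by (rule C1_holder_at_compose[OF assms(2) C1_holder_at_linear assms(3,4)])
       (intro bounded_linear_Pair bounded_linear_ident bounded_linear_zero)
  ultimately show ?thesis using C1_holder_at_add[OF _ _ assms(3)] by fastforce
qed

text \<open>The inverse function theorem supplies a C^1 inverse. Hoelder continuity of its
  derivative comes from A^{-1} - B^{-1} = A^{-1} (B - A) B^{-1}, where A and B are values of
  \<open>\<Phi>'\<close> along the Lipschitz map \<open>\<Psi>\<close>.\<close>

lemma C1_holder_at_inverse:
  fixes \<Phi> :: "'a::euclidean_space \<Rightarrow> 'a"
  assumes \<Phi>: "C1_holder_at \<alpha> \<Phi> p" and \<alpha>: "0 < \<alpha>" "\<alpha> \<le> 1"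
    and D: "(\<Phi> has_derivative D) (at p)" "inj D" and S: "open S" "p \<in> S"
  obtains W W' \<Psi> where "open W" "p \<in> W" "W \<subseteq> S" "open W'" "\<Phi> p \<in> W'" "homeomorphism W W' \<Phi> \<Psi>"
    "C1_holder_at \<alpha> \<Psi> (\<Phi> p)"
proof -
  obtain \<Phi>' e K where e: "0 < e" "e \<le> 1/2" and b: "C1_holder_bound \<alpha> K (ball p e) \<Phi> \<Phi>'"
    using C1_holder_at_bound[OF \<Phi> \<alpha>(1)] by blast
  have pe: "p \<in> ball p e" using e by simp
  have K0: "K \<ge> 0" using C1_holder_bound_nonneg[OF b pe] .
  have DP: "D = blinfun_apply (\<Phi>' p)"
    using has_derivative_unique[OF D(1) C1_holder_boundD(1)[OF b pe]] .
  have cont: "continuous_on (ball p e) \<Phi>'"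
    unfolding continuous_on_def
  proof
    fix x assume x: "x \<in> ball p e"
    have "((\<lambda>y. K * dist y x powr \<alpha>) \<longlongrightarrow> K * 0) (at x within ball p e)"
      by (intro tendsto_mult_left tendsto_zero_powrI[where b=\<alpha>] tendsto_const)
         (use \<alpha> tendsto_dist[OF tendsto_ident_at tendsto_const, of x x] in auto)
    then have "((\<lambda>y. K * dist y x powr \<alpha>) \<longlongrightarrow> 0) (at x within ball p e)" by simp
    moreover have "\<forall>\<^sub>F y in at x within ball p e. norm (dist (\<Phi>' y) (\<Phi>' x)) \<le> K * dist y x powr \<alpha>"
      using C1_holder_boundD(4)[OF b _ x] by (auto simp: eventually_at_filter dist_norm intro!: always_eventually)
    ultimately have "((\<lambda>y. dist (\<Phi>' y) (\<Phi>' x)) \<longlongrightarrow> 0) (at x within ball p e)"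
      by (rule Lim_null_comparison[rotated])
    then show "(\<Phi>' \<longlongrightarrow> \<Phi>' x) (at x within ball p e)" using tendsto_dist_iff by blast
  qed
  obtain g where g: "linear g" "g \<circ> D = id"
    using linear_injective_left_inverse[of D] D has_derivative_linear by blast
  define invf where "invf = Blinfun g"
  have invf: "invf o\<^sub>L \<Phi>' p = id_blinfun"
    using g by (intro blinfun_eqI) (auto simp: invf_def DP bounded_linear_Blinfun_apply linear_conv_bounded_linear fun_eq_iff)
  let ?U = "ball p e \<inter> S"
  obtain W W' \<Psi> \<Psi>' where W: "open W" "W \<subseteq> ?U" "p \<in> W" "open W'" "\<Phi> p \<in> W'" "homeomorphism W W' \<Phi> \<Psi>"
    and dP: "\<And>y. y \<in> W' \<Longrightarrow> (\<Psi> has_derivative (\<Psi>' y)) (at y)"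
    and eP: "\<And>y. y \<in> W' \<Longrightarrow> \<Psi>' y = inv (blinfun_apply (\<Phi>' (\<Psi> y)))"
    and bP: "\<And>y. y \<in> W' \<Longrightarrow> bij (blinfun_apply (\<Phi>' (\<Psi> y)))"
  proof (rule inverse_function_theorem[of ?U \<Phi> \<Phi>' p invf])
    show "continuous_on ?U \<Phi>'" using cont continuous_on_subset by blast
  qed (use S pe C1_holder_boundD(1)[OF b] invf in auto)
  \<comment> \<open>Bounds the inverse of \<open>\<Phi>' p\<close>; the summand 1 makes it positive.
    Where \<open>\<Phi>'\<close> is within \<open>1 / (2 * I)\<close> of \<open>\<Phi>' p\<close>,
    the inverse is bounded by \<open>2 * I\<close>.\<close>
  define I where "I = norm invf + 1"
  have I: "I > 0" by (simp add: I_def add_nonneg_pos)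
  have low0: "norm v \<le> I * norm (\<Phi>' p v)" for v
  proof -
    have "v = invf (\<Phi>' p v)" using invf by (metis blinfun_apply_blinfun_compose blinfun_apply_id_blinfun)
    then have "norm v \<le> norm invf * norm (\<Phi>' p v)" by (metis norm_blinfun)
    also have "\<dots> \<le> I * norm (\<Phi>' p v)" by (intro mult_right_mono) (auto simp: I_def)
    finally show ?thesis .
  qed
  have "isCont \<Phi>' p" using cont pe by (simp add: continuous_on_eq_continuous_at)
  then obtain e1 where e1: "e1 > 0" "\<And>x. dist x p < e1 \<Longrightarrow> dist (\<Phi>' x) (\<Phi>' p) < 1 / (2 * I)"
    unfolding continuous_at_eps_delta using I by (metis divide_pos_pos mult_pos_pos zero_less_one zero_less_numeral)
  have low: "norm v \<le> 2 * I * norm (\<Phi>' x v)" if "dist x p < e1" for x v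
  proof -
    have "norm (\<Phi>' p v) \<le> norm (\<Phi>' x v) + norm ((\<Phi>' x - \<Phi>' p) v)"
      using norm_triangle_ineq4[of "\<Phi>' x v" "(\<Phi>' x - \<Phi>' p) v"] by (simp add: blinfun.diff_left)
    also have "norm ((\<Phi>' x - \<Phi>' p) v) \<le> 1 / (2 * I) * norm v"
      by (rule order_trans[OF norm_blinfun mult_right_mono]) (use e1(2)[OF that] in \<open>auto simp: dist_norm\<close>)
    finally have "I * norm (\<Phi>' p v) \<le> I * (norm (\<Phi>' x v) + 1 / (2 * I) * norm v)"
      using I by (intro mult_left_mono) auto
    also have "\<dots> = I * norm (\<Phi>' x v) + norm v / 2" using I by (simp add: field_simps)
    finally show ?thesis using low0[of v] by linarith
  qed
  have pW: "\<Psi> (\<Phi> p) = p" using W unfolding homeomorphism_def by auto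
  have "isCont \<Psi> (\<Phi> p)" using dP[OF W(5)] has_derivative_continuous by auto
  then obtain e2 where e2: "e2 > 0" "\<And>y. dist y (\<Phi> p) < e2 \<Longrightarrow> dist (\<Psi> y) p < e1"
    unfolding continuous_at_eps_delta pW using e1(1) by blast
  obtain e3 where e3: "e3 > 0" "ball (\<Phi> p) e3 \<subseteq> W'" using W(4,5) open_contains_ball by metis
  let ?B = "ball (\<Phi> p) (min e2 e3)"
  define P where "P = (\<lambda>y. Blinfun (\<Psi>' y))"
  have Papp: "blinfun_apply (P y) = \<Psi>' y" if "y \<in> ?B" for y
    unfolding P_def using that e3
    by (intro bounded_linear_Blinfun_apply has_derivative_bounded_linear[OF dP]) auto
  have inv1: "\<Phi>' (\<Psi> y) (P y v) = v" if "y \<in> ?B" for y v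
    using eP[of y] bP[of y] that e3 Papp[OF that] by (simp add: bij_is_surj subset_eq surj_f_inv_f)
  have inv2: "P y (\<Phi>' (\<Psi> y) v) = v" if "y \<in> ?B" for y v
    using eP[of y] bP[of y] that e3 Papp[OF that] by (simp add: bij_is_inj subset_eq inv_f_f)
  have nP: "norm (P y) \<le> 2 * I" if y: "y \<in> ?B" for y
  proof (rule norm_blinfun_bound)
    fix v show "norm (P y v) \<le> 2 * I * norm v"
      using low[of "\<Psi> y" "P y v"] inv1[OF y] e2(2)[of y] y by (auto simp: dist_commute)
  qed (use I in auto)
  have Psi: "\<Psi> y \<in> ball p e" if "y \<in> ?B" for y
  proof -
    have "y \<in> W'" using e3(2) that by auto
    then have "\<Psi> y \<in> W" using W(6) unfolding homeomorphism_def by blast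
    then show ?thesis using W(2) by blast
  qed
  have lip: "norm (\<Psi> y - \<Psi> z) \<le> 2 * I * norm (y - z)" if y: "y \<in> ?B" and z: "z \<in> ?B" for y z
  proof (rule differentiable_bound[OF convex_ball _ _ y z])
    fix x assume x: "x \<in> ?B"
    show "(\<Psi> has_derivative \<Psi>' x) (at x within ?B)" using x e3 by (intro has_derivative_at_withinI[OF dP]) auto
    show "onorm (\<Psi>' x) \<le> 2 * I" using nP[OF x] Papp[OF x] by (simp add: norm_blinfun.rep_eq)
  qed
  define C where "C = 4 * I * I * (K * (2 * I) powr \<alpha>)"
  have hol: "norm (P y - P z) \<le> C * dist y z powr \<alpha>" if y: "y \<in> ?B" and z: "z \<in> ?B" for y z
  proof -
    have eq: "P y - P z = P y o\<^sub>L (\<Phi>' (\<Psi> z) - \<Phi>' (\<Psi> y)) o\<^sub>L P z"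
      by (rule blinfun_eqI) (simp add: blinfun.bilinear_simps inv1[OF z] inv2[OF y])
    have "norm (\<Phi>' (\<Psi> z) - \<Phi>' (\<Psi> y)) \<le> K * dist (\<Psi> z) (\<Psi> y) powr \<alpha>"
      using C1_holder_boundD(4)[OF b Psi[OF z] Psi[OF y]] .
    also have "\<dots> \<le> K * (2 * I * dist y z) powr \<alpha>"
      using lip[OF z y] \<alpha> K0 by (intro mult_left_mono powr_mono2) (auto simp: dist_norm norm_minus_commute)
    also have "\<dots> = K * (2 * I) powr \<alpha> * dist y z powr \<alpha>" using I by (simp add: powr_mult)
    finally have h: "norm (\<Phi>' (\<Psi> z) - \<Phi>' (\<Psi> y)) \<le> K * (2 * I) powr \<alpha> * dist y z powr \<alpha>" .
    have "norm (P y - P z) \<le> (2 * I * (K * (2 * I) powr \<alpha> * dist y z powr \<alpha>)) * (2 * I)"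
      unfolding eq
      by (rule order_trans[OF norm_blinfun_compose mult_mono[OF order_trans[OF norm_blinfun_compose mult_mono[OF nP[OF y] h]] nP[OF z]]])
         (use I K0 in auto)
    then show ?thesis by (simp add: C_def algebra_simps)
  qed
  have "0 < min e2 e3 \<and> (\<forall>y\<in>?B. (\<Psi> has_derivative blinfun_apply (P y)) (at y)) \<and>
    (\<forall>y\<in>?B. \<forall>z\<in>?B. norm (P y - P z) \<le> C * dist y z powr \<alpha>)"
    using e2 e3 hol Papp dP by (auto simp: subset_eq)
  then have "C1_holder_at \<alpha> \<Psi> (\<Phi> p)" unfolding C1_holder_at_def by blast
  with that[of W W' \<Psi>] W show ?thesis by auto
qed

section \<open>Bounds in \<open>C\<^sup>r(X)\<close> and \<open>C\<^sup>1\<^sup>+\<^sup>\<alpha>(X)\<close>\<close>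

text \<open>A relational substitute for \<open>Cr_norm N r f \<le> M\<close> when 0 < r < 1,
  equivalent to it up to constant factors. It involves no suprema, passes to pointwise limits, and
  for r = 1 expresses a Lipschitz bound.\<close>

definition holder_bound ::
  "(('x, 'e::euclidean_space) chart \<times> 'e \<times> real) set \<Rightarrow> real \<Rightarrow> real \<Rightarrow> ('x \<Rightarrow> real) \<Rightarrow> bool" where
  "holder_bound N r M f \<longleftrightarrow> (\<forall>c a R. (c, a, R) \<in> N \<longrightarrow> (\<forall>z\<in>ball a R. \<bar>f (chart_inv c z)\<bar> \<le> M \<and>
     (\<forall>z'\<in>ball a R. \<bar>f (chart_inv c z) - f (chart_inv c z')\<bar> \<le> M * dist z z' powr r)))"

text \<open>The three constants stay apart because they behave differently: the Lasota-Yorke step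
  contracts only \<open>Ma\<close>, and interpolation trades \<open>M1\<close> against
  \<open>M0\<close> and \<open>Ma\<close>.\<close>

definition C1_bound ::
  "(('x, 'e::euclidean_space) chart \<times> 'e \<times> real) set \<Rightarrow> real \<Rightarrow> real \<Rightarrow> real \<Rightarrow> real \<Rightarrow>
   ('x \<Rightarrow> real) \<Rightarrow> bool" where
  "C1_bound N \<alpha> M0 M1 Ma f \<longleftrightarrow> 0 \<le> M0 \<and> 0 \<le> M1 \<and> 0 \<le> Ma \<and> (\<forall>c a R. (c, a, R) \<in> N \<longrightarrow>
     (\<exists>f' :: 'e \<Rightarrow> 'e \<Rightarrow>\<^sub>L real. \<forall>z\<in>ball a R.
       ((\<lambda>z. f (chart_inv c z)) has_derivative blinfun_apply (f' z)) (at z) \<and>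
       \<bar>f (chart_inv c z)\<bar> \<le> M0 \<and> norm (f' z) \<le> M1 \<and>
       (\<forall>z'\<in>ball a R. norm (f' z - f' z') \<le> Ma * dist z z' powr \<alpha>)))"

lemma coordinate_coverD:
  assumes "coordinate_cover A N"
  shows "finite N"
    and "(c, a, R) \<in> N \<Longrightarrow> c \<in> A" "(c, a, R) \<in> N \<Longrightarrow> R > 0"
    and "(c, a, R) \<in> N \<Longrightarrow> cball a R \<subseteq> chart_img c"
    and "\<exists>c a R z. (c, a, R) \<in> N \<and> z \<in> ball a R \<and> x = chart_inv c z"
proof -
  show "\<exists>c a R z. (c, a, R) \<in> N \<and> z \<in> ball a R \<and> x = chart_inv c z"
  proof -
    have "x \<in> (\<Union>(c, a, R)\<in>N. chart_inv c ` ball a R)" using assms by (simp add: coordinate_cover_def)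
    then show ?thesis by force
  qed
qed (use assms in \<open>auto simp: coordinate_cover_def\<close>)

lemma holder_boundD:
  assumes "holder_bound N r M f" "(c, a, R) \<in> N" "z \<in> ball a R"
  shows "\<bar>f (chart_inv c z)\<bar> \<le> M"
    "z' \<in> ball a R \<Longrightarrow> \<bar>f (chart_inv c z) - f (chart_inv c z')\<bar> \<le> M * dist z z' powr r"
  using assms unfolding holder_bound_def by blast+

lemma holder_bound_sup:
  assumes "coordinate_cover A N" "holder_bound N r M f"
  shows "\<bar>f x\<bar> \<le> M"
  using coordinate_coverD(5)[OF assms(1), of x] holder_boundD(1)[OF assms(2)] by auto

lemma holder_bound_nonneg: "coordinate_cover A N \<Longrightarrow> holder_bound N r M f \<Longrightarrow> 0 \<le> M"
  using holder_bound_sup abs_ge_zero order_trans by blast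

lemma holder_bound_mono:
  assumes "holder_bound N r M f" "M \<le> M'" shows "holder_bound N r M' f"
  unfolding holder_bound_def
proof (intro allI impI ballI conjI)
  fix c a R z assume *: "(c, a, R) \<in> N" "z \<in> ball a R"
  show "\<bar>f (chart_inv c z)\<bar> \<le> M'" using holder_boundD(1)[OF assms(1) *] assms(2) by simp
  fix z' assume "z' \<in> ball a R"
  then show "\<bar>f (chart_inv c z) - f (chart_inv c z')\<bar> \<le> M' * dist z z' powr r"
    using holder_boundD(2)[OF assms(1) *] mult_right_mono[OF assms(2), of "dist z z' powr r"] by fastforce
qed

lemma holder_bound_add:
  assumes "holder_bound N r M f" "holder_bound N r M' h"
  shows "holder_bound N r (M + M') (\<lambda>x. f x + h x)"
  unfolding holder_bound_def
proof (intro allI impI ballI conjI)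
  fix c a R z assume *: "(c, a, R) \<in> N" "z \<in> ball a R"
  show "\<bar>f (chart_inv c z) + h (chart_inv c z)\<bar> \<le> M + M'"
    using holder_boundD(1)[OF assms(1) *] holder_boundD(1)[OF assms(2) *] by linarith
  fix z' assume z': "z' \<in> ball a R"
  show "\<bar>(f (chart_inv c z) + h (chart_inv c z)) - (f (chart_inv c z') + h (chart_inv c z'))\<bar>
      \<le> (M + M') * dist z z' powr r"
    using holder_boundD(2)[OF assms(1) * z'] holder_boundD(2)[OF assms(2) * z']
    unfolding distrib_right by linarith
qed

lemma holder_bound_cmult:
  assumes "holder_bound N r M f"
  shows "holder_bound N r (\<bar>k\<bar> * M) (\<lambda>x. k * f x)"
  unfolding holder_bound_def
proof (intro allI impI ballI conjI)
  fix c a R z assume *: "(c, a, R) \<in> N" "z \<in> ball a R"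
  show "\<bar>k * f (chart_inv c z)\<bar> \<le> \<bar>k\<bar> * M"
    using holder_boundD(1)[OF assms(1) *] by (simp add: abs_mult mult_left_mono)
  fix z' assume z': "z' \<in> ball a R"
  show "\<bar>k * f (chart_inv c z) - k * f (chart_inv c z')\<bar> \<le> \<bar>k\<bar> * M * dist z z' powr r"
    using mult_left_mono[OF holder_boundD(2)[OF assms(1) * z'], of "\<bar>k\<bar>"]
    by (simp add: abs_mult[symmetric] algebra_simps)
qed

lemma holder_bound_diff:
  assumes "holder_bound N r M f" "holder_bound N r M' h"
  shows "holder_bound N r (M + M') (\<lambda>x. f x - h x)"
  using holder_bound_add[OF assms(1) holder_bound_cmult[OF assms(2), of "-1"]] by simp

lemma holder_bound_const: "holder_bound N r \<bar>k\<bar> (\<lambda>x. k)"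
  by (simp add: holder_bound_def)

lemma holder_bound_sum:
  assumes "finite I" "\<And>i. i \<in> I \<Longrightarrow> holder_bound N r (M i) (f i)"
  shows "holder_bound N r (\<Sum>i\<in>I. M i) (\<lambda>x. \<Sum>i\<in>I. f i x)"
  using assms holder_bound_const[of N r 0] by (induction rule: finite_induct) (auto intro: holder_bound_add)

text \<open>For fixed points of a ball both inequalities are closed conditions, so pointwise
  convergence is enough. This serves for the Neumann series and for the limit of difference
  quotients.\<close>

lemma holder_bound_limit:
  assumes "\<forall>\<^sub>F k in F. holder_bound N r (M k) (f k)" "\<And>x. ((\<lambda>k. f k x) \<longlongrightarrow> h x) F"
    "(M \<longlongrightarrow> L) F" "F \<noteq> bot"
  shows "holder_bound N r L h"
  unfolding holder_bound_def
proof (intro allI impI ballI conjI)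
  fix c a R z assume *: "(c, a, R) \<in> N" "z \<in> ball a R"
  show "\<bar>h (chart_inv c z)\<bar> \<le> L"
    by (rule tendsto_le[OF assms(4,3) tendsto_rabs[OF assms(2)]])
       (use assms(1) holder_boundD(1)[OF _ *] in \<open>auto elim: eventually_mono\<close>)
  fix z' assume z': "z' \<in> ball a R"
  show "\<bar>h (chart_inv c z) - h (chart_inv c z')\<bar> \<le> L * dist z z' powr r"
    by (rule tendsto_le[OF assms(4) tendsto_mult_right[OF assms(3)] tendsto_rabs[OF tendsto_diff[OF assms(2) assms(2)]]])
       (use assms(1) holder_boundD(2)[OF _ * z'] in \<open>auto elim: eventually_mono\<close>)
qed

text \<open>Passes from a local to a global Hoelder bound: at distance at least
  \<open>\<epsilon>\<close> the oscillation is at most \<open>2 * M0\<close>, and there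
  \<open>1 \<le> \<epsilon> powr (- r) * dist z z' powr r\<close>.\<close>

lemma holder_bound_near:
  assumes "\<And>c a R z z'. (c, a, R) \<in> N \<Longrightarrow> z \<in> ball a R \<Longrightarrow> z' \<in> ball a R \<Longrightarrow> dist z z' < \<epsilon> \<Longrightarrow>
      \<bar>f (chart_inv c z) - f (chart_inv c z')\<bar> \<le> M * dist z z' powr r"
    and "\<And>x. \<bar>f x\<bar> \<le> M0" "0 < \<epsilon>" "0 < r" "0 \<le> M"
  shows "holder_bound N r (M + (1 + 2 * \<epsilon> powr (- r)) * M0) f"
proof -
  have M0: "0 \<le> M0" using assms(2) abs_ge_zero order_trans by blast
  show ?thesis unfolding holder_bound_def
  proof (intro allI impI ballI conjI)
    fix c a R z assume *: "(c, a, R) \<in> N" "z \<in> ball a R"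
    have "0 \<le> 2 * \<epsilon> powr (- r) * M0" using M0 by simp
    then show "\<bar>f (chart_inv c z)\<bar> \<le> M + (1 + 2 * \<epsilon> powr (- r)) * M0"
      using assms(2)[of "chart_inv c z"] assms(5) unfolding distrib_right by linarith
    fix z' assume z': "z' \<in> ball a R"
    show "\<bar>f (chart_inv c z) - f (chart_inv c z')\<bar> \<le> (M + (1 + 2 * \<epsilon> powr (- r)) * M0) * dist z z' powr r"
    proof (cases "dist z z' < \<epsilon>")
      case True
      have "M * dist z z' powr r \<le> (M + (1 + 2 * \<epsilon> powr (- r)) * M0) * dist z z' powr r"
        using M0 by (intro mult_right_mono) auto
      then show ?thesis using assms(1)[OF * z' True] by linarith
    next
      case False
      have "1 \<le> \<epsilon> powr (-r) * dist z z' powr r"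
      proof -
        have "\<epsilon> powr (-r) * \<epsilon> powr r \<le> \<epsilon> powr (-r) * dist z z' powr r"
          using False assms(3,4) by (intro mult_left_mono powr_mono2) auto
        then show ?thesis using assms(3) by (simp add: powr_minus)
      qed
      then have "2 * M0 * 1 \<le> 2 * M0 * (\<epsilon> powr (-r) * dist z z' powr r)"
        using M0 by (intro mult_left_mono) auto
      moreover have "\<bar>f (chart_inv c z) - f (chart_inv c z')\<bar> \<le> 2 * M0"
        using assms(2)[of "chart_inv c z"] assms(2)[of "chart_inv c z'"] by linarith
      moreover have "0 \<le> M * dist z z' powr r" "0 \<le> M0 * dist z z' powr r" using assms(5) M0 by auto
      ultimately have "\<bar>f (chart_inv c z) - f (chart_inv c z')\<bar> \<le> M * dist z z' powr r +
          (M0 * dist z z' powr r + 2 * M0 * (\<epsilon> powr (-r) * dist z z' powr r))" by linarith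
      then show ?thesis by (simp add: algebra_simps)
    qed
  qed
qed

text \<open>Below distance \<open>\<tau>\<close> the \<alpha>-Hoelder bound has the factor
  \<open>\<tau> powr (\<alpha> - r)\<close> to spare; beyond it the sup bound takes over. A small
  sup norm together with a merely bounded C^\<alpha> norm thus gives a small C^r norm.\<close>

lemma holder_interpolation:
  assumes f: "holder_bound N \<alpha> B f" "\<And>x. \<bar>f x\<bar> \<le> S" and "0 < r" "r < \<alpha>" "0 < \<tau>"
  shows "holder_bound N r (B * \<tau> powr (\<alpha> - r) + (1 + 2 * \<tau> powr (- r)) * S) f"
proof (cases "N = {}")
  case False
  then obtain c a R where "(c, a, R) \<in> N" by auto
  show ?thesis
  proof (cases "0 \<le> B")
    case True
    show ?thesis
    proof (rule holder_bound_near[OF _ f(2) \<open>0 < \<tau>\<close> \<open>0 < r\<close>])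
      fix c a R z z' assume *: "(c, a, R) \<in> N" "z \<in> ball a R" "z' \<in> ball a R" "dist z z' < \<tau>"
      have "dist z z' powr \<alpha> = dist z z' powr (\<alpha> - r) * dist z z' powr r"
        by (simp add: powr_add[symmetric])
      also have "\<dots> \<le> \<tau> powr (\<alpha> - r) * dist z z' powr r"
        using * assms by (intro mult_right_mono powr_mono2) auto
      finally have "B * dist z z' powr \<alpha> \<le> B * (\<tau> powr (\<alpha> - r) * dist z z' powr r)"
        using True by (rule mult_left_mono)
      then show "\<bar>f (chart_inv c z) - f (chart_inv c z')\<bar> \<le> B * \<tau> powr (\<alpha> - r) * dist z z' powr r"
        using holder_boundD(2)[OF f(1) *(1-3)] by simp
    qed (use True in auto)
  next
    case B: False
    \<comment> \<open>A negative \<open>B\<close> can only bound a function if every ball is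
      empty.\<close>
    have "ball a R = {}" if "(c, a, R) \<in> N" for c a R
    proof (rule ccontr)
      assume "ball a R \<noteq> {}"
      then obtain z where "z \<in> ball a R" by blast
      then show False using holder_boundD(1)[OF f(1) that] B abs_ge_zero order_trans by blast
    qed
    then show ?thesis unfolding holder_bound_def by blast
  qed
qed (simp add: holder_bound_def)

section \<open>Comparison of \<open>holder_bound\<close> with the spaces \<open>Cr\<close> and their
  norms\<close>

lemma C_frac_norm_on_bounds:
  fixes f :: "'e::euclidean_space \<Rightarrow> 'b::real_normed_vector"
  assumes "C_frac_on r S f" "z \<in> S" "w \<in> S" "w \<noteq> z"
  shows "norm (f z) \<le> C_frac_norm_on r S f"
    and "0 < r \<Longrightarrow> z' \<in> S \<Longrightarrow> norm (f z - f z') \<le> C_frac_norm_on r S f * dist z z' powr r"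
    and "0 \<le> C_frac_norm_on r S f"
proof -
  have bdd: "bdd_above ((\<lambda>z. norm (f z)) ` S)"
  proof -
    obtain M where "\<forall>x\<in>f ` S. norm x \<le> M" using assms(1) unfolding C_frac_on_def bounded_iff by blast
    then show ?thesis by (intro bdd_aboveI[of _ M]) auto
  qed
  have s: "norm (f z) \<le> (SUP x\<in>S. norm (f x))" using bdd assms(2) by (rule cSUP_upper2) simp
  let ?Q = "{norm (f x - f y) / dist x y powr r | x y. x \<in> S \<and> y \<in> S \<and> x \<noteq> y}"
  have h: "norm (f x - f y) \<le> holder_seminorm_on r S f * dist x y powr r \<and>
      (x \<noteq> y \<longrightarrow> 0 \<le> holder_seminorm_on r S f)" if r: "0 < r" and xy: "x \<in> S" "y \<in> S" for x y
  proof (cases "x = y")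
    case False
    obtain C where C: "\<And>x y. x \<in> S \<Longrightarrow> y \<in> S \<Longrightarrow> norm (f x - f y) \<le> C * dist x y powr r"
      using assms(1) r unfolding C_frac_on_def holder_on_def by blast
    have "bdd_above ?Q"
      by (rule bdd_aboveI[of _ C]) (auto simp: divide_le_eq dest: C)
    then have "norm (f x - f y) / dist x y powr r \<le> holder_seminorm_on r S f"
      unfolding holder_seminorm_on_def using xy False by (intro cSup_upper) auto
    moreover have "0 \<le> norm (f x - f y) / dist x y powr r" by simp
    ultimately have "0 \<le> holder_seminorm_on r S f" by linarith
    then show ?thesis using \<open>norm (f x - f y) / dist x y powr r \<le> holder_seminorm_on r S f\<close> False
      by (auto simp: divide_le_eq)
  qed simp
  have h0: "0 \<le> (if 0 < r then holder_seminorm_on r S f else 0)"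
    using h[OF _ assms(3,2)] assms(4) by auto
  show 1: "norm (f z) \<le> C_frac_norm_on r S f" using s h0 unfolding C_frac_norm_on_def by linarith
  then show "0 \<le> C_frac_norm_on r S f" using norm_ge_zero order_trans by blast
  assume r: "0 < r" and z': "z' \<in> S"
  have "0 \<le> (SUP x\<in>S. norm (f x))" using s norm_ge_zero order_trans by blast
  then have "holder_seminorm_on r S f * dist z z' powr r \<le> C_frac_norm_on r S f * dist z z' powr r"
    using r unfolding C_frac_norm_on_def by (intro mult_right_mono) auto
  then show "norm (f z - f z') \<le> C_frac_norm_on r S f * dist z z' powr r"
    using h[OF r assms(2) z'] by linarith
qed

text \<open>The Hoelder seminorm is a supremum over pairs of distinct points; such a pair has to
  exist before the supremum is known to be nonnegative.\<close>

lemma ball_other_point: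
  fixes a :: "'e::euclidean_space"
  assumes "0 < R"
  obtains w where "w \<in> ball a R" "w \<noteq> z"
proof -
  obtain b :: 'e where b: "b \<in> Basis" using nonempty_Basis by blast
  show ?thesis
  proof (cases "z = a")
    case True
    have "a + (R/2) *\<^sub>R b \<in> ball a R" "a + (R/2) *\<^sub>R b \<noteq> z" using b assms True nonzero_Basis by (auto simp: dist_norm)
    then show ?thesis using that by blast
  qed (use assms that[of a] in auto)
qed

lemma holder_continuous_on:
  assumes "\<And>z z'. z \<in> S \<Longrightarrow> z' \<in> S \<Longrightarrow> norm (f z - f z') \<le> M * dist z z' powr r" "0 < r"
  shows "continuous_on S f"
  unfolding continuous_on_def
proof
  fix x assume x: "x \<in> S"
  have "((\<lambda>y. dist y x) \<longlongrightarrow> 0) (at x within S)"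
    using tendsto_dist[OF tendsto_ident_at tendsto_const, of x x] by simp
  then have "((\<lambda>y. M * dist y x powr r) \<longlongrightarrow> M * 0) (at x within S)"
    by (intro tendsto_mult_left tendsto_zero_powrI[where b=r] tendsto_const) (use assms(2) in auto)
  then have "((\<lambda>y. M * dist y x powr r) \<longlongrightarrow> 0) (at x within S)" by simp
  moreover have "\<forall>\<^sub>F y in at x within S. norm (dist (f y) (f x)) \<le> M * dist y x powr r"
    using assms(1)[OF _ x] by (auto simp: eventually_at_filter dist_norm intro!: always_eventually)
  ultimately have "((\<lambda>y. dist (f y) (f x)) \<longlongrightarrow> 0) (at x within S)"
    by (rule Lim_null_comparison[rotated])
  then show "(f \<longlongrightarrow> f x) (at x within S)" using tendsto_dist_iff by blast
qed

lemma C_frac_onI: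
  fixes f :: "'e::euclidean_space \<Rightarrow> 'b::real_normed_vector"
  assumes "\<And>z. z \<in> S \<Longrightarrow> norm (f z) \<le> M" "0 \<le> \<beta>" "continuous_on S f"
    and "\<And>z z'. 0 < \<beta> \<Longrightarrow> z \<in> S \<Longrightarrow> z' \<in> S \<Longrightarrow> norm (f z - f z') \<le> M * dist z z' powr \<beta>"
    and "z \<in> S" "w \<in> S" "w \<noteq> z"
  shows "C_frac_on \<beta> S f" "C_frac_norm_on \<beta> S f \<le> 2 * M"
proof -
  show "C_frac_on \<beta> S f"
    using assms unfolding C_frac_on_def holder_on_def bounded_iff by auto
  have M: "0 \<le> M" using assms(1)[OF assms(5)] norm_ge_zero order_trans by blast
  have "(SUP x\<in>S. norm (f x)) \<le> M" using assms(1,5) by (intro cSUP_least) auto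
  moreover have "holder_seminorm_on \<beta> S f \<le> M" if "0 < \<beta>"
    unfolding holder_seminorm_on_def
    by (rule cSup_least) (use assms(4)[OF that] assms(5-7) in \<open>auto simp: divide_le_eq\<close>)
  ultimately show "C_frac_norm_on \<beta> S f \<le> 2 * M" using M unfolding C_frac_norm_on_def by auto
qed

lemma holder_bound_continuous_on:
  assumes "holder_bound N r M f" "0 < r" "(c, a, R) \<in> N"
  shows "continuous_on (ball a R) (\<lambda>z. f (chart_inv c z))"
  by (rule holder_continuous_on[where M=M and r=r])
     (use holder_boundD(2)[OF assms(1,3)] assms(2) in auto)

text \<open>On each ball the factor 2 accounts for the supremum and the seminorm. For
  \<open>\<beta> = 0\<close> only continuity and boundedness are at stake.\<close>

lemma holder_bound_imp_Cr:
  assumes cov: "coordinate_cover A N" and f: "holder_bound N r M f" and r: "0 < r" "r < 1" "\<beta> = r \<or> \<beta> = 0"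
  shows "f \<in> Cr N \<beta>" "Cr_norm N \<beta> f \<le> 2 * real (card N) * M"
proof -
  have *: "Cr_on \<beta> (ball a R) (\<lambda>z. f (chart_inv c z)) \<and>
      Cr_norm_on \<beta> (ball a R) (\<lambda>z. f (chart_inv c z)) \<le> 2 * M" if "(c, a, R) \<in> N" for c a R
  proof -
    have R: "R > 0" using coordinate_coverD(3)[OF cov that] .
    obtain w where w: "w \<in> ball a R" "w \<noteq> a" using ball_other_point[OF R] by metis
    have "C_frac_on \<beta> (ball a R) (\<lambda>z. f (chart_inv c z))"
      "C_frac_norm_on \<beta> (ball a R) (\<lambda>z. f (chart_inv c z)) \<le> 2 * M"
      using holder_boundD[OF f that] r holder_bound_continuous_on[OF f r(1) that] R w
      by (intro C_frac_onI[where z=a and w=w]; auto)+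
    then show ?thesis using r by (auto simp: Cr_on_def Cr_norm_on_def)
  qed
  then show "f \<in> Cr N \<beta>" unfolding Cr_def by auto
  have "Cr_norm N \<beta> f \<le> (\<Sum>(c, a, R)\<in>N. 2 * M)" unfolding Cr_norm_def
    using * by (intro sum_mono) auto
  then show "Cr_norm N \<beta> f \<le> 2 * real (card N) * M" by (simp add: case_prod_unfold)
qed

lemma Cr_imp_holder_bound:
  assumes cov: "coordinate_cover A N" and f: "f \<in> Cr N r" and r: "0 < r" "r < 1"
  shows "holder_bound N r (Cr_norm N r f) f"
proof -
  let ?n = "\<lambda>(c, a, R). Cr_norm_on r (ball a R) (\<lambda>z. f (chart_inv c z))"
  have C: "C_frac_on r (ball a R) (\<lambda>z. f (chart_inv c z))" if "(c, a, R) \<in> N" for c a R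
    using f that r unfolding Cr_def Cr_on_def by fastforce
  have n: "?n (c, a, R) = C_frac_norm_on r (ball a R) (\<lambda>z. f (chart_inv c z))" for c a R
    using r by (simp add: Cr_norm_on_def)
  have nn: "0 \<le> ?n b" if "b \<in> N" for b
  proof -
    obtain c a R where b: "b = (c, a, R)" using prod_cases3 by blast
    have R: "R > 0" using coordinate_coverD(3)[OF cov] that b by blast
    obtain w where w: "w \<in> ball a R" "w \<noteq> a" using ball_other_point[OF R] by metis
    show ?thesis using C_frac_norm_on_bounds(3)[OF C[of c a R] _ w] that n[of c a R] R unfolding b by simp
  qed
  have le: "?n b \<le> Cr_norm N r f" if "b \<in> N" for b
    unfolding Cr_norm_def by (rule member_le_sum) (use that nn coordinate_coverD(1)[OF cov] in auto)
  show ?thesis unfolding holder_bound_def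
  proof (intro allI impI ballI conjI)
    fix c a R z assume *: "(c, a, R) \<in> N" "z \<in> ball a R"
    obtain w where w: "w \<in> ball a R" "w \<noteq> z" using ball_other_point[OF coordinate_coverD(3)[OF cov *(1)]] by metis
    show "\<bar>f (chart_inv c z)\<bar> \<le> Cr_norm N r f"
      using C_frac_norm_on_bounds(1)[OF C[OF *(1)] *(2) w] le[OF *(1)] n[of c a R] by simp
    fix z' assume z': "z' \<in> ball a R"
    have "?n (c, a, R) * dist z z' powr r \<le> Cr_norm N r f * dist z z' powr r"
      by (rule mult_right_mono[OF le[OF *(1)]]) simp
    then show "\<bar>f (chart_inv c z) - f (chart_inv c z')\<bar> \<le> Cr_norm N r f * dist z z' powr r"
      using C_frac_norm_on_bounds(2)[OF C[OF *(1)] *(2) w r(1) z'] n[of c a R] by simp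
  qed
qed

lemma Cr_norm_nonneg:
  assumes cov: "coordinate_cover A N" and r: "0 \<le> r" "r < 1" and f: "f \<in> Cr N r"
  shows "0 \<le> Cr_norm N r (f :: 'x::t2_space \<Rightarrow> real)"
proof (cases "r = 0")
  case True
  have "0 \<le> Cr_norm_on 0 (ball a R) (\<lambda>z. f (chart_inv c z))" if n: "(c, a, R) \<in> N" for c a R
  proof -
    have "bounded ((\<lambda>z. f (chart_inv c z)) ` ball a R)"
      using f n unfolding Cr_def Cr_on_def C_frac_on_def True by fastforce
    then have "bdd_above ((\<lambda>z. norm (f (chart_inv c z))) ` ball a R)"
      unfolding bounded_iff bdd_above_def by auto
    moreover have "a \<in> ball a R" using coordinate_coverD(3)[OF cov n] by simp
    ultimately have "0 \<le> (SUP z\<in>ball a R. norm (f (chart_inv c z)))"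
      by (intro cSUP_upper2[of _ _ a]) auto
    then show ?thesis by (simp add: Cr_norm_on_def C_frac_norm_on_def)
  qed
  then show ?thesis unfolding Cr_norm_def True by (intro sum_nonneg) auto
next
  case False
  then show ?thesis using holder_bound_nonneg[OF cov Cr_imp_holder_bound[OF cov f]] r by simp
qed

lemma Cr_iff_holder_bound:
  assumes "coordinate_cover A N" "0 < r" "r < 1"
  shows "f \<in> Cr N r \<longleftrightarrow> (\<exists>M. holder_bound N r M f)"
  using holder_bound_imp_Cr(1)[OF assms(1) _ assms(2,3)] Cr_imp_holder_bound[OF assms(1) _ assms(2,3)] by blast

text \<open>Distances in a ball of radius \<open>R\<close> are at most \<open>2 * R\<close>, so
  lowering the exponent costs at most \<open>(2 * R) powr (r - \<beta>)\<close>; summing over the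
  finite cover gives one constant for all balls.\<close>

lemma holder_bound_exponent:
  assumes cov: "coordinate_cover A N" and r: "0 < \<beta>" "\<beta> \<le> r"
  obtains K where "1 \<le> K" "\<And>f M. holder_bound N r M f \<Longrightarrow> holder_bound N \<beta> (K * M) f"
proof -
  define K where "K = 1 + (\<Sum>(c, a, R)\<in>N. (2 * R) powr (r - \<beta>))"
  have K1: "1 \<le> K" unfolding K_def by (auto intro!: sum_nonneg)
  have K: "(2 * R) powr (r - \<beta>) \<le> K" if "(c, a, R) \<in> N" for c a R
  proof -
    have "(case (c, a, R) of (c, a, R) \<Rightarrow> (2 * R) powr (r - \<beta>)) \<le> (\<Sum>(c, a, R)\<in>N. (2 * R) powr (r - \<beta>))"
      by (rule member_le_sum) (use that coordinate_coverD(1)[OF cov] in auto)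
    then show ?thesis by (simp add: K_def)
  qed
  have "holder_bound N \<beta> (K * M) f" if f: "holder_bound N r M f" for f M
    unfolding holder_bound_def
  proof (intro allI impI ballI conjI)
    have M: "0 \<le> M" using holder_bound_nonneg[OF cov f] .
    fix c a R z assume *: "(c, a, R) \<in> N" "z \<in> ball a R"
    have "1 * M \<le> K * M" using K1 M by (intro mult_right_mono)
    then show "\<bar>f (chart_inv c z)\<bar> \<le> K * M" using holder_boundD(1)[OF f *] by simp
    fix z' assume z': "z' \<in> ball a R"
    have "dist z z' \<le> 2 * R" using * z' dist_triangle_half_r[of a z "2 * R" z'] by (auto simp: dist_commute)
    then have "dist z z' powr (r - \<beta>) \<le> K" using K[OF *(1)] powr_mono2[of "r - \<beta>" "dist z z'" "2 * R"] r by simp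
    then have "dist z z' powr (r - \<beta>) * dist z z' powr \<beta> \<le> K * dist z z' powr \<beta>" by (intro mult_right_mono) auto
    then have "M * dist z z' powr r \<le> M * (K * dist z z' powr \<beta>)"
      using M by (intro mult_left_mono) (auto simp: powr_add[symmetric])
    then show "\<bar>f (chart_inv c z) - f (chart_inv c z')\<bar> \<le> K * M * dist z z' powr \<beta>"
      using holder_boundD(2)[OF f * z'] by (simp add: algebra_simps)
  qed
  with K1 that show ?thesis by blast
qed

lemma holder_bound_imp_Cr_le:
  assumes cov: "coordinate_cover A N" and r: "0 \<le> \<beta>" "\<beta> \<le> r" "0 < r" "r < 1"
  obtains K where "0 \<le> K" "\<And>f M. holder_bound N r M f \<Longrightarrow> f \<in> Cr N \<beta> \<and> Cr_norm N \<beta> f \<le> K * M"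
proof (cases "\<beta> = 0")
  case True
  show ?thesis by (rule that[of "2 * real (card N)"]) (use holder_bound_imp_Cr[OF cov] r True in auto)
next
  case False
  then obtain K where K: "1 \<le> K" "\<And>f M. holder_bound N r M f \<Longrightarrow> holder_bound N \<beta> (K * M) f"
    using holder_bound_exponent[OF cov, of \<beta> r] r by auto
  show ?thesis
  proof (rule that[of "2 * real (card N) * K"])
    fix f M assume "holder_bound N r M f"
    from holder_bound_imp_Cr[OF cov K(2)[OF this], of \<beta>] show
      "f \<in> Cr N \<beta> \<and> Cr_norm N \<beta> f \<le> 2 * real (card N) * K * M" using r False by (simp add: algebra_simps)
  qed (use K in auto)
qed

section \<open>Bounds in C^{1+\<alpha>} and interpolation of the first derivative\<close>

lemma C1_boundD:
  assumes "C1_bound N \<alpha> M0 M1 Ma f"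
  shows "0 \<le> M0" "0 \<le> M1" "0 \<le> Ma"
    and "(c, a, R) \<in> N \<Longrightarrow> \<exists>f' :: 'e \<Rightarrow> 'e \<Rightarrow>\<^sub>L real. \<forall>z\<in>ball a (R::real).
       ((\<lambda>z::'e::euclidean_space. f (chart_inv c z)) has_derivative blinfun_apply (f' z)) (at z) \<and>
       \<bar>f (chart_inv c z)\<bar> \<le> M0 \<and> norm (f' z) \<le> M1 \<and>
       (\<forall>z'\<in>ball a R. norm (f' z - f' z') \<le> Ma * dist z z' powr \<alpha>)"
  using assms unfolding C1_bound_def by blast+

lemma Cr_imp_C1_bound:
  assumes cov: "coordinate_cover A N" and f: "f \<in> Cr N (1 + \<alpha>)" and \<alpha>: "0 < \<alpha>" "\<alpha> < 1"
  obtains M where "C1_bound N \<alpha> M M M f"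
proof -
  have "\<exists>M\<ge>0. \<exists>f' :: 'b \<Rightarrow> 'b \<Rightarrow>\<^sub>L real. \<forall>z\<in>ball a R.
       ((\<lambda>z. f (chart_inv c z)) has_derivative blinfun_apply (f' z)) (at z) \<and>
       \<bar>f (chart_inv c z)\<bar> \<le> M \<and> norm (f' z) \<le> M \<and>
       (\<forall>z'\<in>ball a R. norm (f' z - f' z') \<le> M * dist z z' powr \<alpha>)" if b: "(c, a, R) \<in> N" for c a R
  proof -
    let ?f = "\<lambda>z. f (chart_inv c z)"
    have "Cr_on (1 + \<alpha>) (ball a R) ?f" using f b unfolding Cr_def by auto
    then have h: "C_frac_on 0 (ball a R) ?f" "\<And>z. z \<in> ball a R \<Longrightarrow> ?f differentiable (at z)"
      "C_frac_on \<alpha> (ball a R) (Diff ?f)" using \<alpha> unfolding Cr_on_def by auto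
    obtain M1 where M1: "\<And>z. z \<in> ball a R \<Longrightarrow> norm (?f z) \<le> M1" 
      using h(1) unfolding C_frac_on_def bounded_iff by (metis imageI)
    obtain M2 where M2: "\<And>z. z \<in> ball a R \<Longrightarrow> norm (Diff ?f z) \<le> M2" 
      using h(3) unfolding C_frac_on_def bounded_iff by (metis imageI)
    obtain M3 where M3: "\<And>z z'. z \<in> ball a R \<Longrightarrow> z' \<in> ball a R \<Longrightarrow> norm (Diff ?f z - Diff ?f z') \<le> M3 * dist z z' powr \<alpha>"
      using h(3) \<alpha> unfolding C_frac_on_def holder_on_def by blast
    define M where "M = max 0 (max M1 (max M2 M3))"
    have "(?f has_derivative blinfun_apply (Diff ?f z)) (at z)" if "z \<in> ball a R" for z
      using h(2)[OF that] frechet_derivative_works[of ?f "at z"] unfolding Diff_def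
      by (metis bounded_linear_Blinfun_apply has_derivative_bounded_linear)
    moreover have "norm (Diff ?f z - Diff ?f z') \<le> M * dist z z' powr \<alpha>" if "z \<in> ball a R" "z' \<in> ball a R" for z z'
      using M3[OF that] mult_right_mono[of M3 M "dist z z' powr \<alpha>"] by (fastforce simp: M_def)
    moreover have "\<bar>?f z\<bar> \<le> M" "norm (Diff ?f z) \<le> M" if "z \<in> ball a R" for z
      using M1[OF that] M2[OF that] by (auto simp: M_def)
    ultimately show ?thesis by (intro exI[of _ M] conjI exI[of _ "Diff ?f"]) (auto simp: M_def)
  qed
  then have "\<forall>b\<in>N. \<exists>M. M \<ge> 0 \<and> (\<exists>f' :: 'b \<Rightarrow> 'b \<Rightarrow>\<^sub>L real. \<forall>z\<in>ball (fst (snd b)) (snd (snd b)).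
       ((\<lambda>z. f (chart_inv (fst b) z)) has_derivative blinfun_apply (f' z)) (at z) \<and>
       \<bar>f (chart_inv (fst b) z)\<bar> \<le> M \<and> norm (f' z) \<le> M \<and>
       (\<forall>z'\<in>ball (fst (snd b)) (snd (snd b)). norm (f' z - f' z') \<le> M * dist z z' powr \<alpha>))" by fastforce
  then obtain M where M0: "\<And>b. b \<in> N \<Longrightarrow> 0 \<le> M b" and M: "\<And>b. b \<in> N \<Longrightarrow> \<exists>f' :: 'b \<Rightarrow> 'b \<Rightarrow>\<^sub>L real. \<forall>z\<in>ball (fst (snd b)) (snd (snd b)).
       ((\<lambda>z. f (chart_inv (fst b) z)) has_derivative blinfun_apply (f' z)) (at z) \<and>
       \<bar>f (chart_inv (fst b) z)\<bar> \<le> M b \<and> norm (f' z) \<le> M b \<and>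
       (\<forall>z'\<in>ball (fst (snd b)) (snd (snd b)). norm (f' z - f' z') \<le> M b * dist z z' powr \<alpha>)"
    using bchoice[of N "\<lambda>b M. M \<ge> 0 \<and> (\<exists>f' :: 'b \<Rightarrow> 'b \<Rightarrow>\<^sub>L real. \<forall>z\<in>ball (fst (snd b)) (snd (snd b)).
       ((\<lambda>z. f (chart_inv (fst b) z)) has_derivative blinfun_apply (f' z)) (at z) \<and>
       \<bar>f (chart_inv (fst b) z)\<bar> \<le> M \<and> norm (f' z) \<le> M \<and>
       (\<forall>z'\<in>ball (fst (snd b)) (snd (snd b)). norm (f' z - f' z') \<le> M * dist z z' powr \<alpha>))"] by blast
  \<comment> \<open>The constants of the finitely many balls are nonnegative, so their sum dominates
    each of them.\<close>
  define L where "L = (\<Sum>b\<in>N. M b)"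
  have le_L: "M b \<le> L" if "b \<in> N" for b
    unfolding L_def by (rule member_le_sum) (use that M0 coordinate_coverD(1)[OF cov] in auto)
  have L0: "0 \<le> L" unfolding L_def using M0 by (intro sum_nonneg)
  have "C1_bound N \<alpha> L L L f" unfolding C1_bound_def
  proof (intro conjI L0 allI impI)
    fix c a R assume b: "(c, a, R) \<in> N"
    obtain f' :: "'b \<Rightarrow> 'b \<Rightarrow>\<^sub>L real" where f': "\<And>z. z\<in>ball a R \<Longrightarrow>
       ((\<lambda>z. f (chart_inv c z)) has_derivative blinfun_apply (f' z)) (at z) \<and>
       \<bar>f (chart_inv c z)\<bar> \<le> M (c, a, R) \<and> norm (f' z) \<le> M (c, a, R) \<and>
       (\<forall>z'\<in>ball a R. norm (f' z - f' z') \<le> M (c, a, R) * dist z z' powr \<alpha>)" using M[OF b] unfolding fst_conv snd_conv by blast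
    have "M (c, a, R) * dist z z' powr \<alpha> \<le> L * dist z z' powr \<alpha>" for z z' :: 'b
      using le_L[OF b] by (intro mult_right_mono) auto
    then show "\<exists>f' :: 'b \<Rightarrow> 'b \<Rightarrow>\<^sub>L real. \<forall>z\<in>ball a R.
       ((\<lambda>z. f (chart_inv c z)) has_derivative blinfun_apply (f' z)) (at z) \<and>
       \<bar>f (chart_inv c z)\<bar> \<le> L \<and> norm (f' z) \<le> L \<and>
       (\<forall>z'\<in>ball a R. norm (f' z - f' z') \<le> L * dist z z' powr \<alpha>)"
      using f' le_L[OF b] by (intro exI[of _ f']) (meson order_trans)
  qed
  then show ?thesis using that by blast
qed

lemma C1_bound_sup:
  assumes "coordinate_cover A N" "C1_bound N \<alpha> M0 M1 Ma f"
  shows "\<bar>f x\<bar> \<le> M0"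
  using coordinate_coverD(5)[OF assms(1), of x] C1_boundD(4)[OF assms(2)] by blast

text \<open>\<open>M0'\<close> may be any bound for the values, even one below \<open>M0\<close>: a
  better sup bound can be inserted while the information on the derivative is kept.\<close>

lemma C1_bound_change:
  assumes f: "C1_bound N \<alpha> M0 M1 Ma f" and M: "\<And>x. \<bar>f x\<bar> \<le> M0'" "M1 \<le> M1'" "Ma \<le> Ma'" "0 \<le> M0'"
  shows "C1_bound N \<alpha> M0' M1' Ma' f"
  unfolding C1_bound_def
proof (intro conjI allI impI)
  fix c :: "('a, 'b) chart" and a :: 'b and R :: real assume b: "(c, a, R) \<in> N"
  obtain f' :: "'b \<Rightarrow> 'b \<Rightarrow>\<^sub>L real" where f': "\<And>z. z\<in>ball a R \<Longrightarrow>
       ((\<lambda>z. f (chart_inv c z)) has_derivative blinfun_apply (f' z)) (at z) \<and>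
       \<bar>f (chart_inv c z)\<bar> \<le> M0 \<and> norm (f' z) \<le> M1 \<and>
       (\<forall>z'\<in>ball a R. norm (f' z - f' z') \<le> Ma * dist z z' powr \<alpha>)" using C1_boundD(4)[OF f b] by blast
  have "Ma * dist z z' powr \<alpha> \<le> Ma' * dist z z' powr \<alpha>" for z z' :: 'b
    using M(3) by (intro mult_right_mono) auto
  then show "\<exists>f' :: 'b \<Rightarrow> 'b \<Rightarrow>\<^sub>L real. \<forall>z\<in>ball a R.
       ((\<lambda>z. f (chart_inv c z)) has_derivative blinfun_apply (f' z)) (at z) \<and>
       \<bar>f (chart_inv c z)\<bar> \<le> M0' \<and> norm (f' z) \<le> M1' \<and>
       (\<forall>z'\<in>ball a R. norm (f' z - f' z') \<le> Ma' * dist z z' powr \<alpha>)"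
    using f' M by (intro exI[of _ f']) (meson order_trans)
qed (use C1_boundD[OF f] M in auto)

lemma C1_bound_add:
  assumes f: "C1_bound N \<alpha> M0 M1 Ma f" and h: "C1_bound N \<alpha> M0' M1' Ma' h"
  shows "C1_bound N \<alpha> (M0 + M0') (M1 + M1') (Ma + Ma') (\<lambda>x. f x + h x)"
  unfolding C1_bound_def
proof (intro conjI allI impI)
  fix c :: "('a, 'b) chart" and a :: 'b and R :: real assume b: "(c, a, R) \<in> N"
  obtain f' :: "'b \<Rightarrow> 'b \<Rightarrow>\<^sub>L real" where f': "\<And>z. z\<in>ball a R \<Longrightarrow>
       ((\<lambda>z. f (chart_inv c z)) has_derivative blinfun_apply (f' z)) (at z) \<and>
       \<bar>f (chart_inv c z)\<bar> \<le> M0 \<and> norm (f' z) \<le> M1 \<and>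
       (\<forall>z'\<in>ball a R. norm (f' z - f' z') \<le> Ma * dist z z' powr \<alpha>)" using C1_boundD(4)[OF f b] by blast
  obtain h' :: "'b \<Rightarrow> 'b \<Rightarrow>\<^sub>L real" where h': "\<And>z. z\<in>ball a R \<Longrightarrow>
       ((\<lambda>z. h (chart_inv c z)) has_derivative blinfun_apply (h' z)) (at z) \<and>
       \<bar>h (chart_inv c z)\<bar> \<le> M0' \<and> norm (h' z) \<le> M1' \<and>
       (\<forall>z'\<in>ball a R. norm (h' z - h' z') \<le> Ma' * dist z z' powr \<alpha>)" using C1_boundD(4)[OF h b] by blast
  show "\<exists>f' :: 'b \<Rightarrow> 'b \<Rightarrow>\<^sub>L real. \<forall>z\<in>ball a R.
       ((\<lambda>z. f (chart_inv c z) + h (chart_inv c z)) has_derivative blinfun_apply (f' z)) (at z) \<and>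
       \<bar>f (chart_inv c z) + h (chart_inv c z)\<bar> \<le> M0 + M0' \<and> norm (f' z) \<le> M1 + M1' \<and>
       (\<forall>z'\<in>ball a R. norm (f' z - f' z') \<le> (Ma + Ma') * dist z z' powr \<alpha>)"
  proof (intro exI[of _ "\<lambda>z. f' z + h' z"] ballI conjI)
    fix z assume z: "z \<in> ball a R"
    show "((\<lambda>z. f (chart_inv c z) + h (chart_inv c z)) has_derivative blinfun_apply (f' z + h' z)) (at z)"
      using has_derivative_add f'[OF z] h'[OF z] by (fastforce simp: plus_blinfun.rep_eq)
    show "\<bar>f (chart_inv c z) + h (chart_inv c z)\<bar> \<le> M0 + M0'" using f'[OF z] h'[OF z] by linarith
    show "norm (f' z + h' z) \<le> M1 + M1'" using f'[OF z] h'[OF z] norm_triangle_mono by blast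
    fix z' assume z': "z' \<in> ball a R"
    show "norm ((f' z + h' z) - (f' z' + h' z')) \<le> (Ma + Ma') * dist z z' powr \<alpha>"
      unfolding distrib_right by (rule order_trans[OF norm_diff_triangle_ineq]) (use f'[OF z] h'[OF z] z' in \<open>auto intro: add_mono\<close>)
  qed
qed (use C1_boundD[OF f] C1_boundD[OF h] in auto)

lemma C1_bound_cmult:
  assumes f: "C1_bound N \<alpha> M0 M1 Ma f"
  shows "C1_bound N \<alpha> (\<bar>k\<bar> * M0) (\<bar>k\<bar> * M1) (\<bar>k\<bar> * Ma) (\<lambda>x. k * f x)"
  unfolding C1_bound_def
proof (intro conjI allI impI)
  fix c :: "('a, 'b) chart" and a :: 'b and R :: real assume b: "(c, a, R) \<in> N"
  obtain f' :: "'b \<Rightarrow> 'b \<Rightarrow>\<^sub>L real" where f': "\<And>z. z\<in>ball a R \<Longrightarrow>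
       ((\<lambda>z. f (chart_inv c z)) has_derivative blinfun_apply (f' z)) (at z) \<and>
       \<bar>f (chart_inv c z)\<bar> \<le> M0 \<and> norm (f' z) \<le> M1 \<and>
       (\<forall>z'\<in>ball a R. norm (f' z - f' z') \<le> Ma * dist z z' powr \<alpha>)" using C1_boundD(4)[OF f b] by blast
  show "\<exists>f' :: 'b \<Rightarrow> 'b \<Rightarrow>\<^sub>L real. \<forall>z\<in>ball a R.
       ((\<lambda>z. k * f (chart_inv c z)) has_derivative blinfun_apply (f' z)) (at z) \<and>
       \<bar>k * f (chart_inv c z)\<bar> \<le> \<bar>k\<bar> * M0 \<and> norm (f' z) \<le> \<bar>k\<bar> * M1 \<and>
       (\<forall>z'\<in>ball a R. norm (f' z - f' z') \<le> \<bar>k\<bar> * Ma * dist z z' powr \<alpha>)"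
  proof (intro exI[of _ "\<lambda>z. k *\<^sub>R f' z"] ballI conjI)
    fix z assume z: "z \<in> ball a R"
    show "((\<lambda>z. k * f (chart_inv c z)) has_derivative blinfun_apply (k *\<^sub>R f' z)) (at z)"
      using has_derivative_mult_right f'[OF z] by (fastforce simp: scaleR_blinfun.rep_eq)
    show "\<bar>k * f (chart_inv c z)\<bar> \<le> \<bar>k\<bar> * M0" "norm (k *\<^sub>R f' z) \<le> \<bar>k\<bar> * M1"
      using f'[OF z] by (auto simp: abs_mult intro!: mult_left_mono)
    fix z' assume z': "z' \<in> ball a R"
    have "norm (k *\<^sub>R f' z - k *\<^sub>R f' z') = \<bar>k\<bar> * norm (f' z - f' z')"
      by (simp add: scaleR_diff_right[symmetric])
    also have "\<dots> \<le> \<bar>k\<bar> * (Ma * dist z z' powr \<alpha>)" using f'[OF z] z' by (intro mult_left_mono) auto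
    finally show "norm (k *\<^sub>R f' z - k *\<^sub>R f' z') \<le> \<bar>k\<bar> * Ma * dist z z' powr \<alpha>" by simp
  qed
qed (use C1_boundD[OF f] in auto)

lemma C1_bound_imp_holder_bound:
  assumes cov: "coordinate_cover A N" and r: "0 < r" "r \<le> 1"
  obtains K where "0 \<le> K" "\<And>f \<alpha> M0 M1 Ma. C1_bound N \<alpha> M0 M1 Ma f \<Longrightarrow> holder_bound N r (K * (M0 + M1)) f"
proof -
  obtain K where K: "1 \<le> K" "\<And>f M. holder_bound N 1 M f \<Longrightarrow> holder_bound N r (K * M) f"
    using holder_bound_exponent[OF cov r] by blast
  have "holder_bound N 1 (M0 + M1) f" if f: "C1_bound N \<alpha> M0 M1 Ma f" for f \<alpha> M0 M1 Ma
    unfolding holder_bound_def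
  proof (intro allI impI ballI conjI)
    fix c a R z assume *: "(c, a, R) \<in> N" "z \<in> ball a R"
    obtain f' :: "'b \<Rightarrow> 'b \<Rightarrow>\<^sub>L real" where f': "\<And>z. z\<in>ball a R \<Longrightarrow>
       ((\<lambda>z. f (chart_inv c z)) has_derivative blinfun_apply (f' z)) (at z) \<and>
       \<bar>f (chart_inv c z)\<bar> \<le> M0 \<and> norm (f' z) \<le> M1" using C1_boundD(4)[OF f *(1)] by blast
    show "\<bar>f (chart_inv c z)\<bar> \<le> M0 + M1" using f'[OF *(2)] C1_boundD(2)[OF f] by linarith
    fix z' assume z': "z' \<in> ball a R"
    have "norm (f (chart_inv c z) - f (chart_inv c z')) \<le> M1 * norm (z - z')"
      by (rule differentiable_bound[OF convex_ball _ _ *(2) z'])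
         (use f' in \<open>auto simp: norm_blinfun.rep_eq intro: has_derivative_at_withinI\<close>)
    also have "\<dots> \<le> (M0 + M1) * dist z z' powr 1"
      using C1_boundD[OF f] by (auto simp: dist_norm intro!: mult_right_mono)
    finally show "\<bar>f (chart_inv c z) - f (chart_inv c z')\<bar> \<le> (M0 + M1) * dist z z' powr 1" by simp
  qed
  then show ?thesis using K by (intro that[of K]) auto
qed

text \<open>A point near the boundary of a coordinate ball is first moved towards the centre, so that
  the difference quotients with step \<open>t\<close> stay in the ball.\<close>

lemma C1_interpolation:
  assumes cov: "coordinate_cover A N" and \<alpha>: "0 < \<alpha>"
  obtains t0 where "0 < t0" "\<And>f M0 M1 Ma t. C1_bound N \<alpha> M0 M1 Ma f \<Longrightarrow> 0 < t \<Longrightarrow> t < t0 \<Longrightarrow>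
     C1_bound N \<alpha> M0 (2 * M0 / t + 2 * Ma * t powr \<alpha>) Ma f"
proof -
  obtain t0 where t0: "0 < t0" "\<And>c a R. (c, a, R) \<in> N \<Longrightarrow> t0 \<le> R"
  proof -
    have fin: "finite ((\<lambda>(c, a, R). R) ` N)" using coordinate_coverD(1)[OF cov] by simp
    define t0 where "t0 = Min (insert 1 ((\<lambda>(c, a, R). R) ` N))"
    have "0 < t0" unfolding t0_def using fin coordinate_coverD(3)[OF cov] by (subst Min_gr_iff) auto
    moreover have "t0 \<le> R" if "(c, a, R) \<in> N" for c a R
      unfolding t0_def using fin that by (intro Min_le) force+
    ultimately show ?thesis using that by blast
  qed
  show ?thesis
  proof (rule that[OF t0(1)])
    fix f M0 M1 Ma t assume f: "C1_bound N \<alpha> M0 M1 Ma f" and t: "0 < t" "t < t0"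
    let ?M = "2 * M0 / t + 2 * Ma * t powr \<alpha>"
    show "C1_bound N \<alpha> M0 ?M Ma f"
      unfolding C1_bound_def
    proof (intro conjI allI impI)
      fix c :: "('a, 'b) chart" and a :: 'b and R :: real assume b: "(c, a, R) \<in> N"
      obtain f' :: "'b \<Rightarrow> 'b \<Rightarrow>\<^sub>L real" where f': "\<And>z. z\<in>ball a R \<Longrightarrow>
         ((\<lambda>z. f (chart_inv c z)) has_derivative blinfun_apply (f' z)) (at z) \<and>
         \<bar>f (chart_inv c z)\<bar> \<le> M0 \<and> norm (f' z) \<le> M1 \<and>
         (\<forall>z'\<in>ball a R. norm (f' z - f' z') \<le> Ma * dist z z' powr \<alpha>)" using C1_boundD(4)[OF f b] by blast
      have tR: "t < R" using t0(2)[OF b] t by simp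
      have "norm (f' z) \<le> ?M" if z: "z \<in> ball a R" for z
      proof -
        \<comment> \<open>\<open>y\<close> is within \<open>t\<close> of \<open>z\<close>, and the
          closed ball of radius \<open>t\<close> around \<open>y\<close> stays inside the coordinate
          ball.\<close>
        define y where "y = z + (t / R) *\<^sub>R (a - z)"
        have "y - a = (1 - t / R) *\<^sub>R (z - a)" by (simp add: y_def algebra_simps)
        then have "norm (y - a) = (1 - t / R) * norm (z - a)" using tR t by simp
        also have "\<dots> < (1 - t / R) * R" using z tR t by (intro mult_strict_left_mono) (auto simp: dist_norm norm_minus_commute)
          also have "\<dots> = R - t" using tR t by (simp add: field_simps)
        finally have ya: "norm (y - a) < R - t" .
        have yB: "y \<in> ball a R" using ya t by (simp add: dist_norm norm_minus_commute)
        have "dist z y = t / R * norm (a - z)" using t tR by (simp add: y_def dist_norm)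
        also have "\<dots> \<le> t / R * R" using z t tR by (intro mult_left_mono) (auto simp: dist_norm)
        finally have zy: "dist z y \<le> t" using t tR by simp
        have zyt: "norm (f' z - f' y) \<le> Ma * t powr \<alpha>"
          using f'[OF z] yB zy \<alpha> C1_boundD(3)[OF f]
          by (meson order_trans mult_left_mono powr_mono2 zero_le_dist less_imp_le)
        have inB: "y + v \<in> ball a R" if "norm v \<le> t" for v
          using ya that norm_triangle_ineq[of "y - a" v] by (simp add: dist_norm norm_minus_commute[of a] algebra_simps)
        \<comment> \<open>Comparing values at distance \<open>t\<close> bounds the derivative by
          \<open>2 * M0 / t\<close> plus a linearization error \<open>Ma * t powr \<alpha>\<close>.
          The second copy of that error in \<open>?M\<close> pays for the move from \<open>z\<close>
          to \<open>y\<close>.\<close>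
        have "norm (f' y) \<le> 2 * M0 / t + Ma * t powr \<alpha>"
        proof (rule norm_blinfun_bound)
          show "0 \<le> 2 * M0 / t + Ma * t powr \<alpha>" using C1_boundD[OF f] t by auto
          fix v :: 'b
          have *: "\<bar>f' y w\<bar> \<le> 2 * M0 + t * (Ma * t powr \<alpha>)" if w: "norm w = t" for w
          proof -
            have "norm (f (chart_inv c (y + w)) - f (chart_inv c y) - f' y (y + w - y)) \<le> norm (y + w - y) * (Ma * t powr \<alpha>)"
            proof (rule differentiable_bound_linearization[where S = "cball y t" and f' = "\<lambda>x. blinfun_apply (f' x)" and ?x0.0 = y])
              fix s :: real assume "s \<in> {0..1}"
              then show "y + s *\<^sub>R (y + w - y) \<in> cball y t" using w t mult_left_le_one_le[of t s] by (auto simp: dist_norm)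
            next
              fix x assume x: "x \<in> cball y t"
              then have xB: "x \<in> ball a R" using inB[of "x - y"] by (simp add: dist_norm norm_minus_commute)
              show "((\<lambda>z. f (chart_inv c z)) has_derivative blinfun_apply (f' x)) (at x within cball y t)"
                using f'[OF xB] has_derivative_at_withinI by blast
              have "norm (f' x - f' y) \<le> Ma * dist x y powr \<alpha>" using f'[OF xB] yB by blast
              also have "\<dots> \<le> Ma * t powr \<alpha>" using x \<alpha> C1_boundD(3)[OF f]
                by (intro mult_left_mono powr_mono2) (auto simp: dist_commute)
              finally show "onorm (blinfun_apply (f' x) - blinfun_apply (f' y)) \<le> Ma * t powr \<alpha>"
                by (simp add: norm_blinfun.rep_eq minus_blinfun.rep_eq fun_diff_def)
            qed (use t in auto)
            moreover have "\<bar>f (chart_inv c (y + w))\<bar> \<le> M0" "\<bar>f (chart_inv c y)\<bar> \<le> M0"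
              using f'[OF inB[of w]] f'[OF yB] w by auto
            ultimately show ?thesis using w by (auto simp: abs_if split: if_splits)
          qed
          show "norm (f' y v) \<le> (2 * M0 / t + Ma * t powr \<alpha>) * norm v"
          proof (cases "v = 0")
            case False
            have "\<bar>f' y ((t / norm v) *\<^sub>R v)\<bar> \<le> 2 * M0 + t * (Ma * t powr \<alpha>)"
              by (rule *) (use t False in auto)
            then have "t / norm v * \<bar>f' y v\<bar> \<le> 2 * M0 + t * (Ma * t powr \<alpha>)"
              using t by (simp add: blinfun.scaleR_right abs_mult)
            then show ?thesis using t False by (simp add: field_simps)
          qed simp
        qed
        then show ?thesis using zyt norm_triangle_sub[of "f' z" "f' y"] by simp
      qed
      then show "\<exists>f' :: 'b \<Rightarrow> 'b \<Rightarrow>\<^sub>L real. \<forall>z\<in>ball a R.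
         ((\<lambda>z. f (chart_inv c z)) has_derivative blinfun_apply (f' z)) (at z) \<and>
         \<bar>f (chart_inv c z)\<bar> \<le> M0 \<and> norm (f' z) \<le> ?M \<and>
         (\<forall>z'\<in>ball a R. norm (f' z - f' z') \<le> Ma * dist z z' powr \<alpha>)"
        using f' by (intro exI[of _ f']) blast
    qed (use C1_boundD[OF f] t in auto)
  qed
qed

text \<open>By uniqueness of derivatives the witnesses for different \<open>n\<close> coincide on
  the ball, so only the constants have to converge.\<close>

lemma C1_bound_limit:
  assumes "\<And>n. C1_bound N \<alpha> M0 M1 (Ma n) f" "Ma \<longlonglongrightarrow> L"
  shows "C1_bound N \<alpha> M0 M1 L f"
  unfolding C1_bound_def
proof (intro conjI allI impI)
  show "0 \<le> M0" "0 \<le> M1" using C1_boundD[OF assms(1)] by auto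
  show "0 \<le> L" using assms(2) by (rule LIMSEQ_le_const) (use C1_boundD(3)[OF assms(1)] in auto)
  fix c :: "('a, 'b) chart" and a :: 'b and R :: real assume b: "(c, a, R) \<in> N"
  obtain f' :: "'b \<Rightarrow> 'b \<Rightarrow>\<^sub>L real" where f': "\<And>z. z\<in>ball a R \<Longrightarrow>
     ((\<lambda>z. f (chart_inv c z)) has_derivative blinfun_apply (f' z)) (at z) \<and>
     \<bar>f (chart_inv c z)\<bar> \<le> M0 \<and> norm (f' z) \<le> M1" using C1_boundD(4)[OF assms(1) b] by blast
  have "norm (f' z - f' z') \<le> L * dist z z' powr \<alpha>" if z: "z \<in> ball a R" "z' \<in> ball a R" for z z'
  proof (rule LIMSEQ_le_const[OF tendsto_mult_right[OF assms(2)]])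
    have "norm (f' z - f' z') \<le> Ma n * dist z z' powr \<alpha>" for n
    proof -
      obtain g' :: "'b \<Rightarrow> 'b \<Rightarrow>\<^sub>L real" where g': "\<And>z. z\<in>ball a R \<Longrightarrow>
         ((\<lambda>z. f (chart_inv c z)) has_derivative blinfun_apply (g' z)) (at z) \<and>
         (\<forall>z'\<in>ball a R. norm (g' z - g' z') \<le> Ma n * dist z z' powr \<alpha>)" using C1_boundD(4)[OF assms(1) b] by blast
      have "g' y = f' y" if "y \<in> ball a R" for y
        using has_derivative_unique g'[OF that] f'[OF that] blinfun_apply_inject by metis
      then show ?thesis using g' z by metis
    qed
    then show "\<exists>k. \<forall>n\<ge>k. norm (f' z - f' z') \<le> Ma n * dist z z' powr \<alpha>" by blast
  qed
  then show "\<exists>f' :: 'b \<Rightarrow> 'b \<Rightarrow>\<^sub>L real. \<forall>z\<in>ball a R.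
     ((\<lambda>z. f (chart_inv c z)) has_derivative blinfun_apply (f' z)) (at z) \<and>
     \<bar>f (chart_inv c z)\<bar> \<le> M0 \<and> norm (f' z) \<le> M1 \<and>
     (\<forall>z'\<in>ball a R. norm (f' z - f' z') \<le> L * dist z z' powr \<alpha>)"
    using f' by (intro exI[of _ f']) blast
qed

text \<open>The tube lemma in the language of neighbourhood filters. It combines knowledge near each
  point of \<open>X\<close> into a statement about all preimages at once.\<close>

lemma compact_eventually_all:
  fixes P :: "'a::topological_space \<Rightarrow> 'b::topological_space \<Rightarrow> bool"
  assumes K: "compact K" and P: "\<And>y. y \<in> K \<Longrightarrow> \<forall>\<^sub>F q in nhds (p, y). P (fst q) (snd q)"
  shows "\<forall>\<^sub>F p' in nhds p. \<forall>y\<in>K. P p' y"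
proof -
  define Q where "Q = (\<lambda>y V W. open V \<and> p \<in> V \<and> open W \<and> y \<in> W \<and> (\<forall>p'\<in>V. \<forall>y'\<in>W. P p' y'))"
  have "\<forall>y\<in>K. \<exists>V W. Q y V W"
  proof
    fix y assume "y \<in> K"
    then obtain S where S: "open S" "(p, y) \<in> S" "\<And>q. q \<in> S \<Longrightarrow> P (fst q) (snd q)"
      using P[of y] unfolding eventually_nhds by meson
    obtain V W where "open V" "open W" "(p, y) \<in> V \<times> W" "V \<times> W \<subseteq> S" using open_prod_elim[OF S(1,2)] by blast
    moreover have "P p' y'" if "p' \<in> V" "y' \<in> W" for p' y'
      using S(3)[of "(p', y')"] that \<open>V \<times> W \<subseteq> S\<close> by auto
    ultimately have "Q y V W" by (simp add: Q_def)
    then show "\<exists>V W. Q y V W" by blast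
  qed
  then obtain V where "\<forall>y\<in>K. \<exists>W. Q y (V y) W" using bchoice[of K "\<lambda>y V. \<exists>W. Q y V W"] by blast
  then obtain W where "\<forall>y\<in>K. Q y (V y) (W y)" using bchoice[of K "\<lambda>y W. Q y (V y) W"] by blast
  then have VW: "\<And>y. y \<in> K \<Longrightarrow> open (V y) \<and> p \<in> V y \<and> open (W y) \<and> y \<in> W y \<and> (\<forall>p'\<in>V y. \<forall>y'\<in>W y. P p' y')"
    by (simp add: Q_def)
  obtain C where C: "C \<subseteq> K" "finite C" "K \<subseteq> (\<Union>y\<in>C. W y)"
    by (rule compactE_image[OF K, of K W]) (use VW in auto)
  have "\<forall>\<^sub>F p' in nhds p. \<forall>y\<in>C. p' \<in> V y"
    using C VW by (intro eventually_ball_finite ballI eventually_nhds_in_open) auto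
  then show ?thesis
    by eventually_elim (use C VW in blast)
qed

lemma tendsto_eventually_distinct:
  fixes x y :: "'a::t2_space"
  assumes "(f \<longlongrightarrow> x) F" "(h \<longlongrightarrow> y) F" "x \<noteq> y"
  shows "\<forall>\<^sub>F p in F. f p \<noteq> h p"
proof -
  obtain S S' where S: "open S" "open S'" "x \<in> S" "y \<in> S'" "S \<inter> S' = {}" using hausdorff[OF assms(3)] by blast
  have "\<forall>\<^sub>F p in F. f p \<in> S" "\<forall>\<^sub>F p in F. h p \<in> S'"
    using S topological_tendstoD[OF assms(1)] topological_tendstoD[OF assms(2)] by auto
  then show ?thesis by eventually_elim (use S in auto)
qed

lemma isCont_tendsto_nhds: "isCont f a \<Longrightarrow> (f \<longlongrightarrow> f a) (nhds a)"
  by (simp add: isCont_def tendsto_at_iff_tendsto_nhds)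

section \<open>Inverse branches\<close>

lemma local_C1_holder_at:
  assumes "local_C1_holder \<alpha> S f" "open S" "p \<in> S"
  shows "C1_holder_at \<alpha> f p"
proof -
  obtain f' where f': "\<And>x. x \<in> S \<Longrightarrow> (f has_derivative blinfun_apply (f' x)) (at x)"
    "\<forall>x\<in>S. \<exists>\<epsilon>>0. \<exists>C. \<forall>y\<in>S \<inter> ball x \<epsilon>. \<forall>z\<in>S \<inter> ball x \<epsilon>. norm (f' y - f' z) \<le> C * dist y z powr \<alpha>"
    using assms(1) unfolding local_C1_holder_def by blast
  obtain e C where e: "e > 0" "\<forall>y\<in>S \<inter> ball p e. \<forall>z\<in>S \<inter> ball p e. norm (f' y - f' z) \<le> C * dist y z powr \<alpha>"
    using f'(2) assms(3) by blast
  obtain e1 where e1: "e1 > 0" "ball p e1 \<subseteq> S" using assms open_contains_ball by metis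
  define \<epsilon> where "\<epsilon> = min e e1"
  have "ball p \<epsilon> \<subseteq> S \<inter> ball p e" using e1 by (auto simp: \<epsilon>_def)
  then have "0 < \<epsilon> \<and> (\<forall>x\<in>ball p \<epsilon>. (f has_derivative blinfun_apply (f' x)) (at x)) \<and>
     (\<forall>x\<in>ball p \<epsilon>. \<forall>y\<in>ball p \<epsilon>. norm (f' x - f' y) \<le> C * dist x y powr \<alpha>)"
  proof (intro conjI ballI)
    show "0 < \<epsilon>" using e e1 by (simp add: \<epsilon>_def)
  next
    fix x assume "x \<in> ball p \<epsilon>"
    then show "(f has_derivative blinfun_apply (f' x)) (at x)"
      using f'(1) \<open>ball p \<epsilon> \<subseteq> S \<inter> ball p e\<close> by blast
  next
    fix x y assume "x \<in> ball p \<epsilon>" "y \<in> ball p \<epsilon>"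
    then show "norm (f' x - f' y) \<le> C * dist x y powr \<alpha>"
      using e(2) \<open>ball p \<epsilon> \<subseteq> S \<inter> ball p e\<close> by blast
  qed
  then show ?thesis unfolding C1_holder_at_def by blast
qed

lemma smooth_atlas_chart:
  assumes "smooth_atlas A" "c \<in> A"
  shows "open (fst c)" "open (chart_img c)" "continuous_on (chart_img c) (chart_inv c)" "continuous_on (fst c) (snd c)"
    and "x \<in> fst c \<Longrightarrow> chart_inv c (snd c x) = x" "x \<in> fst c \<Longrightarrow> snd c x \<in> chart_img c"
    and "z \<in> chart_img c \<Longrightarrow> snd c (chart_inv c z) = z" "z \<in> chart_img c \<Longrightarrow> chart_inv c z \<in> fst c"
proof -
  have h: "open (fst c)" "open (chart_img c)" "homeomorphism (fst c) (chart_img c) (snd c) (chart_inv c)"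
    using assms unfolding smooth_atlas_def by auto
  show "open (fst c)" "open (chart_img c)" using h by auto
  show "continuous_on (chart_img c) (chart_inv c)" "continuous_on (fst c) (snd c)"
    "x \<in> fst c \<Longrightarrow> chart_inv c (snd c x) = x" "z \<in> chart_img c \<Longrightarrow> snd c (chart_inv c z) = z"
    using h(3) unfolding homeomorphism_def by auto
  show "x \<in> fst c \<Longrightarrow> snd c x \<in> chart_img c" "z \<in> chart_img c \<Longrightarrow> chart_inv c z \<in> fst c"
    using h(3) unfolding homeomorphism_def by auto
qed

text \<open>\<open>L u f\<close> is, near \<open>(u0, z0)\<close> in the chart \<open>c\<close>, a finite sum over inverse branches, read in
  charts of the cover. At \<open>u0\<close> the branches contract the Riemannian norm by the factor \<open>\<rho>\<close>.\<close>

definition branch_expansion ::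
  "(('x, 'e::euclidean_space) chart \<times> 'e \<times> real) set \<Rightarrow>
   (('x, 'e) chart \<Rightarrow> 'x \<Rightarrow> 'e \<Rightarrow> 'e \<Rightarrow> real) \<Rightarrow> real \<Rightarrow>
   ('p::euclidean_space \<Rightarrow> ('x \<Rightarrow> real) \<Rightarrow> 'x \<Rightarrow> real) \<Rightarrow> 'p \<Rightarrow> ('x, 'e) chart \<Rightarrow> 'e \<Rightarrow> real \<Rightarrow>
   'j set \<Rightarrow> ('j \<Rightarrow> ('x, 'e) chart \<times> 'e \<times> real) \<Rightarrow> ('j \<Rightarrow> 'p \<times> 'e \<Rightarrow> 'e) \<Rightarrow> ('j \<Rightarrow> 'p \<times> 'e \<Rightarrow> real) \<Rightarrow> bool" where
  "branch_expansion N G \<alpha> L u0 c z0 \<rho> J b s \<gamma> \<longleftrightarrow> finite J \<and>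
     (\<forall>j\<in>J. b j \<in> N \<and> C1_holder_at \<alpha> (s j) (u0, z0) \<and> C1_holder_at \<alpha> (\<gamma> j) (u0, z0) \<and>
        \<gamma> j (u0, z0) > 0 \<and> s j (u0, z0) \<in> ball (fst (snd (b j))) (snd (snd (b j))) \<and>
        (\<exists>D. (s j has_derivative D) (at (u0, z0)) \<and>
          (\<forall>v. sqrt (G (fst (b j)) (chart_inv (fst (b j)) (s j (u0, z0))) (D (0, v)) (D (0, v)))
             \<le> \<rho> * sqrt (G c (chart_inv c z0) v v)))) \<and>
     (\<forall>\<^sub>F q in nhds (u0, z0). \<forall>f. L (fst q) f (chart_inv c (snd q)) =
        (\<Sum>j\<in>J. \<gamma> j q * f (chart_inv (fst (b j)) (s j q))))"

text \<open>Composing operators indexes the branches by pairs. Renumbering them by naturals keeps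
  the index type fixed, without which iterates could not be treated by induction.\<close>

lemma branch_expansion_nat:
  assumes "branch_expansion N G \<alpha> L u0 c z0 \<rho> J b s \<gamma>"
  obtains n b' s' \<gamma>' where "branch_expansion N G \<alpha> L u0 c z0 \<rho> {..<n::nat} b' s' \<gamma>'"
proof -
  have fin: "finite J" using assms unfolding branch_expansion_def by blast
  then obtain h where h: "bij_betw h {..<card J} J" using ex_bij_betw_nat_finite[OF fin] by (auto simp: atLeast0LessThan)
  then have hJ: "j < card J \<Longrightarrow> h j \<in> J" for j by (auto simp: bij_betw_def)
  have sum: "(\<Sum>j\<in>J. F j) = (\<Sum>j<card J. F (h j))" for F :: "_ \<Rightarrow> real"
    using sum.reindex_bij_betw[OF h, of F] by simp
  have "branch_expansion N G \<alpha> L u0 c z0 \<rho> {..<card J} (b \<circ> h) (s \<circ> h) (\<gamma> \<circ> h)"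
    using assms hJ unfolding branch_expansion_def sum by (simp add: o_def)
  then show ?thesis using that by blast
qed

locale expanding_family =
  fixes A :: "('x::t2_space, 'e::euclidean_space) chart set"
    and G :: "('x, 'e) chart \<Rightarrow> 'x \<Rightarrow> 'e \<Rightarrow> 'e \<Rightarrow> real"
    and N :: "(('x, 'e) chart \<times> 'e \<times> real) set"
    and \<alpha> :: real
    and U :: "'p::euclidean_space set"
    and T :: "'p \<Rightarrow> 'x \<Rightarrow> 'x"
    and g :: "'p \<Rightarrow> 'x \<Rightarrow> real"
  assumes manifold: "compact_connected_riemannian_manifold A G"
    and cover: "coordinate_cover A N"
    and \<alpha>: "0 < \<alpha>" "\<alpha> < 1"
    and open_U: "open U"
    and map_family: "C1_holder_map_family A \<alpha> U T"
    and expanding: "\<And>u. u \<in> U \<Longrightarrow> expanding_map A G (T u)"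
    and weight_family: "C1_holder_fun_family A \<alpha> U g"
    and weight_pos: "\<And>u x. u \<in> U \<Longrightarrow> g u x > 0"
begin

abbreviation L :: "'p \<Rightarrow> ('x \<Rightarrow> real) \<Rightarrow> 'x \<Rightarrow> real" where
  "L u \<equiv> transfer_op (T u) (g u)"

lemma atlas: "smooth_atlas A"
  and compact_X: "compact (UNIV :: 'x set)" and connected_X: "connected (UNIV :: 'x set)"
  and metric: "riemannian_metric A G"
  using manifold unfolding compact_connected_riemannian_manifold_def by auto

lemma metricD:
  assumes "c \<in> A" "x \<in> fst c"
  shows "bilinear (G c x)" "v \<noteq> 0 \<Longrightarrow> G c x v v > 0" "G c x 0 0 = 0"
proof -
  show b: "bilinear (G c x)" using metric assms unfolding riemannian_metric_def by blast
  show "v \<noteq> 0 \<Longrightarrow> G c x v v > 0" using metric assms unfolding riemannian_metric_def by blast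
  show "G c x 0 0 = 0" using bilinear_lzero[OF b] .
qed

lemma cover_chart:
  assumes "(c, a, R) \<in> N" "z \<in> cball a R"
  shows "c \<in> A" "z \<in> chart_img c" "chart_inv c z \<in> fst c"
proof -
  show "c \<in> A" "z \<in> chart_img c" using coordinate_coverD[OF cover] assms by blast+
  then show "chart_inv c z \<in> fst c" using smooth_atlas_chart(8)[OF atlas] by blast
qed

lemma T_tendsto:
  assumes "u0 \<in> U" shows "((\<lambda>q. T (fst q) (snd q)) \<longlongrightarrow> T u0 y) (nhds (u0, y))"
proof -
  have "continuous_on (U \<times> UNIV) (\<lambda>q. T (fst q) (snd q))"
    using map_family unfolding C1_holder_map_family_def by (simp add: case_prod_beta')
  moreover have "open (U \<times> (UNIV :: 'x set))" using open_U open_Times by blast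
  ultimately have "\<forall>q\<in>U \<times> UNIV. isCont (\<lambda>q. T (fst q) (snd q)) q"
    using continuous_on_eq_continuous_at by blast
  then have "isCont (\<lambda>q. T (fst q) (snd q)) (u0, y)" using assms by simp
  from isCont_tendsto_nhds[OF this] show ?thesis by simp
qed

lemma open_chart_domain:
  assumes "c \<in> A" "d \<in> A"
  shows "open {(u, z). u \<in> U \<and> z \<in> chart_img d \<and> T u (chart_inv d z) \<in> fst c}"
proof -
  note c = smooth_atlas_chart[OF atlas assms(1)] and d = smooth_atlas_chart[OF atlas assms(2)]
  have "continuous_on (U \<times> UNIV) (\<lambda>q. T (fst q) (snd q))"
    using map_family unfolding C1_holder_map_family_def by (simp add: case_prod_beta')
  then have "continuous_on (U \<times> chart_img d) ((\<lambda>q. T (fst q) (snd q)) \<circ> (\<lambda>q. (fst q, chart_inv d (snd q))))"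
  proof (intro continuous_on_compose)
    show "continuous_on (U \<times> chart_img d) (\<lambda>q. (fst q, chart_inv d (snd q)))"
      by (intro continuous_intros continuous_on_compose2[OF d(3)]) auto
  qed (rule continuous_on_subset, assumption, auto)
  moreover have "open (U \<times> chart_img d)" using open_U d(2) open_Times by blast
  ultimately have "open ((U \<times> chart_img d) \<inter> ((\<lambda>q. T (fst q) (snd q)) \<circ> (\<lambda>q. (fst q, chart_inv d (snd q)))) -` fst c)"
    using c(1) continuous_open_preimage by blast
  moreover have "(U \<times> chart_img d) \<inter> ((\<lambda>q. T (fst q) (snd q)) \<circ> (\<lambda>q. (fst q, chart_inv d (snd q)))) -` fst c
     = {(u, z). u \<in> U \<and> z \<in> chart_img d \<and> T u (chart_inv d z) \<in> fst c}" by auto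
  ultimately show ?thesis by simp
qed

lemma expansion_rate:
  assumes "u0 \<in> U"
  obtains \<kappa> where "\<kappa> > 1" "\<And>c d x v. c \<in> A \<Longrightarrow> d \<in> A \<Longrightarrow> x \<in> fst d \<Longrightarrow> T u0 x \<in> fst c \<Longrightarrow>
     \<kappa> * sqrt (G d x v v) \<le> sqrt (G c (T u0 x) (chart_diff d c (T u0) x v) (chart_diff d c (T u0) x v))"
  using expanding[OF assms] unfolding expanding_map_def by blast

text \<open>The last two conclusions serve to count preimages: the branch consists of preimages, and
  every preimage close to \<open>y\<close> lies on it.\<close>

lemma inverse_branch:
  assumes u0: "u0 \<in> U" and c: "c \<in> A" and z0: "z0 \<in> chart_img c" and y: "T u0 y = chart_inv c z0"
    and \<kappa>: "\<kappa> > 1" "\<And>c d x v. c \<in> A \<Longrightarrow> d \<in> A \<Longrightarrow> x \<in> fst d \<Longrightarrow> T u0 x \<in> fst c \<Longrightarrow>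
     \<kappa> * sqrt (G d x v v) \<le> sqrt (G c (T u0 x) (chart_diff d c (T u0) x v) (chart_diff d c (T u0) x v))"
  obtains d a R s where "(d, a, R) \<in> N" "s (u0, z0) \<in> ball a R" "chart_inv d (s (u0, z0)) = y"
    "C1_holder_at \<alpha> s (u0, z0)"
    "\<exists>D. (s has_derivative D) (at (u0, z0)) \<and>
       (\<forall>v. sqrt (G d y (D (0, v)) (D (0, v))) \<le> 1 / \<kappa> * sqrt (G c (chart_inv c z0) v v))"
    "\<forall>\<^sub>F q in nhds (u0, z0). T (fst q) (chart_inv d (s q)) = chart_inv c (snd q)"
    "\<forall>\<^sub>F q in nhds ((u0, z0), y). T (fst (fst q)) (snd q) = chart_inv c (snd (fst q)) \<longrightarrow>
        snd q = chart_inv d (s (fst q))"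
proof -
  obtain d a R \<zeta> where d: "(d, a, R) \<in> N" "\<zeta> \<in> ball a R" "y = chart_inv d \<zeta>"
    using coordinate_coverD(5)[OF cover] by blast
  have dA: "d \<in> A" "\<zeta> \<in> chart_img d" using cover_chart[OF d(1), of \<zeta>] d(2) by auto
  note cc = smooth_atlas_chart[OF atlas c] and dd = smooth_atlas_chart[OF atlas dA(1)]
  define H where "H = (\<lambda>(u, z). snd c (T u (chart_inv d z)))"
  let ?O = "{(u, z). u \<in> U \<and> z \<in> chart_img d \<and> T u (chart_inv d z) \<in> fst c}"
  have x: "chart_inv c z0 \<in> fst c" using cc(8)[OF z0] .
  have pO: "(u0, \<zeta>) \<in> ?O" using u0 dA d y x by auto
  have Op: "open ?O" by (rule open_chart_domain[OF c dA(1)])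
  have "local_C1_holder \<alpha> ?O H"
    using map_family c dA(1) unfolding C1_holder_map_family_def H_def by blast
  then have H: "C1_holder_at \<alpha> H (u0, \<zeta>)" using local_C1_holder_at Op pO by blast
  then obtain H' where H': "(H has_derivative H') (at (u0, \<zeta>))"
    unfolding C1_holder_at_def by (meson centre_in_ball)
  have H0: "H (u0, \<zeta>) = z0" using y d(3) cc(7)[OF z0] by (simp add: H_def)
  have ydom: "y \<in> fst d" "snd d y = \<zeta>" using dd(7,8)[OF dA(2)] d(3) by auto
  have slice: "((\<lambda>z. snd c (T u0 (chart_inv d z))) has_derivative (\<lambda>v. H' (0, v))) (at \<zeta>)"
  proof -
    have "((\<lambda>z. (u0, z)) has_derivative (\<lambda>v. (0, v))) (at \<zeta>)" by (auto intro!: derivative_eq_intros)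
    from has_derivative_compose[OF this, of H H'] H' show ?thesis by (simp add: H_def)
  qed
  then have cd: "chart_diff d c (T u0) y = (\<lambda>v. H' (0, v))"
    unfolding chart_diff_def ydom(2) using frechet_derivative_at by metis
  have exp: "\<kappa> * sqrt (G d y v v) \<le> sqrt (G c (chart_inv c z0) (H' (0, v)) (H' (0, v)))" for v
    using \<kappa>(2)[OF c dA(1) ydom(1), of v] y x unfolding cd by simp
  have linH: "linear H'" using H' has_derivative_linear by blast
  \<comment> \<open>With the parameter as first component, one application of the inverse function
    theorem yields a branch that is C^{1+\<alpha>} jointly in the parameter and the point.\<close>
  define \<Phi> where "\<Phi> = (\<lambda>q. (fst q, H q))"
  define D where "D = (\<lambda>w. (fst w, H' w))"
  have \<Phi>: "C1_holder_at \<alpha> \<Phi> (u0, \<zeta>)" unfolding \<Phi>_def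
    using C1_holder_at_Pair[OF C1_holder_at_linear[OF bounded_linear_fst] H] \<alpha> by simp
  have D: "(\<Phi> has_derivative D) (at (u0, \<zeta>))" unfolding \<Phi>_def D_def
    by (intro has_derivative_Pair H' bounded_linear_imp_has_derivative bounded_linear_fst)
  have linD: "linear D" using D has_derivative_linear by blast
  \<comment> \<open>A vector in the kernel has zero parameter part, and expansion rules out a
    nonzero spatial part.\<close>
  have injD: "inj D"
  proof (rule linear_injective_0[OF linD, THEN iffD2], intro allI impI)
    fix w assume w: "D w = 0"
    then have fw: "fst w = 0" "H' (0, snd w) = 0" by (auto simp: D_def zero_prod_def split: prod.splits) (metis prod.collapse)
    have "\<kappa> * sqrt (G d y (snd w) (snd w)) \<le> 0" using exp[of "snd w"] fw(2) metricD(3)[OF c x] by simp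
    then have "\<not> 0 < G d y (snd w) (snd w)" using \<kappa>(1) by (auto simp: mult_le_0_iff)
    then have "snd w = 0" using metricD(2)[OF dA(1) ydom(1), of "snd w"] by blast
    then show "w = 0" using fw(1) by (simp add: prod_eq_iff)
  qed
  have "open (?O \<inter> (UNIV \<times> ball a R))" using Op open_Times[OF open_UNIV open_ball] by blast
  moreover have "(u0, \<zeta>) \<in> ?O \<inter> (UNIV \<times> ball a R)" using pO d(2) by auto
  ultimately obtain W W' \<Psi> where W: "open W" "(u0, \<zeta>) \<in> W" "W \<subseteq> ?O \<inter> (UNIV \<times> ball a R)" "open W'"
    "\<Phi> (u0, \<zeta>) \<in> W'" "homeomorphism W W' \<Phi> \<Psi>" "C1_holder_at \<alpha> \<Psi> (\<Phi> (u0, \<zeta>))"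
    using C1_holder_at_inverse[OF \<Phi> \<alpha>(1) less_imp_le[OF \<alpha>(2)] D injD] by blast
  have \<Phi>0: "\<Phi> (u0, \<zeta>) = (u0, z0)" by (simp add: \<Phi>_def H0)
  have WP: "\<And>q. q \<in> W \<Longrightarrow> \<Psi> (\<Phi> q) = q" "\<And>q. q \<in> W' \<Longrightarrow> \<Phi> (\<Psi> q) = q" "\<And>q. q \<in> W' \<Longrightarrow> \<Psi> q \<in> W"
     "\<And>q. q \<in> W \<Longrightarrow> \<Phi> q \<in> W'"
    using W(6) unfolding homeomorphism_def by auto
  define s where "s = (\<lambda>q. snd (\<Psi> q))"
  have \<Psi>s: "\<Psi> q = (fst q, s q)" if "q \<in> W'" for q
    using WP(2)[OF that] unfolding \<Phi>_def s_def by (metis fst_conv prod.collapse)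
  have s0: "s (u0, z0) = \<zeta>" using WP(1)[OF W(2)] \<Phi>0 by (simp add: s_def)
  have s: "C1_holder_at \<alpha> s (u0, z0)" unfolding s_def
    by (rule C1_holder_at_compose[OF _ C1_holder_at_linear[OF bounded_linear_snd]]) (use W(7) \<Phi>0 \<alpha> in auto)
  then obtain s' where s': "(s has_derivative s') (at (u0, z0))"
    unfolding C1_holder_at_def by (meson centre_in_ball)
  have Hs: "H (fst q, s q) = snd q" if "q \<in> W'" for q
    using WP(2)[OF that] \<Psi>s[OF that] by (simp add: \<Phi>_def prod_eq_iff)
  \<comment> \<open>Differentiating \<open>H (u, s (u, z)) = z\<close> in \<open>z\<close> turns the
    expansion of \<open>H'\<close> into the contraction of \<open>s'\<close>.\<close>
  have inv: "H' (0, s' (0, v)) = v" for v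
  proof -
    have 1: "((\<lambda>q. (fst q, s q)) has_derivative (\<lambda>w. (fst w, s' w))) (at (u0, z0))"
      by (intro has_derivative_Pair s' bounded_linear_imp_has_derivative bounded_linear_fst)
    have 2: "((\<lambda>q. H (fst q, s q)) has_derivative (\<lambda>w. H' (fst w, s' w))) (at (u0, z0))"
      using has_derivative_compose[OF 1, of H H'] H' s0 by simp
    have 3: "((\<lambda>q. H (fst q, s q)) has_derivative snd) (at (u0, z0))"
      by (rule has_derivative_transform_within_open[OF bounded_linear_imp_has_derivative[OF bounded_linear_snd] W(4)])
         (use W(5) \<Phi>0 Hs in auto)
    show ?thesis using fun_cong[OF has_derivative_unique[OF 2 3], of "(0, v)"] by simp
  qed
  have contr: "sqrt (G d y (s' (0, v)) (s' (0, v))) \<le> 1 / \<kappa> * sqrt (G c (chart_inv c z0) v v)" for v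
    using exp[of "s' (0, v)"] inv[of v] \<kappa>(1) by (simp add: field_simps)
  have W'nh: "\<forall>\<^sub>F q in nhds (u0, z0). q \<in> W'" using W(4,5) \<Phi>0 eventually_nhds_in_open by metis
  have right_inv: "\<forall>\<^sub>F q in nhds (u0, z0). T (fst q) (chart_inv d (s q)) = chart_inv c (snd q)"
    using W'nh
  proof eventually_elim
    case (elim q)
    have "(fst q, s q) \<in> ?O" using WP(3)[OF elim] \<Psi>s[OF elim] W(3) by auto
    then have "T (fst q) (chart_inv d (s q)) \<in> fst c" by simp
    then have "T (fst q) (chart_inv d (s q)) = chart_inv c (H (fst q, s q))" using cc(5) by (simp add: H_def)
    then show ?case using Hs[OF elim] by simp
  qed
  \<comment> \<open>Near \<open>(u0, \<zeta>)\<close> the map \<open>\<Phi>\<close> is injective, so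
    a point of the fibre near \<open>y\<close> has the coordinate prescribed by
    \<open>\<Psi>\<close>.\<close>
  have uniq: "\<forall>\<^sub>F q in nhds ((u0, z0), y). T (fst (fst q)) (snd q) = chart_inv c (snd (fst q)) \<longrightarrow>
        snd q = chart_inv d (s (fst q))"
  proof -
    have lim: "((\<lambda>q. (fst (fst q), snd d (snd q))) \<longlongrightarrow> (u0, \<zeta>)) (nhds ((u0, z0), y))"
    proof (intro tendsto_Pair)
      have sn: "((\<lambda>q. snd q) \<longlongrightarrow> y) (nhds ((u0, z0), y))"
        using tendsto_snd[OF filterlim_ident] by (metis snd_conv)
      have ff: "((\<lambda>q. fst q) \<longlongrightarrow> (u0, z0)) (nhds ((u0, z0), y))"
        using tendsto_fst[OF filterlim_ident] by (metis fst_conv)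
      show "((\<lambda>q. fst (fst q)) \<longlongrightarrow> u0) (nhds ((u0, z0), y))" using tendsto_fst[OF ff] by simp
      have "isCont (snd d) y" using dd(1,4) ydom(1) continuous_on_eq_continuous_at by blast
      from isCont_tendsto_compose[OF this sn] show "((\<lambda>q. snd d (snd q)) \<longlongrightarrow> \<zeta>) (nhds ((u0, z0), y))"
        using ydom(2) by simp
    qed
    have e1: "\<forall>\<^sub>F q in nhds ((u0, z0), y). (fst (fst q), snd d (snd q)) \<in> W"
      using topological_tendstoD[OF lim W(1) W(2)] .
    have e2: "\<forall>\<^sub>F q in nhds ((u0, z0), y). q \<in> (UNIV \<times> chart_img c) \<times> fst d"
      using z0 ydom(1) cc(2) dd(1) by (intro eventually_nhds_in_open open_Times) auto
    show ?thesis using e1 e2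
    proof eventually_elim
      case (elim q)
      show ?case
      proof
        assume eq: "T (fst (fst q)) (snd q) = chart_inv c (snd (fst q))"
        let ?w = "(fst (fst q), snd d (snd q))"
        have q: "snd (fst q) \<in> chart_img c" "snd q \<in> fst d" using elim(2) by (auto simp: mem_Times_iff)
        have "H ?w = snd (fst q)" using eq q dd(5)[OF q(2)] cc(7)[OF q(1)] by (simp add: H_def)
        then have "\<Phi> ?w = fst q" by (simp add: \<Phi>_def)
        then have "\<Psi> (fst q) = ?w" using WP(1)[OF elim(1)] by simp
        then have "s (fst q) = snd d (snd q)" by (simp add: s_def)
        then show "snd q = chart_inv d (s (fst q))" using dd(5)[OF q(2)] by simp
      qed
    qed
  qed
  show ?thesis
    by (rule that[OF d(1), of s]) (use s0 d s s' contr right_inv uniq in auto)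
qed

text \<open>Local uniqueness of the branch isolates each preimage, and a compact discrete set is
  finite.\<close>

lemma finite_fibre:
  assumes u0: "u0 \<in> U" shows "finite {y. T u0 y = x}"
proof -
  obtain \<kappa> where \<kappa>: "\<kappa> > 1" "\<And>c d x v. c \<in> A \<Longrightarrow> d \<in> A \<Longrightarrow> x \<in> fst d \<Longrightarrow> T u0 x \<in> fst c \<Longrightarrow>
     \<kappa> * sqrt (G d x v v) \<le> sqrt (G c (T u0 x) (chart_diff d c (T u0) x v) (chart_diff d c (T u0) x v))"
    using expansion_rate[OF u0] by blast
  obtain c where c: "c \<in> A" "x \<in> fst c" using atlas unfolding smooth_atlas_def by blast
  define z0 where "z0 = snd c x"
  have z0: "z0 \<in> chart_img c" "chart_inv c z0 = x" using smooth_atlas_chart[OF atlas c(1)] c(2) by (auto simp: z0_def)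
  let ?Y = "{y. T u0 y = x}"
  have "continuous_on UNIV (T u0)" using expanding[OF u0] unfolding expanding_map_def C1_map_def by blast
  then have "closed (T u0 -` {x})" using continuous_closed_vimage closed_singleton
    by (metis continuous_on_eq_continuous_at iso_tuple_UNIV_I open_UNIV)
  then have comp: "compact ?Y" using compact_X closed_Int_compact[of ?Y UNIV] by (simp add: vimage_def)
  have "\<exists>W. open W \<and> y \<in> W \<and> W \<inter> ?Y \<subseteq> {y}" if "y \<in> ?Y" for y
  proof -
    have y: "T u0 y = chart_inv c z0" using that z0 by simp
    obtain d a R s where "(d, a, R) \<in> N" "s (u0, z0) \<in> ball a R" and s1: "chart_inv d (s (u0, z0)) = y"
      and "C1_holder_at \<alpha> s (u0, z0)"
      "\<exists>D. (s has_derivative D) (at (u0, z0)) \<and>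
         (\<forall>v. sqrt (G d y (D (0, v)) (D (0, v))) \<le> 1 / \<kappa> * sqrt (G c (chart_inv c z0) v v))"
      "\<forall>\<^sub>F q in nhds (u0, z0). T (fst q) (chart_inv d (s q)) = chart_inv c (snd q)"
      and s2: "\<forall>\<^sub>F q in nhds ((u0, z0), y). T (fst (fst q)) (snd q) = chart_inv c (snd (fst q)) \<longrightarrow>
          snd q = chart_inv d (s (fst q))"
      using inverse_branch[OF u0 c(1) z0(1) y \<kappa>] by blast
    note s = s1 s2
    define Q where "Q = (\<lambda>q. T (fst (fst q)) (snd q) = chart_inv c (snd (fst q)) \<longrightarrow> snd q = chart_inv d (s (fst q)))"
    have "eventually Q (nhds ((u0, z0), y))" using s(2) by (simp only: Q_def)
    then obtain S where S: "open S" "((u0, z0), y) \<in> S" "\<forall>q\<in>S. Q q"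
      unfolding eventually_nhds by blast
    obtain V W where VW: "open V" "open W" "((u0, z0), y) \<in> V \<times> W" "V \<times> W \<subseteq> S" using open_prod_elim[OF S(1,2)] by blast
    have "W \<inter> ?Y \<subseteq> {y}"
    proof
      fix y' assume y': "y' \<in> W \<inter> ?Y"
      then have "((u0, z0), y') \<in> S" using VW by auto
      from bspec[OF S(3) this] show "y' \<in> {y}" using y' z0 s(1) by (simp add: Q_def)
    qed
    then show ?thesis using VW by auto
  qed
  then have "\<forall>y\<in>?Y. \<exists>W. open W \<and> y \<in> W \<and> W \<inter> ?Y \<subseteq> {y}" by blast
  from bchoice[OF this] obtain W where W: "\<And>y. y \<in> ?Y \<Longrightarrow> open (W y) \<and> y \<in> W y \<and> W y \<inter> ?Y \<subseteq> {y}" by meson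
  obtain C where C: "C \<subseteq> ?Y" "finite C" "?Y \<subseteq> (\<Union>y\<in>C. W y)"
    by (rule compactE_image[OF comp, of ?Y W]) (use W in auto)
  have "?Y \<subseteq> C" using C W by blast
  then show ?thesis using C(2) finite_subset by blast
qed

text \<open>The branches through the fibre of \<open>z0\<close> account for all preimages of nearby
  points under nearby maps: near points of the fibre by local uniqueness, near all other points
  because \<open>T u y\<close> and the target stay apart.\<close>

lemma transfer_op_branches:
  assumes u0: "u0 \<in> U" and c: "c \<in> A" and z0: "z0 \<in> chart_img c"
    and \<kappa>: "\<kappa> > 1" "\<And>c d x v. c \<in> A \<Longrightarrow> d \<in> A \<Longrightarrow> x \<in> fst d \<Longrightarrow> T u0 x \<in> fst c \<Longrightarrow>
     \<kappa> * sqrt (G d x v v) \<le> sqrt (G c (T u0 x) (chart_diff d c (T u0) x v) (chart_diff d c (T u0) x v))"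
  obtains n b s \<gamma> where "branch_expansion N G \<alpha> L u0 c z0 (1 / \<kappa>) {..<n::nat} b s \<gamma>"
proof -
  define Y where "Y = {y. T u0 y = chart_inv c z0}"
  have fin: "finite Y" unfolding Y_def by (rule finite_fibre[OF u0])
  define P where "P = (\<lambda>y b s. b \<in> N \<and> s (u0, z0) \<in> ball (fst (snd b)) (snd (snd b)) \<and> chart_inv (fst b) (s (u0, z0)) = y \<and>
    C1_holder_at \<alpha> s (u0, z0) \<and>
    (\<exists>D. (s has_derivative D) (at (u0, z0)) \<and>
       (\<forall>v. sqrt (G (fst b) y (D (0, v)) (D (0, v))) \<le> 1 / \<kappa> * sqrt (G c (chart_inv c z0) v v))) \<and>
    (\<forall>\<^sub>F q in nhds (u0, z0). T (fst q) (chart_inv (fst b) (s q)) = chart_inv c (snd q)) \<and>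
    (\<forall>\<^sub>F q in nhds ((u0, z0), y). T (fst (fst q)) (snd q) = chart_inv c (snd (fst q)) \<longrightarrow>
        snd q = chart_inv (fst b) (s (fst q))))"
  have "\<forall>y\<in>Y. \<exists>b s. P y b s"
  proof
    fix y assume "y \<in> Y"
    then have y: "T u0 y = chart_inv c z0" by (simp add: Y_def)
    obtain d a R s where s: "(d, a, R) \<in> N" "s (u0, z0) \<in> ball a R" "chart_inv d (s (u0, z0)) = y"
      "C1_holder_at \<alpha> s (u0, z0)"
      "\<exists>D. (s has_derivative D) (at (u0, z0)) \<and>
         (\<forall>v. sqrt (G d y (D (0, v)) (D (0, v))) \<le> 1 / \<kappa> * sqrt (G c (chart_inv c z0) v v))"
      "\<forall>\<^sub>F q in nhds (u0, z0). T (fst q) (chart_inv d (s q)) = chart_inv c (snd q)"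
      "\<forall>\<^sub>F q in nhds ((u0, z0), y). T (fst (fst q)) (snd q) = chart_inv c (snd (fst q)) \<longrightarrow>
          snd q = chart_inv d (s (fst q))"
      using inverse_branch[OF u0 c z0 y \<kappa>] by blast
    have "P y (d, a, R) s" using s by (simp add: P_def)
    then show "\<exists>b s. P y b s" by blast
  qed
  then obtain b where "\<forall>y\<in>Y. \<exists>s. P y (b y) s" using bchoice[of Y "\<lambda>y b. \<exists>s. P y b s"] by blast
  then obtain s where P: "\<forall>y\<in>Y. P y (b y) (s y)" using bchoice[of Y "\<lambda>y s. P y (b y) s"] by blast
  then have bs: "\<And>y. y \<in> Y \<Longrightarrow> b y \<in> N \<and> s y (u0, z0) \<in> ball (fst (snd (b y))) (snd (snd (b y))) \<and>
      chart_inv (fst (b y)) (s y (u0, z0)) = y \<and> C1_holder_at \<alpha> (s y) (u0, z0) \<and>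
    (\<exists>D. (s y has_derivative D) (at (u0, z0)) \<and>
       (\<forall>v. sqrt (G (fst (b y)) y (D (0, v)) (D (0, v))) \<le> 1 / \<kappa> * sqrt (G c (chart_inv c z0) v v)))"
    and right_inv: "\<And>y. y \<in> Y \<Longrightarrow> \<forall>\<^sub>F q in nhds (u0, z0). T (fst q) (chart_inv (fst (b y)) (s y q)) = chart_inv c (snd q)"
    and uniq: "\<And>y. y \<in> Y \<Longrightarrow> \<forall>\<^sub>F q in nhds ((u0, z0), y). T (fst (fst q)) (snd q) = chart_inv c (snd (fst q)) \<longrightarrow>
        snd q = chart_inv (fst (b y)) (s y (fst q))"
    unfolding P_def by blast+
  define \<eta> where "\<eta> = (\<lambda>y q. chart_inv (fst (b y)) (s y q))"
  have bimg: "fst (b y) \<in> A \<and> s y (u0, z0) \<in> chart_img (fst (b y))" if "y \<in> Y" for y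
  proof -
    have "(fst (b y), fst (snd (b y)), snd (snd (b y))) \<in> N" using bs[OF that] by simp
    from cover_chart[OF this, of "s y (u0, z0)"] bs[OF that] show ?thesis by auto
  qed
  have lim: "(\<eta> y \<longlongrightarrow> y) (nhds (u0, z0))" if y: "y \<in> Y" for y
  proof -
    note ch = smooth_atlas_chart[OF atlas bimg[OF y, THEN conjunct1]]
    have "isCont (chart_inv (fst (b y))) (s y (u0, z0))"
      using ch(2,3) bimg[OF y] continuous_on_eq_continuous_at by blast
    moreover have "(s y \<longlongrightarrow> s y (u0, z0)) (nhds (u0, z0))"
      using C1_holder_at_continuous isCont_tendsto_nhds bs[OF y] by blast
    ultimately show ?thesis unfolding \<eta>_def using isCont_tendsto_compose bs[OF y] by metis
  qed
  have ev1: "\<forall>\<^sub>F q in nhds (u0, z0). \<forall>y\<in>Y. T (fst q) (\<eta> y q) = chart_inv c (snd q)"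
    unfolding \<eta>_def by (intro eventually_ball_finite fin ballI right_inv)
  \<comment> \<open>Branches starting at different points stay different nearby, so the sum over
    branches counts no preimage twice.\<close>
  have ev2: "\<forall>\<^sub>F q in nhds (u0, z0). \<forall>y\<in>Y. \<forall>y'\<in>Y. y \<noteq> y' \<longrightarrow> \<eta> y q \<noteq> \<eta> y' q"
  proof (intro eventually_ball_finite fin ballI)
    fix y y' assume y: "y \<in> Y" "y' \<in> Y"
    show "\<forall>\<^sub>F q in nhds (u0, z0). y \<noteq> y' \<longrightarrow> \<eta> y q \<noteq> \<eta> y' q"
      using tendsto_eventually_distinct[OF lim[OF y(1)] lim[OF y(2)]] by (cases "y = y'") auto
  qed
  have clim: "((\<lambda>q. chart_inv c (snd q)) \<longlongrightarrow> chart_inv c z0) (nhds (u0, z0))"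
  proof -
    have "isCont (chart_inv c) z0"
      using smooth_atlas_chart(2,3)[OF atlas c] z0 continuous_on_eq_continuous_at by blast
    moreover have "(snd \<longlongrightarrow> z0) (nhds (u0, z0))" using tendsto_snd[OF filterlim_ident] by (metis snd_conv)
    ultimately show ?thesis using isCont_tendsto_compose by metis
  qed
  \<comment> \<open>Compactness of \<open>X\<close> gives one neighbourhood of
    \<open>(u0, z0)\<close> that works for all candidates \<open>y'\<close>.\<close>
  have "\<forall>\<^sub>F q in nhds (u0, z0). \<forall>y'\<in>UNIV. T (fst q) y' = chart_inv c (snd q) \<longrightarrow> (\<exists>y\<in>Y. y' = \<eta> y q)"
  proof (rule compact_eventually_all[OF compact_X])
    fix y'
    show "\<forall>\<^sub>F q in nhds ((u0, z0), y'). T (fst (fst q)) (snd q) = chart_inv c (snd (fst q)) \<longrightarrow> (\<exists>y\<in>Y. snd q = \<eta> y (fst q))"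
    proof (cases "y' \<in> Y")
      case True
      show ?thesis using uniq[OF True] by eventually_elim (use True in \<open>auto simp: \<eta>_def\<close>)
    next
      case False
      have ff: "(fst \<longlongrightarrow> (u0, z0)) (nhds ((u0, z0), y'))" using tendsto_fst[OF filterlim_ident] by (metis fst_conv)
      have ss: "(snd \<longlongrightarrow> y') (nhds ((u0, z0), y'))" using tendsto_snd[OF filterlim_ident] by (metis snd_conv)
      have "((\<lambda>q. (fst (fst q), snd q)) \<longlongrightarrow> (u0, y')) (nhds ((u0, z0), y'))"
        using tendsto_Pair[OF tendsto_fst[OF ff] ss] by simp
      from filterlim_compose[OF T_tendsto[OF u0] this]
      have 1: "((\<lambda>q. T (fst (fst q)) (snd q)) \<longlongrightarrow> T u0 y') (nhds ((u0, z0), y'))" by simp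
      have 2: "((\<lambda>q. chart_inv c (snd (fst q))) \<longlongrightarrow> chart_inv c z0) (nhds ((u0, z0), y'))"
        using filterlim_compose[OF clim ff] .
      have "T u0 y' \<noteq> chart_inv c z0" using False by (simp add: Y_def)
      from tendsto_eventually_distinct[OF 1 2 this] show ?thesis by eventually_elim auto
    qed
  qed
  then have "\<forall>\<^sub>F q in nhds (u0, z0). \<forall>f. L (fst q) f (chart_inv c (snd q)) =
        (\<Sum>y\<in>Y. g (fst q) (\<eta> y q) * f (\<eta> y q))"
    using ev1 ev2
  proof eventually_elim
    case (elim q)
    have eq: "{y'. T (fst q) y' = chart_inv c (snd q)} = (\<lambda>y. \<eta> y q) ` Y" using elim(1,2) by auto
    have inj: "inj_on (\<lambda>y. \<eta> y q) Y" using elim(3) unfolding inj_on_def by blast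
    show ?case unfolding transfer_op_def eq by (simp add: sum.reindex[OF inj])
  qed
  moreover have "C1_holder_at \<alpha> (\<lambda>q. g (fst q) (\<eta> y q)) (u0, z0)" if y: "y \<in> Y" for y
  proof -
    let ?d = "fst (b y)"
    have dA: "?d \<in> A" and simg: "s y (u0, z0) \<in> chart_img ?d" using bimg[OF y] by auto
    have "open (U \<times> chart_img ?d)" using open_U smooth_atlas_chart(2)[OF atlas dA] open_Times by blast
    then have "C1_holder_at \<alpha> (\<lambda>(u, z). g u (chart_inv ?d z)) (u0, s y (u0, z0))"
      using weight_family dA u0 simg unfolding C1_holder_fun_family_def by (intro local_C1_holder_at) auto
    then have *: "C1_holder_at \<alpha> (\<lambda>q. g (fst q) (chart_inv ?d (snd q))) (u0, s y (u0, z0))"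
      by (simp add: case_prod_beta')
    have "C1_holder_at \<alpha> (\<lambda>q. (fst q, s y q)) (u0, z0)"
      using C1_holder_at_Pair[OF C1_holder_at_linear[OF bounded_linear_fst], of \<alpha> "s y"] bs[OF y] \<alpha> by simp
    from C1_holder_at_compose[OF this, of "\<lambda>q. g (fst q) (chart_inv ?d (snd q))"] * \<alpha>
    show ?thesis by (simp add: \<eta>_def)
  qed
  ultimately have "branch_expansion N G \<alpha> L u0 c z0 (1 / \<kappa>) Y b s (\<lambda>y q. g (fst q) (\<eta> y q))"
    unfolding branch_expansion_def
  proof (intro conjI ballI)
    fix y assume y: "y \<in> Y"
    show "0 < g (fst (u0, z0)) (\<eta> y (u0, z0))" using weight_pos[OF u0] by simp
    show "\<exists>D. (s y has_derivative D) (at (u0, z0)) \<and>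
       (\<forall>v. sqrt (G (fst (b y)) (chart_inv (fst (b y)) (s y (u0, z0))) (D (0, v)) (D (0, v)))
          \<le> 1 / \<kappa> * sqrt (G c (chart_inv c z0) v v))"
      using bs[OF y] by simp
  qed (use fin bs in \<open>auto simp: \<eta>_def\<close>)
  from branch_expansion_nat[OF this] show ?thesis using that by blast
qed

text \<open>A branch of the composition is a branch of the outer operator followed by a branch of
  the inner one based at its image. Both rates are measured with the metric at the same intermediate
  point, so they multiply without a chart-dependent constant at each step.\<close>

lemma branch_expansion_Suc:
  assumes e1: "branch_expansion N G \<alpha> L1 u0 c z0 \<rho> I b s \<gamma>" and \<rho>: "0 \<le> \<rho>'"
    and en: "\<And>i. i \<in> I \<Longrightarrow> branch_expansion N G \<alpha> L2 u0 (fst (b i)) (s i (u0, z0)) \<rho>' (J i) (b' i) (s' i) (\<gamma>' i)"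
  shows "branch_expansion N G \<alpha> (\<lambda>u f. L1 u (L2 u f)) u0 c z0 (\<rho>' * \<rho>) (Sigma I J) (\<lambda>(i, j). b' i j)
    (\<lambda>(i, j) q. s' i j (fst q, s i q)) (\<lambda>(i, j) q. \<gamma> i q * \<gamma>' i j (fst q, s i q))"
proof -
  have fin: "finite I" and finJ: "\<And>i. i \<in> I \<Longrightarrow> finite (J i)"
    using e1 en unfolding branch_expansion_def by blast+
  have pairC: "C1_holder_at \<alpha> (\<lambda>q. (fst q, s i q)) (u0, z0)" if "i \<in> I" for i
    using C1_holder_at_Pair[OF C1_holder_at_linear[OF bounded_linear_fst], of \<alpha> "s i" "(u0, z0)"] e1 that \<alpha>
    unfolding branch_expansion_def by simp
  have ev: "\<forall>\<^sub>F q in nhds (u0, z0). \<forall>i\<in>I. \<forall>f. L2 (fst q) f (chart_inv (fst (b i)) (s i q)) =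
        (\<Sum>j\<in>J i. \<gamma>' i j (fst q, s i q) * f (chart_inv (fst (b' i j)) (s' i j (fst q, s i q))))"
  proof (intro eventually_ball_finite fin ballI)
    fix i assume i: "i \<in> I"
    have "((\<lambda>q. (fst q, s i q)) \<longlongrightarrow> (u0, s i (u0, z0))) (nhds (u0, z0))"
      using isCont_tendsto_nhds[OF C1_holder_at_continuous[OF pairC[OF i]]] by simp
    moreover have "\<forall>\<^sub>F q in nhds (u0, s i (u0, z0)). \<forall>f. L2 (fst q) f (chart_inv (fst (b i)) (snd q)) =
        (\<Sum>j\<in>J i. \<gamma>' i j q * f (chart_inv (fst (b' i j)) (s' i j q)))"
      using en[OF i] unfolding branch_expansion_def by blast
    ultimately show "\<forall>\<^sub>F q in nhds (u0, z0). \<forall>f. L2 (fst q) f (chart_inv (fst (b i)) (s i q)) =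
        (\<Sum>j\<in>J i. \<gamma>' i j (fst q, s i q) * f (chart_inv (fst (b' i j)) (s' i j (fst q, s i q))))"
      using eventually_compose_filterlim by fastforce
  qed
  have ev1: "\<forall>\<^sub>F q in nhds (u0, z0). \<forall>f. L1 (fst q) f (chart_inv c (snd q)) =
        (\<Sum>i\<in>I. \<gamma> i q * f (chart_inv (fst (b i)) (s i q)))"
    using e1 unfolding branch_expansion_def by blast
  show ?thesis unfolding branch_expansion_def
  proof (intro conjI ballI)
    show "finite (Sigma I J)" using fin finJ by blast
    show "\<forall>\<^sub>F q in nhds (u0, z0). \<forall>f. L1 (fst q) (L2 (fst q) f) (chart_inv c (snd q)) =
       (\<Sum>p\<in>Sigma I J. (case p of (i, j) \<Rightarrow> \<lambda>q. \<gamma> i q * \<gamma>' i j (fst q, s i q)) q *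
         f (chart_inv (fst (case p of (i, j) \<Rightarrow> b' i j)) ((case p of (i, j) \<Rightarrow> \<lambda>q. s' i j (fst q, s i q)) q)))"
      using ev ev1
    proof eventually_elim
      case (elim q)
      show ?case
      proof
        fix f
        have "L1 (fst q) (L2 (fst q) f) (chart_inv c (snd q)) =
          (\<Sum>i\<in>I. \<Sum>j\<in>J i. \<gamma> i q * \<gamma>' i j (fst q, s i q) * f (chart_inv (fst (b' i j)) (s' i j (fst q, s i q))))"
          using elim by (simp add: sum_distrib_left mult.assoc)
        also have "\<dots> = (\<Sum>(i, j)\<in>Sigma I J. \<gamma> i q * \<gamma>' i j (fst q, s i q) * f (chart_inv (fst (b' i j)) (s' i j (fst q, s i q))))"
          using fin finJ by (intro sum.Sigma) auto
        finally show "L1 (fst q) (L2 (fst q) f) (chart_inv c (snd q)) =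
          (\<Sum>p\<in>Sigma I J. (case p of (i, j) \<Rightarrow> \<lambda>q. \<gamma> i q * \<gamma>' i j (fst q, s i q)) q *
            f (chart_inv (fst (case p of (i, j) \<Rightarrow> b' i j)) ((case p of (i, j) \<Rightarrow> \<lambda>q. s' i j (fst q, s i q)) q)))"
          by (simp add: case_prod_beta')
      qed
    qed
  next
    fix p assume "p \<in> Sigma I J"
    then obtain i j where p: "p = (i, j)" "i \<in> I" "j \<in> J i" by auto
    have i: "C1_holder_at \<alpha> (s i) (u0, z0)" "C1_holder_at \<alpha> (\<gamma> i) (u0, z0)" "\<gamma> i (u0, z0) > 0"
      using e1 p unfolding branch_expansion_def by blast+
    obtain D where D: "(s i has_derivative D) (at (u0, z0))"
      "\<And>v. sqrt (G (fst (b i)) (chart_inv (fst (b i)) (s i (u0, z0))) (D (0, v)) (D (0, v)))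
             \<le> \<rho> * sqrt (G c (chart_inv c z0) v v)"
      using e1 p unfolding branch_expansion_def by blast
    have j: "b' i j \<in> N" "C1_holder_at \<alpha> (s' i j) (u0, s i (u0, z0))" "C1_holder_at \<alpha> (\<gamma>' i j) (u0, s i (u0, z0))"
      "\<gamma>' i j (u0, s i (u0, z0)) > 0"
      "s' i j (u0, s i (u0, z0)) \<in> ball (fst (snd (b' i j))) (snd (snd (b' i j)))"
      using en[OF p(2)] p unfolding branch_expansion_def by blast+
    obtain D' where D': "(s' i j has_derivative D') (at (u0, s i (u0, z0)))"
      "\<And>v. sqrt (G (fst (b' i j)) (chart_inv (fst (b' i j)) (s' i j (u0, s i (u0, z0)))) (D' (0, v)) (D' (0, v)))
             \<le> \<rho>' * sqrt (G (fst (b i)) (chart_inv (fst (b i)) (s i (u0, z0))) v v)"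
      using en[OF p(2)] p unfolding branch_expansion_def by blast
    show "(case p of (i, j) \<Rightarrow> b' i j) \<in> N" using p j by simp
    show "C1_holder_at \<alpha> (case p of (i, j) \<Rightarrow> \<lambda>q. s' i j (fst q, s i q)) (u0, z0)"
      using C1_holder_at_compose[OF pairC[OF p(2)], of "s' i j"] j \<alpha> p by simp
    show "C1_holder_at \<alpha> (case p of (i, j) \<Rightarrow> \<lambda>q. \<gamma> i q * \<gamma>' i j (fst q, s i q)) (u0, z0)"
      using C1_holder_at_mult[OF i(2) C1_holder_at_compose[OF pairC[OF p(2)], of "\<gamma>' i j"]] j \<alpha> p by simp
    show "0 < (case p of (i, j) \<Rightarrow> \<lambda>q. \<gamma> i q * \<gamma>' i j (fst q, s i q)) (u0, z0)"
      using i j p by simp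
    show "(case p of (i, j) \<Rightarrow> \<lambda>q. s' i j (fst q, s i q)) (u0, z0) \<in>
       ball (fst (snd (case p of (i, j) \<Rightarrow> b' i j))) (snd (snd (case p of (i, j) \<Rightarrow> b' i j)))"
      using j p by simp
    have pr: "((\<lambda>q. (fst q, s i q)) has_derivative (\<lambda>w. (fst w, D w))) (at (u0, z0))"
      by (intro has_derivative_Pair D(1) bounded_linear_imp_has_derivative bounded_linear_fst)
    have der: "((\<lambda>q. s' i j (fst q, s i q)) has_derivative (\<lambda>w. D' (fst w, D w))) (at (u0, z0))"
      using has_derivative_compose[OF pr, of "s' i j" D'] D'(1) by simp
    have "sqrt (G (fst (b' i j)) (chart_inv (fst (b' i j)) (s' i j (u0, s i (u0, z0)))) (D' (0, D (0, v))) (D' (0, D (0, v))))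
         \<le> \<rho>' * \<rho> * sqrt (G c (chart_inv c z0) v v)" for v
      using D'(2)[of "D (0, v)"] mult_left_mono[OF D(2)[of v] \<rho>] by (simp add: mult.assoc)
    then show "\<exists>D. ((case p of (i, j) \<Rightarrow> \<lambda>q. s' i j (fst q, s i q)) has_derivative D) (at (u0, z0)) \<and>
       (\<forall>v. sqrt (G (fst (case p of (i, j) \<Rightarrow> b' i j))
          (chart_inv (fst (case p of (i, j) \<Rightarrow> b' i j)) ((case p of (i, j) \<Rightarrow> \<lambda>q. s' i j (fst q, s i q)) (u0, z0)))
          (D (0, v)) (D (0, v))) \<le> \<rho>' * \<rho> * sqrt (G c (chart_inv c z0) v v))"
      using der unfolding p(1) case_prod_conv by (intro exI[of _ "\<lambda>w. D' (fst w, D w)"] conjI allI) (simp_all only: fst_conv)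
  qed
qed

text \<open>The induction splits off the outermost operator and applies the hypothesis at the images
  of its branches, in their own charts; hence \<open>c\<close> and \<open>z0\<close> are
  generalized.\<close>

lemma iterate_branches:
  assumes u0: "u0 \<in> U"
    and \<kappa>: "\<kappa> > 1" "\<And>c d x v. c \<in> A \<Longrightarrow> d \<in> A \<Longrightarrow> x \<in> fst d \<Longrightarrow> T u0 x \<in> fst c \<Longrightarrow>
     \<kappa> * sqrt (G d x v v) \<le> sqrt (G c (T u0 x) (chart_diff d c (T u0) x v) (chart_diff d c (T u0) x v))"
    and c: "c \<in> A" "z0 \<in> chart_img c"
  shows "\<exists>m b s \<gamma>. branch_expansion N G \<alpha> (\<lambda>u f. (L u ^^ Suc n) f) u0 c z0 ((1 / \<kappa>) ^ Suc n) {..<m::nat} b s \<gamma>"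
  using c
proof (induction n arbitrary: c z0)
  case 0
  obtain m b s \<gamma> where "branch_expansion N G \<alpha> L u0 c z0 (1 / \<kappa>) {..<m::nat} b s \<gamma>"
    using transfer_op_branches[OF u0 0 \<kappa>] by blast
  then have "branch_expansion N G \<alpha> (\<lambda>u f. (L u ^^ Suc 0) f) u0 c z0 ((1 / \<kappa>) ^ Suc 0) {..<m} b s \<gamma>" by simp
  then show ?case by (intro exI)
next
  case (Suc n)
  obtain m b s \<gamma> where e1: "branch_expansion N G \<alpha> L u0 c z0 (1 / \<kappa>) {..<m::nat} b s \<gamma>"
    using transfer_op_branches[OF u0 Suc.prems \<kappa>] by blast
  define Q where "Q = (\<lambda>i m' b' s' \<gamma>'. branch_expansion N G \<alpha> (\<lambda>u f. (L u ^^ Suc n) f) u0 (fst (b i)) (s i (u0, z0))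
       ((1 / \<kappa>) ^ Suc n) {..<m'::nat} b' s' \<gamma>')"
  have "\<forall>i\<in>{..<m}. \<exists>m' b' s' \<gamma>'. Q i m' b' s' \<gamma>'"
  proof
    fix i assume i: "i \<in> {..<m}"
    have h: "b i \<in> N" "s i (u0, z0) \<in> ball (fst (snd (b i))) (snd (snd (b i)))"
      using e1 i unfolding branch_expansion_def by blast+
    then have "(fst (b i), fst (snd (b i)), snd (snd (b i))) \<in> N" by simp
    from cover_chart[OF this, of "s i (u0, z0)"] h(2)
    have "fst (b i) \<in> A" "s i (u0, z0) \<in> chart_img (fst (b i))" by auto
    from Suc.IH[OF this] show "\<exists>m' b' s' \<gamma>'. Q i m' b' s' \<gamma>'" unfolding Q_def .
  qed
  from bchoice[OF this] obtain m' where "\<forall>i\<in>{..<m}. \<exists>b' s' \<gamma>'. Q i (m' i) b' s' \<gamma>'" by blast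
  from bchoice[OF this] obtain b' where "\<forall>i\<in>{..<m}. \<exists>s' \<gamma>'. Q i (m' i) (b' i) s' \<gamma>'" by blast
  from bchoice[OF this] obtain s' where "\<forall>i\<in>{..<m}. \<exists>\<gamma>'. Q i (m' i) (b' i) (s' i) \<gamma>'" by blast
  from bchoice[OF this] obtain \<gamma>' where Q: "\<forall>i\<in>{..<m}. Q i (m' i) (b' i) (s' i) (\<gamma>' i)" by blast
  have "branch_expansion N G \<alpha> (\<lambda>u f. L u ((L u ^^ Suc n) f)) u0 c z0 ((1 / \<kappa>) ^ Suc n * (1 / \<kappa>))
    (Sigma {..<m} (\<lambda>i. {..<m' i})) (\<lambda>(i, j). b' i j)
    (\<lambda>(i, j) q. s' i j (fst q, s i q)) (\<lambda>(i, j) q. \<gamma> i q * \<gamma>' i j (fst q, s i q))"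
    by (rule branch_expansion_Suc[OF e1]) (use Q \<kappa>(1) in \<open>auto simp: Q_def\<close>)
  moreover have "(\<lambda>u f. L u ((L u ^^ Suc n) f)) = (\<lambda>u f. (L u ^^ Suc (Suc n)) f)" by simp
  moreover have "(1 / \<kappa>) ^ Suc n * (1 / \<kappa>) = (1 / \<kappa>) ^ Suc (Suc n)" by simp
  ultimately have "branch_expansion N G \<alpha> (\<lambda>u f. (L u ^^ Suc (Suc n)) f) u0 c z0 ((1 / \<kappa>) ^ Suc (Suc n))
    (Sigma {..<m} (\<lambda>i. {..<m' i})) (\<lambda>(i, j). b' i j)
    (\<lambda>(i, j) q. s' i j (fst q, s i q)) (\<lambda>(i, j) q. \<gamma> i q * \<gamma>' i j (fst q, s i q))" by (simp only:)
  then obtain m2 b2 s2 \<gamma>2 where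
    "branch_expansion N G \<alpha> (\<lambda>u f. (L u ^^ Suc (Suc n)) f) u0 c z0 ((1 / \<kappa>) ^ Suc (Suc n)) {..<m2::nat} b2 s2 \<gamma>2"
    by (rule branch_expansion_nat)
  then show ?case by (intro exI)
qed

end

section \<open>Estimates for the transfer operator\<close>

text \<open>Closed coordinate balls are compact and the cover is finite, so local constants can be
  made uniform. \<open>\<epsilon>\<close> acts as a Lebesgue number, and monotonicity in
  \<open>C\<close> permits taking maxima.\<close>

lemma uniform_patch:
  fixes P :: "('x, 'e::euclidean_space) chart \<times> 'e \<times> real \<Rightarrow> real \<Rightarrow> 'p::metric_space \<Rightarrow> 'e \<Rightarrow> 'e \<Rightarrow> bool"
  assumes fin: "finite N"
    and mono: "\<And>b C C' u z z'. P b C u z z' \<Longrightarrow> C \<le> C' \<Longrightarrow> P b C' u z z'"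
    and loc: "\<And>c a R z0. (c, a, R) \<in> N \<Longrightarrow> z0 \<in> cball a R \<Longrightarrow> \<exists>\<epsilon>>0. \<exists>C. \<forall>u\<in>ball u0 \<epsilon>.
      \<forall>z\<in>ball z0 \<epsilon>. \<forall>z'\<in>ball z0 \<epsilon>. P (c, a, R) C u z z'"
  obtains \<epsilon> C where "0 < \<epsilon>" "0 \<le> C" "\<And>c a R u z z'. (c, a, R) \<in> N \<Longrightarrow> u \<in> ball u0 \<epsilon> \<Longrightarrow>
     z \<in> ball a R \<Longrightarrow> z' \<in> ball a R \<Longrightarrow> dist z z' < \<epsilon> \<Longrightarrow> P (c, a, R) C u z z'"
proof -
  define Q where "Q = (\<lambda>b \<epsilon> C. 0 < \<epsilon> \<and> (\<forall>u\<in>ball u0 \<epsilon>. \<forall>z\<in>ball (fst (snd b)) (snd (snd b)).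
     \<forall>z'\<in>ball (fst (snd b)) (snd (snd b)). dist z z' < \<epsilon> \<longrightarrow> P b C u z z'))"
  have "\<exists>\<epsilon> C. Q b \<epsilon> C" if b: "b \<in> N" for b
  proof -
    obtain c a R where bc: "b = (c, a, R)" using prod_cases3 by blast
    define W where "W = (\<lambda>z0 \<epsilon> C. 0 < \<epsilon> \<and> (\<forall>u\<in>ball u0 \<epsilon>. \<forall>z\<in>ball z0 \<epsilon>. \<forall>z'\<in>ball z0 \<epsilon>. P b C u z z'))"
    have "\<forall>z0\<in>cball a R. \<exists>\<epsilon> C. W z0 \<epsilon> C" using loc b unfolding bc W_def by blast
    from bchoice[OF this] obtain e where "\<forall>z0\<in>cball a R. \<exists>C. W z0 (e z0) C" by blast
    from bchoice[OF this] obtain K where W: "\<forall>z0\<in>cball a R. W z0 (e z0) (K z0)" by blast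
    \<comment> \<open>Half radii leave room for \<open>z'\<close>: if \<open>z\<close> lies in the
      half ball and \<open>z'\<close> is close to \<open>z\<close>, both lie in the full
      ball.\<close>
    obtain D where D: "D \<subseteq> cball a R" "finite D" "cball a R \<subseteq> (\<Union>z0\<in>D. ball z0 (e z0 / 2))"
      by (rule compactE_image[where S = "cball a R" and C = "cball a R" and f = "\<lambda>z0. ball z0 (e z0 / 2)"])
         (use W in \<open>auto simp: W_def\<close>)
    define \<epsilon> where "\<epsilon> = Min (insert 1 ((\<lambda>z0. e z0 / 2) ` D))"
    define C where "C = Max (insert 0 (K ` D))"
    have e0: "0 < \<epsilon>" unfolding \<epsilon>_def using D W by (subst Min_gr_iff) (auto simp: W_def)
    have "P b C u z z'" if u: "u \<in> ball u0 \<epsilon>" and z: "z \<in> ball a R" "dist z z' < \<epsilon>" for u z z'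
    proof -
      have "z \<in> cball a R" using z(1) by simp
      then obtain z0 where z0: "z0 \<in> D" "z \<in> ball z0 (e z0 / 2)" using D(3) by blast
      have le: "\<epsilon> \<le> e z0 / 2" "K z0 \<le> C" unfolding \<epsilon>_def C_def using z0(1) D(2) by (intro Min_le Max_ge; simp)+
      have Wz: "W z0 (e z0) (K z0)" using W D(1) z0(1) by blast
      have "z' \<in> ball z0 (e z0)" using z0(2) z(2) le dist_triangle[of z0 z' z] by auto
      moreover have "z \<in> ball z0 (e z0)" using z0(2) Wz by (auto simp: W_def)
      moreover have "u \<in> ball u0 (e z0)" using u le Wz by (auto simp: W_def)
      ultimately have "P b (K z0) u z z'" using Wz unfolding W_def by blast
      then show ?thesis using mono le by blast
    qed
    then have "Q b \<epsilon> C" using e0 unfolding Q_def bc by simp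
    then show ?thesis by blast
  qed
  then have "\<forall>b\<in>N. \<exists>\<epsilon> C. Q b \<epsilon> C" by blast
  from bchoice[OF this] obtain e where "\<forall>b\<in>N. \<exists>C. Q b (e b) C" by blast
  from bchoice[OF this] obtain K where Q: "\<forall>b\<in>N. Q b (e b) (K b)" by blast
  define \<epsilon> where "\<epsilon> = Min (insert 1 (e ` N))"
  define C where "C = Max (insert 0 (K ` N))"
  show ?thesis
  proof (rule that[of \<epsilon> C])
    show "0 < \<epsilon>" unfolding \<epsilon>_def using fin Q by (subst Min_gr_iff) (auto simp: Q_def)
    show "0 \<le> C" unfolding C_def using fin by simp
    fix c a R u z z' assume b: "(c, a, R) \<in> N" and u: "u \<in> ball u0 \<epsilon>" and z: "z \<in> ball a R" "z' \<in> ball a R" "dist z z' < \<epsilon>"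
    have le: "\<epsilon> \<le> e (c, a, R)" "K (c, a, R) \<le> C" unfolding \<epsilon>_def C_def using fin b by (intro Min_le Max_ge; simp)+
    have "Q (c, a, R) (e (c, a, R)) (K (c, a, R))" using Q b by blast
    then have "P (c, a, R) (K (c, a, R)) u z z'" using u z le unfolding Q_def by simp
    then show "P (c, a, R) C u z z'" using mono le by blast
  qed
qed

lemma dist_Pair_le: "dist (u, z) (u', z') \<le> dist u u' + dist z z'"
  unfolding dist_Pair_Pair by (intro sqrt_sum_squares_le_sum) auto

lemma Pair_in_ball: "u \<in> ball u0 (\<epsilon> / 2) \<Longrightarrow> z \<in> ball z0 (\<epsilon> / 2) \<Longrightarrow> (u, z) \<in> ball (u0, z0) \<epsilon>"
  using dist_Pair_le[of u0 z0 u z] by simp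

text \<open>The inclusion of the space directions. Composing a joint derivative with it gives the
  partial derivative in the point at a fixed parameter.\<close>

definition snd_embed :: "'e \<Rightarrow>\<^sub>L ('p::euclidean_space \<times> 'e::euclidean_space)" where
  "snd_embed = Blinfun (\<lambda>v. (0, v))"

lemma snd_embed_apply [simp]: "blinfun_apply snd_embed v = (0, v)"
  unfolding snd_embed_def by (subst bounded_linear_Blinfun_apply) (auto intro: bounded_linear_Pair bounded_linear_zero bounded_linear_ident)

lemma norm_snd_embed: "norm snd_embed \<le> 1"
  by (rule norm_blinfun_bound) (auto simp: norm_Pair)

lemma C1_holder_bound_slice:
  assumes f: "C1_holder_bound \<alpha> K S f f'" and S: "\<And>z. z \<in> B \<Longrightarrow> (u, z) \<in> S"
  shows "C1_holder_bound \<alpha> K B (\<lambda>z. f (u, z)) (\<lambda>z. f' (u, z) o\<^sub>L snd_embed)"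
  unfolding C1_holder_bound_def
proof (intro conjI ballI)
  fix z assume z: "z \<in> B"
  have le: "norm (k o\<^sub>L snd_embed) \<le> norm k" for k :: "('a \<times> 'b) \<Rightarrow>\<^sub>L 'c"
    by (rule order_trans[OF norm_blinfun_compose]) (intro mult_left_le norm_snd_embed norm_ge_zero)
  have "((\<lambda>z. (u, z)) has_derivative (\<lambda>v. (0, v))) (at z)" by (auto intro!: derivative_eq_intros)
  from has_derivative_compose[OF this C1_holder_boundD(1)[OF f S[OF z]]]
  show "((\<lambda>z. f (u, z)) has_derivative blinfun_apply (f' (u, z) o\<^sub>L snd_embed)) (at z)"
    by (simp add: blinfun_compose.rep_eq o_def)
  show "norm (f (u, z)) \<le> K" using C1_holder_boundD(2)[OF f S[OF z]] .
  show "norm (f' (u, z) o\<^sub>L snd_embed) \<le> K" using C1_holder_boundD(3)[OF f S[OF z]] le order_trans by blast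
  fix z' assume z': "z' \<in> B"
  have "norm ((f' (u, z) o\<^sub>L snd_embed) - (f' (u, z') o\<^sub>L snd_embed)) = norm ((f' (u, z) - f' (u, z')) o\<^sub>L snd_embed)"
    by (intro arg_cong[where f=norm] blinfun_eqI) (simp add: blinfun.bilinear_simps)
  also have "\<dots> \<le> norm (f' (u, z) - f' (u, z'))" by (rule le)
  also have "\<dots> \<le> K * dist (u, z) (u, z') powr \<alpha>" using C1_holder_boundD(4)[OF f S[OF z] S[OF z']] .
  finally show "norm ((f' (u, z) o\<^sub>L snd_embed) - (f' (u, z') o\<^sub>L snd_embed)) \<le> K * dist z z' powr \<alpha>"
    by (simp add: dist_Pair_Pair)
qed

text \<open>A quantitative version of \<open>branch_expansion\<close> on one ball, with radius and
  constant common to all branches. \<open>\<eta>\<close> limits how much the derivative of a branch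
  can vary, so that contraction at the base point persists; the factors 1/2 and 2 tie the weights to
  those at the base point.\<close>

definition branch_patch ::
  "(('x, 'e::euclidean_space) chart \<times> 'e \<times> real) set \<Rightarrow> real \<Rightarrow>
   ('p::euclidean_space \<Rightarrow> ('x \<Rightarrow> real) \<Rightarrow> 'x \<Rightarrow> real) \<Rightarrow> 'p \<Rightarrow> ('x, 'e) chart \<Rightarrow> 'e \<Rightarrow>
   nat \<Rightarrow> (nat \<Rightarrow> ('x, 'e) chart \<times> 'e \<times> real) \<Rightarrow> (nat \<Rightarrow> 'p \<times> 'e \<Rightarrow> 'e) \<Rightarrow> (nat \<Rightarrow> 'p \<times> 'e \<Rightarrow> real) \<Rightarrow>
   (nat \<Rightarrow> 'p \<times> 'e \<Rightarrow> ('p \<times> 'e) \<Rightarrow>\<^sub>L 'e) \<Rightarrow> (nat \<Rightarrow> 'p \<times> 'e \<Rightarrow> ('p \<times> 'e) \<Rightarrow>\<^sub>L real) \<Rightarrow> real \<Rightarrow> real \<Rightarrow> real \<Rightarrow> bool" where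
  "branch_patch N \<alpha> L u0 c z0 n b s \<gamma> s' \<gamma>' \<epsilon> K \<eta> \<longleftrightarrow> 0 < \<epsilon> \<and> \<epsilon> \<le> 1/2 \<and> 0 \<le> K \<and>
     (\<forall>j<n. b j \<in> N \<and> C1_holder_bound \<alpha> K (ball (u0, z0) \<epsilon>) (s j) (s' j) \<and>
        C1_holder_bound \<alpha> K (ball (u0, z0) \<epsilon>) (\<gamma> j) (\<gamma>' j) \<and>
        s j ` ball (u0, z0) \<epsilon> \<subseteq> ball (fst (snd (b j))) (snd (snd (b j))) \<and>
        0 < \<gamma> j (u0, z0) \<and>
        (\<forall>p\<in>ball (u0, z0) \<epsilon>. \<gamma> j (u0, z0) / 2 \<le> \<gamma> j p \<and> \<gamma> j p \<le> 2 * \<gamma> j (u0, z0) \<and>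
           norm (s' j p - s' j (u0, z0)) \<le> \<eta>)) \<and>
     (\<forall>p\<in>ball (u0, z0) \<epsilon>. \<forall>f. L (fst p) f (chart_inv c (snd p)) =
        (\<Sum>j<n. \<gamma> j p * f (chart_inv (fst (b j)) (s j p))))"

lemma branch_expansion_patch:
  assumes ex: "branch_expansion N G \<alpha> L u0 c z0 \<rho> {..<n::nat} b s \<gamma>" and \<alpha>: "0 < \<alpha>" and \<eta>: "0 < \<eta>"
  obtains s' \<gamma>' \<epsilon> K where "branch_patch N \<alpha> L u0 c z0 n b s \<gamma> s' \<gamma>' \<epsilon> K \<eta>"
proof -
  let ?p = "(u0, z0)"
  define W where "W = (\<lambda>j s' \<gamma>' \<epsilon> K. 0 < \<epsilon> \<and> \<epsilon> \<le> 1/2 \<and> C1_holder_bound \<alpha> K (ball ?p \<epsilon>) (s j) s' \<and>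
        C1_holder_bound \<alpha> K (ball ?p \<epsilon>) (\<gamma> j) \<gamma>' \<and>
        s j ` ball ?p \<epsilon> \<subseteq> ball (fst (snd (b j))) (snd (snd (b j))) \<and>
        (\<forall>p\<in>ball ?p \<epsilon>. \<gamma> j ?p / 2 \<le> \<gamma> j p \<and> \<gamma> j p \<le> 2 * \<gamma> j ?p \<and> norm (s' p - s' ?p) \<le> \<eta>))"
  have "\<exists>s' \<gamma>' \<epsilon> K. W j s' \<gamma>' \<epsilon> K" if "j < n" for j
  proof -
    have j: "C1_holder_at \<alpha> (s j) ?p" "C1_holder_at \<alpha> (\<gamma> j) ?p" "0 < \<gamma> j ?p"
      "s j ?p \<in> ball (fst (snd (b j))) (snd (snd (b j)))"
      using ex that unfolding branch_expansion_def by blast+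
    obtain s' e1 K1 where 1: "0 < e1" "e1 \<le> 1/2" "C1_holder_bound \<alpha> K1 (ball ?p e1) (s j) s'"
      using C1_holder_at_bound[OF j(1) \<alpha>] by blast
    obtain \<gamma>' e2 K2 where 2: "0 < e2" "e2 \<le> 1/2" "C1_holder_bound \<alpha> K2 (ball ?p e2) (\<gamma> j) \<gamma>'"
      using C1_holder_at_bound[OF j(2) \<alpha>] by blast
    have "isCont (s j) ?p" "isCont (\<gamma> j) ?p" using C1_holder_at_continuous j by blast+
    moreover have "isCont s' ?p"
    proof -
      have "continuous_on (ball ?p e1) s'"
        by (rule holder_continuous_on[where M=K1 and r=\<alpha>]) (use C1_holder_boundD(4)[OF 1(3)] \<alpha> in auto)
      then show ?thesis using 1(1) by (simp add: continuous_on_eq_continuous_at)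
    qed
    ultimately have lim: "(s j \<longlongrightarrow> s j ?p) (nhds ?p)" "(\<gamma> j \<longlongrightarrow> \<gamma> j ?p) (nhds ?p)" "(s' \<longlongrightarrow> s' ?p) (nhds ?p)"
      using isCont_tendsto_nhds by blast+
    have "\<forall>\<^sub>F p in nhds ?p. s j p \<in> ball (fst (snd (b j))) (snd (snd (b j)))"
      using topological_tendstoD[OF lim(1) open_ball j(4)] .
    moreover have "\<forall>\<^sub>F p in nhds ?p. \<gamma> j p \<in> {\<gamma> j ?p / 2<..<2 * \<gamma> j ?p}"
      by (rule topological_tendstoD[OF lim(2)]) (use j(3) in auto)
    moreover have "\<forall>\<^sub>F p in nhds ?p. s' p \<in> ball (s' ?p) \<eta>"
      by (rule topological_tendstoD[OF lim(3)]) (use \<eta> in auto)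
    ultimately have "\<forall>\<^sub>F p in nhds ?p. s j p \<in> ball (fst (snd (b j))) (snd (snd (b j))) \<and>
        \<gamma> j ?p / 2 \<le> \<gamma> j p \<and> \<gamma> j p \<le> 2 * \<gamma> j ?p \<and> norm (s' p - s' ?p) \<le> \<eta>"
      by eventually_elim (auto simp: dist_norm norm_minus_commute)
    then obtain e3 where 3: "0 < e3" "\<And>p. p \<in> ball ?p e3 \<Longrightarrow> s j p \<in> ball (fst (snd (b j))) (snd (snd (b j))) \<and>
        \<gamma> j ?p / 2 \<le> \<gamma> j p \<and> \<gamma> j p \<le> 2 * \<gamma> j ?p \<and> norm (s' p - s' ?p) \<le> \<eta>"
      unfolding eventually_nhds_metric by (auto simp: dist_commute)
    define e where "e = min e1 (min e2 e3)"
    have e: "0 < e" "e \<le> e1" "e \<le> e2" "e \<le> e3" "e \<le> 1/2" using 1 2 3 by (auto simp: e_def)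
    have "W j s' \<gamma>' e (max K1 K2)"
      unfolding W_def
    proof (intro conjI)
      show "C1_holder_bound \<alpha> (max K1 K2) (ball ?p e) (s j) s'" "C1_holder_bound \<alpha> (max K1 K2) (ball ?p e) (\<gamma> j) \<gamma>'"
        by (rule C1_holder_bound_mono[OF 1(3)] C1_holder_bound_mono[OF 2(3)]; use e in auto)+
      show "s j ` ball ?p e \<subseteq> ball (fst (snd (b j))) (snd (snd (b j)))" using 3(2) e(4) by fastforce
      show "\<forall>p\<in>ball ?p e. \<gamma> j ?p / 2 \<le> \<gamma> j p \<and> \<gamma> j p \<le> 2 * \<gamma> j ?p \<and> norm (s' p - s' ?p) \<le> \<eta>"
        using 3(2) e(4) by fastforce
    qed (use e in auto)
    then show ?thesis by blast
  qed
  then have "\<forall>j\<in>{..<n}. \<exists>s' \<gamma>' \<epsilon> K. W j s' \<gamma>' \<epsilon> K" by blast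
  from bchoice[OF this] obtain s' where "\<forall>j\<in>{..<n}. \<exists>\<gamma>' \<epsilon> K. W j (s' j) \<gamma>' \<epsilon> K" by blast
  from bchoice[OF this] obtain \<gamma>' where "\<forall>j\<in>{..<n}. \<exists>\<epsilon> K. W j (s' j) (\<gamma>' j) \<epsilon> K" by blast
  from bchoice[OF this] obtain e where "\<forall>j\<in>{..<n}. \<exists>K. W j (s' j) (\<gamma>' j) (e j) K" by blast
  from bchoice[OF this] obtain k where W: "\<forall>j\<in>{..<n}. W j (s' j) (\<gamma>' j) (e j) (k j)" by blast
  have "\<forall>\<^sub>F q in nhds ?p. \<forall>f. L (fst q) f (chart_inv c (snd q)) =
        (\<Sum>j<n. \<gamma> j q * f (chart_inv (fst (b j)) (s j q)))"
    using ex unfolding branch_expansion_def by blast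
  then obtain e0 where e0: "0 < e0" "\<And>q. q \<in> ball ?p e0 \<Longrightarrow> \<forall>f. L (fst q) f (chart_inv c (snd q)) =
        (\<Sum>j<n. \<gamma> j q * f (chart_inv (fst (b j)) (s j q)))"
    unfolding eventually_nhds_metric by (auto simp: dist_commute)
  define \<epsilon> where "\<epsilon> = Min (insert (min e0 (1/2)) (e ` {..<n}))"
  define K where "K = Max (insert 0 (k ` {..<n}))"
  have le: "\<epsilon> \<le> e j" "k j \<le> K" if "j < n" for j unfolding \<epsilon>_def K_def using that by (intro Min_le Max_ge; simp)+
  have "branch_patch N \<alpha> L u0 c z0 n b s \<gamma> s' \<gamma>' \<epsilon> K \<eta>"
    unfolding branch_patch_def
  proof (intro conjI allI impI ballI)
    show "0 < \<epsilon>" unfolding \<epsilon>_def using e0 W by (subst Min_gr_iff) (auto simp: W_def)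
    have "\<epsilon> \<le> min e0 (1/2)" unfolding \<epsilon>_def by (intro Min_le) auto
    then have le0: "\<epsilon> \<le> e0" "\<epsilon> \<le> 1/2" by auto
    then show "\<epsilon> \<le> 1/2" by simp
    show "0 \<le> K" unfolding K_def by simp
    fix j assume j: "j < n"
    have Wj: "W j (s' j) (\<gamma>' j) (e j) (k j)" using W j by blast
    show "b j \<in> N" "0 < \<gamma> j ?p" using ex j unfolding branch_expansion_def by blast+
    have sub: "ball ?p \<epsilon> \<subseteq> ball ?p (e j)" using le[OF j] by auto
    show "C1_holder_bound \<alpha> K (ball ?p \<epsilon>) (s j) (s' j)" "C1_holder_bound \<alpha> K (ball ?p \<epsilon>) (\<gamma> j) (\<gamma>' j)"
      using Wj C1_holder_bound_mono[OF _ le(2)[OF j] sub] unfolding W_def by blast+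
    show "s j ` ball ?p \<epsilon> \<subseteq> ball (fst (snd (b j))) (snd (snd (b j)))"
      using Wj sub unfolding W_def by blast
    fix p assume "p \<in> ball ?p \<epsilon>"
    then have p: "p \<in> ball ?p (e j)" using sub by blast
    show "\<gamma> j ?p / 2 \<le> \<gamma> j p" "\<gamma> j p \<le> 2 * \<gamma> j ?p" "norm (s' j p - s' j ?p) \<le> \<eta>"
      using Wj p unfolding W_def by blast+
  next
    fix p f assume p: "p \<in> ball ?p \<epsilon>"
    have "\<epsilon> \<le> min e0 (1/2)" unfolding \<epsilon>_def by (intro Min_le) auto
    then have "p \<in> ball ?p e0" using p by auto
    then show "L (fst p) f (chart_inv c (snd p)) = (\<Sum>j<n. \<gamma> j p * f (chart_inv (fst (b j)) (s j p)))"
      using e0(2) by blast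
  qed
  then show ?thesis using that by blast
qed

lemma ball_half_dist: "x \<in> ball p \<epsilon> \<Longrightarrow> y \<in> ball p \<epsilon> \<Longrightarrow> \<epsilon> \<le> 1/2 \<Longrightarrow> dist x y \<le> (1::real)"
  using dist_triangle[of x y p] by (auto simp: dist_commute)

text \<open>A crude estimate, jointly in parameter and point and without use of contraction. The
  bound for the derivative does not involve \<open>Ma\<close>, which later keeps the sup norm of
  \<open>L u f - L u0 f\<close> free of it.\<close>

lemma branch_patch_joint:
  assumes bp: "branch_patch N \<alpha> L u0 c z0 n b s \<gamma> s' \<gamma>' \<epsilon> K \<eta>" and \<alpha>: "0 < \<alpha>" "\<alpha> \<le> 1"
  obtains C where "0 \<le> C" "\<And>f M0 M1 Ma. C1_bound N \<alpha> M0 M1 Ma f \<Longrightarrow> \<exists>F' :: _ \<Rightarrow> _ \<Rightarrow>\<^sub>L real. \<forall>p\<in>ball (u0, z0) \<epsilon>.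
     ((\<lambda>p. L (fst p) f (chart_inv c (snd p))) has_derivative blinfun_apply (F' p)) (at p) \<and>
     norm (F' p) \<le> C * (M0 + M1) \<and>
     (\<forall>p'\<in>ball (u0, z0) \<epsilon>. norm (F' p - F' p') \<le> C * (M0 + M1 + Ma) * dist p p' powr \<alpha>)"
proof -
  let ?S = "ball (u0, z0) \<epsilon>"
  have e: "0 < \<epsilon>" "\<epsilon> \<le> 1/2" "0 \<le> K" using bp unfolding branch_patch_def by blast+
  \<comment> \<open>Chosen to dominate the coefficients of \<open>M0\<close>, \<open>M1\<close> and
    \<open>Ma\<close> that \<open>weighted_composition_estimate\<close> produces when all its bounds
    are \<open>K\<close>.\<close>
  define k where "k = K + K * K + 2 * (K * K) + 2 * K + K * K powr \<alpha> * K"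
  have k0: "0 \<le> k" using e(3) by (simp add: k_def)
  define C where "C = real n * k"
  have C0: "0 \<le> C" using k0 by (simp add: C_def)
  show ?thesis
  proof (rule that[OF C0])
    fix f M0 M1 Ma assume f: "C1_bound N \<alpha> M0 M1 Ma f"
    note f0 = C1_boundD(1-3)[OF f]
    define Q where "Q = (\<lambda>j F'. \<forall>p\<in>?S.
       ((\<lambda>p. \<gamma> j p * f (chart_inv (fst (b j)) (s j p))) has_derivative blinfun_apply (F' p)) (at p) \<and>
       norm (F' p) \<le> k * (M0 + M1) \<and>
       (\<forall>p'\<in>?S. norm (F' p - F' p') \<le> k * (M0 + M1 + Ma) * dist p p' powr \<alpha>))"
    have "\<exists>F'. Q j F'" if "j < n" for j
    proof -
      obtain d a R where bj: "b j = (d, a, R)" using prod_cases3 by blast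
      have j: "(d, a, R) \<in> N" "C1_holder_bound \<alpha> K ?S (s j) (s' j)" "C1_holder_bound \<alpha> K ?S (\<gamma> j) (\<gamma>' j)"
        "s j ` ?S \<subseteq> ball a R"
      proof -
        have "b j \<in> N" "C1_holder_bound \<alpha> K ?S (s j) (s' j)" "C1_holder_bound \<alpha> K ?S (\<gamma> j) (\<gamma>' j)"
          "s j ` ?S \<subseteq> ball (fst (snd (b j))) (snd (snd (b j)))"
          using bp that unfolding branch_patch_def by blast+
        then show "(d, a, R) \<in> N" "C1_holder_bound \<alpha> K ?S (s j) (s' j)" "C1_holder_bound \<alpha> K ?S (\<gamma> j) (\<gamma>' j)"
          "s j ` ?S \<subseteq> ball a R" unfolding bj fst_conv snd_conv by blast+
      qed
      obtain f' where f': "\<forall>z\<in>ball a R. ((\<lambda>z. f (chart_inv d z)) has_derivative blinfun_apply (f' z)) (at z) \<and>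
        \<bar>f (chart_inv d z)\<bar> \<le> M0 \<and> norm (f' z) \<le> M1 \<and> (\<forall>z'\<in>ball a R. norm (f' z - f' z') \<le> Ma * dist z z' powr \<alpha>)"
        using C1_boundD(4)[OF f j(1)] by blast
      define F' where "F' = (\<lambda>x. blinfun_compose (blinfun_scaleR_left (f (chart_inv d (s j x)))) (\<gamma>' j x) + \<gamma> j x *\<^sub>R (f' (s j x) o\<^sub>L s' j x))"
      have est: "x \<in> ?S \<Longrightarrow> ((\<lambda>x. \<gamma> j x *\<^sub>R f (chart_inv d (s j x))) has_derivative blinfun_apply (F' x)) (at x)"
        "x \<in> ?S \<Longrightarrow> norm (F' x) \<le> K * M0 + K * M1 * K"
        "x \<in> ?S \<Longrightarrow> y \<in> ?S \<Longrightarrow> norm (F' x - F' y) \<le>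
          ((M1 * K * K + M0 * K) + (K * M1 * K + K * (Ma * K powr \<alpha>) * K + K * M1 * K)) * dist x y powr \<alpha>" for x y
      proof -
        have gk: "\<And>x. x \<in> ?S \<Longrightarrow> \<bar>\<gamma> j x\<bar> \<le> K" using C1_holder_boundD(2)[OF j(3)] by simp
        have fd: "\<And>z. z \<in> ball a R \<Longrightarrow> ((\<lambda>z. f (chart_inv d z)) has_derivative blinfun_apply (f' z)) (at z)"
          "\<And>z. z \<in> ball a R \<Longrightarrow> norm (f (chart_inv d z)) \<le> M0" "\<And>z. z \<in> ball a R \<Longrightarrow> norm (f' z) \<le> M1"
          "\<And>z z'. z \<in> ball a R \<Longrightarrow> z' \<in> ball a R \<Longrightarrow> norm (f' z - f' z') \<le> Ma * dist z z' powr \<alpha>"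
          using f' by auto
        note E = weighted_composition_estimate[OF convex_ball ball_half_dist[OF _ _ e(2)] \<alpha> j(3) gk j(2)
          C1_holder_boundD(3)[OF j(2)] j(4) fd f0(3) convex_ball]
        show "x \<in> ?S \<Longrightarrow> ((\<lambda>x. \<gamma> j x *\<^sub>R f (chart_inv d (s j x))) has_derivative blinfun_apply (F' x)) (at x)"
          "x \<in> ?S \<Longrightarrow> norm (F' x) \<le> K * M0 + K * M1 * K"
          "x \<in> ?S \<Longrightarrow> y \<in> ?S \<Longrightarrow> norm (F' x - F' y) \<le>
            ((M1 * K * K + M0 * K) + (K * M1 * K + K * (Ma * K powr \<alpha>) * K + K * M1 * K)) * dist x y powr \<alpha>"
          unfolding F'_def by (rule E(1) E(3) E(4); assumption)+
      qed
      have 1: "K * M0 + K * M1 * K \<le> k * (M0 + M1)"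
      proof -
        have "K * M0 \<le> k * M0" "K * K * M1 \<le> k * M1" using e(3) f0 by (intro mult_right_mono; simp add: k_def)+
        then show ?thesis by (simp add: algebra_simps)
      qed
      have 2: "(M1 * K * K + M0 * K) + (K * M1 * K + K * (Ma * K powr \<alpha>) * K + K * M1 * K) \<le> k * (M0 + M1 + Ma)"
      proof -
        have "K * M0 \<le> k * M0" "(3 * (K * K)) * M1 \<le> k * M1" "(K * K powr \<alpha> * K) * Ma \<le> k * Ma"
          using e(3) f0 by (intro mult_right_mono; simp add: k_def)+
        then show ?thesis by (simp add: algebra_simps)
      qed
      have "Q j F'" unfolding Q_def bj fst_conv
      proof (intro ballI conjI)
        fix x assume x: "x \<in> ?S"
        show "((\<lambda>p. \<gamma> j p * f (chart_inv d (s j p))) has_derivative blinfun_apply (F' x)) (at x)"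
          using est(1)[OF x] by simp
        show "norm (F' x) \<le> k * (M0 + M1)" using est(2)[OF x] 1 by simp
        fix y assume y: "y \<in> ?S"
        show "norm (F' x - F' y) \<le> k * (M0 + M1 + Ma) * dist x y powr \<alpha>"
          by (rule order_trans[OF est(3)[OF x y]]) (intro mult_right_mono 2, simp)
      qed
      then show ?thesis by blast
    qed
    then have "\<forall>j\<in>{..<n}. \<exists>F'. Q j F'" by blast
    from bchoice[OF this] obtain F' where F': "\<And>j. j < n \<Longrightarrow> Q j (F' j)" by blast
    show "\<exists>F' :: _ \<Rightarrow> _ \<Rightarrow>\<^sub>L real. \<forall>p\<in>?S.
     ((\<lambda>p. L (fst p) f (chart_inv c (snd p))) has_derivative blinfun_apply (F' p)) (at p) \<and>
     norm (F' p) \<le> C * (M0 + M1) \<and>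
     (\<forall>p'\<in>?S. norm (F' p - F' p') \<le> C * (M0 + M1 + Ma) * dist p p' powr \<alpha>)"
    proof (intro exI[of _ "\<lambda>p. \<Sum>j<n. F' j p"] ballI conjI)
      fix p assume p: "p \<in> ?S"
      have "((\<lambda>p. \<Sum>j<n. \<gamma> j p * f (chart_inv (fst (b j)) (s j p))) has_derivative (\<lambda>v. \<Sum>j<n. blinfun_apply (F' j p) v)) (at p)"
        using F' p unfolding Q_def by (intro has_derivative_sum) blast
      then have "((\<lambda>p. \<Sum>j<n. \<gamma> j p * f (chart_inv (fst (b j)) (s j p))) has_derivative blinfun_apply (\<Sum>j<n. F' j p)) (at p)"
        by (rule has_derivative_eq_rhs) (simp add: blinfun.sum_left fun_eq_iff)
      then show "((\<lambda>p. L (fst p) f (chart_inv c (snd p))) has_derivative blinfun_apply (\<Sum>j<n. F' j p)) (at p)"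
        by (rule has_derivative_transform_within_open[OF _ open_ball p])
           (use bp in \<open>auto simp: branch_patch_def\<close>)
      have "norm (\<Sum>j<n. F' j p) \<le> (\<Sum>j<n. k * (M0 + M1))"
        by (rule sum_norm_le) (use F' p in \<open>auto simp: Q_def\<close>)
      then show "norm (\<Sum>j<n. F' j p) \<le> C * (M0 + M1)" by (simp add: C_def)
      fix p' assume p': "p' \<in> ?S"
      have "norm (\<Sum>j<n. F' j p - F' j p') \<le> (\<Sum>j<n. k * (M0 + M1 + Ma) * dist p p' powr \<alpha>)"
        by (rule sum_norm_le) (use F' p p' in \<open>auto simp: Q_def\<close>)
      then show "norm ((\<Sum>j<n. F' j p) - (\<Sum>j<n. F' j p')) \<le> C * (M0 + M1 + Ma) * dist p p' powr \<alpha>"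
        by (simp add: C_def sum_subtractf)
    qed
  qed
qed

text \<open>At a fixed parameter the contraction of the branches counts. The weights at the base
  point sum to \<open>L u0 1\<close>, nearby weights are at most twice as large, and the branches
  contract by \<open>q + \<eta>\<close>; the product is the coefficient of
  \<open>Ma\<close>.\<close>

lemma branch_patch_slice:
  assumes bp: "branch_patch N \<alpha> L u0 c z0 n b s \<gamma> s' \<gamma>' \<epsilon> K \<eta>" and \<alpha>: "0 < \<alpha>" "\<alpha> \<le> 1"
    and q: "\<And>j v. j < n \<Longrightarrow> norm (s' j (u0, z0) (0, v)) \<le> q * norm v" "0 \<le> q" "0 \<le> \<eta>" "q + \<eta> \<le> 1"
  obtains C where "0 \<le> C" "\<And>f M0 M1 Ma u z z'. C1_bound N \<alpha> M0 M1 Ma f \<Longrightarrow> u \<in> ball u0 (\<epsilon> / 2) \<Longrightarrow>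
     z \<in> ball z0 (\<epsilon> / 2) \<Longrightarrow> z' \<in> ball z0 (\<epsilon> / 2) \<Longrightarrow> \<exists>E E' :: _ \<Rightarrow>\<^sub>L real.
     ((\<lambda>z. L u f (chart_inv c z)) has_derivative blinfun_apply E) (at z) \<and>
     ((\<lambda>z. L u f (chart_inv c z)) has_derivative blinfun_apply E') (at z') \<and>
     norm (E - E') \<le> (2 * L u0 (\<lambda>x. 1) (chart_inv c z0) * (q + \<eta>) * Ma + C * (M0 + M1)) * dist z z' powr \<alpha>"
proof -
  let ?S = "ball (u0, z0) \<epsilon>"
  let ?B = "ball z0 (\<epsilon> / 2)"
  have e: "0 < \<epsilon>" "\<epsilon> \<le> 1/2" "0 \<le> K" using bp unfolding branch_patch_def by blast+
  define Q where "Q = q + \<eta>"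
  have Q: "0 \<le> Q" "Q \<le> 1" using q by (auto simp: Q_def)
  define k where "k = K + K + 2 * K * K"
  have k0: "0 \<le> k" using e(3) by (simp add: k_def)
  define C where "C = real n * (k + K)"
  have C0: "0 \<le> C" using k0 e(3) by (simp add: C_def)
  have S1: "L u0 (\<lambda>x. 1) (chart_inv c z0) = (\<Sum>j<n. \<gamma> j (u0, z0))"
  proof -
    have "(u0, z0) \<in> ?S" using e by simp
    moreover have "\<forall>p\<in>?S. \<forall>f. L (fst p) f (chart_inv c (snd p)) = (\<Sum>j<n. \<gamma> j p * f (chart_inv (fst (b j)) (s j p)))"
      using bp unfolding branch_patch_def by blast
    ultimately have "L (fst (u0, z0)) (\<lambda>x. 1) (chart_inv c (snd (u0, z0))) = (\<Sum>j<n. \<gamma> j (u0, z0) * 1)" by blast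
    then show ?thesis by simp
  qed
  show ?thesis
  proof (rule that[OF C0])
    fix f M0 M1 Ma u z z' assume f: "C1_bound N \<alpha> M0 M1 Ma f" and u: "u \<in> ball u0 (\<epsilon> / 2)" and z: "z \<in> ?B" "z' \<in> ?B"
    note f0 = C1_boundD(1-3)[OF f]
    have uS: "(u, y) \<in> ?S" if "y \<in> ?B" for y using Pair_in_ball[OF u that] .
    define W where "W = (\<lambda>j E E'.
       ((\<lambda>z. \<gamma> j (u, z) * f (chart_inv (fst (b j)) (s j (u, z)))) has_derivative blinfun_apply E) (at z) \<and>
       ((\<lambda>z. \<gamma> j (u, z) * f (chart_inv (fst (b j)) (s j (u, z)))) has_derivative blinfun_apply E') (at z') \<and>
       norm (E - E') \<le> (2 * \<gamma> j (u0, z0) * Q * Ma + (k + K) * (M0 + M1)) * dist z z' powr \<alpha>)"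
    have "\<exists>E E'. W j E E'" if jn: "j < n" for j
    proof -
      obtain d a R where bj: "b j = (d, a, R)" using prod_cases3 by blast
      have j: "(d, a, R) \<in> N" "C1_holder_bound \<alpha> K ?S (s j) (s' j)" "C1_holder_bound \<alpha> K ?S (\<gamma> j) (\<gamma>' j)"
        "s j ` ?S \<subseteq> ball a R" "0 < \<gamma> j (u0, z0)"
        and jp: "\<And>p. p \<in> ?S \<Longrightarrow> \<gamma> j (u0, z0) / 2 \<le> \<gamma> j p \<and> \<gamma> j p \<le> 2 * \<gamma> j (u0, z0) \<and>
           norm (s' j p - s' j (u0, z0)) \<le> \<eta>"
      proof -
        have "b j \<in> N" "C1_holder_bound \<alpha> K ?S (s j) (s' j)" "C1_holder_bound \<alpha> K ?S (\<gamma> j) (\<gamma>' j)"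
          "s j ` ?S \<subseteq> ball (fst (snd (b j))) (snd (snd (b j)))" "0 < \<gamma> j (u0, z0)"
          "\<forall>p\<in>?S. \<gamma> j (u0, z0) / 2 \<le> \<gamma> j p \<and> \<gamma> j p \<le> 2 * \<gamma> j (u0, z0) \<and> norm (s' j p - s' j (u0, z0)) \<le> \<eta>"
          using bp jn unfolding branch_patch_def by blast+
        then show "(d, a, R) \<in> N" "C1_holder_bound \<alpha> K ?S (s j) (s' j)" "C1_holder_bound \<alpha> K ?S (\<gamma> j) (\<gamma>' j)"
          "s j ` ?S \<subseteq> ball a R" "0 < \<gamma> j (u0, z0)"
          "\<And>p. p \<in> ?S \<Longrightarrow> \<gamma> j (u0, z0) / 2 \<le> \<gamma> j p \<and> \<gamma> j p \<le> 2 * \<gamma> j (u0, z0) \<and> norm (s' j p - s' j (u0, z0)) \<le> \<eta>"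
          unfolding bj fst_conv snd_conv by blast+
      qed
      obtain f' where f': "\<forall>z\<in>ball a R. ((\<lambda>z. f (chart_inv d z)) has_derivative blinfun_apply (f' z)) (at z) \<and>
        \<bar>f (chart_inv d z)\<bar> \<le> M0 \<and> norm (f' z) \<le> M1 \<and> (\<forall>z'\<in>ball a R. norm (f' z - f' z') \<le> Ma * dist z z' powr \<alpha>)"
        using C1_boundD(4)[OF f j(1)] by blast
      \<comment> \<open>Two bounds for one weight: \<open>2 * \<gamma> j (u0, z0)\<close> makes the
        \<open>Ma\<close> terms sum to the total weight, while \<open>K\<close> keeps the
        \<open>M1\<close> terms below a constant.\<close>
      define g where "g = min K (2 * \<gamma> j (u0, z0))"
      have gb: "\<bar>\<gamma> j (u, y)\<bar> \<le> g" if "y \<in> ?B" for y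
        using jp[OF uS[OF that]] j(5) C1_holder_boundD(2)[OF j(3) uS[OF that]] by (auto simp: g_def)
      have g0: "0 \<le> g" using gb[OF z(1)] by linarith
      have sl: "C1_holder_bound \<alpha> K ?B (\<lambda>z. s j (u, z)) (\<lambda>z. s' j (u, z) o\<^sub>L snd_embed)"
        "C1_holder_bound \<alpha> K ?B (\<lambda>z. \<gamma> j (u, z)) (\<lambda>z. \<gamma>' j (u, z) o\<^sub>L snd_embed)"
        by (rule C1_holder_bound_slice[OF j(2) uS] C1_holder_bound_slice[OF j(3) uS], assumption)+
      have sq: "norm (s' j (u, y) o\<^sub>L snd_embed) \<le> Q" if "y \<in> ?B" for y
      proof (rule norm_blinfun_bound[OF Q(1)])
        fix v :: 'b
        have "norm ((s' j (u, y) - s' j (u0, z0)) (0, v)) \<le> \<eta> * norm (0 :: 'c, v)"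
          by (rule order_trans[OF norm_blinfun]) (use jp[OF uS[OF that]] in \<open>intro mult_right_mono; simp\<close>)
        then have "norm (s' j (u, y) (0, v) - s' j (u0, z0) (0, v)) \<le> \<eta> * norm v"
          by (simp add: blinfun.bilinear_simps norm_Pair)
        then show "norm ((s' j (u, y) o\<^sub>L snd_embed) v) \<le> Q * norm v"
          using q(1)[OF jn, of v] norm_triangle_sub[of "s' j (u, y) (0, v)" "s' j (u0, z0) (0, v)"]
          by (simp add: Q_def algebra_simps)
      qed
      have sB: "(\<lambda>z. s j (u, z)) ` ?B \<subseteq> ball a R" using j(4) uS by auto
      define F' where "F' = (\<lambda>x. blinfun_compose (blinfun_scaleR_left (f (chart_inv d (s j (u, x))))) (\<gamma>' j (u, x) o\<^sub>L snd_embed)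
          + \<gamma> j (u, x) *\<^sub>R (f' (s j (u, x)) o\<^sub>L (s' j (u, x) o\<^sub>L snd_embed)))"
      have dB: "dist x y \<le> 1" if "x \<in> ?B" "y \<in> ?B" for x y
        using ball_half_dist[OF that] e(2) e(1) by simp
      have est: "x \<in> ?B \<Longrightarrow> ((\<lambda>x. \<gamma> j (u, x) *\<^sub>R f (chart_inv d (s j (u, x)))) has_derivative blinfun_apply (F' x)) (at x)"
        "x \<in> ?B \<Longrightarrow> y \<in> ?B \<Longrightarrow> norm (F' x - F' y) \<le>
          ((M1 * Q * K + M0 * K) + (K * M1 * Q + g * (Ma * Q powr \<alpha>) * Q + g * M1 * K)) * dist x y powr \<alpha>" for x y
      proof -
        have fd: "\<And>z. z \<in> ball a R \<Longrightarrow> ((\<lambda>z. f (chart_inv d z)) has_derivative blinfun_apply (f' z)) (at z)"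
          "\<And>z. z \<in> ball a R \<Longrightarrow> norm (f (chart_inv d z)) \<le> M0" "\<And>z. z \<in> ball a R \<Longrightarrow> norm (f' z) \<le> M1"
          "\<And>z z'. z \<in> ball a R \<Longrightarrow> z' \<in> ball a R \<Longrightarrow> norm (f' z - f' z') \<le> Ma * dist z z' powr \<alpha>"
          using f' by auto
        note E = weighted_composition_estimate[OF convex_ball dB \<alpha> sl(2) gb sl(1) sq sB fd f0(3) convex_ball]
        show "x \<in> ?B \<Longrightarrow> ((\<lambda>x. \<gamma> j (u, x) *\<^sub>R f (chart_inv d (s j (u, x)))) has_derivative blinfun_apply (F' x)) (at x)"
          "x \<in> ?B \<Longrightarrow> y \<in> ?B \<Longrightarrow> norm (F' x - F' y) \<le>
            ((M1 * Q * K + M0 * K) + (K * M1 * Q + g * (Ma * Q powr \<alpha>) * Q + g * M1 * K)) * dist x y powr \<alpha>"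
          unfolding F'_def by (rule E(1) E(4); assumption)+
      qed
      have 2: "(M1 * Q * K + M0 * K) + (K * M1 * Q + g * (Ma * Q powr \<alpha>) * Q + g * M1 * K)
         \<le> 2 * \<gamma> j (u0, z0) * Q * Ma + (k + K) * (M0 + M1)"
      proof -
        \<comment> \<open>Of the factor \<open>Q powr \<alpha> * Q\<close> only \<open>Q\<close> is
          kept; this already becomes arbitrarily small for high iterates.\<close>
        have "Q powr \<alpha> \<le> 1" using powr_le_one Q \<alpha> by simp
        then have "g * Ma * Q * Q powr \<alpha> \<le> g * Ma * Q * 1" using g0 f0 Q by (intro mult_left_mono) auto
        moreover have "g * (Ma * Q) \<le> (2 * \<gamma> j (u0, z0)) * (Ma * Q)" using f0 Q by (intro mult_right_mono) (auto simp: g_def)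
        ultimately have a: "g * (Ma * Q powr \<alpha>) * Q \<le> 2 * \<gamma> j (u0, z0) * Q * Ma" by (simp add: mult_ac)
        have "(M1 * K) * Q \<le> (M1 * K) * 1" using f0 e(3) Q by (intro mult_left_mono) auto
        moreover have "g * (M1 * K) \<le> K * (M1 * K)" using f0 e(3) by (intro mult_right_mono) (auto simp: g_def)
        moreover have "0 \<le> K * M0" "0 \<le> K * M1" "0 \<le> K * K * M0" "0 \<le> K * K * M1" using f0 e(3) by auto
        ultimately show ?thesis using a unfolding k_def by (simp add: algebra_simps)
      qed
      have "W j (F' z) (F' z')" unfolding W_def bj fst_conv
        using est(1)[OF z(1)] est(1)[OF z(2)] order_trans[OF est(2)[OF z] mult_right_mono[OF 2]] by simp
      then show ?thesis by blast
    qed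
    then have "\<forall>j\<in>{..<n}. \<exists>E E'. W j E E'" by blast
    from bchoice[OF this] obtain E where "\<forall>j\<in>{..<n}. \<exists>E'. W j (E j) E'" by blast
    from bchoice[OF this] obtain E' where E: "\<And>j. j < n \<Longrightarrow> W j (E j) (E' j)" by blast
    have exS: "\<forall>p\<in>?S. \<forall>f. L (fst p) f (chart_inv c (snd p)) = (\<Sum>j<n. \<gamma> j p * f (chart_inv (fst (b j)) (s j p)))"
      using bp unfolding branch_patch_def by blast
    have ex: "(\<Sum>j<n. \<gamma> j (u, y) * f (chart_inv (fst (b j)) (s j (u, y)))) = L u f (chart_inv c y)" if "y \<in> ?B" for y
      using bspec[OF exS uS[OF that]] by simp
    show "\<exists>E E' :: _ \<Rightarrow>\<^sub>L real.
     ((\<lambda>z. L u f (chart_inv c z)) has_derivative blinfun_apply E) (at z) \<and>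
     ((\<lambda>z. L u f (chart_inv c z)) has_derivative blinfun_apply E') (at z') \<and>
     norm (E - E') \<le> (2 * L u0 (\<lambda>x. 1) (chart_inv c z0) * (q + \<eta>) * Ma + C * (M0 + M1)) * dist z z' powr \<alpha>"
    proof (rule exI[of _ "\<Sum>j<n. E j"], rule exI[of _ "\<Sum>j<n. E' j"], intro conjI)
      have "((\<lambda>y. \<Sum>j<n. \<gamma> j (u, y) * f (chart_inv (fst (b j)) (s j (u, y)))) has_derivative (\<lambda>v. \<Sum>j<n. blinfun_apply (E j) v)) (at z)"
        using E unfolding W_def by (intro has_derivative_sum) blast
      then have "((\<lambda>y. \<Sum>j<n. \<gamma> j (u, y) * f (chart_inv (fst (b j)) (s j (u, y)))) has_derivative blinfun_apply (\<Sum>j<n. E j)) (at z)"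
        by (rule has_derivative_eq_rhs) (simp add: blinfun.sum_left fun_eq_iff)
      then show "((\<lambda>z. L u f (chart_inv c z)) has_derivative blinfun_apply (\<Sum>j<n. E j)) (at z)"
        by (rule has_derivative_transform_within_open[OF _ open_ball z(1)]) (use ex in auto)
      have "((\<lambda>y. \<Sum>j<n. \<gamma> j (u, y) * f (chart_inv (fst (b j)) (s j (u, y)))) has_derivative (\<lambda>v. \<Sum>j<n. blinfun_apply (E' j) v)) (at z')"
        using E unfolding W_def by (intro has_derivative_sum) blast
      then have "((\<lambda>y. \<Sum>j<n. \<gamma> j (u, y) * f (chart_inv (fst (b j)) (s j (u, y)))) has_derivative blinfun_apply (\<Sum>j<n. E' j)) (at z')"
        by (rule has_derivative_eq_rhs) (simp add: blinfun.sum_left fun_eq_iff)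
      then show "((\<lambda>z. L u f (chart_inv c z)) has_derivative blinfun_apply (\<Sum>j<n. E' j)) (at z')"
        by (rule has_derivative_transform_within_open[OF _ open_ball z(2)]) (use ex in auto)
      have "norm (\<Sum>j<n. E j - E' j) \<le> (\<Sum>j<n. (2 * \<gamma> j (u0, z0) * Q * Ma + (k + K) * (M0 + M1)) * dist z z' powr \<alpha>)"
        by (rule sum_norm_le) (use E in \<open>auto simp: W_def\<close>)
      also have "\<dots> = (2 * (\<Sum>j<n. \<gamma> j (u0, z0)) * Q * Ma + C * (M0 + M1)) * dist z z' powr \<alpha>"
        by (simp add: C_def sum_distrib_left sum_distrib_right sum.distrib algebra_simps)
      finally show "norm ((\<Sum>j<n. E j) - (\<Sum>j<n. E' j)) \<le> (2 * L u0 (\<lambda>x. 1) (chart_inv c z0) * (q + \<eta>) * Ma + C * (M0 + M1)) * dist z z' powr \<alpha>"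
        by (simp add: S1 Q_def sum_subtractf)
    qed
  qed
qed

text \<open>Mean value estimates in the parameter. One derivative is available, so the Hoelder
  exponent of \<open>F'\<close> can be spent either on the distance of two points, which gives the
  mixed difference, or on the parameter, which gives a remainder of order 1 + \<alpha>.\<close>

lemma joint_estimate_consequences:
  fixes F :: "'p::euclidean_space \<times> 'e::euclidean_space \<Rightarrow> real"
  assumes F: "\<forall>p\<in>ball (u0, z0) \<epsilon>. (F has_derivative blinfun_apply (F' p)) (at p) \<and> norm (F' p) \<le> A \<and>
     (\<forall>p'\<in>ball (u0, z0) \<epsilon>. norm (F' p - F' p') \<le> B * dist p p' powr \<alpha>)"
    and u: "u \<in> ball u0 (\<epsilon> / 2)" and z: "z \<in> ball z0 (\<epsilon> / 2)" "z' \<in> ball z0 (\<epsilon> / 2)" and \<alpha>: "0 < \<alpha>" and B: "0 \<le> B"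
  shows "\<bar>F (u, z) - F (u0, z)\<bar> \<le> A * dist u u0"
    and "\<bar>(F (u, z) - F (u0, z)) - (F (u, z') - F (u0, z'))\<bar> \<le> B * dist u u0 * dist z z' powr \<alpha>"
    and "((\<lambda>u. F (u, z)) has_derivative (\<lambda>w. F' (u0, z) (w, 0))) (at u0)"
    and "\<bar>F (u, z) - F (u0, z) - F' (u0, z) (u - u0, 0)\<bar> \<le> B * dist u u0 powr (1 + \<alpha>)"
proof -
  let ?V = "ball u0 (\<epsilon> / 2)"
  have e: "0 < \<epsilon>" using u zero_le_dist[of u0 u] by (simp del: zero_le_dist)
  have u0: "u0 \<in> ?V" using e by simp
  have S: "(w, y) \<in> ball (u0, z0) \<epsilon>" if "w \<in> ?V" "y \<in> ball z0 (\<epsilon> / 2)" for w y using Pair_in_ball[OF that] .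
  have d: "((\<lambda>u. F (u, y)) has_derivative (\<lambda>w. F' (v, y) (w, 0))) (at v)" if "v \<in> ?V" "y \<in> ball z0 (\<epsilon> / 2)" for v y
  proof -
    have "((\<lambda>u. (u, y)) has_derivative (\<lambda>w. (w, 0))) (at v)" by (auto intro!: derivative_eq_intros)
    from has_derivative_compose[OF this, of F] F S[OF that] show ?thesis by blast
  qed
  show "((\<lambda>u. F (u, z)) has_derivative (\<lambda>w. F' (u0, z) (w, 0))) (at u0)" by (rule d[OF u0 z(1)])
  have n: "norm (k (w, 0)) \<le> norm k * norm w" for k :: "('p \<times> 'e) \<Rightarrow>\<^sub>L real" and w :: 'p
    using norm_blinfun[of k "(w, 0)"] by (simp add: norm_Pair)
  have on: "onorm (\<lambda>w. k (w, 0)) \<le> D" if "norm k \<le> D" for k :: "('p \<times> 'e) \<Rightarrow>\<^sub>L real" and D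
    by (rule onorm_le) (rule order_trans[OF n mult_right_mono[OF that norm_ge_zero]])
  have "norm (F (u, z) - F (u0, z)) \<le> A * norm (u - u0)"
    by (rule differentiable_bound[OF convex_ball has_derivative_at_withinI[OF d] _ u u0])
       (use z F S in \<open>auto intro!: on\<close>)
  then show "\<bar>F (u, z) - F (u0, z)\<bar> \<le> A * dist u u0" by (simp add: dist_norm)
  \<comment> \<open>The mean value inequality is applied to \<open>F (u, z) - F (u, z')\<close> as a
    function of \<open>u\<close>, whose derivative is small when \<open>z\<close> and
    \<open>z'\<close> are close.\<close>
  have "norm ((F (u, z) - F (u, z')) - (F (u0, z) - F (u0, z'))) \<le> B * dist z z' powr \<alpha> * norm (u - u0)"
  proof (rule differentiable_bound[OF convex_ball _ _ u u0])
    fix v assume v: "v \<in> ?V"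
    show "((\<lambda>u. F (u, z) - F (u, z')) has_derivative (\<lambda>w. F' (v, z) (w, 0) - F' (v, z') (w, 0))) (at v within ?V)"
      by (rule has_derivative_diff[OF has_derivative_at_withinI[OF d[OF v z(1)]] has_derivative_at_withinI[OF d[OF v z(2)]]])
    have "norm (F' (v, z) - F' (v, z')) \<le> B * dist (v, z) (v, z') powr \<alpha>" using F S[OF v z(1)] S[OF v z(2)] by blast
    then have "onorm (\<lambda>w. (F' (v, z) - F' (v, z')) (w, 0)) \<le> B * dist z z' powr \<alpha>"
      by (rule on[OF ord_le_eq_trans]) (simp add: dist_Pair_Pair)
    then show "onorm (\<lambda>w. F' (v, z) (w, 0) - F' (v, z') (w, 0)) \<le> B * dist z z' powr \<alpha>"
      by (simp add: blinfun.diff_left)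
  qed
  then show "\<bar>(F (u, z) - F (u0, z)) - (F (u, z') - F (u0, z'))\<bar> \<le> B * dist u u0 * dist z z' powr \<alpha>"
    by (simp add: dist_norm algebra_simps)
  have "norm (F (u, z) - F (u0, z) - F' (u0, z) (u - u0, 0)) \<le> norm (u - u0) * (B * dist u u0 powr \<alpha>)"
  proof (rule differentiable_bound_linearization[where S = "?V \<inter> cball u0 (dist u u0)" and f' = "\<lambda>v w. F' (v, z) (w, 0)"
        and f = "\<lambda>u. F (u, z)" and ?x0.0 = u0 and a = u0 and b = u])
    fix t :: real assume t: "t \<in> {0..1}"
    have "norm (t *\<^sub>R (u - u0)) \<le> norm (u - u0)" using t by (simp add: mult_left_le_one_le)
    then show "u0 + t *\<^sub>R (u - u0) \<in> ?V \<inter> cball u0 (dist u u0)" using u by (auto simp: dist_norm norm_minus_commute)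
  next
    fix v assume v: "v \<in> ?V \<inter> cball u0 (dist u u0)"
    show "((\<lambda>u. F (u, z)) has_derivative (\<lambda>w. F' (v, z) (w, 0))) (at v within ?V \<inter> cball u0 (dist u u0))"
      by (rule has_derivative_at_withinI[OF d[OF _ z(1)]]) (use v in auto)
    have "norm (F' (v, z) - F' (u0, z)) \<le> B * dist (v, z) (u0, z) powr \<alpha>" using F S[of v z] S[OF u0 z(1)] v z by blast
    also have "\<dots> \<le> B * dist u u0 powr \<alpha>"
      using v B \<alpha> by (intro mult_left_mono powr_mono2) (auto simp: dist_Pair_Pair dist_commute)
    finally have "onorm (\<lambda>w. (F' (v, z) - F' (u0, z)) (w, 0)) \<le> B * dist u u0 powr \<alpha>" by (rule on)
    then show "onorm ((\<lambda>w. F' (v, z) (w, 0)) - (\<lambda>w. F' (u0, z) (w, 0))) \<le> B * dist u u0 powr \<alpha>"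
      by (simp add: blinfun.diff_left fun_diff_def)
  qed (use e in auto)
  also have "norm (u - u0) * (B * dist u u0 powr \<alpha>) = B * dist u u0 powr (1 + \<alpha>)"
    by (simp add: powr_add dist_norm)
  finally show "\<bar>F (u, z) - F (u0, z) - F' (u0, z) (u - u0, 0)\<bar> \<le> B * dist u u0 powr (1 + \<alpha>)" by simp
qed

section \<open>Dependence of the transfer operator on the parameter\<close>

context expanding_family
begin

lemma finite_cover: "finite N"
  using coordinate_coverD(1)[OF cover] .

lemma transfer_op_patch:
  assumes u0: "u0 \<in> U" and b: "(c, a, R) \<in> N" "z0 \<in> cball a R"
  obtains n b s \<gamma> s' \<gamma>' \<epsilon> K where "branch_patch N \<alpha> L u0 c z0 n b s \<gamma> s' \<gamma>' \<epsilon> K 1"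
proof -
  obtain \<kappa> where \<kappa>: "\<kappa> > 1" "\<And>c d x v. c \<in> A \<Longrightarrow> d \<in> A \<Longrightarrow> x \<in> fst d \<Longrightarrow> T u0 x \<in> fst c \<Longrightarrow>
     \<kappa> * sqrt (G d x v v) \<le> sqrt (G c (T u0 x) (chart_diff d c (T u0) x v) (chart_diff d c (T u0) x v))"
    using expansion_rate[OF u0] by blast
  obtain n br s \<gamma> where "branch_expansion N G \<alpha> L u0 c z0 (1 / \<kappa>) {..<n::nat} br s \<gamma>"
    using transfer_op_branches[OF u0 cover_chart(1,2)[OF b] \<kappa>] by blast
  from this \<alpha>(1) zero_less_one obtain s' \<gamma>' \<epsilon> K where "branch_patch N \<alpha> L u0 c z0 n br s \<gamma> s' \<gamma>' \<epsilon> K 1"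
    by (rule branch_expansion_patch)
  then show ?thesis by (rule that)
qed

lemma transfer_op_joint_patch:
  assumes u0: "u0 \<in> U" and b: "(c, a, R) \<in> N" "z0 \<in> cball a R"
  obtains \<epsilon> C where "0 < \<epsilon>" "0 \<le> C" "\<And>f M0 M1 Ma. C1_bound N \<alpha> M0 M1 Ma f \<Longrightarrow>
    \<exists>F' :: _ \<Rightarrow> _ \<Rightarrow>\<^sub>L real. \<forall>p\<in>ball (u0, z0) \<epsilon>.
     ((\<lambda>p. L (fst p) f (chart_inv c (snd p))) has_derivative blinfun_apply (F' p)) (at p) \<and>
     norm (F' p) \<le> C * (M0 + M1) \<and>
     (\<forall>p'\<in>ball (u0, z0) \<epsilon>. norm (F' p - F' p') \<le> C * (M0 + M1 + Ma) * dist p p' powr \<alpha>)"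
proof -
  obtain n b s \<gamma> s' \<gamma>' \<epsilon> K where bp: "branch_patch N \<alpha> L u0 c z0 n b s \<gamma> s' \<gamma>' \<epsilon> K 1"
    using transfer_op_patch[OF u0 b] by blast
  have e: "0 < \<epsilon>" using bp unfolding branch_patch_def by blast
  show ?thesis by (rule branch_patch_joint[OF bp \<alpha>(1) less_imp_le[OF \<alpha>(2)]]) (rule that[OF e]; assumption)
qed

text \<open>The sup bound involves only \<open>M0\<close> and \<open>M1\<close>. It thus becomes
  small once the derivative of \<open>f\<close> is made small by interpolation, whereas the
  C^\<alpha> bound merely stays proportional to the distance of the parameters.\<close>

lemma transfer_op_diff_bound:
  assumes u0: "u0 \<in> U"
  obtains \<epsilon> C where "0 < \<epsilon>" "0 \<le> C"
    "\<And>f M0 M1 Ma u. C1_bound N \<alpha> M0 M1 Ma f \<Longrightarrow> u \<in> ball u0 \<epsilon> \<Longrightarrow>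
      (\<forall>x. \<bar>L u f x - L u0 f x\<bar> \<le> C * dist u u0 * (M0 + M1)) \<and>
      holder_bound N \<alpha> (C * dist u u0 * (M0 + M1 + Ma)) (\<lambda>x. L u f x - L u0 f x)"
proof -
  define P where "P = (\<lambda>(b :: ('x, 'e) chart \<times> 'e \<times> real) C u z z'. \<forall>f M0 M1 Ma. C1_bound N \<alpha> M0 M1 Ma f \<longrightarrow>
     \<bar>L u f (chart_inv (fst b) z) - L u0 f (chart_inv (fst b) z)\<bar> \<le> C * (dist u u0 * (M0 + M1)) \<and>
     \<bar>(L u f (chart_inv (fst b) z) - L u0 f (chart_inv (fst b) z)) - (L u f (chart_inv (fst b) z') - L u0 f (chart_inv (fst b) z'))\<bar>
       \<le> C * (dist u u0 * (M0 + M1 + Ma) * dist z z' powr \<alpha>))"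
  obtain \<epsilon> C where e: "0 < \<epsilon>" "0 \<le> C" and P: "\<And>c a R u z z'. (c, a, R) \<in> N \<Longrightarrow> u \<in> ball u0 \<epsilon> \<Longrightarrow>
     z \<in> ball a R \<Longrightarrow> z' \<in> ball a R \<Longrightarrow> dist z z' < \<epsilon> \<Longrightarrow> P (c, a, R) C u z z'"
  proof (rule uniform_patch[OF finite_cover, where P = P])
    fix b C C' u z z' assume h: "P b C u z z'" "C \<le> C'"
    show "P b C' u z z'" unfolding P_def
    proof (intro allI impI)
      fix f M0 M1 Ma assume f: "C1_bound N \<alpha> M0 M1 Ma f"
      note f0 = C1_boundD(1-3)[OF f]
      have "C * (dist u u0 * (M0 + M1)) \<le> C' * (dist u u0 * (M0 + M1))"
        "C * (dist u u0 * (M0 + M1 + Ma) * dist z z' powr \<alpha>) \<le> C' * (dist u u0 * (M0 + M1 + Ma) * dist z z' powr \<alpha>)"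
        using f0 h(2) by (intro mult_right_mono; simp)+
      then show "\<bar>L u f (chart_inv (fst b) z) - L u0 f (chart_inv (fst b) z)\<bar> \<le> C' * (dist u u0 * (M0 + M1)) \<and>
       \<bar>(L u f (chart_inv (fst b) z) - L u0 f (chart_inv (fst b) z)) - (L u f (chart_inv (fst b) z') - L u0 f (chart_inv (fst b) z'))\<bar>
         \<le> C' * (dist u u0 * (M0 + M1 + Ma) * dist z z' powr \<alpha>)"
        using h(1) f unfolding P_def by (meson order_trans)
    qed
  next
    fix c a R z0 assume b: "(c, a, R) \<in> N" "z0 \<in> cball a R"
    obtain e C where e: "0 < e" "0 \<le> C" and F: "\<And>f M0 M1 Ma. C1_bound N \<alpha> M0 M1 Ma f \<Longrightarrow>
      \<exists>F' :: _ \<Rightarrow> _ \<Rightarrow>\<^sub>L real. \<forall>p\<in>ball (u0, z0) e.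
       ((\<lambda>p. L (fst p) f (chart_inv c (snd p))) has_derivative blinfun_apply (F' p)) (at p) \<and>
       norm (F' p) \<le> C * (M0 + M1) \<and>
       (\<forall>p'\<in>ball (u0, z0) e. norm (F' p - F' p') \<le> C * (M0 + M1 + Ma) * dist p p' powr \<alpha>)"
      using transfer_op_joint_patch[OF u0 b] by blast
    have "P (c, a, R) C u z z'" if u: "u \<in> ball u0 (e / 2)" and z: "z \<in> ball z0 (e / 2)" "z' \<in> ball z0 (e / 2)" for u z z'
      unfolding P_def fst_conv
    proof (intro allI impI)
      fix f M0 M1 Ma assume f: "C1_bound N \<alpha> M0 M1 Ma f"
      obtain F' :: "_ \<Rightarrow> _ \<Rightarrow>\<^sub>L real" where F': "\<forall>p\<in>ball (u0, z0) e.
       ((\<lambda>p. L (fst p) f (chart_inv c (snd p))) has_derivative blinfun_apply (F' p)) (at p) \<and>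
       norm (F' p) \<le> C * (M0 + M1) \<and>
       (\<forall>p'\<in>ball (u0, z0) e. norm (F' p - F' p') \<le> C * (M0 + M1 + Ma) * dist p p' powr \<alpha>)" using F[OF f] by blast
      have "0 \<le> C * (M0 + M1 + Ma)" using e C1_boundD(1-3)[OF f] by simp
      from joint_estimate_consequences(1,2)[OF F' u z \<alpha>(1) this]
      show "\<bar>L u f (chart_inv c z) - L u0 f (chart_inv c z)\<bar> \<le> C * (dist u u0 * (M0 + M1)) \<and>
       \<bar>(L u f (chart_inv c z) - L u0 f (chart_inv c z)) - (L u f (chart_inv c z') - L u0 f (chart_inv c z'))\<bar>
         \<le> C * (dist u u0 * (M0 + M1 + Ma) * dist z z' powr \<alpha>)"
        by (simp add: mult_ac)
    qed
    then have "0 < e / 2 \<and> (\<forall>u\<in>ball u0 (e / 2). \<forall>z\<in>ball z0 (e / 2). \<forall>z'\<in>ball z0 (e / 2). P (c, a, R) C u z z')"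
      using e(1) by simp
    then show "\<exists>\<epsilon>>0. \<exists>C. \<forall>u\<in>ball u0 \<epsilon>. \<forall>z\<in>ball z0 \<epsilon>. \<forall>z'\<in>ball z0 \<epsilon>. P (c, a, R) C u z z'"
      by blast
  qed (rule that)
  define C' where "C' = C + (1 + 2 * \<epsilon> powr (- \<alpha>)) * C"
  have C': "0 \<le> C'" "C \<le> C'" using e by (auto simp: C'_def)
  show ?thesis
  proof (rule that[OF e(1) C'(1)], intro conjI allI)
    fix f M0 M1 Ma u assume f: "C1_bound N \<alpha> M0 M1 Ma f" and u: "u \<in> ball u0 \<epsilon>"
    note f0 = C1_boundD(1-3)[OF f]
    let ?D = "\<lambda>x. L u f x - L u0 f x"
    have sup: "\<bar>?D x\<bar> \<le> C * (dist u u0 * (M0 + M1))" for x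
    proof -
      obtain c a R z where z: "(c, a, R) \<in> N" "z \<in> ball a R" "x = chart_inv c z" using coordinate_coverD(5)[OF cover] by blast
      have "P (c, a, R) C u z z" using P[OF z(1) u z(2) z(2)] e(1) by simp
      from this[unfolded P_def fst_conv, rule_format, OF f] show ?thesis unfolding z(3) by blast
    qed
    show "\<bar>?D x\<bar> \<le> C' * dist u u0 * (M0 + M1)" for x
      unfolding mult.assoc
      by (rule order_trans[OF sup mult_right_mono[OF C'(2)]]) (use f0 in simp)
    have h: "holder_bound N \<alpha> (C * (dist u u0 * (M0 + M1 + Ma)) + (1 + 2 * \<epsilon> powr (- \<alpha>)) * (C * (dist u u0 * (M0 + M1)))) ?D"
    proof (rule holder_bound_near[OF _ sup e(1) \<alpha>(1)])
      fix c a R z z' assume "(c, a, R) \<in> N" "z \<in> ball a R" "z' \<in> ball a R" "dist z z' < \<epsilon>"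
      from P[OF this(1) u this(2-4), unfolded P_def fst_conv, rule_format, OF f]
      show "\<bar>?D (chart_inv c z) - ?D (chart_inv c z')\<bar> \<le> C * (dist u u0 * (M0 + M1 + Ma)) * dist z z' powr \<alpha>"
        unfolding mult.assoc by blast
    qed (use e f0 in auto)
    have "(1 + 2 * \<epsilon> powr (- \<alpha>)) * (C * (dist u u0 * (M0 + M1))) \<le> (1 + 2 * \<epsilon> powr (- \<alpha>)) * (C * (dist u u0 * (M0 + M1 + Ma)))"
      using e f0 by (intro mult_left_mono) auto
    then show "holder_bound N \<alpha> (C' * dist u u0 * (M0 + M1 + Ma)) ?D"
      using holder_bound_mono[OF h] by (simp add: C'_def algebra_simps)
  qed
qed

text \<open>For a fixed function the first-order remainder has order 1 + \<alpha>, but only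
  uniformly in \<open>x\<close>; in C^\<alpha> no power beyond the first is gained.\<close>

lemma transfer_op_expansion:
  assumes u0: "u0 \<in> U" and f: "C1_bound N \<alpha> M M M f"
  obtains \<epsilon> C D where "0 < \<epsilon>" "0 \<le> C" "\<And>x. ((\<lambda>u. L u f x) has_derivative D x) (at u0)"
    "\<And>u x. u \<in> ball u0 \<epsilon> \<Longrightarrow> \<bar>L u f x - L u0 f x - D x (u - u0)\<bar> \<le> C * dist u u0 powr (1 + \<alpha>)"
proof -
  \<comment> \<open>Defined without reference to a chart, so that the derivatives found in different
    patches agree.\<close>
  define D where "D = (\<lambda>x. frechet_derivative (\<lambda>u. L u f x) (at u0))"
  define P where "P = (\<lambda>(b :: ('x, 'e) chart \<times> 'e \<times> real) C u z (z' :: 'e).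
     ((\<lambda>u. L u f (chart_inv (fst b) z)) has_derivative D (chart_inv (fst b) z)) (at u0) \<and>
     \<bar>L u f (chart_inv (fst b) z) - L u0 f (chart_inv (fst b) z) - D (chart_inv (fst b) z) (u - u0)\<bar> \<le> C * dist u u0 powr (1 + \<alpha>))"
  obtain \<epsilon> C where e: "0 < \<epsilon>" "0 \<le> C" and P: "\<And>c a R u z z'. (c, a, R) \<in> N \<Longrightarrow> u \<in> ball u0 \<epsilon> \<Longrightarrow>
     z \<in> ball a R \<Longrightarrow> z' \<in> ball a R \<Longrightarrow> dist z z' < \<epsilon> \<Longrightarrow> P (c, a, R) C u z z'"
  proof (rule uniform_patch[OF finite_cover, where P = P])
    fix b C C' u z z' assume h: "P b C u z z'" "C \<le> C'"
    have "C * dist u u0 powr (1 + \<alpha>) \<le> C' * dist u u0 powr (1 + \<alpha>)" using h(2) by (intro mult_right_mono) auto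
    then show "P b C' u z z'" using h(1) unfolding P_def by (meson order_trans)
  next
    fix c a R z0 assume b: "(c, a, R) \<in> N" "z0 \<in> cball a R"
    obtain e C where e: "0 < e" "0 \<le> C" and F: "\<And>f M0 M1 Ma. C1_bound N \<alpha> M0 M1 Ma f \<Longrightarrow>
      \<exists>F' :: _ \<Rightarrow> _ \<Rightarrow>\<^sub>L real. \<forall>p\<in>ball (u0, z0) e.
       ((\<lambda>p. L (fst p) f (chart_inv c (snd p))) has_derivative blinfun_apply (F' p)) (at p) \<and>
       norm (F' p) \<le> C * (M0 + M1) \<and>
       (\<forall>p'\<in>ball (u0, z0) e. norm (F' p - F' p') \<le> C * (M0 + M1 + Ma) * dist p p' powr \<alpha>)"
      using transfer_op_joint_patch[OF u0 b] by blast
    obtain F' :: "_ \<Rightarrow> _ \<Rightarrow>\<^sub>L real" where F': "\<forall>p\<in>ball (u0, z0) e.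
       ((\<lambda>p. L (fst p) f (chart_inv c (snd p))) has_derivative blinfun_apply (F' p)) (at p) \<and>
       norm (F' p) \<le> C * (M + M) \<and>
       (\<forall>p'\<in>ball (u0, z0) e. norm (F' p - F' p') \<le> C * (M + M + M) * dist p p' powr \<alpha>)" using F[OF f] by blast
    have B0: "0 \<le> C * (M + M + M)" using e C1_boundD(1-3)[OF f] by simp
    have "P (c, a, R) (C * (M + M + M)) u z z'" if u: "u \<in> ball u0 (e / 2)" and z: "z \<in> ball z0 (e / 2)" "z' \<in> ball z0 (e / 2)" for u z z'
    proof -
      note cons = joint_estimate_consequences(3,4)[OF F' u z \<alpha>(1) B0, unfolded fst_conv snd_conv]
      have "D (chart_inv c z) = (\<lambda>w. F' (u0, z) (w, 0))" unfolding D_def using frechet_derivative_at[OF cons(1)] by simp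
      then show ?thesis unfolding P_def fst_conv using cons by simp
    qed
    then have "0 < e / 2 \<and> (\<forall>u\<in>ball u0 (e / 2). \<forall>z\<in>ball z0 (e / 2). \<forall>z'\<in>ball z0 (e / 2). P (c, a, R) (C * (M + M + M)) u z z')"
      using e(1) by simp
    then show "\<exists>\<epsilon>>0. \<exists>C. \<forall>u\<in>ball u0 \<epsilon>. \<forall>z\<in>ball z0 \<epsilon>. \<forall>z'\<in>ball z0 \<epsilon>. P (c, a, R) C u z z'"
      by blast
  qed (rule that)
  show ?thesis
  proof (rule that[OF e])
    fix x
    obtain c a R z where z: "(c, a, R) \<in> N" "z \<in> ball a R" "x = chart_inv c z" using coordinate_coverD(5)[OF cover] by blast
    show "((\<lambda>u. L u f x) has_derivative D x) (at u0)"
      using P[OF z(1) _ z(2) z(2), of u0] e(1) unfolding P_def z(3) by simp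
    fix u assume u: "u \<in> ball u0 \<epsilon>"
    show "\<bar>L u f x - L u0 f x - D x (u - u0)\<bar> \<le> C * dist u u0 powr (1 + \<alpha>)"
      using P[OF z(1) u z(2) z(2)] e(1) unfolding P_def z(3) by simp
  qed
qed

text \<open>On the compact product of a closed ball and the unit sphere the metric attains a
  positive minimum and a maximum; homogeneity extends the comparison to all vectors.\<close>

lemma metric_comparison:
  obtains k where "1 \<le> k" "\<And>c a R z v. (c, a, R) \<in> N \<Longrightarrow> z \<in> cball a R \<Longrightarrow>
     norm v \<le> k * sqrt (G c (chart_inv c z) v v) \<and> sqrt (G c (chart_inv c z) v v) \<le> k * norm v"
proof -
  define Q where "Q = (\<lambda>b k. 1 \<le> k \<and> (\<forall>z\<in>cball (fst (snd b)) (snd (snd b)). \<forall>v.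
     norm v \<le> k * sqrt (G (fst b) (chart_inv (fst b) z) v v) \<and> sqrt (G (fst b) (chart_inv (fst b) z) v v) \<le> k * norm v))"
  have "\<exists>k. Q b k" if bN: "b \<in> N" for b
  proof -
    obtain c a R where bc: "b = (c, a, R)" using prod_cases3 by blast
    have b: "(c, a, R) \<in> N" using bN bc by simp
    have cA: "c \<in> A" using coordinate_coverD(2)[OF cover b] .
    note ch = cover_chart[OF b]
    have bil: "bilinear (G c (chart_inv c z))" and pos: "v \<noteq> 0 \<Longrightarrow> 0 < G c (chart_inv c z) v v"
      if "z \<in> cball a R" for z v using metricD[OF cA ch(3)[OF that]] by auto
    have cont: "continuous_on (cball a R) (\<lambda>z. G c (chart_inv c z) v w)" for v w
    proof -
      have "smooth_on (chart_img c) (\<lambda>z. G c (chart_inv c z) v w)"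
        using metric cA unfolding riemannian_metric_def by blast
      then have "Ck_on 0 (chart_img c) (\<lambda>z. G c (chart_inv c z) v w)" unfolding smooth_on_def by blast
      then show ?thesis using ch(2) by (auto elim!: continuous_on_subset)
    qed
    \<comment> \<open>Continuity of the metric is known only for fixed vectors; the expansion in a
      basis makes it continuous jointly in the point and the vector.\<close>
    have expand: "G c (chart_inv c z) v v = (\<Sum>(i, j)\<in>Basis \<times> Basis. (v \<bullet> i) * (v \<bullet> j) * G c (chart_inv c z) i j)"
      if z: "z \<in> cball a R" for z v
    proof -
      have "G c (chart_inv c z) v v = G c (chart_inv c z) (\<Sum>i\<in>Basis. (v \<bullet> i) *\<^sub>R i) (\<Sum>i\<in>Basis. (v \<bullet> i) *\<^sub>R i)"
        by (simp add: euclidean_representation)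
      also have "\<dots> = (\<Sum>(i, j)\<in>Basis \<times> Basis. G c (chart_inv c z) ((v \<bullet> i) *\<^sub>R i) ((v \<bullet> j) *\<^sub>R j))"
        by (rule bilinear_sum[OF bil[OF z]])
      also have "\<dots> = (\<Sum>(i, j)\<in>Basis \<times> Basis. (v \<bullet> i) * (v \<bullet> j) * G c (chart_inv c z) i j)"
        by (intro sum.cong refl) (auto simp: bilinear_lmul[OF bil[OF z]] bilinear_rmul[OF bil[OF z]])
      finally show ?thesis .
    qed
    let ?S = "cball a R \<times> sphere (0 :: 'e) 1"
    have "continuous_on ?S (\<lambda>p. \<Sum>(i, j)\<in>Basis \<times> Basis. (snd p \<bullet> i) * (snd p \<bullet> j) * G c (chart_inv c (fst p)) i j)"
      unfolding case_prod_beta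
      by (intro continuous_intros continuous_on_compose2[OF cont continuous_on_fst[OF continuous_on_id]]) auto
    then have contS: "continuous_on ?S (\<lambda>p. G c (chart_inv c (fst p)) (snd p) (snd p))"
      by (rule continuous_on_eq) (auto simp: expand)
    have comp: "compact ?S" by (intro compact_Times compact_cball compact_sphere)
    have ne: "?S \<noteq> {}"
    proof -
      obtain e :: 'e where "e \<in> Basis" using nonempty_Basis by blast
      then have "(a, e) \<in> ?S" using coordinate_coverD(3)[OF cover b] by simp
      then show ?thesis by blast
    qed
    obtain p where p: "p \<in> ?S" "\<And>p'. p' \<in> ?S \<Longrightarrow> G c (chart_inv c (fst p)) (snd p) (snd p) \<le> G c (chart_inv c (fst p')) (snd p') (snd p')"
      using continuous_attains_inf[OF comp ne contS] by blast
    obtain r where r: "r \<in> ?S" "\<And>p'. p' \<in> ?S \<Longrightarrow> G c (chart_inv c (fst p')) (snd p') (snd p') \<le> G c (chart_inv c (fst r)) (snd r) (snd r)"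
      using continuous_attains_sup[OF comp ne contS] by blast
    define m where "m = sqrt (G c (chart_inv c (fst p)) (snd p) (snd p))"
    define M where "M = sqrt (G c (chart_inv c (fst r)) (snd r) (snd r))"
    have "snd p \<noteq> 0" using p(1) by (auto simp: mem_Times_iff)
    then have m: "0 < m" unfolding m_def using pos[of "fst p" "snd p"] p(1) by (auto simp: mem_Times_iff)
    define k where "k = max 1 (max (1 / m) M)"
    have k: "1 \<le> k" "1 / m \<le> k" "M \<le> k" by (auto simp: k_def)
    have "norm v \<le> k * sqrt (G c (chart_inv c z) v v) \<and> sqrt (G c (chart_inv c z) v v) \<le> k * norm v"
      if z: "z \<in> cball a R" for z v
    proof (cases "v = 0")
      case True
      then show ?thesis using bilinear_lzero[OF bil[OF z]] by simp
    next
      case False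
      define w where "w = v /\<^sub>R norm v"
      have w: "(z, w) \<in> ?S" using z False by (simp add: w_def)
      have vw: "v = norm v *\<^sub>R w" using False by (simp add: w_def)
      have "G c (chart_inv c z) v v = norm v * norm v * G c (chart_inv c z) w w"
        by (subst (1 2) vw) (simp add: bilinear_lmul[OF bil[OF z]] bilinear_rmul[OF bil[OF z]])
      then have s: "sqrt (G c (chart_inv c z) v v) = norm v * sqrt (G c (chart_inv c z) w w)"
        by (simp add: real_sqrt_mult)
      have mw: "m \<le> sqrt (G c (chart_inv c z) w w)" "sqrt (G c (chart_inv c z) w w) \<le> M"
        using p(2)[OF w] r(2)[OF w] by (auto simp: m_def M_def)
      have "1 \<le> k * m" using k(2) m by (simp add: divide_le_eq)
      also have "\<dots> \<le> k * sqrt (G c (chart_inv c z) w w)" using mw k(1) by (intro mult_left_mono) auto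
      finally have "norm v * 1 \<le> norm v * (k * sqrt (G c (chart_inv c z) w w))" by (intro mult_left_mono) auto
      moreover have "norm v * sqrt (G c (chart_inv c z) w w) \<le> norm v * k" using mw k by (intro mult_left_mono) auto
      ultimately show ?thesis unfolding s by (simp add: mult_ac)
    qed
    then have "Q b k" unfolding Q_def bc using k(1) by simp
    then show ?thesis by blast
  qed
  then have "\<forall>b\<in>N. \<exists>k. Q b k" by blast
  from bchoice[OF this] obtain k where Q: "\<forall>b\<in>N. Q b (k b)" by blast
  define K where "K = Max (insert 1 (k ` N))"
  show ?thesis
  proof (rule that[of K])
    show "1 \<le> K" unfolding K_def using finite_cover by simp
    fix c a R z v assume b: "(c, a, R) \<in> N" and z: "z \<in> cball a R"
    have kK: "k (c, a, R) \<le> K" unfolding K_def using finite_cover b by (intro Max_ge; simp)+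
    have h: "norm v \<le> k (c, a, R) * sqrt (G c (chart_inv c z) v v)" "sqrt (G c (chart_inv c z) v v) \<le> k (c, a, R) * norm v"
      using Q b z unfolding Q_def by fastforce+
    have "bilinear (G c (chart_inv c z))" "v \<noteq> 0 \<Longrightarrow> 0 < G c (chart_inv c z) v v"
      using metricD[OF cover_chart(1,3)[OF b z]] by auto
    then have "0 \<le> sqrt (G c (chart_inv c z) v v)" by (cases "v = 0") (auto simp: bilinear_lzero)
    then show "norm v \<le> K * sqrt (G c (chart_inv c z) v v) \<and> sqrt (G c (chart_inv c z) v v) \<le> K * norm v"
      using h mult_right_mono[OF kK, of "sqrt (G c (chart_inv c z) v v)"] mult_right_mono[OF kK, of "norm v"] by auto
  qed
qed

text \<open>The comparison constant \<open>k\<close> between Riemannian and Euclidean norms enters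
  only at the two ends of an iterated branch, so for large \<open>m\<close> the power of
  \<open>1 / \<kappa>\<close> beats \<open>k * k\<close>. The iterate \<open>m\<close> is chosen
  before the point and before \<open>\<eta>\<close>.\<close>

lemma iterate_patches:
  assumes u0: "u0 \<in> U" and q: "0 < q"
  shows "\<exists>m>0. \<forall>c a R z0 \<eta>. (c, a, R) \<in> N \<longrightarrow> z0 \<in> cball a R \<longrightarrow> 0 < \<eta> \<longrightarrow>
    (\<exists>n b s \<gamma> s' \<gamma>' \<epsilon> K. branch_patch N \<alpha> (\<lambda>u f. (L u ^^ m) f) u0 c z0 n b s \<gamma> s' \<gamma>' \<epsilon> K \<eta> \<and>
      (\<forall>j<n. \<forall>v. norm (s' j (u0, z0) (0, v)) \<le> q * norm v))"
proof -
  obtain \<kappa> where \<kappa>: "\<kappa> > 1" "\<And>c d x v. c \<in> A \<Longrightarrow> d \<in> A \<Longrightarrow> x \<in> fst d \<Longrightarrow> T u0 x \<in> fst c \<Longrightarrow>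
     \<kappa> * sqrt (G d x v v) \<le> sqrt (G c (T u0 x) (chart_diff d c (T u0) x v) (chart_diff d c (T u0) x v))"
    using expansion_rate[OF u0] by blast
  obtain k where k: "1 \<le> k" "\<And>c a R z v. (c, a, R) \<in> N \<Longrightarrow> z \<in> cball a R \<Longrightarrow>
     norm v \<le> k * sqrt (G c (chart_inv c z) v v) \<and> sqrt (G c (chart_inv c z) v v) \<le> k * norm v"
    using metric_comparison by blast
  have "(\<lambda>n. (1 / \<kappa>) ^ n) \<longlonglongrightarrow> 0" using \<kappa>(1) by (intro LIMSEQ_power_zero) simp
  then have "\<forall>\<^sub>F n in sequentially. (1 / \<kappa>) ^ n < q / (k * k)"
    by (rule order_tendstoD(2)) (use q k(1) in simp)
  then obtain n0 where "\<And>n. n \<ge> n0 \<Longrightarrow> (1 / \<kappa>) ^ n < q / (k * k)" unfolding eventually_sequentially by blast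
  then have n0: "(1 / \<kappa>) ^ Suc n0 < q / (k * k)" using le_SucI by blast
  have kq: "k * (1 / \<kappa>) ^ Suc n0 * k \<le> q" using n0 k(1) by (simp add: field_simps)
  show ?thesis
  proof (rule exI[of _ "Suc n0"], intro conjI allI impI zero_less_Suc)
    fix c a R z0 and \<eta> :: real assume b: "(c, a, R) \<in> N" "z0 \<in> cball a R" and \<eta>: "0 < \<eta>"
    obtain n br s \<gamma> where ex: "branch_expansion N G \<alpha> (\<lambda>u f. (L u ^^ Suc n0) f) u0 c z0 ((1 / \<kappa>) ^ Suc n0) {..<n::nat} br s \<gamma>"
      using iterate_branches[OF u0 \<kappa> cover_chart(1,2)[OF b], of n0] by blast
    obtain s' \<gamma>' \<epsilon> K where bp: "branch_patch N \<alpha> (\<lambda>u f. (L u ^^ Suc n0) f) u0 c z0 n br s \<gamma> s' \<gamma>' \<epsilon> K \<eta>"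
      using branch_expansion_patch[OF ex \<alpha>(1) \<eta>] by blast
    have "norm (s' j (u0, z0) (0, v)) \<le> q * norm v" if j: "j < n" for j v
    proof -
      obtain d e S where bj: "br j = (d, e, S)" using prod_cases3 by blast
      have e: "0 < \<epsilon>" and C: "C1_holder_bound \<alpha> K (ball (u0, z0) \<epsilon>) (s j) (s' j)"
        using bp j unfolding branch_patch_def by blast+
      have jN: "br j \<in> N" "s j (u0, z0) \<in> ball (fst (snd (br j))) (snd (snd (br j)))"
        "\<exists>D. (s j has_derivative D) (at (u0, z0)) \<and>
          (\<forall>v. sqrt (G (fst (br j)) (chart_inv (fst (br j)) (s j (u0, z0))) (D (0, v)) (D (0, v)))
             \<le> (1 / \<kappa>) ^ Suc n0 * sqrt (G c (chart_inv c z0) v v))"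
        using ex j unfolding branch_expansion_def by blast+
      then obtain D where D: "(s j has_derivative D) (at (u0, z0))"
          "sqrt (G d (chart_inv d (s j (u0, z0))) (D (0, v)) (D (0, v))) \<le> (1 / \<kappa>) ^ Suc n0 * sqrt (G c (chart_inv c z0) v v)"
        unfolding bj fst_conv by blast
      have "D = blinfun_apply (s' j (u0, z0))"
        using has_derivative_unique[OF D(1) C1_holder_boundD(1)[OF C]] e by simp
      moreover have "norm (D (0, v)) \<le> k * sqrt (G d (chart_inv d (s j (u0, z0))) (D (0, v)) (D (0, v)))"
        using k(2)[of d e S "s j (u0, z0)" "D (0, v)"] jN(1,2) unfolding bj by simp
      moreover have "k * sqrt (G d (chart_inv d (s j (u0, z0))) (D (0, v)) (D (0, v)))
          \<le> k * ((1 / \<kappa>) ^ Suc n0 * (k * norm v))"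
      proof (rule mult_left_mono[OF order_trans[OF D(2) mult_left_mono]])
        show "sqrt (G c (chart_inv c z0) v v) \<le> k * norm v" using k(2)[OF b] by blast
      qed (use k(1) \<kappa>(1) in auto)
      moreover have "k * ((1 / \<kappa>) ^ Suc n0 * (k * norm v)) \<le> q * norm v"
        using mult_right_mono[OF kq, of "norm v"] by (simp add: mult_ac)
      ultimately show ?thesis by simp
    qed
    with bp show "\<exists>n b s \<gamma> s' \<gamma>' \<epsilon> K. branch_patch N \<alpha> (\<lambda>u f. (L u ^^ Suc n0) f) u0 c z0 n b s \<gamma> s' \<gamma>' \<epsilon> K \<eta> \<and>
      (\<forall>j<n. \<forall>v. norm (s' j (u0, z0) (0, v)) \<le> q * norm v)" by blast
  qed
qed

text \<open>The order of quantifiers matters: \<open>m\<close> depends on \<open>q\<close>, and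
  \<open>S\<close> comes after \<open>m\<close>. With \<open>S\<close> of the form
  \<open>C * lam u0 ^ m\<close>, division by \<open>lam u0 ^ m\<close> leaves the factor
  \<open>4 * C * q\<close>, which is small whatever \<open>m\<close> is. The 4 stems from the factor
  2 for the weights and from taking \<open>\<eta> = q\<close>.\<close>

lemma lasota_yorke:
  assumes u0: "u0 \<in> U" and q: "0 < q" "q \<le> 1/2"
  shows "\<exists>m. \<forall>S. (\<forall>x. (L u0 ^^ m) (\<lambda>x. 1) x \<le> S) \<longrightarrow> (\<exists>\<epsilon>>0. \<exists>C\<ge>0. \<forall>u\<in>ball u0 \<epsilon>. \<forall>f M0 M1 Ma.
    C1_bound N \<alpha> M0 M1 Ma f \<longrightarrow> (\<forall>c a R z z'. (c, a, R) \<in> N \<longrightarrow> z \<in> ball a R \<longrightarrow> z' \<in> ball a R \<longrightarrow> dist z z' < \<epsilon> \<longrightarrow>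
      (\<exists>E E' :: _ \<Rightarrow>\<^sub>L real. ((\<lambda>z. (L u ^^ m) f (chart_inv c z)) has_derivative blinfun_apply E) (at z) \<and>
        ((\<lambda>z. (L u ^^ m) f (chart_inv c z)) has_derivative blinfun_apply E') (at z') \<and>
        norm (E - E') \<le> (4 * S * q * Ma + C * (M0 + M1)) * dist z z' powr \<alpha>)))"
proof -
  obtain m where "0 < m" and mm: "\<forall>c a R z0 \<eta>. (c, a, R) \<in> N \<longrightarrow> z0 \<in> cball a R \<longrightarrow> 0 < \<eta> \<longrightarrow>
    (\<exists>n b s \<gamma> s' \<gamma>' \<epsilon> K. branch_patch N \<alpha> (\<lambda>u f. (L u ^^ m) f) u0 c z0 n b s \<gamma> s' \<gamma>' \<epsilon> K \<eta> \<and>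
      (\<forall>j<n. \<forall>v. norm (s' j (u0, z0) (0, v)) \<le> q * norm v))"
    using iterate_patches[OF u0 q(1)] by blast
  note m = mm[rule_format]
  show ?thesis
  proof (intro exI[of _ m] allI impI)
    fix S assume S: "\<forall>x. (L u0 ^^ m) (\<lambda>x. 1) x \<le> S"
    define W where "W = (\<lambda>c C u z z' f M0 M1 Ma. \<exists>E E' :: 'e \<Rightarrow>\<^sub>L real.
        ((\<lambda>z. (L u ^^ m) f (chart_inv c z)) has_derivative blinfun_apply E) (at z) \<and>
        ((\<lambda>z. (L u ^^ m) f (chart_inv c z)) has_derivative blinfun_apply E') (at z') \<and>
        norm (E - E') \<le> (4 * S * q * Ma + C * (M0 + M1)) * dist z z' powr \<alpha>)"
    define P where "P = (\<lambda>(b :: ('x, 'e) chart \<times> 'e \<times> real) C u z z'. \<forall>f M0 M1 Ma. C1_bound N \<alpha> M0 M1 Ma f \<longrightarrow>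
       W (fst b) C u z z' f M0 M1 Ma)"
    obtain \<epsilon> C where e: "0 < \<epsilon>" "0 \<le> C" and P: "\<And>c a R u z z'. (c, a, R) \<in> N \<Longrightarrow> u \<in> ball u0 \<epsilon> \<Longrightarrow>
       z \<in> ball a R \<Longrightarrow> z' \<in> ball a R \<Longrightarrow> dist z z' < \<epsilon> \<Longrightarrow> P (c, a, R) C u z z'"
    proof (rule uniform_patch[OF finite_cover, where P = P])
      fix b C C' u z z' assume h: "P b C u z z'" "C \<le> C'"
      show "P b C' u z z'" unfolding P_def
      proof (intro allI impI)
        fix f M0 M1 Ma assume f: "C1_bound N \<alpha> M0 M1 Ma f"
        note f0 = C1_boundD(1-3)[OF f]
        have "(4 * S * q * Ma + C * (M0 + M1)) * dist z z' powr \<alpha> \<le> (4 * S * q * Ma + C' * (M0 + M1)) * dist z z' powr \<alpha>"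
          using h(2) f0 by (intro mult_right_mono add_left_mono) auto
        moreover have "W (fst b) C u z z' f M0 M1 Ma" using h(1) f unfolding P_def by blast
        ultimately show "W (fst b) C' u z z' f M0 M1 Ma" unfolding W_def by (meson order_trans)
      qed
    next
      fix c a R z0 assume b: "(c, a, R) \<in> N" "z0 \<in> cball a R"
      obtain n br s \<gamma> s' \<gamma>' e K where bp: "branch_patch N \<alpha> (\<lambda>u f. (L u ^^ m) f) u0 c z0 n br s \<gamma> s' \<gamma>' e K q"
        and con: "\<forall>j<n. \<forall>v. norm (s' j (u0, z0) (0, v)) \<le> q * norm v"
        using m[OF b q(1)] by blast
      have e: "0 < e" using bp unfolding branch_patch_def by blast
      have qq: "0 \<le> q" "q + q \<le> 1" using q by auto
      obtain C where C: "0 \<le> C" "\<And>f M0 M1 Ma u z z'. C1_bound N \<alpha> M0 M1 Ma f \<Longrightarrow> u \<in> ball u0 (e / 2) \<Longrightarrow>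
         z \<in> ball z0 (e / 2) \<Longrightarrow> z' \<in> ball z0 (e / 2) \<Longrightarrow> \<exists>E E' :: _ \<Rightarrow>\<^sub>L real.
         ((\<lambda>z. (L u ^^ m) f (chart_inv c z)) has_derivative blinfun_apply E) (at z) \<and>
         ((\<lambda>z. (L u ^^ m) f (chart_inv c z)) has_derivative blinfun_apply E') (at z') \<and>
         norm (E - E') \<le> (2 * (L u0 ^^ m) (\<lambda>x. 1) (chart_inv c z0) * (q + q) * Ma + C * (M0 + M1)) * dist z z' powr \<alpha>"
        by (rule branch_patch_slice[OF bp \<alpha>(1) less_imp_le[OF \<alpha>(2)] _ qq(1) qq(1) qq(2)]) (use con in blast)+
      have "P (c, a, R) C u z z'" if u: "u \<in> ball u0 (e / 2)" and z: "z \<in> ball z0 (e / 2)" "z' \<in> ball z0 (e / 2)" for u z z'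
        unfolding P_def fst_conv
      proof (intro allI impI)
        fix f M0 M1 Ma assume f: "C1_bound N \<alpha> M0 M1 Ma f"
        have "(L u0 ^^ m) (\<lambda>x. 1) (chart_inv c z0) * (4 * (q * Ma)) \<le> S * (4 * (q * Ma))"
          using S q C1_boundD(3)[OF f] by (intro mult_right_mono) auto
        moreover have "2 * (L u0 ^^ m) (\<lambda>x. 1) (chart_inv c z0) * (q + q) * Ma = (L u0 ^^ m) (\<lambda>x. 1) (chart_inv c z0) * (4 * (q * Ma))"
          by (simp add: algebra_simps)
        moreover have "S * (4 * (q * Ma)) = 4 * S * q * Ma" by simp
        ultimately have "2 * (L u0 ^^ m) (\<lambda>x. 1) (chart_inv c z0) * (q + q) * Ma \<le> 4 * S * q * Ma" by linarith
        then have "(2 * (L u0 ^^ m) (\<lambda>x. 1) (chart_inv c z0) * (q + q) * Ma + C * (M0 + M1)) * dist z z' powr \<alpha>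
            \<le> (4 * S * q * Ma + C * (M0 + M1)) * dist z z' powr \<alpha>"
          by (rule mult_right_mono[OF add_right_mono powr_ge_zero])
        then show "W c C u z z' f M0 M1 Ma" unfolding W_def using C(2)[OF f u z] by (meson order_trans)
      qed
      then have "0 < e / 2 \<and> (\<forall>u\<in>ball u0 (e / 2). \<forall>z\<in>ball z0 (e / 2). \<forall>z'\<in>ball z0 (e / 2). P (c, a, R) C u z z')"
        using e by simp
      then show "\<exists>\<epsilon>>0. \<exists>C. \<forall>u\<in>ball u0 \<epsilon>. \<forall>z\<in>ball z0 \<epsilon>. \<forall>z'\<in>ball z0 \<epsilon>. P (c, a, R) C u z z'"
        by blast
    qed (rule that)
    have "\<forall>u\<in>ball u0 \<epsilon>. \<forall>f M0 M1 Ma. C1_bound N \<alpha> M0 M1 Ma f \<longrightarrow>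
       (\<forall>c a R z z'. (c, a, R) \<in> N \<longrightarrow> z \<in> ball a R \<longrightarrow> z' \<in> ball a R \<longrightarrow> dist z z' < \<epsilon> \<longrightarrow> W c C u z z' f M0 M1 Ma)"
      using P unfolding P_def fst_conv by blast
    then show "\<exists>\<epsilon>>0. \<exists>C\<ge>0. \<forall>u\<in>ball u0 \<epsilon>. \<forall>f M0 M1 Ma.
    C1_bound N \<alpha> M0 M1 Ma f \<longrightarrow> (\<forall>c a R z z'. (c, a, R) \<in> N \<longrightarrow> z \<in> ball a R \<longrightarrow> z' \<in> ball a R \<longrightarrow> dist z z' < \<epsilon> \<longrightarrow>
      (\<exists>E E' :: _ \<Rightarrow>\<^sub>L real. ((\<lambda>z. (L u ^^ m) f (chart_inv c z)) has_derivative blinfun_apply E) (at z) \<and>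
        ((\<lambda>z. (L u ^^ m) f (chart_inv c z)) has_derivative blinfun_apply E') (at z') \<and>
        norm (E - E') \<le> (4 * S * q * Ma + C * (M0 + M1)) * dist z z' powr \<alpha>))"
      using e unfolding W_def by blast
  qed
qed

text \<open>A Lipschitz bound for the logarithm in multiplicative form: it makes sense where
  \<open>f\<close> vanishes and survives pointwise limits.\<close>

definition log_lipschitz :: "real \<Rightarrow> real \<Rightarrow> ('x \<Rightarrow> real) \<Rightarrow> bool" where
  "log_lipschitz \<epsilon> K f \<longleftrightarrow> (\<forall>x. 0 \<le> f x) \<and> (\<forall>c a R. (c, a, R) \<in> N \<longrightarrow> (\<forall>z\<in>ball a R. \<forall>z'\<in>ball a R.
     dist z z' < \<epsilon> \<longrightarrow> f (chart_inv c z) \<le> exp (K * dist z z') * f (chart_inv c z')))"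

text \<open>The map \<open>K \<mapsto> C + K / 2\<close> preserves \<open>{0..2 * C}\<close>, so an iterate of the operator preserves
  the cone of functions with locally \<open>2 * C\<close>-Lipschitz logarithm.\<close>

lemma log_lipschitz_iterate:
  assumes u0: "u0 \<in> U"
  obtains m \<epsilon> C where "0 < m" "0 < \<epsilon>" "0 \<le> C" "\<And>f K. 0 \<le> K \<Longrightarrow> log_lipschitz \<epsilon> K f \<Longrightarrow> log_lipschitz \<epsilon> (C + K / 2) ((L u0 ^^ m) f)"
proof -
  have q4: "0 < (1/4::real)" by simp
  obtain m where m0: "0 < m" and mm: "\<forall>c a R z0 \<eta>. (c, a, R) \<in> N \<longrightarrow> z0 \<in> cball a R \<longrightarrow> 0 < \<eta> \<longrightarrow>
    (\<exists>n b s \<gamma> s' \<gamma>' \<epsilon> K. branch_patch N \<alpha> (\<lambda>u f. (L u ^^ m) f) u0 c z0 n b s \<gamma> s' \<gamma>' \<epsilon> K \<eta> \<and>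
      (\<forall>j<n. \<forall>v. norm (s' j (u0, z0) (0, v)) \<le> 1/4 * norm v))"
    using iterate_patches[OF u0 q4] by blast
  note m = mm[rule_format]
  \<comment> \<open>The premise \<open>u = u0\<close> fits a statement about one operator to
    \<open>uniform_patch\<close>. The threshold \<open>\<delta>\<close> is arbitrary, which is
    possible because branches shrink distances; it is later set to the \<open>\<epsilon>\<close>
    obtained here.\<close>
  define P where "P = (\<lambda>(b :: ('x, 'e) chart \<times> 'e \<times> real) C u z z'. \<forall>f K \<delta>. u = u0 \<longrightarrow> 0 \<le> K \<longrightarrow> dist z z' < \<delta> \<longrightarrow> log_lipschitz \<delta> K f \<longrightarrow>
     (L u0 ^^ m) f (chart_inv (fst b) z) \<le> exp ((C + K / 2) * dist z z') * (L u0 ^^ m) f (chart_inv (fst b) z'))"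
  have Lpos: "0 \<le> L u0 f x" if "\<And>x. 0 \<le> f x" for f x
    unfolding transfer_op_def using that less_imp_le[OF weight_pos[OF u0]] by (intro sum_nonneg) simp
  have Lmpos: "0 \<le> (L u0 ^^ k) f x" if "\<And>x. 0 \<le> f x" for f x k
    using that Lpos by (induction k arbitrary: x) auto
  obtain \<epsilon> C where e: "0 < \<epsilon>" "0 \<le> C" and P: "\<And>c a R u z z'. (c, a, R) \<in> N \<Longrightarrow> u \<in> ball u0 \<epsilon> \<Longrightarrow>
     z \<in> ball a R \<Longrightarrow> z' \<in> ball a R \<Longrightarrow> dist z z' < \<epsilon> \<Longrightarrow> P (c, a, R) C u z z'"
  proof (rule uniform_patch[OF finite_cover, where P = P])
    fix b C C' u z z' assume h: "P b C u z z'" "C \<le> C'"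
    show "P b C' u z z'" unfolding P_def
    proof (intro allI impI)
      fix f K \<delta> assume f: "u = u0" "0 \<le> K" "dist z z' < \<delta>" "log_lipschitz \<delta> K f"
      have "exp ((C + K / 2) * dist z z') * (L u0 ^^ m) f (chart_inv (fst b) z') \<le> exp ((C' + K / 2) * dist z z') * (L u0 ^^ m) f (chart_inv (fst b) z')"
        using h(2) f(4) by (intro mult_right_mono Lmpos) (auto simp: log_lipschitz_def intro: mult_right_mono)
      then show "(L u0 ^^ m) f (chart_inv (fst b) z) \<le> exp ((C' + K / 2) * dist z z') * (L u0 ^^ m) f (chart_inv (fst b) z')"
        using h(1) f unfolding P_def by (meson order_trans)
    qed
  next
    fix c a R z0 assume b: "(c, a, R) \<in> N" "z0 \<in> cball a R"
    obtain n br s \<gamma> s' \<gamma>' e K0 where bp: "branch_patch N \<alpha> (\<lambda>u f. (L u ^^ m) f) u0 c z0 n br s \<gamma> s' \<gamma>' e K0 (1/4)"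
      and con: "\<forall>j<n. \<forall>v. norm (s' j (u0, z0) (0, v)) \<le> 1/4 * norm v"
      using m[OF b q4] by blast
    have e: "0 < e" "0 \<le> K0" using bp unfolding branch_patch_def by blast+
    let ?B = "ball z0 (e / 2)"
    have S: "(u0, z) \<in> ball (u0, z0) e" if "z \<in> ?B" for z
      by (rule Pair_in_ball[OF _ that]) (use e in simp)
    \<comment> \<open>A weight with Lipschitz constant \<open>K0\<close> and values at least
      \<open>\<gamma> j (u0, z0) / 2\<close> has a logarithm with Lipschitz constant
      \<open>2 * K0 / \<gamma> j (u0, z0)\<close>; the sum dominates every branch.\<close>
    define C where "C = (\<Sum>j<n. 2 * K0 / \<gamma> j (u0, z0))"
    have gpos: "0 < \<gamma> j (u0, z0)" if "j < n" for j using bp that unfolding branch_patch_def by blast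
    have Cj: "2 * K0 / \<gamma> j (u0, z0) \<le> C" if "j < n" for j
      unfolding C_def by (rule member_le_sum) (use that e gpos in \<open>auto intro!: divide_nonneg_pos\<close>)
    have "P (c, a, R) C u z z'" if z: "z \<in> ?B" "z' \<in> ?B" for u z z'
      unfolding P_def fst_conv
    proof (intro allI impI)
      fix f K \<delta> assume u: "u = u0" and K: "0 \<le> K" and \<delta>: "dist z z' < \<delta>" and f: "log_lipschitz \<delta> K f"
      let ?d = "dist z z'"
      have summand: "\<gamma> j (u0, z) * f (chart_inv (fst (br j)) (s j (u0, z))) \<le>
         exp ((C + K / 2) * ?d) * (\<gamma> j (u0, z') * f (chart_inv (fst (br j)) (s j (u0, z'))))" if j: "j < n" for j
      proof -
        have bj: "br j \<in> N" "C1_holder_bound \<alpha> K0 (ball (u0, z0) e) (s j) (s' j)" "C1_holder_bound \<alpha> K0 (ball (u0, z0) e) (\<gamma> j) (\<gamma>' j)"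
          "s j ` ball (u0, z0) e \<subseteq> ball (fst (snd (br j))) (snd (snd (br j)))"
          "\<forall>p\<in>ball (u0, z0) e. \<gamma> j (u0, z0) / 2 \<le> \<gamma> j p \<and> \<gamma> j p \<le> 2 * \<gamma> j (u0, z0) \<and> norm (s' j p - s' j (u0, z0)) \<le> 1/4"
          using bp j unfolding branch_patch_def by blast+
        have gz: "\<gamma> j (u0, z0) / 2 \<le> \<gamma> j (u0, z')" using bj(5) S[OF z(2)] by blast
        have "\<bar>\<gamma> j (u0, z) - \<gamma> j (u0, z')\<bar> \<le> K0 * dist (u0, z) (u0, z')"
          using C1_holder_bound_lipschitz[OF convex_ball bj(3) S[OF z(1)] S[OF z(2)]] by simp
        also have "\<dots> = K0 * ?d" by (simp add: dist_Pair_Pair)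
        also have "\<dots> = (2 * K0 / \<gamma> j (u0, z0)) * ?d * (\<gamma> j (u0, z0) / 2)" using gpos[OF j] by simp
        also have "\<dots> \<le> C * ?d * \<gamma> j (u0, z')"
        proof (intro mult_mono mult_right_mono Cj[OF j] gz)
          have "0 \<le> 2 * K0 / \<gamma> j (u0, z0)" using e gpos[OF j] by simp
          then show "0 \<le> C" using Cj[OF j] by linarith
          then show "0 \<le> C * ?d" by simp
        qed (use gpos[OF j] in auto)
        finally have "\<gamma> j (u0, z) \<le> (1 + C * ?d) * \<gamma> j (u0, z')" by (simp add: algebra_simps)
        also have "\<dots> \<le> exp (C * ?d) * \<gamma> j (u0, z')"
          using gz gpos[OF j] by (intro mult_right_mono exp_ge_add_one_self) auto
        finally have g: "\<gamma> j (u0, z) \<le> exp (C * ?d) * \<gamma> j (u0, z')" .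
        \<comment> \<open>The rate 1/2 is 1/4 from the contraction at the base point plus 1/4 from
          the variation of the derivative on the patch.\<close>
        have "norm (s j (u0, z) - s j (u0, z')) \<le> 1/2 * norm (z - z')"
        proof (rule differentiable_bound[OF convex_ball _ _ z])
          fix y assume y: "y \<in> ?B"
          have sl: "C1_holder_bound \<alpha> K0 ?B (\<lambda>z. s j (u0, z)) (\<lambda>z. s' j (u0, z) o\<^sub>L snd_embed)"
            by (rule C1_holder_bound_slice[OF bj(2) S])
          show "((\<lambda>z. s j (u0, z)) has_derivative blinfun_apply (s' j (u0, y) o\<^sub>L snd_embed)) (at y within ?B)"
            using C1_holder_boundD(1)[OF sl y] by (rule has_derivative_at_withinI)
          have "norm (s' j (u0, y) o\<^sub>L snd_embed) \<le> 1/2"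
          proof (rule norm_blinfun_bound)
            fix v :: 'e
            have "norm ((s' j (u0, y) - s' j (u0, z0)) (0, v)) \<le> 1/4 * norm (0 :: 'p, v)"
              by (rule order_trans[OF norm_blinfun mult_right_mono]) (use bj(5) S[OF y] in auto)
            then have "norm (s' j (u0, y) (0, v) - s' j (u0, z0) (0, v)) \<le> 1/4 * norm v"
              by (simp add: blinfun.bilinear_simps norm_Pair)
            moreover have "norm (s' j (u0, z0) (0, v)) \<le> 1/4 * norm v" using con j by blast
            ultimately show "norm ((s' j (u0, y) o\<^sub>L snd_embed) v) \<le> 1/2 * norm v"
              using norm_triangle_sub[of "s' j (u0, y) (0, v)" "s' j (u0, z0) (0, v)"] by simp
          qed simp
          then show "onorm (blinfun_apply (s' j (u0, y) o\<^sub>L snd_embed)) \<le> 1/2" by (simp add: norm_blinfun.rep_eq)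
        qed
        then have sd: "dist (s j (u0, z)) (s j (u0, z')) \<le> ?d / 2" by (simp add: dist_norm)
        have sB: "s j (u0, z) \<in> ball (fst (snd (br j))) (snd (snd (br j)))" "s j (u0, z') \<in> ball (fst (snd (br j))) (snd (snd (br j)))"
          using bj(4) S[OF z(1)] S[OF z(2)] by blast+
        have brN: "(fst (br j), fst (snd (br j)), snd (snd (br j))) \<in> N" using bj(1) by simp
        have "dist (s j (u0, z)) (s j (u0, z')) < \<delta>" using sd \<delta> zero_le_dist[of z z'] by linarith
        then have "f (chart_inv (fst (br j)) (s j (u0, z))) \<le> exp (K * dist (s j (u0, z)) (s j (u0, z'))) * f (chart_inv (fst (br j)) (s j (u0, z')))"
          using f brN sB unfolding log_lipschitz_def by blast
        also have "\<dots> \<le> exp (K * (?d / 2)) * f (chart_inv (fst (br j)) (s j (u0, z')))"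
        proof (rule mult_right_mono)
          show "exp (K * dist (s j (u0, z)) (s j (u0, z'))) \<le> exp (K * (?d / 2))"
            unfolding exp_le_cancel_iff by (rule mult_left_mono[OF sd K])
        qed (use f in \<open>auto simp: log_lipschitz_def\<close>)
        finally have fz: "f (chart_inv (fst (br j)) (s j (u0, z))) \<le> exp (K * (?d / 2)) * f (chart_inv (fst (br j)) (s j (u0, z')))" .
        have "\<gamma> j (u0, z) * f (chart_inv (fst (br j)) (s j (u0, z))) \<le>
          (exp (C * ?d) * \<gamma> j (u0, z')) * (exp (K * (?d / 2)) * f (chart_inv (fst (br j)) (s j (u0, z'))))"
        proof (rule mult_mono[OF g fz])
          show "0 \<le> exp (C * ?d) * \<gamma> j (u0, z')" using gz gpos[OF j] by simp
          show "0 \<le> f (chart_inv (fst (br j)) (s j (u0, z)))" using f by (simp add: log_lipschitz_def)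
        qed
        also have "\<dots> = exp ((C + K / 2) * ?d) * (\<gamma> j (u0, z') * f (chart_inv (fst (br j)) (s j (u0, z'))))"
        proof -
          have "(C + K / 2) * ?d = C * ?d + K * (?d / 2)" by (simp add: distrib_right)
          then show ?thesis by (simp only: exp_add mult_ac)
        qed
        finally show ?thesis .
      qed
      have ex: "(L u0 ^^ m) f (chart_inv c y) = (\<Sum>j<n. \<gamma> j (u0, y) * f (chart_inv (fst (br j)) (s j (u0, y))))" if "y \<in> ?B" for y
      proof -
        have "\<forall>p\<in>ball (u0, z0) e. \<forall>f. (L (fst p) ^^ m) f (chart_inv c (snd p)) = (\<Sum>j<n. \<gamma> j p * f (chart_inv (fst (br j)) (s j p)))"
          using bp unfolding branch_patch_def by blast
        from bspec[OF this S[OF that]] show ?thesis by simp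
      qed
      show "(L u0 ^^ m) f (chart_inv c z) \<le> exp ((C + K / 2) * ?d) * (L u0 ^^ m) f (chart_inv c z')"
        unfolding ex[OF z(1)] ex[OF z(2)] sum_distrib_left using summand by (intro sum_mono) auto
    qed
    then have "0 < e / 2 \<and> (\<forall>u\<in>ball u0 (e / 2). \<forall>z\<in>?B. \<forall>z'\<in>?B. P (c, a, R) C u z z')"
      using e by simp
    then show "\<exists>\<epsilon>>0. \<exists>C. \<forall>u\<in>ball u0 \<epsilon>. \<forall>z\<in>ball z0 \<epsilon>. \<forall>z'\<in>ball z0 \<epsilon>. P (c, a, R) C u z z'"
      by blast
  qed (rule that)
  show ?thesis
  proof (rule that[OF m0 e])
    fix f K assume K: "0 \<le> K" and f: "log_lipschitz \<epsilon> K f"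
    show "log_lipschitz \<epsilon> (C + K / 2) ((L u0 ^^ m) f)"
      unfolding log_lipschitz_def
    proof (intro conjI allI impI ballI)
      show "0 \<le> (L u0 ^^ m) f x" for x using f by (intro Lmpos) (auto simp: log_lipschitz_def)
      fix c a R z z' assume h: "(c, a, R) \<in> N" "z \<in> ball a R" "z' \<in> ball a R" "dist z z' < \<epsilon>"
      have "P (c, a, R) C u0 z z'" using P[OF h(1) _ h(2-4)] e(1) by simp
      then show "(L u0 ^^ m) f (chart_inv c z) \<le> exp ((C + K / 2) * dist z z') * (L u0 ^^ m) f (chart_inv c z')"
        unfolding P_def fst_conv using K f h(4) by blast
    qed
  qed
qed

end

section \<open>Spectral data\<close>

text \<open>Only \<open>l u (\<phi> u) = 1\<close> is fixed here, so every parameter can serve as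
  base point. Normalization by one fixed functional enters as a hypothesis of the final
  lemmas.\<close>

locale spectral_family = expanding_family A G N \<alpha> U T g
  for A :: "('x::t2_space, 'e::euclidean_space) chart set" and G N \<alpha> and U :: "'p::euclidean_space set" and T g +
  fixes lam :: "'p \<Rightarrow> real" and \<phi> :: "'p \<Rightarrow> 'x \<Rightarrow> real" and l :: "'p \<Rightarrow> ('x \<Rightarrow> real) \<Rightarrow> real"
  assumes spectral: "\<And>u. u \<in> U \<Longrightarrow> spectral_data N \<alpha> (T u) (g u) (lam u) (\<phi> u) (l u)"
    and l_phi: "\<And>u. u \<in> U \<Longrightarrow> l u (\<phi> u) = 1"
begin

abbreviation R :: "'p \<Rightarrow> ('x \<Rightarrow> real) \<Rightarrow> 'x \<Rightarrow> real" where
  "R u \<equiv> remainder_op (T u) (g u) (lam u) (l u) (\<phi> u)"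

definition Id_minus_R :: "'p \<Rightarrow> ('x \<Rightarrow> real) \<Rightarrow> 'x \<Rightarrow> real" where
  "Id_minus_R u f = (\<lambda>x. f x - R u f x / lam u)"

lemma lam_pos: "u \<in> U \<Longrightarrow> 0 < lam u"
  and L_phi: "u \<in> U \<Longrightarrow> L u (\<phi> u) = (\<lambda>x. lam u * \<phi> u x)"
  using spectral unfolding spectral_data_def by blast+

lemma phi_C1_bound: "u \<in> U \<Longrightarrow> \<exists>M. C1_bound N \<alpha> M M M (\<phi> u)"
  using spectral[of u] Cr_imp_C1_bound[OF cover _ \<alpha>] unfolding spectral_data_def by metis

lemma Cr_iff: "0 < r \<Longrightarrow> r \<le> \<alpha> \<Longrightarrow> f \<in> Cr N r \<longleftrightarrow> (\<exists>M. holder_bound N r M f)"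
  using Cr_iff_holder_bound[OF cover, of r] \<alpha> by simp

lemma Cr_add: "0 < r \<Longrightarrow> r \<le> \<alpha> \<Longrightarrow> f \<in> Cr N r \<Longrightarrow> h \<in> Cr N r \<Longrightarrow> (\<lambda>x. f x + h x :: real) \<in> Cr N r"
  unfolding Cr_iff using holder_bound_add by blast

lemma Cr_diff: "0 < r \<Longrightarrow> r \<le> \<alpha> \<Longrightarrow> f \<in> Cr N r \<Longrightarrow> h \<in> Cr N r \<Longrightarrow> (\<lambda>x. f x - h x :: real) \<in> Cr N r"
  unfolding Cr_iff using holder_bound_diff by blast

lemma Cr_cmult: "0 < r \<Longrightarrow> r \<le> \<alpha> \<Longrightarrow> f \<in> Cr N r \<Longrightarrow> (\<lambda>x. a * f x :: real) \<in> Cr N r"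
  unfolding Cr_iff using holder_bound_cmult by blast

lemma Cr_const: "0 < r \<Longrightarrow> r \<le> \<alpha> \<Longrightarrow> (\<lambda>x. a :: real) \<in> Cr N r"
  unfolding Cr_iff using holder_bound_const by blast

lemma C1_bound_imp_Cr: "0 < r \<Longrightarrow> r \<le> \<alpha> \<Longrightarrow> C1_bound N \<alpha> M0 M1 Ma f \<Longrightarrow> f \<in> Cr N r"
  using C1_bound_imp_holder_bound[OF cover, of r] \<alpha> unfolding Cr_iff by (metis less_imp_le order_trans)

lemma phi_Cr: "u \<in> U \<Longrightarrow> 0 < r \<Longrightarrow> r \<le> \<alpha> \<Longrightarrow> \<phi> u \<in> Cr N r"
  using phi_C1_bound C1_bound_imp_Cr by blast

lemma Cr_mono: "0 < r \<Longrightarrow> r \<le> r' \<Longrightarrow> r' \<le> \<alpha> \<Longrightarrow> f \<in> Cr N r' \<Longrightarrow> (f :: 'x \<Rightarrow> real) \<in> Cr N r"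
  using holder_bound_exponent[OF cover, of r r'] Cr_iff[of r f] Cr_iff[of r' f] by (metis less_le_trans order_trans)

lemma spectral_r:
  assumes "u \<in> U" "0 < r" "r \<le> \<alpha>"
  shows "Cr_dual N r (l u)" "\<And>f. f \<in> Cr N r \<Longrightarrow> l u (L u f) = lam u * l u f"
    "\<exists>C>0. \<exists>\<sigma>\<in>{0<..<1}. \<forall>n. \<forall>f\<in>Cr N r. (R u ^^ n) f \<in> Cr N r \<and>
       Cr_norm N r (\<lambda>x. (R u ^^ n) f x / lam u ^ n) \<le> C * \<sigma> ^ n * Cr_norm N r f"
proof -
  have r: "r \<in> {0<..1 + \<alpha>}" using assms by auto
  show "Cr_dual N r (l u)" "\<And>f. f \<in> Cr N r \<Longrightarrow> l u (L u f) = lam u * l u f"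
    "\<exists>C>0. \<exists>\<sigma>\<in>{0<..<1}. \<forall>n. \<forall>f\<in>Cr N r. (R u ^^ n) f \<in> Cr N r \<and>
       Cr_norm N r (\<lambda>x. (R u ^^ n) f x / lam u ^ n) \<le> C * \<sigma> ^ n * Cr_norm N r f"
    using spectral[OF assms(1)] r unfolding spectral_data_def by blast+
qed

lemma l_linear:
  assumes "u \<in> U" "0 < r" "r \<le> \<alpha>" "f \<in> Cr N r"
  shows "l u (\<lambda>x. a * f x) = a * l u f"
    and "h \<in> Cr N r \<Longrightarrow> l u (\<lambda>x. f x + h x) = l u f + l u h"
    and "h \<in> Cr N r \<Longrightarrow> l u (\<lambda>x. f x - h x) = l u f - l u h"
proof -
  note d = spectral_r(1)[OF assms(1-3)]
  show c: "l u (\<lambda>x. a * f x) = a * l u f" using d assms(4) unfolding Cr_dual_def by blast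
  show "h \<in> Cr N r \<Longrightarrow> l u (\<lambda>x. f x + h x) = l u f + l u h" using d assms(4) unfolding Cr_dual_def by blast
  assume h: "h \<in> Cr N r"
  have 1: "l u (\<lambda>x. -1 * h x) = -1 * l u h" using d h unfolding Cr_dual_def by blast
  have 2: "(\<lambda>x. -1 * h x) \<in> Cr N r" by (rule Cr_cmult[OF assms(2,3) h])
  have add: "l u (\<lambda>x. f x + k x) = l u f + l u k" if "k \<in> Cr N r" for k
    using d assms(4) that unfolding Cr_dual_def by blast
  have 3: "l u (\<lambda>x. f x + -1 * h x) = l u f + l u (\<lambda>x. -1 * h x)" by (rule add[OF 2])
  show "l u (\<lambda>x. f x - h x) = l u f - l u h" using 1 3 by simp
qed

lemma l_bounded:
  assumes "u \<in> U" "0 < r" "r \<le> \<alpha>"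
  obtains K where "0 \<le> K" "\<And>f M. holder_bound N r M f \<Longrightarrow> \<bar>l u f\<bar> \<le> K * M"
proof -
  obtain K where K: "\<And>f. f \<in> Cr N r \<Longrightarrow> \<bar>l u f\<bar> \<le> K * Cr_norm N r f"
    using spectral_r(1)[OF assms] unfolding Cr_dual_def by blast
  show ?thesis
  proof (rule that[of "\<bar>K\<bar> * (2 * real (card N))"])
    fix f M assume f: "holder_bound N r M f"
    have fc: "f \<in> Cr N r" "Cr_norm N r f \<le> 2 * real (card N) * M"
      using holder_bound_imp_Cr[OF cover f, of r] assms \<alpha> by auto
    have "0 \<le> Cr_norm N r f"
      using holder_bound_nonneg[OF cover Cr_imp_holder_bound[OF cover fc(1)]] assms \<alpha> by simp
    then have "K * Cr_norm N r f \<le> \<bar>K\<bar> * Cr_norm N r f" by (intro mult_right_mono) auto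
    also have "\<dots> \<le> \<bar>K\<bar> * (2 * real (card N) * M)" using fc(2) by (intro mult_left_mono) auto
    finally show "\<bar>l u f\<bar> \<le> \<bar>K\<bar> * (2 * real (card N)) * M" using K[OF fc(1)] by (simp add: mult.assoc)
  qed simp
qed

section \<open>Iterates of \<open>L u\<close> and \<open>R u\<close>\<close>

lemma L_add: "L u (\<lambda>x. f x + h x) = (\<lambda>x. L u f x + L u h x)"
  and L_diff: "L u (\<lambda>x. f x - h x) = (\<lambda>x. L u f x - L u h x)"
  and L_cmult: "L u (\<lambda>x. a * f x) = (\<lambda>x. a * L u f x)"
  unfolding transfer_op_def
  by (auto simp: fun_eq_iff sum.distrib sum_subtractf sum_distrib_left algebra_simps)

lemma L_mono: "u \<in> U \<Longrightarrow> (\<And>x. f x \<le> h x) \<Longrightarrow> L u f x \<le> L u h x"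
  unfolding transfer_op_def using weight_pos by (intro sum_mono) (auto intro: mult_left_mono less_imp_le)

lemma L_iter_mono: "u \<in> U \<Longrightarrow> (\<And>x. f x \<le> h x) \<Longrightarrow> (L u ^^ n) f x \<le> (L u ^^ n) h x"
proof (induction n arbitrary: x)
  case (Suc n)
  then show ?case by (simp add: L_mono)
qed simp

lemma L_iter_cmult: "(L u ^^ n) (\<lambda>x. a * f x) = (\<lambda>x. a * (L u ^^ n) f x)"
  by (induction n) (simp_all add: L_cmult)

lemma L_iter_eigen:
  assumes "L u f = (\<lambda>x. b * f x)" shows "(L u ^^ n) f = (\<lambda>x. b ^ n * f x)"
proof (induction n)
  case (Suc n)
  then show ?case using L_cmult[of u "b ^ n" f] assms by (simp add: mult_ac)
qed simp

lemma R_eq: "R u f x = L u f x - lam u * (l u f * \<phi> u x)"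
  by (simp add: remainder_op_def eigen_proj_def)

lemma R_Cr: "u \<in> U \<Longrightarrow> 0 < r \<Longrightarrow> r \<le> \<alpha> \<Longrightarrow> f \<in> Cr N r \<Longrightarrow> (R u ^^ n) f \<in> Cr N r"
  using spectral_r(3) by blast

text \<open>The spectral data speak of \<open>R u\<close>; adding back the projector part, a
  multiple of \<open>\<phi> u\<close>, recovers \<open>L u\<close>.\<close>

lemma L_Cr:
  assumes "u \<in> U" "0 < r" "r \<le> \<alpha>" "f \<in> Cr N r"
  shows "L u f \<in> Cr N r"
proof -
  have "R u f \<in> Cr N r" using R_Cr[OF assms, of 1] by simp
  from Cr_add[OF assms(2,3) this Cr_cmult[OF assms(2,3) phi_Cr[OF assms(1-3)], of "lam u * l u f"]]
  show ?thesis by (simp add: R_eq[abs_def] mult.assoc)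
qed

lemma L_iter_Cr: "u \<in> U \<Longrightarrow> 0 < r \<Longrightarrow> r \<le> \<alpha> \<Longrightarrow> f \<in> Cr N r \<Longrightarrow> (L u ^^ n) f \<in> Cr N r"
  by (induction n) (simp_all add: L_Cr)

lemma l_L_iter: "u \<in> U \<Longrightarrow> 0 < r \<Longrightarrow> r \<le> \<alpha> \<Longrightarrow> f \<in> Cr N r \<Longrightarrow> l u ((L u ^^ n) f) = lam u ^ n * l u f"
  by (induction n) (simp_all add: spectral_r(2) L_iter_Cr)

text \<open>\<open>R u\<close> annihilates \<open>\<phi> u\<close> and agrees with
  \<open>L u\<close> on the kernel of \<open>l u\<close>, so the projector part is removed once and
  for all by the first step. Only the zeroth power, the identity, still contains it.\<close>

lemma R_iter:
  assumes "u \<in> U" "0 < r" "r \<le> \<alpha>" "f \<in> Cr N r"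
  shows "(R u ^^ n) f = (\<lambda>x. (L u ^^ n) f x - (if n = 0 then 0 else lam u ^ n * l u f * \<phi> u x))"
proof (induction n)
  case (Suc n)
  define a where "a = (if n = 0 then 0 else lam u ^ n * l u f)"
  have IH: "(R u ^^ n) f = (\<lambda>x. (L u ^^ n) f x - a * \<phi> u x)" using Suc by (auto simp: a_def fun_eq_iff)
  note ph = phi_Cr[OF assms(1-3)]
  have "l u (\<lambda>x. (L u ^^ n) f x - a * \<phi> u x) = lam u ^ n * l u f - a"
    using l_linear(3)[OF assms(1-3) L_iter_Cr[OF assms] Cr_cmult[OF assms(2,3) ph]] l_L_iter[OF assms]
      l_linear(1)[OF assms(1-3) ph] l_phi[OF assms(1)] by simp
  moreover have "L u (\<lambda>x. (L u ^^ n) f x - a * \<phi> u x) = (\<lambda>x. (L u ^^ Suc n) f x - a * (lam u * \<phi> u x))"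
    by (simp add: L_diff L_cmult L_phi[OF assms(1)])
  moreover have "(R u ^^ Suc n) f = R u (\<lambda>x. (L u ^^ n) f x - a * \<phi> u x)" by (simp only: funpow.simps o_apply IH)
  ultimately have "(R u ^^ Suc n) f = (\<lambda>x. (L u ^^ Suc n) f x - a * (lam u * \<phi> u x) - lam u * ((lam u ^ n * l u f - a) * \<phi> u x))"
    unfolding R_eq[abs_def] by (simp only:)
  then show ?case by (simp add: fun_eq_iff algebra_simps)
qed simp

lemma R_linear:
  assumes "u \<in> U" "0 < r" "r \<le> \<alpha>" "f \<in> Cr N r"
  shows "R u (\<lambda>x. a * f x) = (\<lambda>x. a * R u f x)"
    and "h \<in> Cr N r \<Longrightarrow> R u (\<lambda>x. f x - h x) = (\<lambda>x. R u f x - R u h x)"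
    and "h \<in> Cr N r \<Longrightarrow> R u (\<lambda>x. f x + h x) = (\<lambda>x. R u f x + R u h x)"
proof -
  show "R u (\<lambda>x. a * f x) = (\<lambda>x. a * R u f x)"
    by (rule ext) (simp add: R_eq L_cmult l_linear(1)[OF assms] right_diff_distrib)
  show "R u (\<lambda>x. f x - h x) = (\<lambda>x. R u f x - R u h x)" if "h \<in> Cr N r"
    unfolding R_eq[abs_def] L_diff l_linear(3)[OF assms that] by (rule ext) (simp add: algebra_simps)
  show "R u (\<lambda>x. f x + h x) = (\<lambda>x. R u f x + R u h x)" if "h \<in> Cr N r"
    unfolding R_eq[abs_def] L_add l_linear(2)[OF assms that] by (rule ext) (simp add: algebra_simps)
qed

lemma R_iter_linear:
  assumes "u \<in> U" "0 < r" "r \<le> \<alpha>" "f \<in> Cr N r"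
  shows "(R u ^^ n) (\<lambda>x. a * f x) = (\<lambda>x. a * (R u ^^ n) f x)"
    and "h \<in> Cr N r \<Longrightarrow> (R u ^^ n) (\<lambda>x. f x - h x) = (\<lambda>x. (R u ^^ n) f x - (R u ^^ n) h x)"
proof -
  show "(R u ^^ n) (\<lambda>x. a * f x) = (\<lambda>x. a * (R u ^^ n) f x)"
    by (induction n) (simp_all add: R_linear(1)[OF assms(1-3) R_Cr[OF assms]])
  show "(R u ^^ n) (\<lambda>x. f x - h x) = (\<lambda>x. (R u ^^ n) f x - (R u ^^ n) h x)" if "h \<in> Cr N r"
    by (induction n) (simp_all add: R_linear(2)[OF assms(1-3) R_Cr[OF assms] R_Cr[OF assms(1-3) that]])
qed

lemma R_iter_bound:
  assumes "u \<in> U" "0 < r" "r \<le> \<alpha>"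
  obtains C \<sigma> where "0 \<le> C" "0 < \<sigma>" "\<sigma> < 1"
    "\<And>n f M. holder_bound N r M f \<Longrightarrow> holder_bound N r (C * \<sigma> ^ n * M) (\<lambda>x. (R u ^^ n) f x / lam u ^ n)"
proof -
  obtain C \<sigma> where C: "C > 0" "0 < \<sigma>" "\<sigma> < 1" and h: "\<And>n f. f \<in> Cr N r \<Longrightarrow> (R u ^^ n) f \<in> Cr N r \<and>
       Cr_norm N r (\<lambda>x. (R u ^^ n) f x / lam u ^ n) \<le> C * \<sigma> ^ n * Cr_norm N r f"
    using spectral_r(3)[OF assms] by fastforce
  have r1: "r < 1" using assms \<alpha> by simp
  show ?thesis
  proof (rule that[of "C * (2 * real (card N))" \<sigma>])
    fix n f M assume f: "holder_bound N r M f"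
    have fc: "f \<in> Cr N r" "Cr_norm N r f \<le> 2 * real (card N) * M"
      using holder_bound_imp_Cr[OF cover f, of r] assms r1 by auto
    have "(\<lambda>x. (1 / lam u ^ n) * (R u ^^ n) f x) \<in> Cr N r" using h[OF fc(1)] by (intro Cr_cmult[OF assms(2,3)]) blast
    then have "(\<lambda>x. (R u ^^ n) f x / lam u ^ n) \<in> Cr N r" by simp
    from Cr_imp_holder_bound[OF cover this assms(2) r1]
    have 1: "holder_bound N r (Cr_norm N r (\<lambda>x. (R u ^^ n) f x / lam u ^ n)) (\<lambda>x. (R u ^^ n) f x / lam u ^ n)" .
    have "C * \<sigma> ^ n * Cr_norm N r f \<le> C * \<sigma> ^ n * (2 * real (card N) * M)"
      using fc(2) C by (intro mult_left_mono) auto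
    then show "holder_bound N r (C * (2 * real (card N)) * \<sigma> ^ n * M) (\<lambda>x. (R u ^^ n) f x / lam u ^ n)"
      using h[OF fc(1), of n] by (intro holder_bound_mono[OF 1]) (simp add: mult_ac)
  qed (use C in auto)
qed

section \<open>Inversion of \<open>Id - R u / lam u\<close> on Hoelder spaces\<close>

lemma Id_minus_R_linear:
  assumes "u \<in> U" "0 < r" "r \<le> \<alpha>" "f \<in> Cr N r"
  shows "Id_minus_R u f \<in> Cr N r"
    and "Id_minus_R u (\<lambda>x. a * f x) = (\<lambda>x. a * Id_minus_R u f x)"
    and "h \<in> Cr N r \<Longrightarrow> Id_minus_R u (\<lambda>x. f x - h x) = (\<lambda>x. Id_minus_R u f x - Id_minus_R u h x)"
    and "h \<in> Cr N r \<Longrightarrow> Id_minus_R u (\<lambda>x. f x + h x) = (\<lambda>x. Id_minus_R u f x + Id_minus_R u h x)"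
proof -
  have "R u f \<in> Cr N r" using R_Cr[OF assms, of 1] by simp
  from Cr_diff[OF assms(2,3,4) Cr_cmult[OF assms(2,3) this, of "1 / lam u"]]
  show "Id_minus_R u f \<in> Cr N r" by (simp add: Id_minus_R_def)
  show "Id_minus_R u (\<lambda>x. a * f x) = (\<lambda>x. a * Id_minus_R u f x)"
    unfolding Id_minus_R_def R_linear(1)[OF assms] by (rule ext) (simp add: right_diff_distrib)
  show "Id_minus_R u (\<lambda>x. f x - h x) = (\<lambda>x. Id_minus_R u f x - Id_minus_R u h x)" if "h \<in> Cr N r"
    unfolding Id_minus_R_def R_linear(2)[OF assms that] by (rule ext) (simp add: diff_divide_distrib)
  show "Id_minus_R u (\<lambda>x. f x + h x) = (\<lambda>x. Id_minus_R u f x + Id_minus_R u h x)" if "h \<in> Cr N r"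
    unfolding Id_minus_R_def R_linear(3)[OF assms that] by (rule ext) (simp add: add_divide_distrib)
qed

text \<open>The inverse is the Neumann series of \<open>R u / lam u\<close>.\<close>

lemma resolvent:
  assumes u: "u \<in> U" and r: "0 < r" "r \<le> \<alpha>"
  obtains K where "0 \<le> K"
    "\<And>f M. f \<in> Cr N r \<Longrightarrow> holder_bound N r M (Id_minus_R u f) \<Longrightarrow> holder_bound N r (K * M) f"
    "bij_betw (Id_minus_R u) (Cr N r) (Cr N r)"
proof -
  obtain C \<sigma> where C: "0 \<le> C" "0 < \<sigma>" "\<sigma> < 1" and
    Rb: "\<And>n f M. holder_bound N r M f \<Longrightarrow> holder_bound N r (C * \<sigma> ^ n * M) (\<lambda>x. (R u ^^ n) f x / lam u ^ n)"
    using R_iter_bound[OF u r] by blast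
  define S where "S = (\<lambda>k f x. (R u ^^ k) f x / lam u ^ k)"
  have S_bound: "holder_bound N r (C * \<sigma> ^ n * M) (S n f)" if "holder_bound N r M f" for n f M
    using Rb[OF that] by (simp add: S_def)
  have S_tendsto: "(\<lambda>n. S n f x) \<longlonglongrightarrow> 0" if f: "f \<in> Cr N r" for f x
  proof -
    obtain M where M: "holder_bound N r M f" using f Cr_iff[OF r] by blast
    have "(\<lambda>n. C * \<sigma> ^ n * M) \<longlonglongrightarrow> C * 0 * M" using C by (intro tendsto_intros LIMSEQ_power_zero) auto
    then have z: "(\<lambda>n. C * \<sigma> ^ n * M) \<longlonglongrightarrow> 0" by simp
    show ?thesis
      by (rule Lim_null_comparison[OF _ z]) (use holder_bound_sup[OF cover S_bound[OF M]] in auto)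
  qed
  \<comment> \<open>The series applied to \<open>Id_minus_R u f\<close> telescopes to
    \<open>f\<close>. This gives the norm bound for the inverse and, as a special case,
    injectivity.\<close>
  have S_M: "S k (Id_minus_R u f) x = S k f x - S (Suc k) f x" if f: "f \<in> Cr N r" for k f x
  proof -
    have Rf: "R u f \<in> Cr N r" using R_Cr[OF u r f, of 1] by simp
    have "Id_minus_R u f = (\<lambda>x. f x - (1 / lam u) * R u f x)" by (simp add: Id_minus_R_def)
    then have "(R u ^^ k) (Id_minus_R u f) = (\<lambda>x. (R u ^^ k) f x - (1 / lam u) * (R u ^^ k) (R u f) x)"
      using R_iter_linear(2)[OF u r f Cr_cmult[OF r Rf], of k "1 / lam u"] R_iter_linear(1)[OF u r Rf, of k "1 / lam u"] by simp
    then show ?thesis unfolding S_def by (simp add: funpow_swap1 diff_divide_distrib)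
  qed
  have geo: "(\<Sum>k<n. C * \<sigma> ^ k * M) \<le> C / (1 - \<sigma>) * M" if "0 \<le> M" for n M
  proof -
    have "(\<Sum>k<n. C * \<sigma> ^ k * M) = C * M * (\<Sum>k<n. \<sigma> ^ k)" by (simp add: sum_distrib_left mult_ac)
    also have "(\<Sum>k<n. \<sigma> ^ k) \<le> 1 / (1 - \<sigma>)" using C by (subst sum_gp_strict) (auto intro!: divide_right_mono)
    then have "C * M * (\<Sum>k<n. \<sigma> ^ k) \<le> C * M * (1 / (1 - \<sigma>))" using C that by (intro mult_left_mono) auto
    finally show ?thesis by simp
  qed
  have sum_bound: "holder_bound N r (C / (1 - \<sigma>) * M) (\<lambda>x. \<Sum>k<n. S k f x)" if f: "holder_bound N r M f" for n f M
    by (rule holder_bound_mono[OF holder_bound_sum geo]) (use S_bound[OF f] holder_bound_nonneg[OF cover f] in auto)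
  define K where "K = C / (1 - \<sigma>)"
  have K: "0 \<le> K" using C by (simp add: K_def)
  have bound: "holder_bound N r (K * M) f" if f: "f \<in> Cr N r" and M: "holder_bound N r M (Id_minus_R u f)" for f M
  proof (rule holder_bound_limit[where F = sequentially and f = "\<lambda>n x. \<Sum>k<n. S k (Id_minus_R u f) x" and M = "\<lambda>n. K * M"])
    show "\<forall>\<^sub>F n in sequentially. holder_bound N r (K * M) (\<lambda>x. \<Sum>k<n. S k (Id_minus_R u f) x)"
      using sum_bound[OF M] by (auto simp: K_def)
    fix x
    have "(\<Sum>k<n. S k (Id_minus_R u f) x) = f x - S n f x" for n
      unfolding S_M[OF f] by (subst sum_lessThan_telescope') (simp add: S_def)
    then show "(\<lambda>n. \<Sum>k<n. S k (Id_minus_R u f) x) \<longlonglongrightarrow> f x"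
      using tendsto_diff[OF tendsto_const S_tendsto[OF f], of "f x" x] by simp
  qed auto
  have inj: "inj_on (Id_minus_R u) (Cr N r)"
  proof (rule inj_onI)
    fix f h assume f: "f \<in> Cr N r" and h: "h \<in> Cr N r" and eq: "Id_minus_R u f = Id_minus_R u h"
    have "Id_minus_R u (\<lambda>x. f x - h x) = (\<lambda>x. 0)" using Id_minus_R_linear(3)[OF u r f h] eq by simp
    then have "holder_bound N r (K * 0) (\<lambda>x. f x - h x)"
      using holder_bound_const[of N r 0] by (intro bound Cr_diff r f h) simp
    from holder_bound_sup[OF cover this] show "f = h" by (auto simp: fun_eq_iff)
  qed
  have surj: "\<exists>f\<in>Cr N r. Id_minus_R u f = h" if h: "h \<in> Cr N r" for h
  proof -
    obtain M where M: "holder_bound N r M h" using h Cr_iff[OF r] by blast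
    have M0: "0 \<le> M" using holder_bound_nonneg[OF cover M] .
    have summ: "summable (\<lambda>k. S k h x)" for x
    proof (rule summable_comparison_test[of _ "\<lambda>k. C * M * \<sigma> ^ k"])
      show "\<exists>N. \<forall>n\<ge>N. norm (S n h x) \<le> C * M * \<sigma> ^ n"
        using holder_bound_sup[OF cover S_bound[OF M]] by (auto simp: mult_ac)
      show "summable (\<lambda>k. C * M * \<sigma> ^ k)" using C by (intro summable_mult summable_geometric) auto
    qed
    define f where "f = (\<lambda>x. \<Sum>k. S k h x)"
    have lim: "(\<lambda>n. \<Sum>k<n. S k h x) \<longlonglongrightarrow> f x" for x unfolding f_def by (rule summable_LIMSEQ[OF summ])
    have "holder_bound N r (K * M) f"
      by (rule holder_bound_limit[where F = sequentially, OF _ lim tendsto_const]) (use sum_bound[OF M] in \<open>auto simp: K_def\<close>)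
    then have f: "f \<in> Cr N r" using Cr_iff[OF r] by blast
    have sC: "(\<lambda>x. \<Sum>k<n. S k h x) \<in> Cr N r" for n using sum_bound[OF M] Cr_iff[OF r] by blast
    \<comment> \<open>The tail has to be small in C^r: \<open>R u\<close> contains
      \<open>l u\<close>, whose continuity is known in norm and not under pointwise
      convergence.\<close>
    have tail: "holder_bound N r (K * (\<sigma> ^ n * M)) (\<lambda>x. f x - (\<Sum>k<n. S k h x))" for n
    proof (rule holder_bound_limit[where F = sequentially and f = "\<lambda>m x. \<Sum>k<m. S (k + n) h x" and M = "\<lambda>m. K * (\<sigma> ^ n * M)"])
      have 1: "holder_bound N r (\<Sum>k<m. C * \<sigma> ^ (k + n) * M) (\<lambda>x. \<Sum>k<m. S (k + n) h x)" for m
        by (rule holder_bound_sum) (use S_bound[OF M] in auto)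
      have 2: "(\<Sum>k<m. C * \<sigma> ^ (k + n) * M) \<le> K * (\<sigma> ^ n * M)" for m
        using geo[of "\<sigma> ^ n * M" m] M0 C by (simp add: K_def power_add mult_ac)
      show "\<forall>\<^sub>F m in sequentially. holder_bound N r (K * (\<sigma> ^ n * M)) (\<lambda>x. \<Sum>k<m. S (k + n) h x)"
        by (intro always_eventually allI) (rule holder_bound_mono[OF 1 2])
      fix x
      have "(\<lambda>m. \<Sum>k<m. S (k + n) h x) \<longlonglongrightarrow> (\<Sum>k. S (k + n) h x)"
        using summ by (intro summable_LIMSEQ summable_ignore_initial_segment)
      then show "(\<lambda>m. \<Sum>k<m. S (k + n) h x) \<longlonglongrightarrow> f x - (\<Sum>k<n. S k h x)"
        using suminf_minus_initial_segment[OF summ[of x], of n] by (simp add: f_def)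
    qed auto
    have Ms: "Id_minus_R u (\<lambda>x. \<Sum>k<n. S k h x) x = h x - S n h x" for n x
    proof -
      have SC: "S k h \<in> Cr N r" for k using S_bound[OF M] Cr_iff[OF r] by blast
      have SS: "Id_minus_R u (S k h) x = S k h x - S (Suc k) h x" for k x
        using R_linear(1)[OF u r R_Cr[OF u r h], of "1 / lam u ^ k" k]
        by (simp add: Id_minus_R_def S_def)
      show ?thesis
      proof (induction n)
        case 0
        have "Id_minus_R u (\<lambda>x. 0 * h x) x = 0" using Id_minus_R_linear(2)[OF u r h, of 0] by simp
        then show ?case by (simp add: S_def)
      next
        case (Suc n)
        have "Id_minus_R u (\<lambda>x. (\<Sum>k<n. S k h x) + S n h x) x = Id_minus_R u (\<lambda>x. \<Sum>k<n. S k h x) x + Id_minus_R u (S n h) x"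
          using Id_minus_R_linear(4)[OF u r sC SC] by metis
        then show ?case using Suc SS by simp
      qed
    qed
    have "Id_minus_R u f x = h x" for x
    proof -
      \<comment> \<open>The three terms estimate the tail, its image under
        \<open>R u / lam u\<close>, and the last term left over by telescoping; all tend to
        0.\<close>
      let ?e = "\<lambda>n. K * (\<sigma> ^ n * M) + C * \<sigma> ^ 1 * (K * (\<sigma> ^ n * M)) + \<bar>S n h x\<bar>"
      have "\<bar>Id_minus_R u f x - h x\<bar> \<le> ?e n" for n
      proof -
        let ?t = "\<lambda>x. f x - (\<Sum>k<n. S k h x)"
        have "Id_minus_R u ?t x = Id_minus_R u f x - (h x - S n h x)"
          using Id_minus_R_linear(3)[OF u r f sC] Ms by simp
        moreover have "\<bar>?t x\<bar> \<le> K * (\<sigma> ^ n * M)" using holder_bound_sup[OF cover tail] .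
        moreover have "\<bar>R u ?t x / lam u\<bar> \<le> C * \<sigma> ^ 1 * (K * (\<sigma> ^ n * M))"
          using holder_bound_sup[OF cover S_bound[OF tail], of 1 n x] by (simp add: S_def)
        ultimately show ?thesis unfolding Id_minus_R_def by linarith
      qed
      moreover have "?e \<longlonglongrightarrow> K * (0 * M) + C * \<sigma> ^ 1 * (K * (0 * M)) + \<bar>0\<bar>"
        using C S_tendsto[OF h] by (intro tendsto_intros LIMSEQ_power_zero) auto
      ultimately have "\<bar>Id_minus_R u f x - h x\<bar> \<le> K * (0 * M) + C * \<sigma> ^ 1 * (K * (0 * M)) + \<bar>0\<bar>"
        by (intro LIMSEQ_le_const) auto
      then show ?thesis by simp
    qed
    then show ?thesis using f by blast
  qed
  have "bij_betw (Id_minus_R u) (Cr N r) (Cr N r)"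
    unfolding bij_betw_def using inj surj Id_minus_R_linear(1)[OF u r] by (auto simp: image_iff)
  with K bound that show ?thesis by blast
qed

lemma Id_minus_R_invertible:
  assumes "u \<in> U" "0 < r" "r \<le> \<alpha>"
  shows "Cr_invertible N r (Id_minus_R u)"
proof -
  obtain K where K: "0 \<le> K"
    "\<And>f M. f \<in> Cr N r \<Longrightarrow> holder_bound N r M (Id_minus_R u f) \<Longrightarrow> holder_bound N r (K * M) f"
    and bij: "bij_betw (Id_minus_R u) (Cr N r) (Cr N r)"
    using resolvent[OF assms] by blast
  have r1: "r < 1" using assms \<alpha> by simp
  have "Cr_norm N r f \<le> 2 * real (card N) * K * Cr_norm N r (Id_minus_R u f)" if f: "f \<in> Cr N r" for f
  proof -
    have "holder_bound N r (Cr_norm N r (Id_minus_R u f)) (Id_minus_R u f)"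
      by (rule Cr_imp_holder_bound[OF cover Id_minus_R_linear(1)[OF assms f] assms(2) r1])
    from holder_bound_imp_Cr(2)[OF cover K(2)[OF f this] assms(2) r1, of r] show ?thesis by (simp add: mult.assoc)
  qed
  with bij show ?thesis unfolding Cr_invertible_def by blast
qed

section \<open>Growth of iterates and positivity of eigenfunctions\<close>

lemma L_iter_tendsto:
  assumes "u \<in> U" "0 < r" "r \<le> \<alpha>" "f \<in> Cr N r"
  shows "(\<lambda>n. (L u ^^ n) f x / lam u ^ n) \<longlonglongrightarrow> l u f * \<phi> u x"
proof -
  obtain C \<sigma> where C: "0 \<le> C" "0 < \<sigma>" "\<sigma> < 1" and
    Rb: "\<And>n f M. holder_bound N r M f \<Longrightarrow> holder_bound N r (C * \<sigma> ^ n * M) (\<lambda>x. (R u ^^ n) f x / lam u ^ n)"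
    using R_iter_bound[OF assms(1-3)] by blast
  obtain M where M: "holder_bound N r M f" using assms Cr_iff by blast
  have "(\<lambda>n. C * \<sigma> ^ n * M) \<longlonglongrightarrow> C * 0 * M" using C by (intro tendsto_intros LIMSEQ_power_zero) auto
  then have z: "(\<lambda>n. C * \<sigma> ^ n * M) \<longlonglongrightarrow> 0" by simp
  have "(\<lambda>n. (R u ^^ n) f x / lam u ^ n) \<longlonglongrightarrow> 0"
    by (rule Lim_null_comparison[OF _ z]) (use holder_bound_sup[OF cover Rb[OF M]] in auto)
  then have "(\<lambda>n. (R u ^^ n) f x / lam u ^ n + l u f * \<phi> u x) \<longlonglongrightarrow> 0 + l u f * \<phi> u x" by (intro tendsto_intros)
  then have lim: "(\<lambda>n. (R u ^^ n) f x / lam u ^ n + l u f * \<phi> u x) \<longlonglongrightarrow> l u f * \<phi> u x" by simp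
  show ?thesis
  proof (rule Lim_transform_eventually[OF lim])
    show "\<forall>\<^sub>F n in sequentially. (R u ^^ n) f x / lam u ^ n + l u f * \<phi> u x = (L u ^^ n) f x / lam u ^ n"
      using eventually_gt_at_top[of "0::nat"]
    proof eventually_elim
      case (elim n)
      have "lam u ^ n \<noteq> 0" using lam_pos[OF assms(1)] by simp
      then show ?case using elim by (simp add: R_iter[OF assms] field_simps)
    qed
  qed
qed

lemma L_iter_one_bound:
  assumes "u \<in> U"
  obtains C where "0 < C" "\<And>n x. (L u ^^ n) (\<lambda>x. 1) x \<le> C * lam u ^ n"
proof -
  have a: "0 < \<alpha>" "\<alpha> \<le> \<alpha>" using \<alpha> by auto
  obtain C \<sigma> where C: "0 \<le> C" "0 < \<sigma>" "\<sigma> < 1" and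
    Rb: "\<And>n f M. holder_bound N \<alpha> M f \<Longrightarrow> holder_bound N \<alpha> (C * \<sigma> ^ n * M) (\<lambda>x. (R u ^^ n) f x / lam u ^ n)"
    using R_iter_bound[OF assms a] by blast
  obtain M where M: "C1_bound N \<alpha> M M M (\<phi> u)" using phi_C1_bound[OF assms] by blast
  \<comment> \<open>The first two summands bound the remainder and the projector part of the
    iterate; the last makes \<open>K\<close> strictly positive.\<close>
  define K where "K = C + \<bar>l u (\<lambda>x. 1)\<bar> * M + 1"
  show ?thesis
  proof (rule that[of K])
    have M0: "0 \<le> M" using C1_boundD(1)[OF M] .
    show K0: "0 < K" using C M0 by (simp add: K_def add_nonneg_pos)
    fix n x
    have lp: "0 < lam u ^ n" using lam_pos[OF assms] by simp
    have "\<bar>(R u ^^ n) (\<lambda>x. 1) x / lam u ^ n\<bar> \<le> C * \<sigma> ^ n * 1"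
      using holder_bound_sup[OF cover Rb[OF holder_bound_const[of N \<alpha> 1]]] by simp
    also have "\<dots> \<le> C" using C by (simp add: mult_left_le power_le_one)
    finally have "\<bar>(R u ^^ n) (\<lambda>x. 1) x\<bar> \<le> C * lam u ^ n" using lp by (simp add: divide_le_eq abs_divide)
    moreover have "l u (\<lambda>x. 1) * \<phi> u x \<le> \<bar>l u (\<lambda>x. 1)\<bar> * M"
      by (rule order_trans[OF abs_ge_self]) (unfold abs_mult, rule mult_left_mono[OF C1_bound_sup[OF cover M] abs_ge_zero])
    then have "lam u ^ n * (l u (\<lambda>x. 1) * \<phi> u x) \<le> lam u ^ n * (\<bar>l u (\<lambda>x. 1)\<bar> * M)" using lp by (intro mult_left_mono) auto
    moreover have "0 \<le> lam u ^ n * (\<bar>l u (\<lambda>x. 1)\<bar> * M)" using lp M0 by simp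
    moreover have "(R u ^^ n) (\<lambda>x. 1) x = (L u ^^ n) (\<lambda>x. 1) x - (if n = 0 then 0 else lam u ^ n * (l u (\<lambda>x. 1) * \<phi> u x))"
      unfolding R_iter[OF assms a Cr_const[OF a]] by (simp add: mult.assoc)
    moreover have "K * lam u ^ n = C * lam u ^ n + lam u ^ n * (\<bar>l u (\<lambda>x. 1)\<bar> * M) + lam u ^ n"
      by (simp add: K_def algebra_simps)
    ultimately show "(L u ^^ n) (\<lambda>x. 1) x \<le> K * lam u ^ n"
    proof -
      assume f: "\<bar>(R u ^^ n) (\<lambda>x. 1) x\<bar> \<le> C * lam u ^ n"
        "lam u ^ n * (l u (\<lambda>x. 1) * \<phi> u x) \<le> lam u ^ n * (\<bar>l u (\<lambda>x. 1)\<bar> * M)"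
        "0 \<le> lam u ^ n * (\<bar>l u (\<lambda>x. 1)\<bar> * M)"
        "(R u ^^ n) (\<lambda>x. 1) x = (L u ^^ n) (\<lambda>x. 1) x - (if n = 0 then 0 else lam u ^ n * (l u (\<lambda>x. 1) * \<phi> u x))"
        "K * lam u ^ n = C * lam u ^ n + lam u ^ n * (\<bar>l u (\<lambda>x. 1)\<bar> * M) + lam u ^ n"
      have "(if n = 0 then 0 else lam u ^ n * (l u (\<lambda>x. 1) * \<phi> u x)) \<le> lam u ^ n * (\<bar>l u (\<lambda>x. 1)\<bar> * M)"
        using f(2,3) by (rule if_split[THEN iffD2, OF conjI[OF impI impI], rotated])
      then show "(L u ^^ n) (\<lambda>x. 1) x \<le> K * lam u ^ n" using f(1,4,5) lp by linarith
    qed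
  qed
qed

text \<open>Up to its sign, the eigenfunction is positive: it is a limit of functions in the
  cone, so its zero set is open and closed.\<close>

lemma eigenfunction_positive:
  assumes u: "u \<in> U"
  obtains c where "0 < c" "\<And>x. c \<le> l u (\<lambda>x. 1) * \<phi> u x"
proof -
  have a: "0 < \<alpha>" "\<alpha> \<le> \<alpha>" using \<alpha> by auto
  \<comment> \<open>The limit of \<open>(L u ^^ n) 1 / lam u ^ n\<close>; the factor
    \<open>l u 1\<close> corrects the sign of the eigenfunction.\<close>
  define w where "w = (\<lambda>x. l u (\<lambda>x. 1) * \<phi> u x)"
  obtain m \<epsilon> C where m: "0 < m" and e: "0 < \<epsilon>" "0 \<le> C"
    and inv: "\<And>f K. 0 \<le> K \<Longrightarrow> log_lipschitz \<epsilon> K f \<Longrightarrow> log_lipschitz \<epsilon> (C + K / 2) ((L u ^^ m) f)"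
    using log_lipschitz_iterate[OF u] by metis
  define f where "f = (\<lambda>k. (L u ^^ (m * k)) (\<lambda>x. 1))"
  have f: "log_lipschitz \<epsilon> (2 * C) (f k)" for k
  proof (induction k)
    case 0
    have "1 \<le> exp (2 * C * dist z z')" for z z' :: 'e using e by simp
    then show ?case by (simp add: f_def log_lipschitz_def)
  next
    case (Suc k)
    have "f (Suc k) = (L u ^^ m) (f k)" by (simp add: f_def funpow_add)
    moreover have "0 \<le> 2 * C" using e by simp
    ultimately show ?case using inv[OF _ Suc] by simp
  qed
  have lim: "(\<lambda>k. f k x / lam u ^ (m * k)) \<longlonglongrightarrow> w x" for x
  proof -
    have "filterlim (\<lambda>k. m * k) at_top sequentially"
      using m by (intro filterlim_subseq) (auto simp: strict_mono_def)
    from filterlim_compose[OF L_iter_tendsto[OF u a Cr_const[OF a], of 1 x] this]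
    show ?thesis by (simp add: f_def w_def)
  qed
  have lp: "0 < lam u ^ k" for k using lam_pos[OF u] by simp
  have w0: "0 \<le> w x" for x
    by (rule LIMSEQ_le_const[OF lim]) (use f lp in \<open>auto simp: log_lipschitz_def intro!: divide_nonneg_pos\<close>)
  have wl: "w (chart_inv c z) \<le> exp (2 * C * dist z z') * w (chart_inv c z')"
    if h: "(c, a, R) \<in> N" "z \<in> ball a R" "z' \<in> ball a R" "dist z z' < \<epsilon>" for c a R z z'
  proof (rule LIMSEQ_le[OF lim tendsto_mult_left[OF lim]])
    have "f k (chart_inv c z) / lam u ^ (m * k) \<le> exp (2 * C * dist z z') * (f k (chart_inv c z') / lam u ^ (m * k))" for k
    proof -
      have "f k (chart_inv c z) \<le> exp (2 * C * dist z z') * f k (chart_inv c z')"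
        using f[of k] h unfolding log_lipschitz_def by blast
      from divide_right_mono[OF this less_imp_le[OF lp[of "m * k"]]] show ?thesis by simp
    qed
    then show "\<exists>k. \<forall>n\<ge>k. f n (chart_inv c z) / lam u ^ (m * n) \<le> exp (2 * C * dist z z') * (f n (chart_inv c z') / lam u ^ (m * n))"
      by blast
  qed
  \<comment> \<open>A Harnack inequality: near \<open>x\<close> the values of \<open>w\<close> are
    comparable with \<open>w x\<close> up to one fixed factor, so both the zero set and its
    complement are open.\<close>
  have nbhd: "\<exists>V. open V \<and> x \<in> V \<and> (\<forall>y\<in>V. w x \<le> exp (2 * C * \<epsilon>) * w y \<and> w y \<le> exp (2 * C * \<epsilon>) * w x)" for x
  proof -
    obtain c a R z where z: "(c, a, R) \<in> N" "z \<in> ball a R" "x = chart_inv c z" using coordinate_coverD(5)[OF cover] by blast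
    have cA: "c \<in> A" "z \<in> chart_img c" "x \<in> fst c" using cover_chart[OF z(1), of z] z(2,3) by auto
    note ch = smooth_atlas_chart[OF atlas cA(1)]
    define V where "V = fst c \<inter> snd c -` (ball a R \<inter> ball z \<epsilon>)"
    have "open V" unfolding V_def by (rule continuous_open_preimage[OF ch(4,1)]) auto
    moreover have "x \<in> V" using ch(7)[OF cA(2)] cA(3) z e by (simp add: V_def)
    moreover have "w x \<le> exp (2 * C * \<epsilon>) * w y \<and> w y \<le> exp (2 * C * \<epsilon>) * w x" if "y \<in> V" for y
    proof -
      have y: "y = chart_inv c (snd c y)" "snd c y \<in> ball a R" "dist z (snd c y) < \<epsilon>"
        using that ch(5) by (auto simp: V_def)
      have ex: "exp (2 * C * dist z (snd c y)) \<le> exp (2 * C * \<epsilon>)" using y(3) e(2) by (simp add: mult_left_mono)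
      have "w x \<le> exp (2 * C * dist z (snd c y)) * w y" using wl[OF z(1,2) y(2,3)] z(3) y(1) by simp
      moreover have "w y \<le> exp (2 * C * dist z (snd c y)) * w x"
        using wl[OF z(1) y(2) z(2)] y(1,3) z(3) by (simp add: dist_commute)
      ultimately show ?thesis using mult_right_mono[OF ex w0[of x]] mult_right_mono[OF ex w0[of y]] by linarith
    qed
    ultimately show ?thesis by blast
  qed
  define Z where "Z = {x. w x = 0}"
  have "open Z"
  proof (rule topological_space_class.openI)
    fix x assume x: "x \<in> Z"
    obtain V where V: "open V" "x \<in> V" "\<forall>y\<in>V. w x \<le> exp (2 * C * \<epsilon>) * w y \<and> w y \<le> exp (2 * C * \<epsilon>) * w x"
      using nbhd by blast
    have "V \<subseteq> Z"
    proof
      fix y assume "y \<in> V"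
      then have "w y \<le> exp (2 * C * \<epsilon>) * w x" using V by blast
      then show "y \<in> Z" using x w0[of y] by (simp add: Z_def)
    qed
    then show "\<exists>T. open T \<and> x \<in> T \<and> T \<subseteq> Z" using V by blast
  qed
  moreover have "open (- Z)"
  proof (rule topological_space_class.openI)
    fix x assume x: "x \<in> - Z"
    obtain V where V: "open V" "x \<in> V" "\<forall>y\<in>V. w x \<le> exp (2 * C * \<epsilon>) * w y \<and> w y \<le> exp (2 * C * \<epsilon>) * w x"
      using nbhd by blast
    have "V \<subseteq> - Z"
    proof
      fix y assume "y \<in> V"
      then have "w x \<le> exp (2 * C * \<epsilon>) * w y" using V by blast
      then show "y \<in> - Z" using x w0[of x] by (auto simp: Z_def)
    qed
    then show "\<exists>T. open T \<and> x \<in> T \<and> T \<subseteq> - Z" using V by blast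
  qed
  ultimately have "Z \<inter> UNIV = {} \<or> - Z \<inter> UNIV = {}"
    by (intro connectedD[OF connected_X]) auto
  then have "Z = {} \<or> Z = UNIV" by auto
  \<comment> \<open>If \<open>w\<close> vanished everywhere, then \<open>l u 1\<close> would be 0.
    But \<open>\<bar>\<phi> u\<bar> \<le> M\<close> and monotonicity give \<open>\<bar>\<phi> u
    x\<bar> \<le> M * ((L u ^^ n) 1 x / lam u ^ n)\<close>, whose right side would then tend to
    0.\<close>
  moreover have "Z \<noteq> UNIV"
  proof
    assume Z: "Z = UNIV"
    have phC: "\<phi> u \<in> Cr N \<alpha>" by (rule phi_Cr[OF u a])
    have "\<exists>x. \<phi> u x \<noteq> 0"
    proof (rule ccontr)
      assume "\<not> (\<exists>x. \<phi> u x \<noteq> 0)"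
      then have "\<phi> u = (\<lambda>x. 0 * \<phi> u x)" by auto
      then have "l u (\<phi> u) = 0 * l u (\<phi> u)" using l_linear(1)[OF u a phC, of 0] by simp
      then show False using l_phi[OF u] by simp
    qed
    then obtain x where x: "\<phi> u x \<noteq> 0" by blast
    have l0: "l u (\<lambda>x. 1) = 0" using Z x unfolding Z_def w_def by auto
    obtain M where M: "C1_bound N \<alpha> M M M (\<phi> u)" using phi_C1_bound[OF u] by blast
    have "\<bar>\<phi> u x\<bar> \<le> M * ((L u ^^ n) (\<lambda>x. 1) x / lam u ^ n)" for n
    proof -
      have "\<phi> u y \<le> M * 1" "- 1 * \<phi> u y \<le> M * 1" for y using C1_bound_sup[OF cover M, of y] by auto
      then have "(L u ^^ n) (\<phi> u) x \<le> (L u ^^ n) (\<lambda>x. M * 1) x" "(L u ^^ n) (\<lambda>x. - 1 * \<phi> u x) x \<le> (L u ^^ n) (\<lambda>x. M * 1) x"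
        using L_iter_mono[OF u, of "\<phi> u" "\<lambda>x. M * 1" n x] L_iter_mono[OF u, of "\<lambda>x. - 1 * \<phi> u x" "\<lambda>x. M * 1" n x] by blast+
      then have "lam u ^ n * \<phi> u x \<le> M * (L u ^^ n) (\<lambda>x. 1) x" "- 1 * (lam u ^ n * \<phi> u x) \<le> M * (L u ^^ n) (\<lambda>x. 1) x"
        unfolding L_iter_cmult L_iter_eigen[OF L_phi[OF u]] by auto
      then have "lam u ^ n * \<bar>\<phi> u x\<bar> \<le> M * (L u ^^ n) (\<lambda>x. 1) x" by (cases "0 \<le> \<phi> u x") auto
      then show ?thesis using lp[of n] by (simp add: field_simps)
    qed
    moreover have "(\<lambda>n. M * ((L u ^^ n) (\<lambda>x. 1) x / lam u ^ n)) \<longlonglongrightarrow> M * (l u (\<lambda>x. 1) * \<phi> u x)"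
      by (intro tendsto_mult_left L_iter_tendsto[OF u a Cr_const[OF a]])
    ultimately have "\<bar>\<phi> u x\<bar> \<le> M * (l u (\<lambda>x. 1) * \<phi> u x)" by (intro LIMSEQ_le_const) auto
    then show False using l0 x by simp
  qed
  ultimately have wpos: "0 < w x" for x using w0[of x] by (auto simp: Z_def order_less_le)
  \<comment> \<open>Finitely many of these neighbourhoods cover \<open>X\<close>; the Harnack factor
    on each then turns pointwise positivity into a uniform lower bound.\<close>
  define V where "V = (\<lambda>x. SOME V. open V \<and> x \<in> V \<and> (\<forall>y\<in>V. w x \<le> exp (2 * C * \<epsilon>) * w y \<and> w y \<le> exp (2 * C * \<epsilon>) * w x))"
  have V: "open (V x)" "x \<in> V x" "y \<in> V x \<Longrightarrow> w x \<le> exp (2 * C * \<epsilon>) * w y" for x y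
    using someI_ex[OF nbhd[of x]] unfolding V_def by blast+
  obtain D where D: "D \<subseteq> UNIV" "finite D" "UNIV \<subseteq> (\<Union>x\<in>D. V x)"
    by (rule compactE_image[OF compact_X, of UNIV V]) (use V in auto)
  define c where "c = Min (insert 1 ((\<lambda>x. w x / exp (2 * C * \<epsilon>)) ` D))"
  show ?thesis
  proof (rule that[of c])
    show "0 < c" unfolding c_def using D(2) wpos by (subst Min_gr_iff) auto
    fix y
    obtain x where x: "x \<in> D" "y \<in> V x" using D(3) by blast
    have "c \<le> w x / exp (2 * C * \<epsilon>)" unfolding c_def using D(2) x(1) by (intro Min_le) auto
    also have "\<dots> \<le> w y" using V(3)[OF x(2)] by (simp add: divide_le_eq mult.commute)
    finally show "c \<le> l u (\<lambda>x. 1) * \<phi> u y" by (simp add: w_def)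
  qed
qed

definition pos_eigenfun :: "'p \<Rightarrow> 'x \<Rightarrow> real" where
  "pos_eigenfun u = (\<lambda>x. l u (\<lambda>x. 1) * \<phi> u x)"

lemma L_pos_eigenfun: "u \<in> U \<Longrightarrow> L u (pos_eigenfun u) = (\<lambda>x. lam u * pos_eigenfun u x)"
  unfolding pos_eigenfun_def L_cmult L_phi by (simp add: mult_ac)

lemma pos_eigenfun_bounds:
  assumes u: "u \<in> U"
  shows "\<exists>c M. 0 < c \<and> C1_bound N \<alpha> M M M (pos_eigenfun u) \<and> (\<forall>x. c \<le> pos_eigenfun u x)"
proof -
  obtain c where c: "0 < c" "\<And>x. c \<le> l u (\<lambda>x. 1) * \<phi> u x" using eigenfunction_positive[OF u] by blast
  obtain M where M: "C1_bound N \<alpha> M M M (\<phi> u)" using phi_C1_bound[OF u] by blast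
  show ?thesis unfolding pos_eigenfun_def using c C1_bound_cmult[OF M, of "l u (\<lambda>x. 1)"] by blast
qed

text \<open>The positive eigenfunction at \<open>u\<close> dominates a positive multiple of the one
  at \<open>v\<close>. Applying \<open>L v\<close> repeatedly preserves this, while the normalized
  iterates converge to \<open>l v w * \<phi> v x\<close>, which would be 0.\<close>

lemma l_phi_nonzero:
  assumes u: "u \<in> U" and v: "v \<in> U"
  shows "l v (\<phi> u) \<noteq> 0"
proof
  assume z: "l v (\<phi> u) = 0"
  have a: "0 < \<alpha>" "\<alpha> \<le> \<alpha>" using \<alpha> by auto
  define w w' where "w = pos_eigenfun u" and "w' = pos_eigenfun v"
  obtain c M where w: "0 < c" "C1_bound N \<alpha> M M M w" "\<And>x. c \<le> w x"
    using pos_eigenfun_bounds[OF u] unfolding w_def by blast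
  obtain c' M' where w': "0 < c'" "C1_bound N \<alpha> M' M' M' w'" "\<And>x. c' \<le> w' x"
    using pos_eigenfun_bounds[OF v] unfolding w'_def by blast
  have Lw': "L v w' = (\<lambda>x. lam v * w' x)" unfolding w'_def by (rule L_pos_eigenfun[OF v])
  have l0: "l v w = 0" unfolding w_def pos_eigenfun_def using l_linear(1)[OF v a phi_Cr[OF u a]] z by simp
  fix x :: 'x
  have M': "w' y \<le> M'" for y using C1_bound_sup[OF cover w'(2), of y] by simp
  have M0: "0 < M'" using w'(1) w'(3)[of x] M'[of x] by linarith
  have "(c / M') * w' y \<le> w y" for y
  proof -
    have "(c / M') * w' y \<le> (c / M') * M'" using M' w(1) M0 by (intro mult_left_mono) auto
    then show ?thesis using w(3)[of y] M0 by simp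
  qed
  then have le: "(c / M') * (lam v ^ n * w' x) \<le> (L v ^^ n) w x" for n
    using L_iter_mono[OF v, of "\<lambda>y. (c / M') * w' y" w n x] unfolding L_iter_cmult L_iter_eigen[OF Lw'] by blast
  have "(c / M') * w' x \<le> (L v ^^ n) w x / lam v ^ n" for n
    using le[of n] lam_pos[OF v] by (simp add: le_divide_eq mult_ac)
  moreover have "(\<lambda>n. (L v ^^ n) w x / lam v ^ n) \<longlonglongrightarrow> l v w * \<phi> v x"
    by (rule L_iter_tendsto[OF v a C1_bound_imp_Cr[OF a w(2)]])
  ultimately have "(c / M') * w' x \<le> l v w * \<phi> v x" by (intro LIMSEQ_le_const) auto
  then have "(c / M') * w' x \<le> 0" using l0 by simp
  moreover have "0 < (c / M') * w' x" using w(1) M0 w'(1) w'(3)[of x] by simp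
  ultimately show False by simp
qed

text \<open>Otherwise the powers of \<open>a / b\<close> would be unbounded. In this way eigenvalues
  are compared as growth rates of iterates.\<close>

lemma power_le_imp_le_of_bound:
  fixes a b C :: real
  assumes "0 \<le> a" "0 < b" "0 < c" "\<And>n. c * a ^ n \<le> C * b ^ n"
  shows "a \<le> b"
proof (rule ccontr)
  assume "\<not> a \<le> b"
  then have "1 < a / b" using assms by simp
  then obtain n where n: "C / c < (a / b) ^ n" using real_arch_pow by blast
  have "(a / b) ^ n \<le> C / c" using assms(4)[of n] assms(2,3) by (simp add: power_divide field_simps)
  then show False using n by simp
qed

text \<open>Positivity replaces perturbation theory: the positive eigenfunction \<open>w\<close> at
  \<open>u0\<close> satisfies \<open>L u w = lam u0 * w\<close> up to a relative error, monotonicity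
  propagates this to all iterates of \<open>L u\<close>, and their growth rate is
  \<open>lam u\<close>.\<close>

lemma lam_lipschitz:
  assumes u0: "u0 \<in> U"
  obtains \<epsilon> C where "0 < \<epsilon>" "0 \<le> C" "ball u0 \<epsilon> \<subseteq> U" "\<And>u. u \<in> ball u0 \<epsilon> \<Longrightarrow> \<bar>lam u - lam u0\<bar> \<le> C * dist u u0"
proof -
  define w where "w = pos_eigenfun u0"
  obtain c M where w: "0 < c" "C1_bound N \<alpha> M M M w" "\<And>x. c \<le> w x"
    using pos_eigenfun_bounds[OF u0] unfolding w_def by blast
  have Lw: "L u0 w = (\<lambda>x. lam u0 * w x)" unfolding w_def by (rule L_pos_eigenfun[OF u0])
  obtain e C where e: "0 < e" "0 \<le> C" and
    d: "\<And>f M0 M1 Ma u. C1_bound N \<alpha> M0 M1 Ma f \<Longrightarrow> u \<in> ball u0 e \<Longrightarrow>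
      (\<forall>x. \<bar>L u f x - L u0 f x\<bar> \<le> C * dist u u0 * (M0 + M1)) \<and>
      holder_bound N \<alpha> (C * dist u u0 * (M0 + M1 + Ma)) (\<lambda>x. L u f x - L u0 f x)"
    by (rule transfer_op_diff_bound[OF u0]) (rule that)
  obtain e1 where e1: "0 < e1" "ball u0 e1 \<subseteq> U" using open_U u0 open_contains_ball by metis
  have M0: "0 \<le> M" using C1_boundD(1)[OF w(2)] .
  \<comment> \<open>Division by the lower bound \<open>c\<close> of \<open>w\<close> turns the
    absolute error of \<open>L u w\<close> into a relative one.\<close>
  define K where "K = C * (M + M) / c"
  have K: "0 \<le> K" using e M0 w(1) by (simp add: K_def)
  \<comment> \<open>The last entry ensures \<open>\<eta> \<le> lam u0\<close>, so that powers of
    \<open>lam u0 - \<eta>\<close> are nonnegative and the lower estimate can be iterated.\<close>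
  define \<epsilon> where "\<epsilon> = Min {e, e1, lam u0 / (K + 1)}"
  have eps: "0 < \<epsilon>" "\<epsilon> \<le> e" "\<epsilon> \<le> e1" "\<epsilon> \<le> lam u0 / (K + 1)" using e e1 lam_pos[OF u0] K by (auto simp: \<epsilon>_def)
  show ?thesis
  proof (rule that[OF eps(1) K])
    show "ball u0 \<epsilon> \<subseteq> U" using e1 eps by auto
    fix u assume ub: "u \<in> ball u0 \<epsilon>"
    then have u: "u \<in> U" "u \<in> ball u0 e" using e1 eps by auto
    define \<eta> where "\<eta> = K * dist u u0"
    have \<eta>0: "0 \<le> \<eta>" using K by (simp add: \<eta>_def)
    have "\<eta> \<le> K * (lam u0 / (K + 1))" unfolding \<eta>_def using ub eps K by (intro mult_left_mono) (auto simp: dist_commute)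
    also have "\<dots> \<le> lam u0" using K lam_pos[OF u0] by (simp add: field_simps)
    finally have \<eta>1: "\<eta> \<le> lam u0" .
    have diff: "\<bar>L u w x - lam u0 * w x\<bar> \<le> \<eta> * w x" for x
    proof -
      have "\<bar>L u w x - L u0 w x\<bar> \<le> C * dist u u0 * (M + M)" using d[OF w(2) u(2)] by blast
      also have "\<dots> = \<eta> * c" using w(1) by (simp add: \<eta>_def K_def)
      also have "\<dots> \<le> \<eta> * w x" using w(3) \<eta>0 by (intro mult_left_mono)
      finally show ?thesis by (simp add: Lw)
    qed
    have low: "(lam u0 - \<eta>) ^ n * w x \<le> (L u ^^ n) w x" for n x
    proof (induction n arbitrary: x)
      case (Suc n)
      have "(lam u0 - \<eta>) ^ Suc n * w x \<le> (lam u0 - \<eta>) ^ n * L u w x"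
      proof -
        have "(lam u0 - \<eta>) * w x \<le> L u w x" using diff[of x] by (simp add: algebra_simps abs_le_iff)
        from mult_left_mono[OF this, of "(lam u0 - \<eta>) ^ n"] show ?thesis using \<eta>1 by (simp add: mult_ac)
      qed
      also have "\<dots> = L u (\<lambda>x. (lam u0 - \<eta>) ^ n * w x) x" by (simp add: L_cmult)
      also have "\<dots> \<le> L u ((L u ^^ n) w) x" using Suc by (intro L_mono[OF u(1)])
      finally show ?case by simp
    qed simp
    have up: "(L u ^^ n) w x \<le> (lam u0 + \<eta>) ^ n * w x" for n x
    proof (induction n arbitrary: x)
      case (Suc n)
      have "L u ((L u ^^ n) w) x \<le> L u (\<lambda>x. (lam u0 + \<eta>) ^ n * w x) x" using Suc by (intro L_mono[OF u(1)])
      also have "\<dots> = (lam u0 + \<eta>) ^ n * L u w x" by (simp add: L_cmult)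
      also have "\<dots> \<le> (lam u0 + \<eta>) ^ n * ((lam u0 + \<eta>) * w x)"
        using diff[of x] \<eta>0 lam_pos[OF u0] by (intro mult_left_mono) (auto simp: algebra_simps)
      finally show ?case by (simp add: mult_ac)
    qed simp
    obtain K1 where K1: "0 < K1" "\<And>n x. (L u ^^ n) (\<lambda>x. 1) x \<le> K1 * lam u ^ n" using L_iter_one_bound[OF u(1)] by blast
    \<comment> \<open>From below: \<open>w\<close> is at most a multiple of the constant 1, and the
      iterates of 1 under \<open>L u\<close> grow at most like \<open>lam u ^ n\<close>.\<close>
    have "lam u0 - \<eta> \<le> lam u"
    proof (rule power_le_imp_le_of_bound)
      fix n
      fix x :: 'x
      have "c * (lam u0 - \<eta>) ^ n \<le> w x * (lam u0 - \<eta>) ^ n" using w(3) \<eta>1 by (intro mult_right_mono) auto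
      also have "\<dots> \<le> (L u ^^ n) w x" using low[of n x] by (simp add: mult.commute)
      also have "\<dots> \<le> (L u ^^ n) (\<lambda>x. M * 1) x"
      proof (rule L_iter_mono[OF u(1)])
        fix x show "w x \<le> M * 1" using C1_bound_sup[OF cover w(2), of x] by simp
      qed
      also have "\<dots> \<le> M * (K1 * lam u ^ n)" unfolding L_iter_cmult using K1(2) M0 by (intro mult_left_mono)
      finally show "c * (lam u0 - \<eta>) ^ n \<le> (M * K1) * lam u ^ n" by (simp add: mult.assoc)
    qed (use \<eta>1 lam_pos[OF u(1)] w(1) in auto)
    \<comment> \<open>From above: the positive eigenfunction at \<open>u\<close> grows exactly like
      \<open>lam u ^ n\<close> and is dominated by a multiple of \<open>w\<close>.\<close>
    moreover have "lam u \<le> lam u0 + \<eta>"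
    proof -
      define w' where "w' = pos_eigenfun u"
      obtain c' M' where w': "0 < c'" "C1_bound N \<alpha> M' M' M' w'" "\<And>x. c' \<le> w' x"
        using pos_eigenfun_bounds[OF u(1)] unfolding w'_def by blast
      have Lw': "L u w' = (\<lambda>x. lam u * w' x)" unfolding w'_def by (rule L_pos_eigenfun[OF u(1)])
      show ?thesis
      proof (rule power_le_imp_le_of_bound)
        fix n
        fix x :: 'x
        have M': "w' y \<le> M'" for y using C1_bound_sup[OF cover w'(2), of y] by simp
        have M'0: "0 \<le> M'" using C1_boundD(1)[OF w'(2)] .
        have "c' * lam u ^ n \<le> lam u ^ n * w' x" using w'(3) lam_pos[OF u(1)] by (simp add: mult.commute mult_left_mono)
        also have "\<dots> = (L u ^^ n) w' x" by (simp add: L_iter_eigen[OF Lw'])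
        also have "\<dots> \<le> (L u ^^ n) (\<lambda>x. (M' / c) * w x) x"
        proof (rule L_iter_mono[OF u(1)])
          fix y
          have "(M' / c) * c \<le> (M' / c) * w y" using w(1,3) M'0 by (intro mult_left_mono) auto
          then show "w' y \<le> (M' / c) * w y" using M'[of y] w(1) by simp
        qed
        also have "\<dots> \<le> (M' / c) * ((lam u0 + \<eta>) ^ n * M)"
        proof -
          have "(L u ^^ n) w x \<le> (lam u0 + \<eta>) ^ n * M"
            using C1_bound_sup[OF cover w(2), of x] \<eta>0 lam_pos[OF u0]
            by (intro order_trans[OF up] mult_left_mono) auto
          then show ?thesis unfolding L_iter_cmult using w(1) M'0 by (intro mult_left_mono) auto
        qed
        finally show "c' * lam u ^ n \<le> (M' / c * M) * (lam u0 + \<eta>) ^ n" by (simp add: mult_ac)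
      qed (use \<eta>0 lam_pos[OF u(1)] lam_pos[OF u0] w'(1) in auto)
    qed
    ultimately show "\<bar>lam u - lam u0\<bar> \<le> K * dist u u0" by (simp add: \<eta>_def abs_le_iff)
  qed
qed

section \<open>Perturbation of the eigenfunction\<close>

text \<open>For an eigenfunction the Lasota-Yorke inequality for \<open>L u ^^ m\<close> is an
  estimate of \<open>\<psi>\<close> by itself once \<open>lam u ^ m\<close> is divided out. It
  strictly improves \<open>Ma\<close> and leaves \<open>M0\<close> and \<open>M1\<close> as they
  are.\<close>

lemma eigenfunction_step:
  assumes u0: "u0 \<in> U"
  shows "\<exists>\<epsilon>>0. \<exists>C\<ge>0. ball u0 \<epsilon> \<subseteq> U \<and> (\<forall>u\<in>ball u0 \<epsilon>. \<forall>\<psi> M0 M1 Ma. C1_bound N \<alpha> M0 M1 Ma \<psi> \<longrightarrow>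
    L u \<psi> = (\<lambda>x. lam u * \<psi> x) \<longrightarrow> C1_bound N \<alpha> M0 M1 (Ma / 4 + C * (M0 + M1)) \<psi>)"
proof -
  obtain C1 where C1: "0 < C1" "\<And>n x. (L u0 ^^ n) (\<lambda>x. 1) x \<le> C1 * lam u0 ^ n" using L_iter_one_bound[OF u0] by blast
  \<comment> \<open>After division by \<open>lam u0 ^ m / 2\<close> the coefficient of
    \<open>Ma\<close> is \<open>8 * C1 * q\<close>, which is to be at most 1/4.\<close>
  define q where "q = min (1/2) (1 / (32 * C1))"
  have q: "0 < q" "q \<le> 1/2" "q \<le> 1 / (32 * C1)" using C1(1) by (auto simp: q_def)
  have q8: "8 * C1 * q \<le> 1/4" using q(3) C1(1) by (simp add: field_simps)
  obtain m where m: "\<forall>S. (\<forall>x. (L u0 ^^ m) (\<lambda>x. 1) x \<le> S) \<longrightarrow> (\<exists>\<epsilon>>0. \<exists>C\<ge>0. \<forall>u\<in>ball u0 \<epsilon>. \<forall>f M0 M1 Ma.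
    C1_bound N \<alpha> M0 M1 Ma f \<longrightarrow> (\<forall>c a R z z'. (c, a, R) \<in> N \<longrightarrow> z \<in> ball a R \<longrightarrow> z' \<in> ball a R \<longrightarrow> dist z z' < \<epsilon> \<longrightarrow>
      (\<exists>E E' :: _ \<Rightarrow>\<^sub>L real. ((\<lambda>z. (L u ^^ m) f (chart_inv c z)) has_derivative blinfun_apply E) (at z) \<and>
        ((\<lambda>z. (L u ^^ m) f (chart_inv c z)) has_derivative blinfun_apply E') (at z') \<and>
        norm (E - E') \<le> (4 * S * q * Ma + C * (M0 + M1)) * dist z z' powr \<alpha>)))"
    using lasota_yorke[OF u0 q(1,2)] by blast
  obtain e1 C where e1: "0 < e1" "0 \<le> C" and ly: "\<forall>u\<in>ball u0 e1. \<forall>f M0 M1 Ma.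
    C1_bound N \<alpha> M0 M1 Ma f \<longrightarrow> (\<forall>c a R z z'. (c, a, R) \<in> N \<longrightarrow> z \<in> ball a R \<longrightarrow> z' \<in> ball a R \<longrightarrow> dist z z' < e1 \<longrightarrow>
      (\<exists>E E' :: _ \<Rightarrow>\<^sub>L real. ((\<lambda>z. (L u ^^ m) f (chart_inv c z)) has_derivative blinfun_apply E) (at z) \<and>
        ((\<lambda>z. (L u ^^ m) f (chart_inv c z)) has_derivative blinfun_apply E') (at z') \<and>
        norm (E - E') \<le> (4 * (C1 * lam u0 ^ m) * q * Ma + C * (M0 + M1)) * dist z z' powr \<alpha>))"
    using m C1(2)[of m] by blast
  obtain e2 K where e2: "0 < e2" "0 \<le> K" "ball u0 e2 \<subseteq> U" "\<And>u. u \<in> ball u0 e2 \<Longrightarrow> \<bar>lam u - lam u0\<bar> \<le> K * dist u u0"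
    by (rule lam_lipschitz[OF u0]) (rule that)
  \<comment> \<open>The Lipschitz estimate for the eigenvalue yields
    \<open>lam u ^ m \<ge> lam u0 ^ m / 2\<close> uniformly near \<open>u0\<close>.\<close>
  have "((\<lambda>u. (lam u0 - K * dist u u0) ^ m) \<longlongrightarrow> (lam u0 - K * dist u0 u0) ^ m) (nhds u0)"
    by (intro tendsto_intros filterlim_ident)
  then have "\<forall>\<^sub>F u in nhds u0. lam u0 ^ m / 2 < (lam u0 - K * dist u u0) ^ m"
    by (rule order_tendstoD(1)) (use lam_pos[OF u0] in simp)
  moreover have "((\<lambda>u. lam u0 - K * dist u u0) \<longlongrightarrow> lam u0 - K * dist u0 u0) (nhds u0)"
    by (intro tendsto_intros filterlim_ident)
  then have "\<forall>\<^sub>F u in nhds u0. 0 < lam u0 - K * dist u u0"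
    by (rule order_tendstoD(1)) (use lam_pos[OF u0] in simp)
  ultimately have "\<forall>\<^sub>F u in nhds u0. lam u0 ^ m / 2 < (lam u0 - K * dist u u0) ^ m \<and> 0 < lam u0 - K * dist u u0"
    by eventually_elim simp
  then obtain e3 where e3: "0 < e3" "\<And>u. dist u u0 < e3 \<Longrightarrow> lam u0 ^ m / 2 < (lam u0 - K * dist u u0) ^ m \<and> 0 < lam u0 - K * dist u u0"
    unfolding eventually_nhds_metric by blast
  define \<epsilon> where "\<epsilon> = min e1 (min e2 e3)"
  have eps: "0 < \<epsilon>" "\<epsilon> \<le> e1" "\<epsilon> \<le> e2" "\<epsilon> \<le> e3" using e1 e2 e3 by (auto simp: \<epsilon>_def)
  have l0: "0 < lam u0 ^ m" using lam_pos[OF u0] by simp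
  \<comment> \<open>The first summand serves pairs closer than \<open>e1\<close>; for the others the
    oscillation of the derivative is at most \<open>2 * M1\<close>, whence the second.\<close>
  define C' where "C' = 2 * C / lam u0 ^ m + 2 * e1 powr (- \<alpha>)"
  have C': "0 \<le> C'" using e1 l0 by (simp add: C'_def)
  have "C1_bound N \<alpha> M0 M1 (Ma / 4 + C' * (M0 + M1)) \<psi>"
    if ub: "u \<in> ball u0 \<epsilon>" and \<psi>: "C1_bound N \<alpha> M0 M1 Ma \<psi>" and eig: "L u \<psi> = (\<lambda>x. lam u * \<psi> x)" for u \<psi> M0 M1 Ma
    unfolding C1_bound_def
  proof (intro conjI allI impI)
    note p0 = C1_boundD(1-3)[OF \<psi>]
    show "0 \<le> M0" "0 \<le> M1" "0 \<le> Ma / 4 + C' * (M0 + M1)" using p0 C' by auto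
    have u1: "u \<in> ball u0 e1" and u2: "u \<in> ball u0 e2" using ub eps by auto
    have "dist u u0 < e3" using ub eps by (simp add: dist_commute)
    note e3u = e3(2)[OF this]
    have "(lam u0 - K * dist u u0) ^ m \<le> lam u ^ m"
      using e3u e2(4)[OF u2] by (intro power_mono) auto
    then have lu: "lam u0 ^ m / 2 \<le> lam u ^ m" using e3u by simp
    then have lu0: "0 < lam u ^ m" using l0 by linarith
    have it: "(L u ^^ m) \<psi> = (\<lambda>x. lam u ^ m * \<psi> x)" by (rule L_iter_eigen[OF eig])
    fix c :: "('x, 'e) chart" and a :: 'e and R :: real assume b: "(c, a, R) \<in> N"
    obtain f' :: "'e \<Rightarrow> 'e \<Rightarrow>\<^sub>L real" where f': "\<forall>z\<in>ball a R.
       ((\<lambda>z. \<psi> (chart_inv c z)) has_derivative blinfun_apply (f' z)) (at z) \<and>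
       \<bar>\<psi> (chart_inv c z)\<bar> \<le> M0 \<and> norm (f' z) \<le> M1 \<and>
       (\<forall>z'\<in>ball a R. norm (f' z - f' z') \<le> Ma * dist z z' powr \<alpha>)" using C1_boundD(4)[OF \<psi> b] by blast
    have "norm (f' z - f' z') \<le> (Ma / 4 + C' * (M0 + M1)) * dist z z' powr \<alpha>" if z: "z \<in> ball a R" "z' \<in> ball a R" for z z'
    proof (cases "dist z z' < e1")
      case True
      obtain E E' :: "'e \<Rightarrow>\<^sub>L real" where E: "((\<lambda>z. (L u ^^ m) \<psi> (chart_inv c z)) has_derivative blinfun_apply E) (at z)"
        "((\<lambda>z. (L u ^^ m) \<psi> (chart_inv c z)) has_derivative blinfun_apply E') (at z')"
        "norm (E - E') \<le> (4 * (C1 * lam u0 ^ m) * q * Ma + C * (M0 + M1)) * dist z z' powr \<alpha>"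
        using ly u1 \<psi> b z True by blast
      have der: "((\<lambda>z. (L u ^^ m) \<psi> (chart_inv c z)) has_derivative blinfun_apply (lam u ^ m *\<^sub>R f' y)) (at y)" if "y \<in> ball a R" for y
        unfolding it using has_derivative_mult_right[of "\<lambda>z. \<psi> (chart_inv c z)" "f' y" "at y" "lam u ^ m"] f' that
        by (simp add: scaleR_blinfun.rep_eq)
      have "E = lam u ^ m *\<^sub>R f' z" "E' = lam u ^ m *\<^sub>R f' z'"
        using has_derivative_unique[OF E(1) der[OF z(1)]] has_derivative_unique[OF E(2) der[OF z(2)]]
        by (simp_all add: blinfun_apply_inject)
      then have "norm (E - E') = lam u ^ m * norm (f' z - f' z')" using lu0 by (simp add: scaleR_diff_right[symmetric])
      then have 1: "lam u ^ m * norm (f' z - f' z') \<le> (4 * (C1 * lam u0 ^ m) * q * Ma + C * (M0 + M1)) * dist z z' powr \<alpha>"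
        using E(3) by simp
      have "lam u0 ^ m / 2 * norm (f' z - f' z') \<le> lam u ^ m * norm (f' z - f' z')" using lu by (intro mult_right_mono) auto
      then have "lam u0 ^ m / 2 * norm (f' z - f' z') \<le> (4 * (C1 * lam u0 ^ m) * q * Ma + C * (M0 + M1)) * dist z z' powr \<alpha>"
        using 1 by linarith
      then have "norm (f' z - f' z') \<le> (4 * (C1 * lam u0 ^ m) * q * Ma + C * (M0 + M1)) * dist z z' powr \<alpha> / (lam u0 ^ m / 2)"
        using l0 by (simp add: pos_le_divide_eq mult.commute)
      also have "\<dots> = (8 * C1 * q * Ma + 2 * C / lam u0 ^ m * (M0 + M1)) * dist z z' powr \<alpha>"
      proof -
        have "(4 * (C1 * k) * q * Ma + C * X) * d / (k / 2) = (8 * C1 * q * Ma + 2 * C / k * X) * d" if "0 < k" for k X d :: real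
          using that by (simp add: field_simps)
        from this[OF l0] show ?thesis .
      qed
      also have "\<dots> \<le> (1/4 * Ma + C' * (M0 + M1)) * dist z z' powr \<alpha>"
        using q8 p0 by (intro mult_right_mono add_mono) (auto simp: C'_def)
      finally show ?thesis by simp
    next
      case False
      have "norm (f' z) \<le> M1" "norm (f' z') \<le> M1" using f' z by blast+
      then have "norm (f' z - f' z') \<le> 2 * M1"
        using norm_triangle_ineq4[of "f' z" "f' z'"] by linarith
      also have "\<dots> \<le> 2 * M1 * (e1 powr (- \<alpha>) * dist z z' powr \<alpha>)"
      proof -
        have "e1 powr (- \<alpha>) * e1 powr \<alpha> \<le> e1 powr (- \<alpha>) * dist z z' powr \<alpha>"
          using False e1 \<alpha> by (intro mult_left_mono powr_mono2) auto
        then have "1 \<le> e1 powr (- \<alpha>) * dist z z' powr \<alpha>" using e1 by (simp add: powr_minus)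
        from mult_left_mono[OF this, of "2 * M1"] p0 show ?thesis by simp
      qed
      also have "\<dots> = (2 * e1 powr (- \<alpha>) * M1) * dist z z' powr \<alpha>" by simp
      also have "\<dots> \<le> (Ma / 4 + C' * (M0 + M1)) * dist z z' powr \<alpha>"
      proof (rule mult_right_mono)
        have "0 \<le> 2 * C / lam u0 ^ m * (M0 + M1)" "0 \<le> 2 * e1 powr (- \<alpha>) * M0" using e1 l0 p0 by auto
        then show "2 * e1 powr (- \<alpha>) * M1 \<le> Ma / 4 + C' * (M0 + M1)" using p0 by (simp add: C'_def algebra_simps)
      qed simp
      finally show ?thesis .
    qed
    then show "\<exists>f' :: 'e \<Rightarrow> 'e \<Rightarrow>\<^sub>L real. \<forall>z\<in>ball a R.
       ((\<lambda>z. \<psi> (chart_inv c z)) has_derivative blinfun_apply (f' z)) (at z) \<and>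
       \<bar>\<psi> (chart_inv c z)\<bar> \<le> M0 \<and> norm (f' z) \<le> M1 \<and>
       (\<forall>z'\<in>ball a R. norm (f' z - f' z') \<le> (Ma / 4 + C' * (M0 + M1)) * dist z z' powr \<alpha>)"
      using f' by blast
  qed
  moreover have "ball u0 \<epsilon> \<subseteq> U" using e2(3) eps by auto
  ultimately show ?thesis using eps(1) C' by blast
qed

text \<open>The improvement of \<open>Ma\<close> alternates with interpolation of \<open>M1\<close>.
  Each round at least halves \<open>Ma\<close> up to a multiple of \<open>S\<close>, so the initial
  bound \<open>M\<close>, which is not uniform in the parameter, disappears in the limit.\<close>

lemma eigenfunction_C1_bound:
  assumes u0: "u0 \<in> U"
  shows "\<exists>\<epsilon>>0. \<exists>C\<ge>0. ball u0 \<epsilon> \<subseteq> U \<and> (\<forall>u\<in>ball u0 \<epsilon>. \<forall>\<psi> S M. C1_bound N \<alpha> M M M \<psi> \<longrightarrow>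
    L u \<psi> = (\<lambda>x. lam u * \<psi> x) \<longrightarrow> (\<forall>x. \<bar>\<psi> x\<bar> \<le> S) \<longrightarrow> C1_bound N \<alpha> S (C * S) (C * S) \<psi>)"
proof -
  obtain \<epsilon> C where e: "0 < \<epsilon>" "0 \<le> C" "ball u0 \<epsilon> \<subseteq> U" and
    step: "\<And>u \<psi> M0 M1 Ma. u \<in> ball u0 \<epsilon> \<Longrightarrow> C1_bound N \<alpha> M0 M1 Ma \<psi> \<Longrightarrow>
    L u \<psi> = (\<lambda>x. lam u * \<psi> x) \<Longrightarrow> C1_bound N \<alpha> M0 M1 (Ma / 4 + C * (M0 + M1)) \<psi>"
    using eigenfunction_step[OF u0] by blast
  obtain t0 where t0: "0 < t0" and ip: "\<And>(f :: 'x \<Rightarrow> real) M0 M1 Ma t. C1_bound N \<alpha> M0 M1 Ma f \<Longrightarrow> 0 < t \<Longrightarrow> t < t0 \<Longrightarrow>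
     C1_bound N \<alpha> M0 (2 * M0 / t + 2 * Ma * t powr \<alpha>) Ma f"
    by (rule C1_interpolation[OF cover \<alpha>(1)]) (rule that)
  \<comment> \<open>Interpolation feeds \<open>2 * C * t powr \<alpha>\<close> times the Hoelder
    constant back into it. A fixed \<open>t\<close> makes this at most 1/4, which with the 1/4 of
    the step adds up to 1/2.\<close>
  have "((\<lambda>t::real. 2 * C * t powr \<alpha>) \<longlongrightarrow> 2 * C * 0) (at_right 0)"
    by (intro tendsto_mult_left tendsto_zero_powrI[where b=\<alpha>] tendsto_const tendsto_ident_at)
       (use \<alpha> in \<open>auto simp: eventually_at_right_less eventually_at_filter\<close>)
  then have "\<forall>\<^sub>F t in at_right 0. 2 * C * t powr \<alpha> < 1/4" by (rule order_tendstoD(2)) simp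
  moreover have "\<forall>\<^sub>F t in at_right 0. 0 < t \<and> t < t0"
    using t0 by (auto simp: eventually_at_right)
  ultimately have "\<forall>\<^sub>F t in at_right (0::real). 2 * C * t powr \<alpha> < 1/4 \<and> 0 < t \<and> t < t0" by eventually_elim simp
  then obtain t where t: "2 * C * t powr \<alpha> < 1/4" "0 < t" "t < t0"
    using eventually_happens'[OF trivial_limit_at_right_real] by blast
  define D where "D = C * (1 + 2 / t)"
  have D: "0 \<le> D" using e t by (simp add: D_def)
  define K where "K = max (2 / t + 4 * D * t powr \<alpha>) (2 * D)"
  have K: "0 \<le> K" using D by (auto simp: K_def)
  have "C1_bound N \<alpha> S (K * S) (K * S) \<psi>"
    if u: "u \<in> ball u0 \<epsilon>" and \<psi>: "C1_bound N \<alpha> M M M \<psi>" and eig: "L u \<psi> = (\<lambda>x. lam u * \<psi> x)" and S: "\<forall>x. \<bar>\<psi> x\<bar> \<le> S" for u \<psi> S M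
  proof -
    have S0: "0 \<le> S" using S abs_ge_zero order_trans by blast
    \<comment> \<open>The solution of \<open>a (Suc n) = a n / 2 + D * S\<close> that starts above
      \<open>M\<close>; it decreases to the fixed point \<open>2 * D * S\<close>.\<close>
    define a where "a = (\<lambda>n::nat. 2 * D * S + max M (2 * D * S) / 2 ^ n)"
    have DS: "0 \<le> D * S" using D S0 by simp
    then have a0: "0 \<le> a n" for n by (auto simp: a_def le_max_iff_disj intro!: add_nonneg_nonneg divide_nonneg_nonneg)
    have aSuc: "a (Suc n) = a n / 2 + D * S" for n by (simp add: a_def field_simps)
    have an: "a n \<le> a 0" for n
    proof -
      have "max M (2 * D * S) / 2 ^ n \<le> max M (2 * D * S) / 1"
        using C1_boundD(1)[OF \<psi>] by (intro divide_left_mono) auto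
      then show ?thesis by (simp add: a_def)
    qed
    have main: "C1_bound N \<alpha> S (2 * S / t + 2 * a n * t powr \<alpha>) (a n) \<psi>" for n
    proof (induction n)
      case 0
      have "C1_bound N \<alpha> S M (a 0) \<psi>"
        by (rule C1_bound_change[OF \<psi>]) (use S S0 DS in \<open>auto simp: a_def max_def\<close>)
      from ip[OF this t(2,3)] show ?case .
    next
      case (Suc n)
      have "C * (S + (2 * S / t + 2 * a n * t powr \<alpha>)) = D * S + (2 * C * t powr \<alpha>) * a n"
        by (simp add: D_def algebra_simps)
      also have "\<dots> \<le> D * S + 1/4 * a n" using t(1) a0 by (intro add_left_mono mult_right_mono) auto
      finally have "a n / 4 + C * (S + (2 * S / t + 2 * a n * t powr \<alpha>)) \<le> a (Suc n)" unfolding aSuc by linarith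
      from C1_bound_change[OF step[OF u Suc eig] _ order_refl this S0] S
      have "C1_bound N \<alpha> S (2 * S / t + 2 * a n * t powr \<alpha>) (a (Suc n)) \<psi>" by blast
      from ip[OF this t(2,3)] show ?case .
    qed
    \<comment> \<open>\<open>C1_bound_limit\<close> wants the derivative bound independent of
      \<open>n\<close>, hence \<open>a 0\<close>. Once the limit is taken, a last interpolation
      makes that bound proportional to \<open>S\<close> too.\<close>
    have "C1_bound N \<alpha> S (2 * S / t + 2 * a 0 * t powr \<alpha>) (a n) \<psi>" for n
      by (rule C1_bound_change[OF main[of n]]) (use S S0 an in \<open>auto intro!: mult_right_mono\<close>)
    moreover have "a \<longlonglongrightarrow> 2 * D * S + 0"
      unfolding a_def by (intro tendsto_add tendsto_const LIMSEQ_divide_realpow_zero) simp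
    ultimately have "C1_bound N \<alpha> S (2 * S / t + 2 * a 0 * t powr \<alpha>) (2 * D * S) \<psi>"
      using C1_bound_limit by fastforce
    from ip[OF this t(2,3)] have 1: "C1_bound N \<alpha> S (2 * S / t + 2 * (2 * D * S) * t powr \<alpha>) (2 * D * S) \<psi>" .
    have "(2 / t + 4 * D * t powr \<alpha>) * S \<le> K * S" "2 * D * S \<le> K * S"
      using S0 by (intro mult_right_mono; simp add: K_def)+
    then show ?thesis using S S0 by (intro C1_bound_change[OF 1]) (auto simp: algebra_simps)
  qed
  then show ?thesis using e K by blast
qed

section \<open>Eigenfunctions normalized at a base point\<close>

definition normalized_phi :: "'p \<Rightarrow> 'p \<Rightarrow> 'x \<Rightarrow> real" where
  "normalized_phi v u = (\<lambda>x. \<phi> u x / l v (\<phi> u))"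

lemma normalized_phi:
  assumes u: "u \<in> U" and v: "v \<in> U"
  shows "\<exists>M. C1_bound N \<alpha> M M M (normalized_phi v u)"
    and "L u (normalized_phi v u) = (\<lambda>x. lam u * normalized_phi v u x)"
    and "l v (normalized_phi v u) = 1"
    and "normalized_phi v v = \<phi> v"
proof -
  have a: "0 < \<alpha>" "\<alpha> \<le> \<alpha>" using \<alpha> by auto
  have eq: "normalized_phi v u = (\<lambda>x. (1 / l v (\<phi> u)) * \<phi> u x)" by (simp add: normalized_phi_def)
  obtain M where M: "C1_bound N \<alpha> M M M (\<phi> u)" using phi_C1_bound[OF u] by blast
  show "\<exists>M. C1_bound N \<alpha> M M M (normalized_phi v u)" using C1_bound_cmult[OF M] unfolding eq by blast
  show "L u (normalized_phi v u) = (\<lambda>x. lam u * normalized_phi v u x)"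
    unfolding eq L_cmult L_phi[OF u] by (simp add: mult_ac)
  show "l v (normalized_phi v u) = 1"
    unfolding eq l_linear(1)[OF v a phi_Cr[OF u a]] using l_phi_nonzero[OF u v] by simp
  show "normalized_phi v v = \<phi> v" by (simp add: normalized_phi_def l_phi[OF v])
qed

text \<open>\<open>l v\<close> vanishes on the difference, so there \<open>R v\<close> acts as
  \<open>L v\<close> and both eigenvalue equations can be inserted.\<close>

lemma Id_minus_R_normalized:
  assumes u: "u \<in> U" and v: "v \<in> U"
  defines "\<psi> \<equiv> normalized_phi v u"
  shows "Id_minus_R v (\<lambda>x. \<psi> x - \<phi> v x) =
    (\<lambda>x. (1 / lam v) * ((L u \<psi> x - L v \<psi> x) + (lam v - lam u) * \<psi> x))"
proof
  fix x
  have a: "0 < \<alpha>" "\<alpha> \<le> \<alpha>" using \<alpha> by auto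
  have \<psi>C: "\<psi> \<in> Cr N \<alpha>" using normalized_phi(1)[OF u v] C1_bound_imp_Cr[OF a] unfolding \<psi>_def by blast
  have "l v (\<lambda>x. \<psi> x - \<phi> v x) = 0"
    using l_linear(3)[OF v a \<psi>C phi_Cr[OF v a]] normalized_phi(3)[OF u v] l_phi[OF v] by (simp add: \<psi>_def)
  then have "R v (\<lambda>x. \<psi> x - \<phi> v x) x = L v \<psi> x - lam v * \<phi> v x"
    by (simp add: R_eq L_diff L_phi[OF v])
  moreover have "L u \<psi> x = lam u * \<psi> x" using normalized_phi(2)[OF u v] by (simp add: \<psi>_def)
  ultimately show "Id_minus_R v (\<lambda>x. \<psi> x - \<phi> v x) x =
    (1 / lam v) * ((L u \<psi> x - L v \<psi> x) + (lam v - lam u) * \<psi> x)"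
    unfolding Id_minus_R_def using lam_pos[OF v] by (simp add: field_simps)
qed

text \<open>Results from pairing \<open>L u \<psi> = lam u * \<psi>\<close> with \<open>l v\<close>,
  where \<open>l v \<psi> = 1\<close>; nothing about \<open>l u\<close> is used.\<close>

lemma lam_diff:
  assumes u: "u \<in> U" and v: "v \<in> U"
  defines "\<psi> \<equiv> normalized_phi v u"
  shows "lam u - lam v = l v (\<lambda>x. L u \<psi> x - L v \<psi> x)"
proof -
  have a: "0 < \<alpha>" "\<alpha> \<le> \<alpha>" using \<alpha> by auto
  have \<psi>C: "\<psi> \<in> Cr N \<alpha>" using normalized_phi(1)[OF u v] C1_bound_imp_Cr[OF a] unfolding \<psi>_def by blast
  have "l v (\<lambda>x. L u \<psi> x - L v \<psi> x) = l v (L u \<psi>) - l v (L v \<psi>)"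
    by (rule l_linear(3)[OF v a L_Cr[OF u a \<psi>C] L_Cr[OF v a \<psi>C]])
  also have "l v (L v \<psi>) = lam v" using spectral_r(2)[OF v a \<psi>C] normalized_phi(3)[OF u v] by (simp add: \<psi>_def)
  also have "l v (L u \<psi>) = lam u"
    using l_linear(1)[OF v a \<psi>C, of "lam u"] normalized_phi(2,3)[OF u v] by (simp add: \<psi>_def)
  finally show ?thesis by simp
qed

lemma diff_bound:
  assumes v: "v \<in> U"
  shows "\<exists>\<epsilon>>0. \<exists>C\<ge>0. \<forall>u\<in>ball v \<epsilon>. \<forall>f M0 M1 Ma. C1_bound N \<alpha> M0 M1 Ma f \<longrightarrow>
      (\<forall>x. \<bar>L u f x - L v f x\<bar> \<le> C * dist u v * (M0 + M1)) \<and>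
      holder_bound N \<alpha> (C * dist u v * (M0 + M1 + Ma)) (\<lambda>x. L u f x - L v f x)"
proof (rule transfer_op_diff_bound[OF v])
  fix \<epsilon> C :: real assume "0 < \<epsilon>" "0 \<le> C"
    and "\<And>f M0 M1 Ma u. C1_bound N \<alpha> M0 M1 Ma f \<Longrightarrow> u \<in> ball v \<epsilon> \<Longrightarrow>
      (\<forall>x. \<bar>L u f x - L v f x\<bar> \<le> C * dist u v * (M0 + M1)) \<and>
      holder_bound N \<alpha> (C * dist u v * (M0 + M1 + Ma)) (\<lambda>x. L u f x - L v f x)"
  then show ?thesis by blast
qed

text \<open>A bootstrap: every estimate is linear in the supremum \<open>S\<close> of
  \<open>\<bar>\<psi>\<bar>\<close>. For \<open>u\<close> near \<open>v\<close> the difference to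
  \<open>\<phi> v\<close> is at most \<open>S / 2\<close>, so \<open>S\<close> itself is at most
  twice the bound for \<open>\<phi> v\<close>, and all constants become uniform.\<close>

lemma normalized_phi_close:
  assumes v: "v \<in> U"
  shows "\<exists>\<epsilon>>0. \<exists>C\<ge>0. ball v \<epsilon> \<subseteq> U \<and> (\<forall>u\<in>ball v \<epsilon>. C1_bound N \<alpha> C C C (normalized_phi v u) \<and>
    holder_bound N \<alpha> (C * dist u v) (\<lambda>x. normalized_phi v u x - \<phi> v x))"
proof -
  have a: "0 < \<alpha>" "\<alpha> \<le> \<alpha>" using \<alpha> by auto
  obtain e1 C1 where 1: "0 < e1" "0 \<le> C1" "ball v e1 \<subseteq> U" "\<forall>u\<in>ball v e1. \<forall>\<psi> S M. C1_bound N \<alpha> M M M \<psi> \<longrightarrow>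
    L u \<psi> = (\<lambda>x. lam u * \<psi> x) \<longrightarrow> (\<forall>x. \<bar>\<psi> x\<bar> \<le> S) \<longrightarrow> C1_bound N \<alpha> S (C1 * S) (C1 * S) \<psi>"
    using eigenfunction_C1_bound[OF v] by blast
  obtain e2 C2 where 2: "0 < e2" "0 \<le> C2" "\<forall>u\<in>ball v e2. \<forall>f M0 M1 Ma. C1_bound N \<alpha> M0 M1 Ma f \<longrightarrow>
      (\<forall>x. \<bar>L u f x - L v f x\<bar> \<le> C2 * dist u v * (M0 + M1)) \<and>
      holder_bound N \<alpha> (C2 * dist u v * (M0 + M1 + Ma)) (\<lambda>x. L u f x - L v f x)"
    using diff_bound[OF v] by blast
  obtain e3 C3 where 3: "0 < e3" "0 \<le> C3" "ball v e3 \<subseteq> U" "\<And>u. u \<in> ball v e3 \<Longrightarrow> \<bar>lam u - lam v\<bar> \<le> C3 * dist u v"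
    by (rule lam_lipschitz[OF v]) (rule that)
  obtain K where K: "0 \<le> K" "\<And>f M. f \<in> Cr N \<alpha> \<Longrightarrow> holder_bound N \<alpha> M (Id_minus_R v f) \<Longrightarrow> holder_bound N \<alpha> (K * M) f"
    by (rule resolvent[OF v a]) (rule that)
  obtain K4 where K4: "0 \<le> K4" "\<And>(f :: 'x \<Rightarrow> real) \<beta> M0 M1 Ma. C1_bound N \<beta> M0 M1 Ma f \<Longrightarrow> holder_bound N \<alpha> (K4 * (M0 + M1)) f"
    by (rule C1_bound_imp_holder_bound[OF cover a(1) less_imp_le[OF \<alpha>(2)]]) (rule that)
  obtain B where B: "C1_bound N \<alpha> B B B (\<phi> v)" using phi_C1_bound[OF v] by blast
  have B0: "0 \<le> B" using C1_boundD(1)[OF B] .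
  \<comment> \<open>Resolvent bound times the C^\<alpha> size, per unit of \<open>S\<close> and of
    distance, of the operator difference and of the eigenvalue difference times
    \<open>\<psi>\<close>.\<close>
  define Q where "Q = K * ((1 / lam v) * (C2 * (1 + C1 + C1) + C3 * (K4 * (1 + C1))))"
  have Q: "0 \<le> Q" using K 1 2 3 K4 lam_pos[OF v] by (auto simp: Q_def intro!: mult_nonneg_nonneg add_nonneg_nonneg)
  define \<epsilon> where "\<epsilon> = Min {e1, e2, e3, 1 / (2 * Q + 1)}"
  have eps: "0 < \<epsilon>" "\<epsilon> \<le> e1" "\<epsilon> \<le> e2" "\<epsilon> \<le> e3" "\<epsilon> \<le> 1 / (2 * Q + 1)" using 1 2 3 Q by (auto simp: \<epsilon>_def)
  define C where "C = max (2 * B) (max (C1 * (2 * B)) (Q * (2 * B)))"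
  have C: "2 * B \<le> C" "C1 * (2 * B) \<le> C" "Q * (2 * B) \<le> C" by (auto simp: C_def)
  have C0: "0 \<le> C" using B0 C by linarith
  have "C1_bound N \<alpha> C C C (normalized_phi v u) \<and> holder_bound N \<alpha> (C * dist u v) (\<lambda>x. normalized_phi v u x - \<phi> v x)"
    if ub: "u \<in> ball v \<epsilon>" for u
  proof -
    have ubs: "u \<in> ball v e1" "u \<in> ball v e2" "u \<in> ball v e3" using ub eps by auto
    have u: "u \<in> U" using 1(3) ubs by blast
    define \<psi> where "\<psi> = normalized_phi v u"
    obtain M where M: "C1_bound N \<alpha> M M M \<psi>" using normalized_phi(1)[OF u v] unfolding \<psi>_def by blast
    have eig: "L u \<psi> = (\<lambda>x. lam u * \<psi> x)" using normalized_phi(2)[OF u v] by (simp add: \<psi>_def)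
    \<comment> \<open>Finite because \<open>\<psi>\<close> is bounded for each \<open>u\<close>; its
      uniformity in \<open>u\<close> is what has to be shown.\<close>
    define S where "S = (SUP x. \<bar>\<psi> x\<bar>)"
    have bdd: "bdd_above (range (\<lambda>x. \<bar>\<psi> x\<bar>))" using C1_bound_sup[OF cover M] by (intro bdd_aboveI2)
    have S: "\<forall>x. \<bar>\<psi> x\<bar> \<le> S" unfolding S_def using cSUP_upper[OF UNIV_I bdd] by blast
    have S0: "0 \<le> S" using S abs_ge_zero order_trans by blast
    have \<psi>S: "C1_bound N \<alpha> S (C1 * S) (C1 * S) \<psi>" using 1(4) ubs(1) M eig S by blast
    let ?d = "dist u v"
    have h1: "holder_bound N \<alpha> (C2 * ?d * (S + C1 * S + C1 * S)) (\<lambda>x. L u \<psi> x - L v \<psi> x)"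
      using 2(3) ubs(2) \<psi>S by blast
    have h2: "holder_bound N \<alpha> (C3 * ?d * (K4 * (S + C1 * S))) (\<lambda>x. (lam v - lam u) * \<psi> x)"
    proof (rule holder_bound_mono[OF holder_bound_cmult[OF K4(2)[OF \<psi>S]]])
      show "\<bar>lam v - lam u\<bar> * (K4 * (S + C1 * S)) \<le> C3 * ?d * (K4 * (S + C1 * S))"
        using 3(4)[OF ubs(3)] K4 S0 1 by (intro mult_right_mono) (auto simp: abs_minus_commute)
    qed
    have "holder_bound N \<alpha> (\<bar>1 / lam v\<bar> * (C2 * ?d * (S + C1 * S + C1 * S) + C3 * ?d * (K4 * (S + C1 * S))))
       (Id_minus_R v (\<lambda>x. \<psi> x - \<phi> v x))"
      unfolding Id_minus_R_normalized[OF u v, folded \<psi>_def] by (rule holder_bound_cmult[OF holder_bound_add[OF h1 h2]])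
    moreover have "(\<lambda>x. \<psi> x - \<phi> v x) \<in> Cr N \<alpha>"
      by (rule Cr_diff[OF a C1_bound_imp_Cr[OF a M] phi_Cr[OF v a]])
    ultimately have "holder_bound N \<alpha> (K * (\<bar>1 / lam v\<bar> * (C2 * ?d * (S + C1 * S + C1 * S) + C3 * ?d * (K4 * (S + C1 * S))))) (\<lambda>x. \<psi> x - \<phi> v x)"
      using K(2) by blast
    moreover have "K * (\<bar>1 / lam v\<bar> * (C2 * ?d * (S + C1 * S + C1 * S) + C3 * ?d * (K4 * (S + C1 * S)))) = Q * ?d * S"
      using lam_pos[OF v] by (simp add: Q_def algebra_simps)
    ultimately have h: "holder_bound N \<alpha> (Q * ?d * S) (\<lambda>x. \<psi> x - \<phi> v x)" by simp
    \<comment> \<open>The entry \<open>1 / (2 * Q + 1)\<close> in the definition of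
      \<open>\<epsilon>\<close> is made for this.\<close>
    have Qd: "Q * ?d \<le> 1/2"
    proof -
      have "Q * ?d \<le> Q * (1 / (2 * Q + 1))" using ub eps Q by (intro mult_left_mono) (auto simp: dist_commute)
      also have "\<dots> \<le> 1/2" using Q by (simp add: field_simps)
      finally show ?thesis .
    qed
    have "\<bar>\<psi> x\<bar> \<le> B + 1/2 * S" for x
    proof -
      have "\<bar>\<psi> x - \<phi> v x\<bar> \<le> Q * ?d * S" by (rule holder_bound_sup[OF cover h])
      also have "\<dots> \<le> 1/2 * S" using Qd S0 by (intro mult_right_mono)
      finally show ?thesis using C1_bound_sup[OF cover B, of x] by linarith
    qed
    then have "S \<le> B + 1/2 * S" unfolding S_def by (intro cSUP_least) auto
    then have S2: "S \<le> 2 * B" by simp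
    have "C1_bound N \<alpha> C C C \<psi>"
    proof (rule C1_bound_change[OF \<psi>S])
      show "\<bar>\<psi> x\<bar> \<le> C" for x using S S2 C(1) by (meson order_trans)
      have "C1 * S \<le> C1 * (2 * B)" using S2 1 by (intro mult_left_mono)
      then show "C1 * S \<le> C" "C1 * S \<le> C" using C by auto
    qed (rule C0)
    moreover have "Q * ?d * S \<le> C * ?d"
    proof -
      have "Q * S \<le> Q * (2 * B)" using S2 Q by (intro mult_left_mono)
      then have "Q * S \<le> C" using C by simp
      from mult_right_mono[OF this, of ?d] show ?thesis by (simp add: mult_ac)
    qed
    ultimately show ?thesis using holder_bound_mono[OF h] unfolding \<psi>_def by (intro conjI)
  qed
  moreover have "ball v \<epsilon> \<subseteq> U" using 1(3) eps by auto
  ultimately show ?thesis using eps(1) C0 by (intro exI[of _ \<epsilon>] exI[of _ C] conjI ballI) auto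
qed

text \<open>\<open>deriv\<close> has a value even where no derivative exists. The first claim
  certifies that \<open>dL\<close> consists of genuine directional derivatives.\<close>

lemma param_deriv:
  assumes v: "v \<in> U"
  defines "dL \<equiv> transfer_op_param_deriv T g v (\<phi> v)"
  shows "\<And>h x. (\<lambda>t. L (v + t *\<^sub>R h) (\<phi> v) x) field_differentiable at 0"
    and "\<And>x. linear (\<lambda>h. dL h x)"
    and "\<exists>\<epsilon>>0. \<exists>C\<ge>0. (\<forall>h. holder_bound N \<alpha> (C * norm h) (dL h)) \<and>
      (\<forall>u\<in>ball v \<epsilon>. \<forall>x. \<bar>L u (\<phi> v) x - L v (\<phi> v) x - dL (u - v) x\<bar> \<le> C * dist u v powr (1 + \<alpha>))"
proof -
  obtain B where B: "C1_bound N \<alpha> B B B (\<phi> v)" using phi_C1_bound[OF v] by blast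
  have B0: "0 \<le> B" using C1_boundD(1)[OF B] .
  obtain e1 C1 D where 1: "0 < e1" "0 \<le> C1" "\<And>x. ((\<lambda>u. L u (\<phi> v) x) has_derivative D x) (at v)"
    "\<And>u x. u \<in> ball v e1 \<Longrightarrow> \<bar>L u (\<phi> v) x - L v (\<phi> v) x - D x (u - v)\<bar> \<le> C1 * dist u v powr (1 + \<alpha>)"
    by (rule transfer_op_expansion[OF v B]) (rule that)
  have linD: "linear (D x)" for x using 1(3) has_derivative_linear by blast
  have der: "((\<lambda>t. L (v + t *\<^sub>R h) (\<phi> v) x) has_real_derivative D x h) (at 0)" for h x
  proof -
    have 2: "((\<lambda>t::real. v + t *\<^sub>R h) has_derivative (\<lambda>t. t *\<^sub>R h)) (at 0)" by (auto intro!: derivative_eq_intros)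
    have "((\<lambda>t. L (v + t *\<^sub>R h) (\<phi> v) x) has_derivative (\<lambda>t. D x (t *\<^sub>R h))) (at 0)"
      using has_derivative_compose[OF 2, of "\<lambda>u. L u (\<phi> v) x" "D x"] 1(3)[of x] by simp
    moreover have "(\<lambda>t. D x (t *\<^sub>R h)) = (*) (D x h)" using linear_cmul[OF linD[of x]] by (auto simp: fun_eq_iff)
    ultimately show ?thesis unfolding has_field_derivative_def by simp
  qed
  have dLD: "dL h x = D x h" for h x
    unfolding dL_def transfer_op_param_deriv_def using DERIV_imp_deriv[OF der] .
  show "(\<lambda>t. L (v + t *\<^sub>R h) (\<phi> v) x) field_differentiable at 0" for h x
    using der unfolding field_differentiable_def by blast
  show "linear (\<lambda>h. dL h x)" for x unfolding dLD using linD[of x] by simp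
  obtain e2 C2 where 2: "0 < e2" "0 \<le> C2" "\<forall>u\<in>ball v e2. \<forall>f M0 M1 Ma. C1_bound N \<alpha> M0 M1 Ma f \<longrightarrow>
      (\<forall>x. \<bar>L u f x - L v f x\<bar> \<le> C2 * dist u v * (M0 + M1)) \<and>
      holder_bound N \<alpha> (C2 * dist u v * (M0 + M1 + Ma)) (\<lambda>x. L u f x - L v f x)"
    using diff_bound[OF v] by blast
  \<comment> \<open>The difference quotients are \<alpha>-Hoelder with a constant independent of
    \<open>t\<close>, and the bound passes to their pointwise limit.\<close>
  have hb: "holder_bound N \<alpha> (C2 * (B + B + B) * norm h) (dL h)" for h
  proof (rule holder_bound_limit[where F = "at_right (0::real)" and f = "\<lambda>t x. (1 / t) * (L (v + t *\<^sub>R h) (\<phi> v) x - L v (\<phi> v) x)"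
      and M = "\<lambda>t. C2 * (B + B + B) * norm h"])
    have lim: "((\<lambda>t. norm (t *\<^sub>R h)) \<longlongrightarrow> norm ((0::real) *\<^sub>R h)) (at_right 0)" by (intro tendsto_intros)
    have "\<forall>\<^sub>F t in at_right (0::real). norm (t *\<^sub>R h) < e2" by (rule order_tendstoD(2)[OF lim]) (use 2 in simp)
    then show "\<forall>\<^sub>F t in at_right (0::real). holder_bound N \<alpha> (C2 * (B + B + B) * norm h) (\<lambda>x. (1 / t) * (L (v + t *\<^sub>R h) (\<phi> v) x - L v (\<phi> v) x))"
      using eventually_at_right_less[of "0::real"]
    proof eventually_elim
      case (elim t)
      have "v + t *\<^sub>R h \<in> ball v e2" using elim by (simp add: dist_norm)
      then have "holder_bound N \<alpha> (C2 * dist (v + t *\<^sub>R h) v * (B + B + B)) (\<lambda>x. L (v + t *\<^sub>R h) (\<phi> v) x - L v (\<phi> v) x)"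
        using 2(3) B by blast
      from holder_bound_cmult[OF this, of "1 / t"] show ?case
        using elim(2) by (simp add: dist_norm mult_ac)
    qed
    fix x
    have "((\<lambda>t. (L (v + t *\<^sub>R h) (\<phi> v) x - L (v + 0 *\<^sub>R h) (\<phi> v) x) / (t - 0)) \<longlongrightarrow> D x h) (at 0)"
      using der[of h x] unfolding has_field_derivative_iff .
    then have "((\<lambda>t. (1 / t) * (L (v + t *\<^sub>R h) (\<phi> v) x - L v (\<phi> v) x)) \<longlongrightarrow> D x h) (at 0)" by simp
    then show "((\<lambda>t. (1 / t) * (L (v + t *\<^sub>R h) (\<phi> v) x - L v (\<phi> v) x)) \<longlongrightarrow> dL h x) (at_right 0)"
      unfolding dLD by (rule filterlim_mono) (auto simp: at_within_le_at)
  qed auto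
  define C where "C = max C1 (C2 * (B + B + B))"
  have C: "0 \<le> C" "C1 \<le> C" "C2 * (B + B + B) \<le> C" using 1 by (auto simp: C_def)
  have "holder_bound N \<alpha> (C * norm h) (dL h)" for h
    by (rule holder_bound_mono[OF hb mult_right_mono[OF C(3)]]) simp
  moreover have "\<bar>L u (\<phi> v) x - L v (\<phi> v) x - dL (u - v) x\<bar> \<le> C * dist u v powr (1 + \<alpha>)" if "u \<in> ball v e1" for u x
    unfolding dLD by (rule order_trans[OF 1(4)[OF that] mult_right_mono[OF C(2)]]) simp
  ultimately show "\<exists>\<epsilon>>0. \<exists>C\<ge>0. (\<forall>h. holder_bound N \<alpha> (C * norm h) (dL h)) \<and>
      (\<forall>u\<in>ball v \<epsilon>. \<forall>x. \<bar>L u (\<phi> v) x - L v (\<phi> v) x - dL (u - v) x\<bar> \<le> C * dist u v powr (1 + \<alpha>))"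
    using 1(1) C(1) by blast
qed

text \<open>The statement that \<open>F u\<close> is o(\<bar>u - v\<bar>) in C^r, phrased without
  norms.\<close>

definition holder_small :: "real \<Rightarrow> 'p \<Rightarrow> ('p \<Rightarrow> 'x \<Rightarrow> real) \<Rightarrow> bool" where
  "holder_small r v F \<longleftrightarrow> (\<forall>\<eta>>0. \<exists>\<epsilon>>0. \<forall>u\<in>ball v \<epsilon>. holder_bound N r (\<eta> * dist u v) (F u))"

text \<open>Interpolation in a fixed order: first a scale \<open>\<tau>\<close> at which the
  C^\<alpha> contribution is at most half of what is allowed, then a neighbourhood on which the sup
  norm takes care of the rest. The loss from \<alpha> to \<open>r\<close> occurs here.\<close>

lemma holder_smallI:
  assumes r: "0 < r" "r < \<alpha>" and C: "0 < e" "0 \<le> C" "\<And>u. u \<in> ball v e \<Longrightarrow> holder_bound N \<alpha> (C * dist u v) (F u)"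
    and sup: "\<And>\<eta>. 0 < \<eta> \<Longrightarrow> \<exists>\<epsilon>>0. \<forall>u\<in>ball v \<epsilon>. \<forall>x. \<bar>F u x\<bar> \<le> \<eta> * dist u v"
  shows "holder_small r v F"
  unfolding holder_small_def
proof (intro allI impI)
  fix \<eta> :: real assume \<eta>: "0 < \<eta>"
  \<comment> \<open>Solves \<open>\<tau> powr (\<alpha> - r) = \<eta> / (2 * (C + 1))\<close>; the
    added 1 avoids division by zero.\<close>
  define \<tau> where "\<tau> = (\<eta> / (2 * (C + 1))) powr (1 / (\<alpha> - r))"
  have \<tau>: "0 < \<tau>" "\<tau> powr (\<alpha> - r) = \<eta> / (2 * (C + 1))"
    using \<eta> C r by (auto simp: \<tau>_def powr_powr)
  have C\<tau>: "C * \<tau> powr (\<alpha> - r) \<le> \<eta> / 2" unfolding \<tau>(2) using C \<eta> by (simp add: field_simps)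
  define k where "k = 1 + 2 * \<tau> powr (- r)"
  have k: "0 < k" by (simp add: k_def add_pos_nonneg)
  obtain e2 where e2: "0 < e2" "\<forall>u\<in>ball v e2. \<forall>x. \<bar>F u x\<bar> \<le> \<eta> / (2 * k) * dist u v"
    using sup[of "\<eta> / (2 * k)"] \<eta> k by auto
  have "holder_bound N r (\<eta> * dist u v) (F u)" if u: "u \<in> ball v (min e e2)" for u
  proof -
    have "holder_bound N r (C * dist u v * \<tau> powr (\<alpha> - r) + (1 + 2 * \<tau> powr (- r)) * (\<eta> / (2 * k) * dist u v)) (F u)"
      by (rule holder_interpolation[OF C(3) _ r \<tau>(1)]) (use u e2 in auto)
    moreover have "C * dist u v * \<tau> powr (\<alpha> - r) + (1 + 2 * \<tau> powr (- r)) * (\<eta> / (2 * k) * dist u v) \<le> \<eta> * dist u v"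
    proof -
      have "k * (\<eta> / (2 * k)) = \<eta> / 2" using k by simp
      then have "(C * \<tau> powr (\<alpha> - r) + k * (\<eta> / (2 * k))) * dist u v \<le> \<eta> * dist u v"
        using C\<tau> by (intro mult_right_mono) auto
      moreover have "C * dist u v * \<tau> powr (\<alpha> - r) + k * (\<eta> / (2 * k) * dist u v)
          = (C * \<tau> powr (\<alpha> - r) + k * (\<eta> / (2 * k))) * dist u v"
        by (simp only: distrib_left distrib_right mult_ac)
      ultimately show ?thesis unfolding k_def[symmetric] by simp
    qed
    ultimately show ?thesis by (rule holder_bound_mono)
  qed
  then show "\<exists>\<epsilon>>0. \<forall>u\<in>ball v \<epsilon>. holder_bound N r (\<eta> * dist u v) (F u)"
    using C(1) e2(1) by (intro exI[of _ "min e e2"]) auto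
qed

lemma holder_small_add:
  assumes "holder_small r v F" "holder_small r v H"
  shows "holder_small r v (\<lambda>u x. F u x + H u x)"
  unfolding holder_small_def
proof (intro allI impI)
  fix \<eta> :: real assume "0 < \<eta>"
  then have h: "0 < \<eta> / 2" by simp
  obtain e1 where e1: "0 < e1" "\<forall>u\<in>ball v e1. holder_bound N r (\<eta> / 2 * dist u v) (F u)"
    using assms(1) h unfolding holder_small_def by blast
  obtain e2 where e2: "0 < e2" "\<forall>u\<in>ball v e2. holder_bound N r (\<eta> / 2 * dist u v) (H u)"
    using assms(2) h unfolding holder_small_def by blast
  have "holder_bound N r (\<eta> * dist u v) (\<lambda>x. F u x + H u x)" if "u \<in> ball v (min e1 e2)" for u
  proof -
    have "holder_bound N r (\<eta> / 2 * dist u v + \<eta> / 2 * dist u v) (\<lambda>x. F u x + H u x)"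
      using e1(2) e2(2) that by (intro holder_bound_add) auto
    then show ?thesis by simp
  qed
  then show "\<exists>\<epsilon>>0. \<forall>u\<in>ball v \<epsilon>. holder_bound N r (\<eta> * dist u v) (\<lambda>x. F u x + H u x)"
    using e1(1) e2(1) by (intro exI[of _ "min e1 e2"]) auto
qed

lemma holder_small_dominated:
  assumes F: "holder_small r v F" and K: "0 \<le> K" "0 < e" and H: "\<And>u M. u \<in> ball v e \<Longrightarrow> holder_bound N r M (F u) \<Longrightarrow> holder_bound N r (K * M) (H u)"
  shows "holder_small r v H"
  unfolding holder_small_def
proof (intro allI impI)
  fix \<eta> :: real assume \<eta>: "0 < \<eta>"
  then have "0 < \<eta> / (K + 1)" using K by simp
  then obtain e1 where e1: "0 < e1" "\<forall>u\<in>ball v e1. holder_bound N r (\<eta> / (K + 1) * dist u v) (F u)"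
    using F unfolding holder_small_def by blast
  have "holder_bound N r (\<eta> * dist u v) (H u)" if u: "u \<in> ball v (min e e1)" for u
  proof (rule holder_bound_mono[OF H])
    show "u \<in> ball v e" "holder_bound N r (\<eta> / (K + 1) * dist u v) (F u)" using u e1 by auto
    have "K * (\<eta> / (K + 1)) \<le> \<eta>" using K \<eta> by (simp add: field_simps)
    from mult_right_mono[OF this, of "dist u v"] show "K * (\<eta> / (K + 1) * dist u v) \<le> \<eta> * dist u v" by simp
  qed
  then show "\<exists>\<epsilon>>0. \<forall>u\<in>ball v \<epsilon>. holder_bound N r (\<eta> * dist u v) (H u)"
    using K(2) e1(1) by (intro exI[of _ "min e e1"]) auto
qed

lemma holder_small_quadratic:
  assumes "0 < e" "0 \<le> C" "\<And>u. u \<in> ball v e \<Longrightarrow> holder_bound N r (C * dist u v * dist u v) (F u)"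
  shows "holder_small r v F"
  unfolding holder_small_def
proof (intro allI impI)
  fix \<eta> :: real assume \<eta>: "0 < \<eta>"
  have "holder_bound N r (\<eta> * dist u v) (F u)" if u: "u \<in> ball v (min e (\<eta> / (C + 1)))" for u
  proof (rule holder_bound_mono[OF assms(3)])
    show "u \<in> ball v e" using u by auto
    have "C * dist u v \<le> C * (\<eta> / (C + 1))" using u assms(2) by (intro mult_left_mono) (auto simp: dist_commute)
    also have "\<dots> \<le> \<eta>" using assms(2) \<eta> by (simp add: field_simps)
    finally show "C * dist u v * dist u v \<le> \<eta> * dist u v" by (intro mult_right_mono) auto
  qed
  then show "\<exists>\<epsilon>>0. \<forall>u\<in>ball v \<epsilon>. holder_bound N r (\<eta> * dist u v) (F u)"
    using assms(1,2) \<eta> by (intro exI[of _ "min e (\<eta> / (C + 1))"]) auto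
qed

text \<open>The first-order expansion of \<open>L u\<close>, applied to the moving eigenfunction: the error is
  \<open>O(\<bar>u - v\<bar>)\<close> in \<open>C\<^sup>\<alpha>\<close> and \<open>o(\<bar>u - v\<bar>)\<close> uniformly, hence \<open>o(\<bar>u - v\<bar>)\<close> in \<open>C\<^sup>r\<close> for \<open>r < \<alpha>\<close>.\<close>

lemma moving_expansion:
  assumes v: "v \<in> U" and r: "0 < r" "r < \<alpha>"
  shows "holder_small r v (\<lambda>u x. L u (normalized_phi v u) x - L v (normalized_phi v u) x
           - transfer_op_param_deriv T g v (\<phi> v) (u - v) x)"
proof -
  let ?dL = "transfer_op_param_deriv T g v (\<phi> v)"
  let ?\<psi> = "normalized_phi v"
  obtain e1 C1 where 1: "0 < e1" "0 \<le> C1" "ball v e1 \<subseteq> U" "\<forall>u\<in>ball v e1. C1_bound N \<alpha> C1 C1 C1 (?\<psi> u) \<and>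
    holder_bound N \<alpha> (C1 * dist u v) (\<lambda>x. ?\<psi> u x - \<phi> v x)" using normalized_phi_close[OF v] by blast
  obtain e2 C2 where 2: "0 < e2" "0 \<le> C2" "\<forall>u\<in>ball v e2. \<forall>f M0 M1 Ma. C1_bound N \<alpha> M0 M1 Ma f \<longrightarrow>
      (\<forall>x. \<bar>L u f x - L v f x\<bar> \<le> C2 * dist u v * (M0 + M1)) \<and>
      holder_bound N \<alpha> (C2 * dist u v * (M0 + M1 + Ma)) (\<lambda>x. L u f x - L v f x)"
    using diff_bound[OF v] by blast
  obtain e3 C3 where 3: "0 < e3" "0 \<le> C3" "\<forall>h. holder_bound N \<alpha> (C3 * norm h) (?dL h)"
      "\<forall>u\<in>ball v e3. \<forall>x. \<bar>L u (\<phi> v) x - L v (\<phi> v) x - ?dL (u - v) x\<bar> \<le> C3 * dist u v powr (1 + \<alpha>)"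
    using param_deriv(3)[OF v] by blast
  obtain t0 where t0: "0 < t0" and ip: "\<And>(f :: 'x \<Rightarrow> real) M0 M1 Ma t. C1_bound N \<alpha> M0 M1 Ma f \<Longrightarrow> 0 < t \<Longrightarrow> t < t0 \<Longrightarrow>
     C1_bound N \<alpha> M0 (2 * M0 / t + 2 * Ma * t powr \<alpha>) Ma f"
    by (rule C1_interpolation[OF cover \<alpha>(1)]) (rule that)
  have \<phi>1: "C1_bound N \<alpha> C1 C1 C1 (\<phi> v)" using 1(4) 1(1) normalized_phi(4)[OF v v] by (metis centre_in_ball)
  \<comment> \<open>Only the sup bound is small. The derivatives of \<open>\<psi> u\<close> and
    \<open>\<phi> v\<close> are bounded but not yet known to be close.\<close>
  have diffC: "C1_bound N \<alpha> (C1 * dist u v) (2 * C1) (2 * C1) (\<lambda>x. ?\<psi> u x - \<phi> v x)" if u: "u \<in> ball v e1" for u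
  proof -
    have "C1_bound N \<alpha> (C1 + \<bar>-1\<bar> * C1) (C1 + \<bar>-1\<bar> * C1) (C1 + \<bar>-1\<bar> * C1) (\<lambda>x. ?\<psi> u x + -1 * \<phi> v x)"
      using 1(4) u by (intro C1_bound_add C1_bound_cmult \<phi>1) blast
    then have "C1_bound N \<alpha> (2 * C1) (2 * C1) (2 * C1) (\<lambda>x. ?\<psi> u x - \<phi> v x)" by simp
    moreover have "\<bar>?\<psi> u x - \<phi> v x\<bar> \<le> C1 * dist u v" for x
      using bspec[OF 1(4) u] by (intro holder_bound_sup[OF cover, of \<alpha> "C1 * dist u v"]) simp
    ultimately show ?thesis
      by (rule C1_bound_change) (use 1 in auto)
  qed
  define e where "e = min e1 (min e2 e3)"
  have e: "0 < e" "e \<le> e1" "e \<le> e2" "e \<le> e3" using 1 2 3 by (auto simp: e_def)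
  \<comment> \<open>The change of the operator acting on the change of the eigenfunction. It is
    O(\<bar>u - v\<bar>) in C^\<alpha>; to be o(\<bar>u - v\<bar>) uniformly it needs the derivative
    of \<open>\<psi> u - \<phi> v\<close> to be small, which interpolation provides.\<close>
  have s1: "holder_small r v (\<lambda>u x. L u (\<lambda>x. ?\<psi> u x - \<phi> v x) x - L v (\<lambda>x. ?\<psi> u x - \<phi> v x) x)"
  proof (rule holder_smallI[OF r])
    define e' where "e' = min e 1"
    show "0 < e'" using e by (simp add: e'_def)
    show "0 \<le> C2 * (C1 + 2 * C1 + 2 * C1)" using 1 2 by simp
    fix u assume "u \<in> ball v e'"
    then have u: "u \<in> ball v e1" "u \<in> ball v e2" "dist u v \<le> 1" using e by (auto simp: e'_def dist_commute)
    have "holder_bound N \<alpha> (C2 * dist u v * (C1 * dist u v + 2 * C1 + 2 * C1)) (\<lambda>x. L u (\<lambda>x. ?\<psi> u x - \<phi> v x) x - L v (\<lambda>x. ?\<psi> u x - \<phi> v x) x)"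
      using 2(3) u(2) diffC[OF u(1)] by blast
    moreover have "C2 * dist u v * (C1 * dist u v + 2 * C1 + 2 * C1) \<le> C2 * dist u v * (C1 * 1 + 2 * C1 + 2 * C1)"
      using u(3) 1 2 by (intro mult_left_mono add_mono) auto
    ultimately show "holder_bound N \<alpha> (C2 * (C1 + 2 * C1 + 2 * C1) * dist u v) (\<lambda>x. L u (\<lambda>x. ?\<psi> u x - \<phi> v x) x - L v (\<lambda>x. ?\<psi> u x - \<phi> v x) x)"
      using holder_bound_mono by (simp add: mult_ac)
  next
    fix \<eta> :: real assume \<eta>: "0 < \<eta>"
    define k where "k = 4 * C1 * C2 + 1"
    have k: "0 < k" using 1 2 by (simp add: k_def add_nonneg_pos)
    \<comment> \<open>\<open>t\<close> is fixed first, making the contribution of the Hoelder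
      constant at most \<open>\<eta> / 2\<close>; afterwards \<open>u\<close> is moved close to
      \<open>v\<close> to control the terms with \<open>1 / t\<close>.\<close>
    define t where "t = min (t0 / 2) ((\<eta> / (2 * k)) powr (1 / \<alpha>))"
    have t: "0 < t" "t < t0" using t0 \<eta> k by (auto simp: t_def)
    have "t powr \<alpha> \<le> ((\<eta> / (2 * k)) powr (1 / \<alpha>)) powr \<alpha>" using t \<alpha> by (intro powr_mono2) (auto simp: t_def)
    also have "\<dots> = \<eta> / (2 * k)" using \<alpha> \<eta> k by (simp add: powr_powr)
    finally have "4 * C1 * C2 * t powr \<alpha> \<le> 4 * C1 * C2 * (\<eta> / (2 * k))" using 1 2 by (intro mult_left_mono) auto
    also have "\<dots> \<le> \<eta> / 2" using k \<eta> unfolding k_def by (simp add: field_simps)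
    finally have ta: "4 * C1 * C2 * t powr \<alpha> \<le> \<eta> / 2" .
    define m where "m = C2 * (C1 + 2 * C1 / t)"
    have m: "0 \<le> m" using 1 2 t by (simp add: m_def)
    define e' where "e' = min e (\<eta> / (2 * (m + 1)))"
    have e': "0 < e'" using e \<eta> m by (simp add: e'_def)
    have "\<bar>L u (\<lambda>x. ?\<psi> u x - \<phi> v x) x - L v (\<lambda>x. ?\<psi> u x - \<phi> v x) x\<bar> \<le> \<eta> * dist u v" if "u \<in> ball v e'" for u x
    proof -
      have u: "u \<in> ball v e1" "u \<in> ball v e2" "dist u v \<le> \<eta> / (2 * (m + 1))" using that e by (auto simp: e'_def dist_commute)
      let ?d = "dist u v"
      have "\<bar>L u (\<lambda>x. ?\<psi> u x - \<phi> v x) x - L v (\<lambda>x. ?\<psi> u x - \<phi> v x) x\<bar>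
          \<le> C2 * ?d * (C1 * ?d + (2 * (C1 * ?d) / t + 2 * (2 * C1) * t powr \<alpha>))"
        using 2(3) u(2) ip[OF diffC[OF u(1)] t] by blast
      also have "\<dots> = (m * ?d + 4 * C1 * C2 * t powr \<alpha>) * ?d" by (simp add: m_def algebra_simps)
      also have "\<dots> \<le> (\<eta> / 2 + \<eta> / 2) * ?d"
      proof (intro mult_right_mono add_mono ta)
        have "m * ?d \<le> m * (\<eta> / (2 * (m + 1)))" using u(3) m by (intro mult_left_mono)
        also have "\<dots> \<le> \<eta> / 2" using m \<eta> by (simp add: field_simps)
        finally show "m * ?d \<le> \<eta> / 2" .
      qed simp
      finally show ?thesis by simp
    qed
    then show "\<exists>\<epsilon>>0. \<forall>u\<in>ball v \<epsilon>. \<forall>x. \<bar>L u (\<lambda>x. ?\<psi> u x - \<phi> v x) x - L v (\<lambda>x. ?\<psi> u x - \<phi> v x) x\<bar> \<le> \<eta> * dist u v"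
      using e' by blast
  qed
  \<comment> \<open>On the fixed function \<open>\<phi> v\<close> the remainder of order 1 +
    \<alpha> gives the smallness in sup norm.\<close>
  have s2: "holder_small r v (\<lambda>u x. L u (\<phi> v) x - L v (\<phi> v) x - ?dL (u - v) x)"
  proof (rule holder_smallI[OF r e(1)])
    show "0 \<le> C2 * (C1 + C1 + C1) + C3" using 1 2 3 by simp
    fix u assume "u \<in> ball v e"
    then have u: "u \<in> ball v e2" using e by auto
    have "holder_bound N \<alpha> (C2 * dist u v * (C1 + C1 + C1) + C3 * norm (u - v)) (\<lambda>x. L u (\<phi> v) x - L v (\<phi> v) x - ?dL (u - v) x)"
      using 2(3) u \<phi>1 3(3) by (intro holder_bound_diff) blast+
    then show "holder_bound N \<alpha> ((C2 * (C1 + C1 + C1) + C3) * dist u v) (\<lambda>x. L u (\<phi> v) x - L v (\<phi> v) x - ?dL (u - v) x)"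
      by (simp add: dist_norm algebra_simps)
  next
    fix \<eta> :: real assume \<eta>: "0 < \<eta>"
    define k where "k = (\<eta> / (C3 + 1)) powr (1 / \<alpha>)"
    have k: "0 < k" using \<eta> 3 by (simp add: k_def)
    have "\<bar>L u (\<phi> v) x - L v (\<phi> v) x - ?dL (u - v) x\<bar> \<le> \<eta> * dist u v" if "u \<in> ball v (min e k)" for u x
    proof -
      have u: "u \<in> ball v e3" "dist u v \<le> k" using that e by (auto simp: dist_commute)
      have "dist u v powr \<alpha> \<le> k powr \<alpha>" using u \<alpha> by (intro powr_mono2) auto
      also have "\<dots> = \<eta> / (C3 + 1)" using \<alpha> \<eta> 3 by (simp add: k_def powr_powr)
      finally have "C3 * dist u v powr \<alpha> \<le> C3 * (\<eta> / (C3 + 1))" using 3 by (intro mult_left_mono)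
      also have "\<dots> \<le> \<eta>" using 3 \<eta> by (simp add: field_simps)
      finally have "C3 * dist u v powr \<alpha> * dist u v \<le> \<eta> * dist u v" by (intro mult_right_mono) auto
      moreover have "C3 * dist u v powr (1 + \<alpha>) = C3 * dist u v powr \<alpha> * dist u v" by (simp add: powr_add)
      ultimately show ?thesis using spec[OF bspec[OF 3(4) u(1)], of x] by linarith
    qed
    then show "\<exists>\<epsilon>>0. \<forall>u\<in>ball v \<epsilon>. \<forall>x. \<bar>L u (\<phi> v) x - L v (\<phi> v) x - ?dL (u - v) x\<bar> \<le> \<eta> * dist u v"
      using e(1) k by (intro exI[of _ "min e k"]) auto
  qed
  have "(\<lambda>u x. (L u (\<lambda>x. ?\<psi> u x - \<phi> v x) x - L v (\<lambda>x. ?\<psi> u x - \<phi> v x) x) + (L u (\<phi> v) x - L v (\<phi> v) x - ?dL (u - v) x))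
     = (\<lambda>u x. L u (?\<psi> u) x - L v (?\<psi> u) x - ?dL (u - v) x)" by (simp add: L_diff fun_eq_iff)
  with holder_small_add[OF s1 s2] show ?thesis by simp
qed

section \<open>Differentiability\<close>

text \<open>The counterpart of \<open>Cr_has_derivative\<close> in terms of
  \<open>holder_bound\<close>, which makes the product and chain rules below elementary.\<close>

definition holder_has_derivative :: "real \<Rightarrow> ('p \<Rightarrow> 'x \<Rightarrow> real) \<Rightarrow> ('p \<Rightarrow> 'x \<Rightarrow> real) \<Rightarrow> 'p \<Rightarrow> bool" where
  "holder_has_derivative r F D v \<longleftrightarrow> (\<forall>x. linear (\<lambda>h. D h x)) \<and> (\<exists>K\<ge>0. \<forall>h. holder_bound N r (K * norm h) (D h)) \<and>
     (\<exists>e>0. \<forall>u\<in>ball v e. \<exists>M. holder_bound N r M (F u)) \<and> holder_small r v (\<lambda>u x. F u x - F v x - D (u - v) x)"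

text \<open>A bound with exponent \<open>r > 0\<close> controls all norms of lower exponent,
  including the sup norm; in this way \<open>\<beta> = 0\<close> is reached from a positive
  exponent.\<close>

lemma holder_has_derivative_imp_Cr:
  assumes F: "holder_has_derivative r F D v" and r: "0 \<le> \<beta>" "\<beta> \<le> r" "0 < r" "r < 1"
  shows "Cr_has_derivative N \<beta> F D v"
proof -
  obtain K where K: "0 \<le> K" "\<And>(f :: 'x \<Rightarrow> real) M. holder_bound N r M f \<Longrightarrow> f \<in> Cr N \<beta> \<and> Cr_norm N \<beta> f \<le> K * M"
    by (rule holder_bound_imp_Cr_le[OF cover r]) (rule that)
  obtain K1 where K1: "0 \<le> K1" "\<forall>h. holder_bound N r (K1 * norm h) (D h)"
    using F unfolding holder_has_derivative_def by blast
  obtain e where e: "0 < e" "\<forall>u\<in>ball v e. \<exists>M. holder_bound N r M (F u)"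
    using F unfolding holder_has_derivative_def by blast
  have small: "holder_small r v (\<lambda>u x. F u x - F v x - D (u - v) x)"
    using F unfolding holder_has_derivative_def by blast
  have "\<forall>\<^sub>F u in nhds v. u \<in> ball v e" using e(1) by (intro eventually_nhds_in_open) auto
  then have 1: "\<forall>\<^sub>F u in nhds v. F u \<in> Cr N \<beta>"
    by (rule eventually_mono) (use e(2) K(2) in blast)
  have 2: "\<forall>h. D h \<in> Cr N \<beta>" using K1(2) K(2) by blast
  have "Cr_norm N \<beta> (D h) \<le> (K * K1) * norm h" for h
    using K(2)[OF spec[OF K1(2), of h]] by (simp add: mult.assoc)
  then have 3: "\<exists>K. \<forall>h. Cr_norm N \<beta> (D h) \<le> K * norm h" by blast
  have 4: "((\<lambda>h. Cr_norm N \<beta> (\<lambda>x. F (v + h) x - F v x - D h x) / norm h) \<longlongrightarrow> 0) (at 0)"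
  proof (rule tendstoI)
    fix \<epsilon> :: real assume \<epsilon>: "0 < \<epsilon>"
    define \<eta> where "\<eta> = \<epsilon> / (2 * (K + 1))"
    have \<eta>: "0 < \<eta>" using \<epsilon> K by (simp add: \<eta>_def)
    obtain d where d: "0 < d" "\<forall>u\<in>ball v d. holder_bound N r (\<eta> * dist u v) (\<lambda>x. F u x - F v x - D (u - v) x)"
      using small \<eta> unfolding holder_small_def by blast
    have "dist (Cr_norm N \<beta> (\<lambda>x. F (v + h) x - F v x - D h x) / norm h) 0 < \<epsilon>" if h: "h \<noteq> 0" "dist h 0 < d" for h
    proof -
      let ?f = "\<lambda>x. F (v + h) x - F v x - D h x"
      have "v + h \<in> ball v d" using h by (simp add: dist_norm)
      from bspec[OF d(2) this] have "holder_bound N r (\<eta> * norm h) ?f" by (simp add: dist_norm)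
      then have f: "?f \<in> Cr N \<beta>" "Cr_norm N \<beta> ?f \<le> K * (\<eta> * norm h)" using K(2) by blast+
      have "0 \<le> Cr_norm N \<beta> ?f" by (rule Cr_norm_nonneg[OF cover r(1) _ f(1)]) (use r in simp)
      moreover have "K * \<eta> < \<epsilon>"
      proof -
        have "K * \<eta> = \<epsilon> * (K / (2 * (K + 1)))" by (simp add: \<eta>_def)
        also have "\<dots> < \<epsilon> * 1" using K(1) \<epsilon> by (intro mult_strict_left_mono) auto
        finally show ?thesis by simp
      qed
      then have "(K * \<eta>) * norm h < \<epsilon> * norm h" using h by (intro mult_strict_right_mono) auto
      with f(2) have "Cr_norm N \<beta> ?f < \<epsilon> * norm h" by (simp add: mult.assoc)
      then have "Cr_norm N \<beta> ?f / norm h < \<epsilon>" using h by (simp add: divide_less_eq)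
      ultimately show ?thesis by (simp add: dist_real_def)
    qed
    then show "\<forall>\<^sub>F h in at 0. dist (Cr_norm N \<beta> (\<lambda>x. F (v + h) x - F v x - D h x) / norm h) 0 < \<epsilon>"
      using d(1) unfolding eventually_at by blast
  qed
  show ?thesis using 1 2 3 4 F unfolding Cr_has_derivative_def holder_has_derivative_def by (intro conjI) auto
qed

lemma holder_has_derivative_cong:
  assumes F: "holder_has_derivative r F D v" and e: "0 < e" "\<And>u. u \<in> ball v e \<Longrightarrow> F' u = F u"
  shows "holder_has_derivative r F' D v"
proof -
  obtain d where d: "0 < d" "\<forall>u\<in>ball v d. \<exists>M. holder_bound N r M (F u)"
    using F unfolding holder_has_derivative_def by blast
  have "holder_small r v (\<lambda>u x. F' u x - F' v x - D (u - v) x)"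
    by (rule holder_small_dominated[where K=1 and e=e and F="\<lambda>u x. F u x - F v x - D (u - v) x"])
       (use F e in \<open>auto simp: holder_has_derivative_def\<close>)
  moreover have "\<exists>e>0. \<forall>u\<in>ball v e. \<exists>M. holder_bound N r M (F' u)"
    using d e by (intro exI[of _ "min d e"]) auto
  ultimately show ?thesis using F unfolding holder_has_derivative_def by blast
qed

text \<open>Product rule with a scalar factor. The remainder consists of \<open>s u\<close> times
  the remainder of \<open>F\<close>, a quadratic term, and \<open>F v\<close> times the remainder of
  \<open>s\<close>.\<close>

lemma holder_has_derivative_scale:
  assumes F: "holder_has_derivative r F D v" and s: "(s has_derivative s') (at v)"
  shows "holder_has_derivative r (\<lambda>u x. s u * F u x) (\<lambda>h x. s v * D h x + s' h * F v x) v"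
proof -
  obtain K1 where K1: "0 \<le> K1" "\<forall>h. holder_bound N r (K1 * norm h) (D h)"
    using F unfolding holder_has_derivative_def by blast
  obtain e where e: "0 < e" "\<forall>u\<in>ball v e. \<exists>M. holder_bound N r M (F u)"
    using F unfolding holder_has_derivative_def by blast
  have small: "holder_small r v (\<lambda>u x. F u x - F v x - D (u - v) x)"
    using F unfolding holder_has_derivative_def by blast
  obtain M where M: "holder_bound N r M (F v)" using e by (meson centre_in_ball)
  have M0: "0 \<le> M" by (rule holder_bound_nonneg[OF cover M])
  have bl: "bounded_linear s'" and alt: "\<And>\<eta>. 0 < \<eta> \<Longrightarrow> \<exists>d>0. \<forall>u. norm (u - v) < d \<longrightarrow> norm (s u - s v - s' (u - v)) \<le> \<eta> * norm (u - v)"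
    using s unfolding has_derivative_at_alt by blast+
  obtain B where B: "0 < B" "\<And>h. norm (s' h) \<le> norm h * B" using bounded_linear.pos_bounded[OF bl] by blast
  obtain d1 where d1: "0 < d1" "\<forall>u. norm (u - v) < d1 \<longrightarrow> norm (s u - s v - s' (u - v)) \<le> 1 * norm (u - v)"
    using alt[of 1] by auto
  have lip: "\<bar>s u - s v\<bar> \<le> (B + 1) * dist u v" if "u \<in> ball v d1" for u
  proof -
    have "\<bar>s u - s v - s' (u - v)\<bar> \<le> dist u v" using d1(2) that by (auto simp: dist_norm norm_minus_commute)
    moreover have "\<bar>s' (u - v)\<bar> \<le> B * dist u v" using B(2)[of "u - v"] by (simp add: dist_norm mult.commute)
    ultimately show ?thesis by (simp add: distrib_right)
  qed
  have s1: "holder_small r v (\<lambda>u x. s u * (F u x - F v x - D (u - v) x))"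
  proof (rule holder_small_dominated[OF small])
    show "0 \<le> \<bar>s v\<bar> + (B + 1) * d1" using B d1 by simp
    fix u M' assume u: "u \<in> ball v d1" and b: "holder_bound N r M' (\<lambda>x. F u x - F v x - D (u - v) x)"
    have "(B + 1) * dist u v \<le> (B + 1) * d1" using u B by (intro mult_left_mono) (auto simp: dist_commute)
    then have "\<bar>s u\<bar> \<le> \<bar>s v\<bar> + (B + 1) * d1" using lip[OF u] by linarith
    then show "holder_bound N r ((\<bar>s v\<bar> + (B + 1) * d1) * M') (\<lambda>x. s u * (F u x - F v x - D (u - v) x))"
      by (intro holder_bound_mono[OF holder_bound_cmult[OF b]] mult_right_mono holder_bound_nonneg[OF cover b])
  qed (rule d1(1))
  have s2: "holder_small r v (\<lambda>u x. (s u - s v) * D (u - v) x)"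
  proof (rule holder_small_quadratic[OF d1(1)])
    show "0 \<le> (B + 1) * K1" using B K1 by simp
    fix u assume u: "u \<in> ball v d1"
    have "\<bar>s u - s v\<bar> * (K1 * norm (u - v)) \<le> ((B + 1) * dist u v) * (K1 * norm (u - v))"
      using lip[OF u] K1 by (intro mult_right_mono) auto
    also have "\<dots> = (B + 1) * K1 * dist u v * dist u v" by (simp add: dist_norm)
    finally show "holder_bound N r ((B + 1) * K1 * dist u v * dist u v) (\<lambda>x. (s u - s v) * D (u - v) x)"
      by (rule holder_bound_mono[OF holder_bound_cmult[OF spec[OF K1(2)]]])
  qed
  have s3: "holder_small r v (\<lambda>u x. (s u - s v - s' (u - v)) * F v x)"
    unfolding holder_small_def
  proof (intro allI impI)
    fix \<eta> :: real assume \<eta>: "0 < \<eta>"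
    then have "0 < \<eta> / (M + 1)" using M0 by simp
    from alt[OF this] obtain d where d: "0 < d" "\<forall>u. norm (u - v) < d \<longrightarrow> norm (s u - s v - s' (u - v)) \<le> \<eta> / (M + 1) * norm (u - v)" by blast
    have "holder_bound N r (\<eta> * dist u v) (\<lambda>x. (s u - s v - s' (u - v)) * F v x)" if u: "u \<in> ball v d" for u
    proof (rule holder_bound_mono[OF holder_bound_cmult[OF M]])
      have "\<bar>s u - s v - s' (u - v)\<bar> * M \<le> (\<eta> / (M + 1) * dist u v) * M"
        using d(2) u M0 by (intro mult_right_mono) (auto simp: dist_norm norm_minus_commute)
      also have "\<dots> = (\<eta> * (M / (M + 1))) * dist u v" by simp
      also have "\<dots> \<le> (\<eta> * 1) * dist u v" using M0 \<eta> by (intro mult_right_mono mult_left_mono) auto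
      finally show "\<bar>s u - s v - s' (u - v)\<bar> * M \<le> \<eta> * dist u v" by simp
    qed
    then show "\<exists>\<epsilon>>0. \<forall>u\<in>ball v \<epsilon>. holder_bound N r (\<eta> * dist u v) (\<lambda>x. (s u - s v - s' (u - v)) * F v x)"
      using d(1) by blast
  qed
  have eq: "(\<lambda>u x. s u * (F u x - F v x - D (u - v) x) + (s u - s v) * D (u - v) x + (s u - s v - s' (u - v)) * F v x)
    = (\<lambda>u x. s u * F u x - s v * F v x - (s v * D (u - v) x + s' (u - v) * F v x))"
    by (intro ext) (simp add: algebra_simps)
  have small': "holder_small r v (\<lambda>u x. s u * F u x - s v * F v x - (s v * D (u - v) x + s' (u - v) * F v x))"
    using holder_small_add[OF holder_small_add[OF s1 s2] s3] unfolding eq .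
  have lin: "linear (\<lambda>h. s v * D h x + s' h * F v x)" for x
  proof -
    interpret D: linear "\<lambda>h. D h x" using F unfolding holder_has_derivative_def by blast
    interpret S: bounded_linear s' by (rule bl)
    show ?thesis by (rule linearI) (simp_all add: D.add S.add D.scale S.scale algebra_simps)
  qed
  have "holder_bound N r ((\<bar>s v\<bar> * K1 + B * M) * norm h) (\<lambda>x. s v * D h x + s' h * F v x)" for h
  proof (rule holder_bound_mono[OF holder_bound_add[OF holder_bound_cmult[OF spec[OF K1(2)]] holder_bound_cmult[OF M]]])
    have "\<bar>s' h\<bar> * M \<le> (norm h * B) * M" using B(2)[of h] M0 by (intro mult_right_mono) auto
    then show "\<bar>s v\<bar> * (K1 * norm h) + \<bar>s' h\<bar> * M \<le> (\<bar>s v\<bar> * K1 + B * M) * norm h" by (simp add: algebra_simps)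
  qed
  moreover have "0 \<le> \<bar>s v\<bar> * K1 + B * M" using K1 B M0 by simp
  moreover have "\<exists>e>0. \<forall>u\<in>ball v e. \<exists>M. holder_bound N r M (\<lambda>x. s u * F u x)"
    using e holder_bound_cmult by blast
  ultimately show ?thesis using lin small' unfolding holder_has_derivative_def by blast
qed

text \<open>Chain rule for the bounded functional \<open>l w\<close>. It makes the scalar
  normalizing factors differentiable.\<close>

lemma l_has_derivative:
  assumes F: "holder_has_derivative r F D v" and w: "w \<in> U" and r: "0 < r" "r \<le> \<alpha>"
  shows "((\<lambda>u. l w (F u)) has_derivative (\<lambda>h. l w (D h))) (at v)"
proof -
  obtain K1 where K1: "0 \<le> K1" "\<forall>h. holder_bound N r (K1 * norm h) (D h)"
    using F unfolding holder_has_derivative_def by blast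
  obtain e where e: "0 < e" "\<forall>u\<in>ball v e. \<exists>M. holder_bound N r M (F u)"
    using F unfolding holder_has_derivative_def by blast
  have small: "holder_small r v (\<lambda>u x. F u x - F v x - D (u - v) x)"
    using F unfolding holder_has_derivative_def by blast
  have lin: "\<And>x. linear (\<lambda>h. D h x)" using F unfolding holder_has_derivative_def by blast
  obtain K where K: "0 \<le> K" "\<And>f M. holder_bound N r M f \<Longrightarrow> \<bar>l w f\<bar> \<le> K * M"
    by (rule l_bounded[OF w r]) (rule that)
  have DC: "D h \<in> Cr N r" for h using K1(2) Cr_iff[OF r] by blast
  have FC: "F u \<in> Cr N r" if "u \<in> ball v e" for u using e(2) that Cr_iff[OF r] by blast
  have bl: "bounded_linear (\<lambda>h. l w (D h))"
  proof (rule bounded_linear_intro)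
    fix h k :: 'p and a :: real
    have "D (h + k) = (\<lambda>x. D h x + D k x)" using linear_add[OF lin] by (intro ext) simp
    then show "l w (D (h + k)) = l w (D h) + l w (D k)" using l_linear(2)[OF w r DC DC] by simp
    have "D (a *\<^sub>R h) = (\<lambda>x. a * D h x)" using linear_scale[OF lin] by (intro ext) simp
    then show "l w (D (a *\<^sub>R h)) = a *\<^sub>R l w (D h)" using l_linear(1)[OF w r DC] by simp
    show "norm (l w (D h)) \<le> norm h * (K * K1)" using K(2)[OF spec[OF K1(2), of h]] by (simp add: mult_ac)
  qed
  show ?thesis
    unfolding has_derivative_at_alt
  proof (intro conjI bl allI impI)
    fix \<eta> :: real assume \<eta>: "0 < \<eta>"
    then have "0 < \<eta> / (K + 1)" using K by simp
    with small obtain d where d: "0 < d" "\<forall>u\<in>ball v d. holder_bound N r (\<eta> / (K + 1) * dist u v) (\<lambda>x. F u x - F v x - D (u - v) x)"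
      unfolding holder_small_def by blast
    have "norm (l w (F u) - l w (F v) - l w (D (u - v))) \<le> \<eta> * norm (u - v)" if "norm (u - v) < min d e" for u
    proof -
      have u: "u \<in> ball v d" "u \<in> ball v e" using that by (auto simp: dist_norm norm_minus_commute)
      have v: "v \<in> ball v e" using e by simp
      have "l w (\<lambda>x. F u x - F v x - D (u - v) x) = l w (F u) - l w (F v) - l w (D (u - v))"
        using l_linear(3)[OF w r Cr_diff[OF r FC[OF u(2)] FC[OF v]] DC] l_linear(3)[OF w r FC[OF u(2)] FC[OF v]] by simp
      moreover have "\<bar>l w (\<lambda>x. F u x - F v x - D (u - v) x)\<bar> \<le> K * (\<eta> / (K + 1) * dist u v)"
        by (rule K(2)) (use d u in blast)
      moreover have "K * (\<eta> / (K + 1) * dist u v) \<le> \<eta> * dist u v"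
      proof -
        have "(\<eta> * (K / (K + 1))) * dist u v \<le> (\<eta> * 1) * dist u v"
          using K(1) \<eta> by (intro mult_right_mono mult_left_mono) auto
        then show ?thesis by (simp add: mult_ac)
      qed
      ultimately show ?thesis by (simp only: dist_norm real_norm_def)
    qed
    then show "\<exists>d>0. \<forall>u. norm (u - v) < d \<longrightarrow> norm (l w (F u) - l w (F v) - l w (D (u - v))) \<le> \<eta> * norm (u - v)"
      using d(1) e(1) by (intro exI[of _ "min d e"]) auto
  qed
qed

abbreviation dL :: "'p \<Rightarrow> 'p \<Rightarrow> 'x \<Rightarrow> real" where
  "dL v \<equiv> transfer_op_param_deriv T g v (\<phi> v)"

text \<open>The derivative formula with the inverse taken on C^\<alpha>; \<open>Dphi_eq\<close>
  shows that every smaller exponent gives the same function.\<close>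

definition Dphi :: "'p \<Rightarrow> 'p \<Rightarrow> 'x \<Rightarrow> real" where
  "Dphi v h = (\<lambda>x. (1 / lam v) *
     inv_into (Cr N \<alpha>) (Id_minus_R v) (\<lambda>y. dL v h y - l v (dL v h) * \<phi> v y) x)"

lemma dL_bound: "v \<in> U \<Longrightarrow> \<exists>C\<ge>0. \<forall>h. holder_bound N \<alpha> (C * norm h) (dL v h)"
  using param_deriv(3) by blast

lemma dL_Cr: "v \<in> U \<Longrightarrow> dL v h \<in> Cr N \<alpha>"
  using dL_bound[of v] Cr_iff[of \<alpha>] \<alpha> by blast

lemma Dphi_rhs_Cr:
  assumes v: "v \<in> U" and r: "0 < r" "r \<le> \<alpha>"
  shows "(\<lambda>y. dL v h y - l v (dL v h) * \<phi> v y) \<in> Cr N r"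
proof -
  have a: "0 < \<alpha>" "\<alpha> \<le> \<alpha>" using \<alpha> by auto
  show ?thesis by (rule Cr_mono[OF r a(2) Cr_diff[OF a dL_Cr[OF v] Cr_cmult[OF a phi_Cr[OF v a]]]])
qed

lemma Dphi_unique:
  assumes v: "v \<in> U" and r: "0 < r" "r \<le> \<alpha>"
    and w: "w \<in> Cr N r" "Id_minus_R v w = (\<lambda>y. dL v h y - l v (dL v h) * \<phi> v y)"
  shows "inv_into (Cr N r) (Id_minus_R v) (\<lambda>y. dL v h y - l v (dL v h) * \<phi> v y) = w"
proof -
  have "bij_betw (Id_minus_R v) (Cr N r) (Cr N r)" by (rule resolvent[OF v r])
  then show ?thesis by (intro inv_into_f_eq w) (simp add: bij_betw_def)
qed

lemma Dphi_inverse: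
  fixes h
  assumes v: "v \<in> U" and r: "0 < r" "r \<le> \<alpha>"
  defines "I \<equiv> inv_into (Cr N r) (Id_minus_R v) (\<lambda>y. dL v h y - l v (dL v h) * \<phi> v y)"
  shows "I \<in> Cr N r" "Id_minus_R v I = (\<lambda>y. dL v h y - l v (dL v h) * \<phi> v y)"
proof -
  have "bij_betw (Id_minus_R v) (Cr N r) (Cr N r)" by (rule resolvent[OF v r])
  then have "(\<lambda>y. dL v h y - l v (dL v h) * \<phi> v y) \<in> Id_minus_R v ` Cr N r"
    using Dphi_rhs_Cr[OF v r] by (simp add: bij_betw_def)
  then show "I \<in> Cr N r" "Id_minus_R v I = (\<lambda>y. dL v h y - l v (dL v h) * \<phi> v y)"
    unfolding I_def by (rule inv_into_into, rule f_inv_into_f)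
qed

text \<open>The preimage found in C^\<alpha> also lies in C^r, and injectivity on C^r identifies it
  with the preimage taken there.\<close>

lemma Dphi_eq:
  assumes v: "v \<in> U" and r: "0 < r" "r \<le> \<alpha>"
  shows "Dphi v h x = (1 / lam v) * inv_into (Cr N r) (Id_minus_R v) (\<lambda>y. dL v h y - l v (dL v h) * \<phi> v y) x"
proof -
  have a: "0 < \<alpha>" "\<alpha> \<le> \<alpha>" using \<alpha> by auto
  show ?thesis
    unfolding Dphi_def Dphi_unique[OF v r Cr_mono[OF r a(2) Dphi_inverse(1)[OF v a]] Dphi_inverse(2)[OF v a]] by simp
qed

text \<open>\<open>inv_into\<close> is not linear by construction; additivity and homogeneity in
  \<open>h\<close> follow from uniqueness of the preimage, and the bound from the resolvent
  estimate.\<close>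

lemma Dphi:
  assumes v: "v \<in> U"
  shows "Dphi v h \<in> Cr N \<alpha>"
    and "Id_minus_R v (Dphi v h) = (\<lambda>x. (1 / lam v) * (dL v h x - l v (dL v h) * \<phi> v x))"
    and "linear (\<lambda>h. Dphi v h x)"
    and "\<exists>K\<ge>0. \<forall>h. holder_bound N \<alpha> (K * norm h) (Dphi v h)"
proof -
  have a: "0 < \<alpha>" "\<alpha> \<le> \<alpha>" using \<alpha> by auto
  define W where "W h = inv_into (Cr N \<alpha>) (Id_minus_R v) (\<lambda>y. dL v h y - l v (dL v h) * \<phi> v y)" for h
  have D: "Dphi v h = (\<lambda>x. (1 / lam v) * W h x)" for h unfolding Dphi_def W_def ..
  have W: "W h \<in> Cr N \<alpha>" "Id_minus_R v (W h) = (\<lambda>y. dL v h y - l v (dL v h) * \<phi> v y)" for h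
    unfolding W_def by (rule Dphi_inverse[OF v a])+
  have uniq: "W h = w" if "w \<in> Cr N \<alpha>" "Id_minus_R v w = (\<lambda>y. dL v h y - l v (dL v h) * \<phi> v y)" for w h
    unfolding W_def by (rule Dphi_unique[OF v a that])
  show DC: "Dphi v h \<in> Cr N \<alpha>" for h unfolding D by (rule Cr_cmult[OF a W(1)])
  show ID: "Id_minus_R v (Dphi v h) = (\<lambda>x. (1 / lam v) * (dL v h x - l v (dL v h) * \<phi> v x))" for h
    unfolding D Id_minus_R_linear(2)[OF v a W(1)] W(2) ..
  have lin: "linear (\<lambda>h. dL v h x)" for x by (rule param_deriv(2)[OF v])
  have dadd: "dL v (h + k) = (\<lambda>x. dL v h x + dL v k x)" for h k using linear_add[OF lin] by (intro ext) simp
  have dsc: "dL v (c *\<^sub>R h) = (\<lambda>x. c * dL v h x)" for h c using linear_scale[OF lin] by (intro ext) simp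
  have Wadd: "W (h + k) = (\<lambda>x. W h x + W k x)" for h k
  proof (rule uniq)
    show "(\<lambda>x. W h x + W k x) \<in> Cr N \<alpha>" by (rule Cr_add[OF a W(1) W(1)])
    show "Id_minus_R v (\<lambda>x. W h x + W k x) = (\<lambda>y. dL v (h + k) y - l v (dL v (h + k)) * \<phi> v y)"
      unfolding Id_minus_R_linear(4)[OF v a W(1) W(1)] W(2) dadd l_linear(2)[OF v a dL_Cr[OF v] dL_Cr[OF v]]
      by (intro ext) (simp add: algebra_simps)
  qed
  have Wsc: "W (c *\<^sub>R h) = (\<lambda>x. c * W h x)" for h c
  proof (rule uniq)
    show "(\<lambda>x. c * W h x) \<in> Cr N \<alpha>" by (rule Cr_cmult[OF a W(1)])
    show "Id_minus_R v (\<lambda>x. c * W h x) = (\<lambda>y. dL v (c *\<^sub>R h) y - l v (dL v (c *\<^sub>R h)) * \<phi> v y)"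
      unfolding Id_minus_R_linear(2)[OF v a W(1)] W(2) dsc l_linear(1)[OF v a dL_Cr[OF v]]
      by (intro ext) (simp add: algebra_simps)
  qed
  show "linear (\<lambda>h. Dphi v h x)" unfolding D by (rule linearI) (simp_all add: Wadd Wsc algebra_simps)
  obtain K where K: "0 \<le> K"
    "\<And>f M. f \<in> Cr N \<alpha> \<Longrightarrow> holder_bound N \<alpha> M (Id_minus_R v f) \<Longrightarrow> holder_bound N \<alpha> (K * M) f"
    using resolvent[OF v a] by metis
  obtain C where C: "0 \<le> C" "\<forall>h. holder_bound N \<alpha> (C * norm h) (dL v h)" using dL_bound[OF v] by blast
  obtain Kl where Kl: "0 \<le> Kl" "\<And>f M. holder_bound N \<alpha> M f \<Longrightarrow> \<bar>l v f\<bar> \<le> Kl * M"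
    by (rule l_bounded[OF v a]) (rule that)
  obtain B where B: "holder_bound N \<alpha> B (\<phi> v)" using phi_Cr[OF v a] Cr_iff[OF a] by blast
  have B0: "0 \<le> B" by (rule holder_bound_nonneg[OF cover B])
  define Q where "Q = K * (\<bar>1 / lam v\<bar> * (C + Kl * C * B))"
  have "holder_bound N \<alpha> (Q * norm h) (Dphi v h)" for h
  proof -
    have "\<bar>l v (dL v h)\<bar> * B \<le> (Kl * (C * norm h)) * B"
      by (rule mult_right_mono[OF Kl(2)[OF spec[OF C(2)]] B0])
    then have "holder_bound N \<alpha> (C * norm h + (Kl * (C * norm h)) * B) (\<lambda>x. dL v h x - l v (dL v h) * \<phi> v x)"
      by (intro holder_bound_diff spec[OF C(2)] holder_bound_mono[OF holder_bound_cmult[OF B]])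
    from K(2)[OF DC, unfolded ID, OF holder_bound_cmult[OF this]]
    show ?thesis by (simp add: Q_def algebra_simps)
  qed
  moreover have "0 \<le> Q" using K C Kl B0 by (simp add: Q_def)
  ultimately show "\<exists>K\<ge>0. \<forall>h. holder_bound N \<alpha> (K * norm h) (Dphi v h)" by blast
qed

text \<open>Applying \<open>Id_minus_R v\<close> to the remainder of the expansion leaves only terms
  that are o(\<bar>u - v\<bar>) in C^r; the resolvent on C^r carries this back to the
  remainder.\<close>

lemma normalized_phi_has_derivative:
  assumes v: "v \<in> U" and r: "0 < r" "r < \<alpha>"
  shows "holder_has_derivative r (normalized_phi v) (Dphi v) v"
proof -
  have a: "0 < \<alpha>" "\<alpha> \<le> \<alpha>" using \<alpha> by auto
  have ra: "0 < r" "r \<le> \<alpha>" using r by auto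
  let ?\<psi> = "normalized_phi v"
  define q where "q = (\<lambda>u x. L u (?\<psi> u) x - L v (?\<psi> u) x - dL v (u - v) x)"
  obtain K1 where K1: "1 \<le> K1" "\<And>(f :: 'x \<Rightarrow> real) M. holder_bound N \<alpha> M f \<Longrightarrow> holder_bound N r (K1 * M) f"
    by (rule holder_bound_exponent[OF cover ra]) (rule that)
  obtain K2 where K2: "0 \<le> K2" "\<And>(f :: 'x \<Rightarrow> real) \<alpha> M0 M1 Ma. C1_bound N \<alpha> M0 M1 Ma f \<Longrightarrow> holder_bound N r (K2 * (M0 + M1)) f"
    by (rule C1_bound_imp_holder_bound[OF cover r(1)]) (use r \<alpha> in simp, rule that)
  obtain Kr where Kr: "0 \<le> Kr"
    "\<And>f M. f \<in> Cr N r \<Longrightarrow> holder_bound N r M (Id_minus_R v f) \<Longrightarrow> holder_bound N r (Kr * M) f"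
    using resolvent[OF v ra] by metis
  obtain Kl where Kl: "0 \<le> Kl" "\<And>f M. holder_bound N r M f \<Longrightarrow> \<bar>l v f\<bar> \<le> Kl * M"
    by (rule l_bounded[OF v ra]) (rule that)
  obtain e C where e: "0 < e" "0 \<le> C" "ball v e \<subseteq> U" "\<forall>u\<in>ball v e. C1_bound N \<alpha> C C C (?\<psi> u) \<and>
    holder_bound N \<alpha> (C * dist u v) (\<lambda>x. ?\<psi> u x - \<phi> v x)" using normalized_phi_close[OF v] by blast
  obtain C3 where C3: "0 \<le> C3" "\<forall>h. holder_bound N \<alpha> (C3 * norm h) (dL v h)" using dL_bound[OF v] by blast
  obtain KD where KD: "0 \<le> KD" "\<forall>h. holder_bound N \<alpha> (KD * norm h) (Dphi v h)" using Dphi(4)[OF v] by blast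
  have \<psi>r: "holder_bound N r (K2 * (C + C)) (?\<psi> u)" if "u \<in> ball v e" for u using e(4) that K2(2) by blast
  have \<psi>C: "?\<psi> u \<in> Cr N \<alpha>" if "u \<in> ball v e" for u using e(4) that C1_bound_imp_Cr[OF a] by blast
  have q: "holder_small r v q" unfolding q_def by (rule moving_expansion[OF v r])
  have s2: "holder_small r v (\<lambda>u x. - l v (q u) * ?\<psi> u x)"
  proof (rule holder_small_dominated[OF q _ e(1)])
    show "0 \<le> Kl * (K2 * (C + C))" using Kl K2 e by simp
    fix u M assume u: "u \<in> ball v e" and b: "holder_bound N r M (q u)"
    have "\<bar>- l v (q u)\<bar> * (K2 * (C + C)) \<le> (Kl * M) * (K2 * (C + C))"
      using Kl(2)[OF b] K2 e by (intro mult_right_mono) auto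
    also have "\<dots> = Kl * (K2 * (C + C)) * M" by (simp add: mult_ac)
    finally show "holder_bound N r (Kl * (K2 * (C + C)) * M) (\<lambda>x. - l v (q u) * ?\<psi> u x)"
      by (rule holder_bound_mono[OF holder_bound_cmult[OF \<psi>r[OF u]]])
  qed
  have s3: "holder_small r v (\<lambda>u x. - l v (dL v (u - v)) * (?\<psi> u x - \<phi> v x))"
  proof (rule holder_small_quadratic[OF e(1)])
    show "0 \<le> Kl * (K1 * C3) * (K1 * C)" using Kl K1 C3 e by simp
    fix u assume u: "u \<in> ball v e"
    have "\<bar>- l v (dL v (u - v))\<bar> \<le> Kl * (K1 * (C3 * norm (u - v)))"
      using Kl(2)[OF K1(2)[OF spec[OF C3(2)]]] by simp
    then have "\<bar>- l v (dL v (u - v))\<bar> * (K1 * (C * dist u v)) \<le> Kl * (K1 * (C3 * norm (u - v))) * (K1 * (C * dist u v))"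
      using K1 e by (intro mult_right_mono) auto
    also have "\<dots> = Kl * (K1 * C3) * (K1 * C) * dist u v * dist u v" by (simp add: dist_norm)
    finally show "holder_bound N r (Kl * (K1 * C3) * (K1 * C) * dist u v * dist u v) (\<lambda>x. - l v (dL v (u - v)) * (?\<psi> u x - \<phi> v x))"
      using e(4) u by (intro holder_bound_mono[OF holder_bound_cmult[OF K1(2)]]) auto
  qed
  \<comment> \<open>With \<open>lam u - lam v = l v (q u) + l v (dL v (u - v))\<close>, the linear
    part and its projection onto \<open>\<phi> v\<close> cancel against \<open>Dphi\<close>. There
    remain the expansion error, its pairing with \<open>l v\<close>, and a product of two
    first-order terms.\<close>
  let ?G = "\<lambda>u x. q u x + - l v (q u) * ?\<psi> u x + - l v (dL v (u - v)) * (?\<psi> u x - \<phi> v x)"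
  have G: "holder_small r v ?G" by (rule holder_small_add[OF holder_small_add[OF q s2] s3])
  have "holder_small r v (\<lambda>u x. ?\<psi> u x - \<phi> v x - Dphi v (u - v) x)"
  proof (rule holder_small_dominated[OF G _ e(1)])
    show "0 \<le> Kr * \<bar>1 / lam v\<bar>" using Kr by simp
    fix u M assume u: "u \<in> ball v e" and b: "holder_bound N r M (?G u)"
    have uU: "u \<in> U" using u e by blast
    have dC: "(\<lambda>x. ?\<psi> u x - \<phi> v x) \<in> Cr N \<alpha>" by (rule Cr_diff[OF a \<psi>C[OF u] phi_Cr[OF v a]])
    have LC: "(\<lambda>x. L u (?\<psi> u) x - L v (?\<psi> u) x) \<in> Cr N \<alpha>"
      by (rule Cr_diff[OF a L_Cr[OF uU a \<psi>C[OF u]] L_Cr[OF v a \<psi>C[OF u]]])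
    have lq: "l v (q u) = (lam u - lam v) - l v (dL v (u - v))"
      unfolding q_def l_linear(3)[OF v a LC dL_Cr[OF v]] lam_diff[OF uU v] ..
    have "Id_minus_R v (\<lambda>x. ?\<psi> u x - \<phi> v x - Dphi v (u - v) x) = (\<lambda>x. (1 / lam v) * ?G u x)"
      unfolding Id_minus_R_linear(3)[OF v a dC Dphi(1)[OF v]] Id_minus_R_normalized[OF uU v] Dphi(2)[OF v] lq
      by (intro ext) (simp add: q_def algebra_simps)
    then have "holder_bound N r (\<bar>1 / lam v\<bar> * M) (Id_minus_R v (\<lambda>x. ?\<psi> u x - \<phi> v x - Dphi v (u - v) x))"
      using holder_bound_cmult[OF b, of "1 / lam v"] by simp
    moreover have "(\<lambda>x. ?\<psi> u x - \<phi> v x - Dphi v (u - v) x) \<in> Cr N r"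
      by (rule Cr_mono[OF ra a(2) Cr_diff[OF a dC Dphi(1)[OF v]]])
    ultimately show "holder_bound N r (Kr * \<bar>1 / lam v\<bar> * M) (\<lambda>x. ?\<psi> u x - \<phi> v x - Dphi v (u - v) x)"
      using Kr(2) by (metis mult.assoc)
  qed
  then have "holder_small r v (\<lambda>u x. ?\<psi> u x - ?\<psi> v x - Dphi v (u - v) x)" by (simp add: normalized_phi(4)[OF v v])
  moreover have "\<exists>e>0. \<forall>u\<in>ball v e. \<exists>M. holder_bound N r M (?\<psi> u)" using e(1) \<psi>r by blast
  moreover have "holder_bound N r (K1 * KD * norm h) (Dphi v h)" for h
    using K1(2)[OF spec[OF KD(2), of h]] by (simp add: mult.assoc)
  moreover have "0 \<le> K1 * KD" using K1 KD by simp
  ultimately show ?thesis using Dphi(3)[OF v] unfolding holder_has_derivative_def by blast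
qed

text \<open>At the base point of the given normalization \<open>normalized_phi v u\<close> is
  \<open>\<phi> u\<close>, so the formula holds without a correction factor.\<close>

lemma phi_has_derivative_base:
  assumes v: "v \<in> U" and r: "0 < r" "r < \<alpha>" and norm: "\<And>u. u \<in> U \<Longrightarrow> l v (\<phi> u) = 1"
  shows "holder_has_derivative r \<phi> (Dphi v) v"
proof -
  obtain e where e: "0 < e" "ball v e \<subseteq> U" using open_U v open_contains_ball by blast
  show ?thesis
    by (rule holder_has_derivative_cong[OF normalized_phi_has_derivative[OF v r] e(1)])
       (use norm e in \<open>auto simp: normalized_phi_def\<close>)
qed

text \<open>Away from the base point \<open>w\<close> of the normalization, \<open>\<phi> u\<close>
  is \<open>normalized_phi v u\<close> divided by its pairing with \<open>l w\<close>. This scalar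
  is differentiable and nonzero at \<open>v\<close>, so the product rule applies.\<close>

lemma phi_differentiable:
  assumes v: "v \<in> U" and w: "w \<in> U" and r: "0 < r" "r < \<alpha>" and norm: "\<And>u. u \<in> U \<Longrightarrow> l w (\<phi> u) = 1"
  shows "\<exists>D. holder_has_derivative r \<phi> D v"
proof -
  have ra: "0 < r" "r \<le> \<alpha>" using r by auto
  obtain e where e: "0 < e" "ball v e \<subseteq> U" using open_U v open_contains_ball by blast
  note D = normalized_phi_has_derivative[OF v r]
  have lw: "l w (normalized_phi v u) = 1 / l v (\<phi> u)" if u: "u \<in> U" for u
    using l_linear(1)[OF w ra phi_Cr[OF u ra], of "1 / l v (\<phi> u)"] norm[OF u] by (simp add: normalized_phi_def)
  have nz: "l w (normalized_phi v v) \<noteq> 0" using lw[OF v] l_phi[OF v] by simp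
  from Deriv.has_derivative_inverse[OF nz l_has_derivative[OF D w ra]]
  obtain s' where s': "((\<lambda>u. inverse (l w (normalized_phi v u))) has_derivative s') (at v)" by blast
  have "\<phi> u = (\<lambda>x. inverse (l w (normalized_phi v u)) * normalized_phi v u x)" if "u \<in> ball v e" for u
    using that e lw[of u] l_phi_nonzero[of u v] v by (auto simp: normalized_phi_def)
  then show ?thesis
    by (intro exI) (rule holder_has_derivative_cong[OF holder_has_derivative_scale[OF D s'] e(1)])
qed

end

theorem theorem3:
  fixes A :: "('x::t2_space, 'e::euclidean_space) chart set"
    and G :: "('x, 'e) chart \<Rightarrow> 'x \<Rightarrow> 'e \<Rightarrow> 'e \<Rightarrow> real"
    and N :: "(('x, 'e) chart \<times> 'e \<times> real) set"
    and \<alpha> \<beta> :: real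
    and U :: "(real ^ 'd) set" and u0 :: "real ^ 'd"
    and T :: "real ^ 'd \<Rightarrow> 'x \<Rightarrow> 'x"
    and g :: "real ^ 'd \<Rightarrow> 'x \<Rightarrow> real"
    and lam :: "real ^ 'd \<Rightarrow> real"
    and \<phi> :: "real ^ 'd \<Rightarrow> 'x \<Rightarrow> real"
    and l :: "real ^ 'd \<Rightarrow> ('x \<Rightarrow> real) \<Rightarrow> real"
  assumes "compact_connected_riemannian_manifold A G"
    and "coordinate_cover A N"
    and "0 \<le> \<beta>" and "\<beta> < \<alpha>" and "\<alpha> < 1"
    and "open U" and "u0 \<in> U"
    and "C1_holder_map_family A \<alpha> U T"
    and "\<And>u. u \<in> U \<Longrightarrow> expanding_map A G (T u)"
    and "C1_holder_fun_family A \<alpha> U g"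
    and "\<And>u x. u \<in> U \<Longrightarrow> g u x > 0"
    and "\<And>u. u \<in> U \<Longrightarrow> spectral_data N \<alpha> (T u) (g u) (lam u) (\<phi> u) (l u)"
    and "\<And>u. u \<in> U \<Longrightarrow> l u (\<phi> u) = 1"
    and "\<And>u. u \<in> U \<Longrightarrow> l u0 (\<phi> u) = 1"
  shows "(\<forall>u\<in>U. \<exists>D. Cr_has_derivative N \<beta> \<phi> D u) \<and>
    (let P = eigen_proj (l u0) (\<phi> u0);
         R = remainder_op (T u0) (g u0) (lam u0) (l u0) (\<phi> u0);
         Id_minus_R = (\<lambda>f x. f x - R f x / lam u0);
         dL = transfer_op_param_deriv T g u0 (\<phi> u0)
     in (\<forall>h x. (\<lambda>t. transfer_op (T (u0 + t *\<^sub>R h)) (g (u0 + t *\<^sub>R h)) (\<phi> u0) x)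
                 field_differentiable at 0) \<and>
        (\<forall>h. dL h \<in> Cr N \<alpha>) \<and>
        (\<forall>r\<in>{0<..\<alpha>}. Cr_invertible N r Id_minus_R \<and>
           Cr_has_derivative N \<beta> \<phi>
             (\<lambda>h x. inverse (lam u0) *
                inv_into (Cr N r) Id_minus_R (\<lambda>y. dL h y - P (dL h) y) x) u0))"
proof -
  have \<alpha>: "0 < \<alpha>" using assms(3,4) by simp
  interpret spectral_family A G N \<alpha> U T g lam \<phi> l
    by unfold_locales (use assms \<alpha> in auto)
  \<comment> \<open>Strictly below \<alpha>, as interpolation requires, and positive even if
    \<open>\<beta> = 0\<close>.\<close>
  define r0 where "r0 = (\<alpha> + \<beta>) / 2"
  have r0: "0 < r0" "r0 < \<alpha>" "0 \<le> \<beta>" "\<beta> \<le> r0" "r0 < 1" using assms(3-5) by (auto simp: r0_def)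
  have "\<exists>D. Cr_has_derivative N \<beta> \<phi> D u" if u: "u \<in> U" for u
  proof -
    obtain D where "holder_has_derivative r0 \<phi> D u"
      using phi_differentiable[OF u assms(7) r0(1,2) assms(14)] by blast
    from holder_has_derivative_imp_Cr[OF this r0(3,4,1,5)] show ?thesis by blast
  qed
  moreover have deriv: "Cr_has_derivative N \<beta> \<phi> (Dphi u0) u0"
    by (rule holder_has_derivative_imp_Cr[OF phi_has_derivative_base[OF assms(7) r0(1,2) assms(14)] r0(3,4,1,5)])
  moreover have "Cr_has_derivative N \<beta> \<phi> (\<lambda>h x. inverse (lam u0) * inv_into (Cr N r) (Id_minus_R u0)
      (\<lambda>y. dL u0 h y - eigen_proj (l u0) (\<phi> u0) (dL u0 h) y) x) u0" if r: "r \<in> {0<..\<alpha>}" for r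
  proof -
    \<comment> \<open>The derivative has been found with one exponent; independence of the exponent
      transfers the formula to every \<open>r\<close>, including
      \<open>r = \<alpha>\<close>.\<close>
    have "Dphi u0 = (\<lambda>h x. inverse (lam u0) * inv_into (Cr N r) (Id_minus_R u0)
      (\<lambda>y. dL u0 h y - eigen_proj (l u0) (\<phi> u0) (dL u0 h) y) x)"
      using r by (intro ext) (simp add: Dphi_eq[OF assms(7), of r] eigen_proj_def inverse_eq_divide)
    with deriv show ?thesis by simp
  qed
  moreover have "Cr_invertible N r (Id_minus_R u0)" if "r \<in> {0<..\<alpha>}" for r
    using Id_minus_R_invertible[OF assms(7)] that by simp
  moreover have "(\<lambda>f x. f x - R u0 f x / lam u0) = Id_minus_R u0"
    by (simp add: Id_minus_R_def fun_eq_iff)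
  ultimately show ?thesis
    using param_deriv(1)[OF assms(7)] dL_Cr[OF assms(7)] by (simp add: Let_def)
qed

end
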